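(* For every permutation group $G\subseteq S_4$, the set $\mathcal{P}_4(G)$ is a finite union of polytopes of dimension $3$.
   Context: For a nondegenerate rank $n$ ring with homomorphisms $\sigma_i$ to $\mathbb{C}$, $|x|=\sqrt{\frac1n\sum|\sigma_i(x)|^2}$ and $\lambda_i$ is the smallest $r$ with $i+1$ linearly independent elements of length $\le r$. Pairs $(R,C)$: $R$ a nondegenerate quartic ring, $C$ a cubic resolvent ring of $R$ in Bhargava's sense; $\Delta=|\mathrm{Disc}(R)|$. $R$ is a $G$-ring if $\mathrm{Gal}(R\otimes\mathbb{Q})\cong G$ as permutation groups. $\mathcal{P}_4(G)$ is the set of limit points of the multiset $\{(\log_\Delta\lambda_1(R),\log_\Delta\lambda_2(R),\log_\Delta\lambda_3(R),\log_\Delta\lambda_1(C),\log_\Delta\lambda_2(C))\}\subseteq\mathbb{R}^5$ over isomorphism classes of pairs $(R,C)$ with $R$ a $G$-ring. *)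

theory Defs
  imports
    "HOL-Analysis.Analysis"
    "HOL-Algebra.Algebra"
    "HOL-Algebra.Algebraic_Closure_Type"
    "Jordan_Normal_Form.Determinant"
begin

section \<open>Rings of rank n\<close>

definition zlincomb :: "('a, 'm) ring_scheme \<Rightarrow> nat set \<Rightarrow> (nat \<Rightarrow> int) \<Rightarrow> (nat \<Rightarrow> 'a) \<Rightarrow> 'a" where
  "zlincomb R I a v = (\<Oplus>\<^bsub>R\<^esub>i\<in>I. [a i] \<cdot>\<^bsub>R\<^esub> v i)"

definition zindep :: "('a, 'm) ring_scheme \<Rightarrow> nat set \<Rightarrow> (nat \<Rightarrow> 'a) \<Rightarrow> bool" where
  "zindep R I v \<longleftrightarrow> (\<forall>a. zlincomb R I a v = \<zero>\<^bsub>R\<^esub> \<longrightarrow> (\<forall>i\<in>I. a i = 0))"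

definition zbasis :: "('a, 'm) ring_scheme \<Rightarrow> nat \<Rightarrow> (nat \<Rightarrow> 'a) \<Rightarrow> bool" where
  "zbasis R n b \<longleftrightarrow> b \<in> {..<n} \<rightarrow> carrier R \<and>
     (\<forall>x\<in>carrier R. \<exists>!a. a \<in> {..<n} \<rightarrow>\<^sub>E (UNIV :: int set) \<and> x = zlincomb R {..<n} a b)"

definition zcoord :: "('a, 'm) ring_scheme \<Rightarrow> nat \<Rightarrow> (nat \<Rightarrow> 'a) \<Rightarrow> 'a \<Rightarrow> nat \<Rightarrow> int" where
  "zcoord R n b x = (THE a. a \<in> {..<n} \<rightarrow>\<^sub>E (UNIV :: int set) \<and> x = zlincomb R {..<n} a b)"

text \<open>The trace of multiplication by an element, read off in the basis \<open>b\<close>.\<close>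

definition ztrace :: "('a, 'm) ring_scheme \<Rightarrow> nat \<Rightarrow> (nat \<Rightarrow> 'a) \<Rightarrow> 'a \<Rightarrow> int" where
  "ztrace R n b x = (\<Sum>i<n. zcoord R n b (x \<otimes>\<^bsub>R\<^esub> b i) i)"

text \<open>The value does not depend on the basis: a change of basis multiplies it by the
  square of a determinant \<open>\<plusminus>1\<close>.\<close>

definition ring_disc :: "nat \<Rightarrow> ('a, 'm) ring_scheme \<Rightarrow> int" where
  "ring_disc n R = (let b = (SOME b. zbasis R n b) in
     Determinant.det (Matrix.mat n n (\<lambda>(i, j). ztrace R n b (b i \<otimes>\<^bsub>R\<^esub> b j))))"

definition rank_ring :: "nat \<Rightarrow> ('a, 'm) ring_scheme \<Rightarrow> bool" where
  "rank_ring n R \<longleftrightarrow> cring R \<and> (\<exists>b. zbasis R n b)"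

definition nondeg_ring :: "nat \<Rightarrow> ('a, 'm) ring_scheme \<Rightarrow> bool" where
  "nondeg_ring n R \<longleftrightarrow> rank_ring n R \<and> ring_disc n R \<noteq> 0"


section \<open>Complex embeddings and successive minima\<close>

abbreviation complex_ring :: "complex ring" where
  "complex_ring \<equiv> ring_of_type_algebra"

text \<open>Homomorphisms are made extensional, so that each one is counted once; a nondegenerate
  ring of rank \<open>n\<close> has exactly \<open>n\<close> of them.\<close>

definition homs :: "('a, 'm) ring_scheme \<Rightarrow> ('a \<Rightarrow> complex) set" where
  "homs R = Ring.ring_hom R complex_ring \<inter> extensional (carrier R)"

definition len :: "nat \<Rightarrow> ('a, 'm) ring_scheme \<Rightarrow> 'a \<Rightarrow> real" where
  "len n R x = sqrt ((1 / real n) * (\<Sum>\<sigma>\<in>homs R. (cmod (\<sigma> x))\<^sup>2))"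

definition succ_min :: "nat \<Rightarrow> ('a, 'm) ring_scheme \<Rightarrow> nat \<Rightarrow> real" where
  "succ_min n R i = (LEAST r. \<exists>v. v \<in> {..i} \<rightarrow> carrier R \<and> zindep R {..i} v \<and>
     (\<forall>j\<le>i. len n R (v j) \<le> r))"


section \<open>The Galois group as a permutation group\<close>

text \<open>The compositum in \<open>\<complex>\<close> of the images of \<open>R \<otimes> \<rat>\<close> under all its homomorphisms; it is the
  Galois closure of the etale algebra \<open>R \<otimes> \<rat>\<close>.\<close>

definition galois_closure :: "('a, 'm) ring_scheme \<Rightarrow> complex ring" where
  "galois_closure R =
     complex_ring\<lparr>carrier := generate_field complex_ring (\<Union>\<sigma>\<in>homs R. \<sigma> ` carrier R)\<rparr>"

text \<open>The permutations by which the automorphisms of the Galois closure act on the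
  homomorphisms \<open>R \<rightarrow> \<complex>\<close>, the latter being numbered by \<open>e\<close>.\<close>

definition galois_perms :: "nat \<Rightarrow> ('a, 'm) ring_scheme \<Rightarrow> (nat \<Rightarrow> 'a \<Rightarrow> complex) \<Rightarrow> (nat \<Rightarrow> nat) set" where
  "galois_perms n R e = {p. p permutes {1..n} \<and>
     (\<exists>\<alpha>\<in>ring_iso (galois_closure R) (galois_closure R).
        \<forall>i\<in>{1..n}. e (p i) = (\<lambda>x\<in>carrier R. \<alpha> (e i x)))}"

definition is_G_ring :: "nat \<Rightarrow> (nat \<Rightarrow> nat) set \<Rightarrow> ('a, 'm) ring_scheme \<Rightarrow> bool" where
  "is_G_ring n G R \<longleftrightarrow> (\<exists>e. bij_betw e {1..n} (homs R) \<and> galois_perms n R e = G)"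


section \<open>Cubic resolvent rings\<close>

definition fun_ring :: "'i set \<Rightarrow> ('i \<Rightarrow> complex) ring" where
  "fun_ring I = \<lparr>carrier = I \<rightarrow>\<^sub>E UNIV,
     monoid.mult = (\<lambda>f g. \<lambda>i\<in>I. f i * g i), monoid.one = (\<lambda>i\<in>I. 1),
     ring.zero = (\<lambda>i\<in>I. 0), ring.add = (\<lambda>f g. \<lambda>i\<in>I. f i + g i)\<rparr>"

definition hom_orderings :: "('a, 'm) ring_scheme \<Rightarrow> ('a \<Rightarrow> complex) list set" where
  "hom_orderings R = {s. distinct s \<and> set s = homs R}"

text \<open>For a nondegenerate quartic ring \<open>R\<close>, the map sending \<open>x\<^sub>0 \<otimes> x\<^sub>1 \<otimes> x\<^sub>2 \<otimes> x\<^sub>3\<close> to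
  the function \<open>s \<mapsto> (s!0) x\<^sub>0 * (s!1) x\<^sub>1 * (s!2) x\<^sub>2 * (s!3) x\<^sub>3\<close> on the 24 orderings \<open>s\<close> of the
  homomorphisms \<open>R \<rightarrow> \<complex>\<close> has as its image Bhargava's \<open>S\<^sub>4\<close>-closure of \<open>R\<close>. The four conjugates
  of \<open>x\<close> in the \<open>S\<^sub>4\<close>-closure are the functions \<open>s \<mapsto> (s!k) x\<close>. The following ring contains the
  \<open>S\<^sub>4\<close>-closure and its tensor product with \<open>\<rat>\<close>.\<close>

abbreviation conj_ring :: "('a, 'm) ring_scheme \<Rightarrow> (('a \<Rightarrow> complex) list \<Rightarrow> complex) ring" where
  "conj_ring R \<equiv> fun_ring (hom_orderings R)"

text \<open>Bhargava's resolvent map \<open>x \<mapsto> x x' + x'' x'''\<close>.\<close>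

definition resolvent_map :: "('a, 'm) ring_scheme \<Rightarrow> 'a \<Rightarrow> ('a \<Rightarrow> complex) list \<Rightarrow> complex" where
  "resolvent_map R x = (\<lambda>s\<in>hom_orderings R. (s ! 0) x * (s ! 1) x + (s ! 2) x * (s ! 3) x)"

definition cubic_invariant_ring :: "('a, 'm) ring_scheme \<Rightarrow> (('a \<Rightarrow> complex) list \<Rightarrow> complex) set" where
  "cubic_invariant_ring R = generate_ring (conj_ring R) (resolvent_map R ` carrier R)"

text \<open>Bhargava's definition for quartic rings of nonzero discriminant: a cubic ring that
  contains the cubic invariant ring and has the same discriminant as \<open>R\<close>. Having rank 3, it lies
  in the rational span of the cubic invariant ring.\<close>

definition cubic_resolvent ::
  "('a, 'm) ring_scheme \<Rightarrow> (('a \<Rightarrow> complex) list \<Rightarrow> complex) ring \<Rightarrow> bool" where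
  "cubic_resolvent R C \<longleftrightarrow>
     (\<exists>K. subring K (conj_ring R) \<and> C = (conj_ring R)\<lparr>carrier := K\<rparr>) \<and>
     rank_ring 3 C \<and> cubic_invariant_ring R \<subseteq> carrier C \<and> ring_disc 3 C = ring_disc 4 R"


section \<open>The limit set\<close>

text \<open>Quartic rings are countably infinite, so each of them is isomorphic to one whose carrier
  is a set of natural numbers. Hence the isomorphism classes below are all isomorphism classes.\<close>

type_synonym quartic_pair = "nat ring \<times> ((nat \<Rightarrow> complex) list \<Rightarrow> complex) ring"

definition G_pairs :: "(nat \<Rightarrow> nat) set \<Rightarrow> quartic_pair set" where
  "G_pairs G = {(R, C). nondeg_ring 4 R \<and> cubic_resolvent R C \<and> is_G_ring 4 G R}"

definition pair_iso :: "(nat \<Rightarrow> nat) set \<Rightarrow> (quartic_pair \<times> quartic_pair) set" where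
  "pair_iso G = {((R, C), (R', C')). (R, C) \<in> G_pairs G \<and> (R', C') \<in> G_pairs G \<and>
     (\<exists>f\<in>ring_iso R R'. \<exists>g\<in>ring_iso C C'.
        \<forall>x\<in>carrier R. g (resolvent_map R x) = resolvent_map R' (f x))}"

definition min_point :: "quartic_pair \<Rightarrow> real^5" where
  "min_point = (\<lambda>(R, C). let D = real_of_int \<bar>ring_disc 4 R\<bar> in
     vector [log D (succ_min 4 R 1), log D (succ_min 4 R 2), log D (succ_min 4 R 3),
             log D (succ_min 3 C 1), log D (succ_min 3 C 2)])"

text \<open>A limit point of a multiset is a point each of whose neighbourhoods contains infinitely
  many members counted with multiplicity, that is, the points of infinitely many isomorphism
  classes. The finitely many classes with \<open>\<Delta> = 1\<close>, where \<open>log 1\<close> is meaningless, play no role.\<close>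

definition P4 :: "(nat \<Rightarrow> nat) set \<Rightarrow> (real^5) set" where
  "P4 G = {p. \<forall>\<epsilon>>0. infinite ({P \<in> G_pairs G. dist (min_point P) p < \<epsilon>} // pair_iso G)}"

end

(* Embed R in C^4 and C in C^3. A pair (R, C) is then a lattice b closed under multiplication, a lattice w closed
   under multiplication with the same covolume, and the requirement that the quadratic map phi (the cubic resolvent)
   carries b into w. In reduced bases the successive minima are the lengths of the basis vectors up to constants,
   and a nonzero coefficient of w_k in phi(b_i, b_j) forces |w_k| <= const * |b_i| |b_j|. Together with the
   covolume relation, every limit point therefore lies in one of the finitely many polytopes "cell N", where N is the
   set of index triples (i, j, k) with nonzero coefficient; discriminants tend to infinity along a limit because only
   finitely many classes have bounded discriminant.
   Conversely, rescaling the basis vectors of one pair by powers of 2 whose exponents satisfy the inequalities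
   defining "cell N" gives pairs with the same Galois group, and their minima approach any point of "cell N".
   Each cell contains a fixed point with slack in all inequalities, hence has dimension 3. There is at least one
   cell: every subgroup of S_4 is the Galois group of a monic integral quartic, with powers of the roots as basis. *)
theory Submission
 imports Defs
  "HOL-Computational_Algebra.Fundamental_Theorem_Algebra"
  "HOL-Computational_Algebra.Polynomial_Factorial"
begin

section \<open>Lattices spanned by complex vectors\<close>

text \<open>The obstacle in the converse is that rescaling basis vectors need not preserve closure
  under multiplication. It does here because the resolvent map controls both multiplication tables:
  the structure constants of the quartic lattice that rescaling could spoil are, up to sign, 2 by 2
  minors of the two integral quadratic forms that make up \<open>phi\<close>, and the critical
  structure constant of the cubic lattice is a multiple of the determinant of the second form. A
  nonzero structure constant thus forces nonzero entries of the forms, and the inequalities attached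
  to these entries, added up with the covolume relation, give the inequality that this structure
  constant requires. Hence conditions on \<open>phi\<close> alone describe the admissible exponents.
  The point with slack is close to the one where both lattices have equal minima, 1/6 and 1/4: there
  every resolvent inequality reads \<open>1/4 <= 1/3\<close>. It is perturbed slightly so that the
  orderings of the minima become strict as well.\<close>

definition rcomb :: "nat => (nat => nat => complex) => (nat => real) => nat => complex" where
 "rcomb n b x k = (\<Sum>j<n. of_real (x j) * b j k)"

abbreviation icomb :: "nat => (nat => nat => complex) => (nat => int) => nat => complex" where
 "icomb n b a \<equiv> rcomb n b (\<lambda>j. real_of_int (a j))"

text \<open>Vectors are total functions of which only the entries below \<open>n\<close> count;
  membership is tested on those entries alone, and congruence rules such as
  \<open>lattice_cong\<close> take the place of equality of vectors.\<close>

definition zlattice :: "nat => (nat => nat => complex) => (nat => complex) set" where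
 "zlattice n b = {v. \<exists>a. \<forall>k<n. v k = icomb n b a k}"

definition vnorm :: "nat => (nat => complex) => real" where
 "vnorm n v = L2_set (\<lambda>k. cmod (v k)) {..<n}"

definition emat :: "nat => (nat => nat => complex) => complex mat" where
 "emat n b = Matrix.mat n n (\<lambda>(k, j). b j k)"

definition edet :: "nat => (nat => nat => complex) => complex" where
 "edet n b = Determinant.det (emat n b)"

lemma latticeE:
 assumes "v \<in> zlattice n b" obtains a where "\<And>k. k < n ==> v k = icomb n b a k"
 using assms by (auto simp: zlattice_def)

lemma latticeI: "(\<And>k. k < n ==> v k = icomb n b a k) ==> v \<in> zlattice n b"
 by (auto simp: zlattice_def)

lemma lattice_cong: "(\<And>k. k < n ==> v k = w k) ==> v \<in> zlattice n b \<longleftrightarrow> w \<in> zlattice n b"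
 by (auto simp: zlattice_def)

lemma vnorm_cong: "(\<And>k. k < n ==> v k = w k) ==> vnorm n v = vnorm n w"
 unfolding vnorm_def by (rule L2_set_cong) auto

lemma vnorm_nonneg [simp]: "0 \<le> vnorm n v"
 by (simp add: vnorm_def)

lemma vnorm_sq: "(vnorm n v)\<^sup>2 = (\<Sum>k<n. (cmod (v k))\<^sup>2)"
 unfolding vnorm_def L2_set_def by (simp add: sum_nonneg)

lemma cmod_le_vnorm: "k < n ==> cmod (v k) \<le> vnorm n v"
 unfolding vnorm_def by (rule member_le_L2_set) auto

lemma vnorm_add: "vnorm n (\<lambda>k. v k + w k) \<le> vnorm n v + vnorm n w"
proof -
 have "vnorm n (\<lambda>k. v k + w k) \<le> L2_set (\<lambda>k. cmod (v k) + cmod (w k)) {..<n}"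
  unfolding vnorm_def by (rule L2_set_mono) (auto simp: norm_triangle_ineq)
 also have "\<dots> \<le> vnorm n v + vnorm n w"
  unfolding vnorm_def by (rule L2_set_triangle_ineq)
 finally show ?thesis .
qed

lemma vnorm_scale: "vnorm n (\<lambda>k. c * v k) = cmod c * vnorm n v"
 unfolding vnorm_def by (simp add: norm_mult L2_set_right_distrib)

lemma vnorm_sum: "finite I ==> vnorm n (\<lambda>k. \<Sum>i\<in>I. f i k) \<le> (\<Sum>i\<in>I. vnorm n (f i))"
proof (induction I rule: finite_induct)
 case empty
 then show ?case by (simp add: vnorm_def L2_set_def)
next
 case (insert x F)
 have "vnorm n (\<lambda>k. f x k + (\<Sum>i\<in>F. f i k)) \<le> vnorm n (f x) + vnorm n (\<lambda>k. \<Sum>i\<in>F. f i k)"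
  by (rule vnorm_add)
 then show ?case using insert by simp
qed

lemma vnorm_mono: "(\<And>k. k < n ==> cmod (v k) \<le> cmod (w k)) ==> vnorm n v \<le> vnorm n w"
 unfolding vnorm_def by (rule L2_set_mono) auto

lemma vnorm_zero_iff: "vnorm n v = 0 \<longleftrightarrow> (\<forall>k<n. v k = 0)"
 unfolding vnorm_def by (subst L2_set_eq_0_iff) auto

lemma vnorm_le_sum: "vnorm n v \<le> (\<Sum>k<n. cmod (v k))"
 unfolding vnorm_def by (rule order_trans[OF L2_set_le_sum]) auto

lemma vnorm_le_bound: "(\<And>k. k < n ==> cmod (v k) \<le> B) ==> vnorm n v \<le> real n * B"
 by (rule order_trans[OF vnorm_le_sum]) (rule sum_bounded_above[THEN order_trans], auto)

lemma vnorm_const: "vnorm n (\<lambda>_. c) = sqrt (real n) * cmod c"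
 unfolding vnorm_def L2_set_def by (simp add: real_sqrt_mult)

lemma lattice_add: "v \<in> zlattice n b ==> w \<in> zlattice n b ==> (\<lambda>k. v k + w k) \<in> zlattice n b"
proof -
 assume "v \<in> zlattice n b" "w \<in> zlattice n b"
 then obtain a c where "\<And>k. k < n ==> v k = icomb n b a k" "\<And>k. k < n ==> w k = icomb n b c k"
  by (metis latticeE)
 then show ?thesis
  by (intro latticeI[of n _ b "\<lambda>j. a j + c j"]) (simp add: rcomb_def sum.distrib ring_distribs)
qed

lemma lattice_scale: "v \<in> zlattice n b ==> (\<lambda>k. of_int s * v k) \<in> zlattice n b"
proof -
 assume "v \<in> zlattice n b"
 then obtain a where "\<And>k. k < n ==> v k = icomb n b a k" by (metis latticeE)
 then show ?thesis
  by (intro latticeI[of n _ b "\<lambda>j. s * a j"]) (simp add: rcomb_def sum_distrib_left mult_ac)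
qed

lemma lattice_zero: "(\<lambda>k. 0) \<in> zlattice n b"
 by (intro latticeI[of n _ b "\<lambda>j. 0"]) (simp add: rcomb_def)

lemma lattice_diff: "v \<in> zlattice n b ==> w \<in> zlattice n b ==> (\<lambda>k. v k - w k) \<in> zlattice n b"
 using lattice_add[of v n b "\<lambda>k. of_int (-1) * w k"] lattice_scale[of w n b "-1"] by simp

lemma lattice_sum:
 "finite I ==> (\<And>i. i \<in> I ==> f i \<in> zlattice n b) ==> (\<lambda>k. \<Sum>i\<in>I. f i k) \<in> zlattice n b"
 by (induction I rule: finite_induct) (auto simp: lattice_zero intro: lattice_add)

lemma lattice_basis: "j < n ==> b j \<in> zlattice n b"
 by (intro latticeI[of n _ b "\<lambda>i. if i = j then 1 else 0"])
   (simp add: rcomb_def if_distrib[where f=of_int] if_distrib[where f=of_real] if_distrib[where f="\<lambda>c. c * _"] cong: if_cong)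

lemma lattice_icomb: "(\<And>j. j < n ==> b' j \<in> zlattice n b) ==> icomb n b' a \<in> zlattice n b"
 unfolding rcomb_def of_real_of_int_eq by (intro lattice_sum lattice_scale) auto

lemma lattice_subset: "(\<And>j. j < n ==> b' j \<in> zlattice n b) ==> zlattice n b' \<subseteq> zlattice n b"
proof
 fix v assume b': "\<And>j. j < n ==> b' j \<in> zlattice n b" and "v \<in> zlattice n b'"
 then obtain a where "\<And>k. k < n ==> v k = icomb n b' a k" by (metis latticeE)
 then show "v \<in> zlattice n b" using lattice_icomb[of n b' b a] b' lattice_cong[of n v] by blast
qed

section \<open>Determinants and changes of basis\<close>

lemma emat_carrier [simp]: "emat n b \<in> carrier_mat n n" by (simp add: emat_def)

lemma edet_cong: "(\<And>j k. j < n ==> k < n ==> b j k = b' j k) ==> edet n b = edet n b'"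
 unfolding edet_def emat_def by (intro arg_cong[where f=Determinant.det]) auto

lemma edet_change:
 assumes "\<And>j k. j < n ==> k < n ==> b' j k = icomb n b (A j) k"
 shows "edet n b' = edet n b * of_int (Determinant.det (Matrix.mat n n (\<lambda>(i, j). A j i)))"
proof -
 let ?A = "Matrix.mat n n (\<lambda>(i, j). A j i)"
 have "emat n b' = emat n b * of_int_hom.mat_hom ?A"
  by (rule eq_matI) (auto simp: emat_def assms rcomb_def scalar_prod_def atLeast0LessThan mult.commute)
 then show ?thesis unfolding edet_def
  by (simp add: Determinant.det_mult[of _ n] of_int_hom.hom_det)
qed

lemma edet_lattice_subset:
 assumes "zlattice n b' \<subseteq> zlattice n b"
 obtains d :: int where "edet n b' = edet n b * of_int d"
proof -
 have "\<exists>a. \<forall>k<n. b' j k = icomb n b a k" if "j < n" for j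
  using subsetD[OF assms lattice_basis[OF that]] by (auto simp: zlattice_def)
 then obtain A where "\<And>j k. j < n ==> k < n ==> b' j k = icomb n b (A j) k" by metis
 with edet_change[of n b' b A] show ?thesis using that by blast
qed

lemma edet_lattice_nz: "zlattice n b \<subseteq> zlattice n b' ==> edet n b ~= 0 ==> edet n b' ~= 0"
 by (metis edet_lattice_subset mult_eq_0_iff)

text \<open>Each determinant is an integer multiple of the other, so the two integer factors are
  mutually inverse and equal to 1 or -1.\<close>

lemma edet_lattice_sq:
 assumes "zlattice n b = zlattice n b'" "edet n b ~= 0"
 shows "(edet n b')\<^sup>2 = (edet n b)\<^sup>2"
proof -
 obtain d where d: "edet n b' = edet n b * of_int d"
  using edet_lattice_subset[of n b' b] assms by auto
 obtain e where e: "edet n b = edet n b' * of_int e"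
  using edet_lattice_subset[of n b b'] assms by auto
 have "edet n b = edet n b * of_int (d * e)" by (subst e, subst d) simp
 then have "(1::complex) = of_int (d * e)" using assms(2) by (metis mult_cancel_left mult.right_neutral)
 then have "d * e = 1" by (metis of_int_eq_1_iff)
 then have "d\<^sup>2 = 1" by (metis zmult_eq_1_iff power2_eq_square one_power2 power2_minus)
 then show ?thesis by (simp add: d power_mult_distrib flip: of_int_power)
qed

text \<open>The condition \<open>a j = 0\<close> makes the added combination the same in the old and
  in the new basis, so that subtracting it inverts the operation.\<close>

lemma lattice_modify:
 assumes j: "j < n" and aj: "a j = 0"
  and b': "\<And>i k. i < n ==> k < n ==> b' i k = (if i = j then b j k + icomb n b a k else b i k)"
 shows "zlattice n b' = zlattice n b"
proof
 have 1: "(\<lambda>k. b j k + icomb n b a k) \<in> zlattice n b"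
  using j by (intro lattice_add lattice_icomb lattice_basis) auto
 show "zlattice n b' \<subseteq> zlattice n b"
 proof (rule lattice_subset)
  fix i assume i: "i < n"
  show "b' i \<in> zlattice n b"
   using lattice_cong[of n "b' i" "if i = j then (\<lambda>k. b j k + icomb n b a k) else b i" b] b'[OF i] 1
    lattice_basis[OF i, of b] by (cases "i = j") auto
 qed
 show "zlattice n b \<subseteq> zlattice n b'"
 proof (rule lattice_subset)
  fix i assume i: "i < n"
  have eq: "icomb n b' a k = icomb n b a k" if "k < n" for k
   unfolding rcomb_def using b' that aj by (intro sum.cong) auto
  have "(\<lambda>k. b' j k - icomb n b' a k) \<in> zlattice n b'"
   using j by (intro lattice_diff lattice_icomb lattice_basis) auto
  then have "b j \<in> zlattice n b'" using lattice_cong[of n "b j" "\<lambda>k. b' j k - icomb n b' a k"] eq b'[OF j] by auto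
  moreover have "b i \<in> zlattice n b'" if "i ~= j"
   using lattice_cong[of n "b i" "b' i" b'] b'[OF i] lattice_basis[OF i, of b'] that by auto
  ultimately show "b i \<in> zlattice n b'" by (cases "i = j") auto
 qed
qed

lemma lattice_permute:
 assumes "p permutes {..<n}"
 shows "zlattice n (\<lambda>j. b (p j)) = zlattice n b"
proof
 show "zlattice n (\<lambda>j. b (p j)) \<subseteq> zlattice n b"
  using permutes_in_image[OF assms] by (intro lattice_subset lattice_basis) auto
 show "zlattice n b \<subseteq> zlattice n (\<lambda>j. b (p j))"
 proof (rule lattice_subset)
  fix j assume "j < n"
  then have "Hilbert_Choice.inv p j < n" using permutes_in_image[OF permutes_inv[OF assms]] by auto
  from lattice_basis[OF this, of "\<lambda>j. b (p j)"] show "b j \<in> zlattice n (\<lambda>j. b (p j))"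
   by (simp add: permutes_inverses(1)[OF assms])
 qed
qed

lemma lattice_negate:
 assumes "j < n" "\<And>i k. i < n ==> k < n ==> b' i k = (if i = j then - b j k else b i k)"
 shows "zlattice n b' = zlattice n b"
proof -
 have neg: "(\<lambda>k. - v k) \<in> zlattice n c" if "v \<in> zlattice n c" for v c
  using lattice_scale[OF that, of "-1"] by simp
 have *: "zlattice n b' \<subseteq> zlattice n b" if "\<And>i k. i < n ==> k < n ==> b' i k = (if i = j then - b j k else b i k)" for b b'
 proof (rule lattice_subset)
  fix i assume i: "i < n"
  show "b' i \<in> zlattice n b"
   using lattice_cong[of n "b' i" "if i = j then (\<lambda>k. - b j k) else b i" b] that[OF i] neg[OF lattice_basis[OF assms(1), of b]]
    lattice_basis[OF i, of b] by (cases "i = j") auto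
 qed
 show ?thesis using *[of b' b] *[of b b'] assms(2) by fastforce
qed

text \<open>\<open>Z\<close> is the dual basis: \<open>Z j\<close> reads off the \<open>j\<close>-th
  coordinate. Its determinant is recorded because an upper bound for the entries of \<open>Z\<close>
  later bounds the covolume from below.\<close>

lemma edet_inverse:
 assumes "edet n b ~= 0"
 obtains Z where "\<And>k l. k < n ==> l < n ==> (\<Sum>j<n. b j k * Z j l) = (if k = l then 1 else 0)"
  "\<And>i j. i < n ==> j < n ==> (\<Sum>k<n. Z i k * b j k) = (if i = j then 1 else 0)"
  "Determinant.det (Matrix.mat n n (\<lambda>(j, k). Z j k)) * edet n b = 1"
proof -
 from det_non_zero_imp_unit[OF emat_carrier, of n b] assms
 obtain B where B: "B \<in> carrier_mat n n" "B * emat n b = 1\<^sub>m n" "emat n b * B = 1\<^sub>m n"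
  by (auto simp: edet_def Units_def ring_mat_def)
 define Z where "Z = (\<lambda>j k. B $$ (j, k))"
 have BZ: "B = Matrix.mat n n (\<lambda>(j, k). Z j k)" using B(1) by (auto simp: Z_def)
 show ?thesis
 proof
  fix k l assume kl: "k < n" "l < n"
  have "(emat n b * B) $$ (k, l) = (\<Sum>j<n. b j k * Z j l)"
   using kl B(1) by (simp add: emat_def scalar_prod_def atLeast0LessThan Z_def)
  then show "(\<Sum>j<n. b j k * Z j l) = (if k = l then 1 else 0)" using kl B(3) by simp
  have "(B * emat n b) $$ (k, l) = (\<Sum>i<n. Z k i * b l i)"
   using kl B(1) by (simp add: emat_def scalar_prod_def atLeast0LessThan Z_def)
  then show "(\<Sum>i<n. Z k i * b l i) = (if k = l then 1 else 0)" using kl B(2) by simp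
 next
  have "Determinant.det (B * emat n b) = 1" by (simp add: B)
  then show "Determinant.det (Matrix.mat n n (\<lambda>(j, k). Z j k)) * edet n b = 1"
   using B(1) by (simp add: Determinant.det_mult[of _ n] edet_def flip: BZ)
 qed
qed

lemma rcomb_inverse:
 fixes c :: "nat => complex"
 assumes Z: "\<And>i j. i < n ==> j < n ==> (\<Sum>k<n. Z i k * b j k) = (if i = j then 1 else 0)"
  and "i < n" and v: "\<And>k. k < n ==> v k = (\<Sum>j<n. c j * b j k)"
 shows "c i = (\<Sum>k<n. Z i k * v k)"
proof -
 have "(\<Sum>k<n. Z i k * v k) = (\<Sum>k<n. \<Sum>j<n. c j * (Z i k * b j k))"
  by (intro sum.cong refl) (simp add: v sum_distrib_left mult.left_commute)
 also have "\<dots> = (\<Sum>j<n. c j * (\<Sum>k<n. Z i k * b j k))"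
  by (subst sum.swap) (simp add: sum_distrib_left)
 also have "\<dots> = (\<Sum>j<n. if j = i then c j else 0)"
  using Z \<open>i < n\<close> by (intro sum.cong) auto
 also have "\<dots> = c i" using \<open>i < n\<close> by simp
 finally show ?thesis by simp
qed

lemma comb_unique:
 assumes "edet n b ~= 0" "\<And>k. k < n ==> (\<Sum>j<n. c j * b j k) = (\<Sum>j<n. d j * b j k)" "j < n"
 shows "c j = (d j :: complex)"
proof -
 obtain Z where Z: "\<And>i j. i < n ==> j < n ==> (\<Sum>k<n. Z i k * b j k) = (if i = j then 1 else 0)"
  using edet_inverse[OF assms(1)] by metis
 show ?thesis
  using rcomb_inverse[OF Z assms(3), of "\<lambda>k. (\<Sum>j<n. c j * b j k)" c] 
    rcomb_inverse[OF Z assms(3), of "\<lambda>k. (\<Sum>j<n. c j * b j k)" d] assms(2) by auto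
qed

lemma icomb_unique:
 assumes "edet n b ~= 0" "\<And>k. k < n ==> icomb n b a k = icomb n b c k" "j < n"
 shows "a j = c j"
 using comb_unique[OF assms(1), of "\<lambda>j. of_int (a j)" "\<lambda>j. of_int (c j)"] assms(2,3) by (simp add: rcomb_def)

text \<open>The coordinates are the values of the dual basis, whose members are bounded linear
  forms.\<close>

lemma coord_bound:
 assumes "edet n b ~= 0"
 obtains K where "K > 0" "\<And>x j. j < n ==> \<bar>x j\<bar> \<le> K * vnorm n (rcomb n b x)"
proof -
 obtain Z where Z: "\<And>i j. i < n ==> j < n ==> (\<Sum>k<n. Z i k * b j k) = (if i = j then 1 else 0)"
  using edet_inverse[OF assms] by metis
 \<comment> \<open>The summand 1 makes \<open>K\<close> positive even for an empty basis.\<close>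
 define K where "K = (\<Sum>i<n. \<Sum>k<n. cmod (Z i k)) + 1"
 show ?thesis
 proof
  have "(\<Sum>i<n. \<Sum>k<n. cmod (Z i k)) \<ge> 0" by (intro sum_nonneg) auto
  then show "K > 0" by (simp add: K_def)
  fix x j assume j: "j < n"
  have "complex_of_real (x j) = (\<Sum>k<n. Z j k * rcomb n b x k)"
   by (rule rcomb_inverse[OF Z j]) (auto simp: rcomb_def)
  then have "\<bar>x j\<bar> = cmod (\<Sum>k<n. Z j k * rcomb n b x k)" by (metis norm_of_real)
  also have "\<dots> \<le> (\<Sum>k<n. cmod (Z j k) * vnorm n (rcomb n b x))"
   by (rule norm_sum[THEN order_trans], rule sum_mono) (auto simp: norm_mult intro!: mult_left_mono cmod_le_vnorm)
  also have "\<dots> = (\<Sum>k<n. cmod (Z j k)) * vnorm n (rcomb n b x)" by (simp add: sum_distrib_right)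
  also have "\<dots> \<le> K * vnorm n (rcomb n b x)"
  proof (rule mult_right_mono)
   have "(\<Sum>k<n. cmod (Z j k)) \<le> (\<Sum>i<n. \<Sum>k<n. cmod (Z i k))"
    using j by (intro member_le_sum) (auto intro: sum_nonneg)
   then show "(\<Sum>k<n. cmod (Z j k)) \<le> K" by (simp add: K_def)
  qed simp
  finally show "\<bar>x j\<bar> \<le> K * vnorm n (rcomb n b x)" .
 qed
qed

text \<open>A bound on the length bounds every integer coordinate. Coordinate functions are taken
  extensional so that each lattice point is counted once.\<close>

lemma finite_lattice_ball:
 assumes "edet n b ~= 0"
 shows "finite {a \<in> {..<n} \<rightarrow>\<^sub>E (UNIV :: int set). vnorm n (icomb n b a) \<le> r}"
proof -
 obtain K where K: "K > 0" "\<And>x j. j < n ==> \<bar>x j\<bar> \<le> K * vnorm n (rcomb n b x)"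
  using coord_bound[OF assms] by metis
 define B where "B = \<lceil>K * r\<rceil>"
 have "a j \<in> {-B..B}" if "vnorm n (icomb n b a) \<le> r" "j < n" for a j
 proof -
  have "\<bar>real_of_int (a j)\<bar> \<le> K * vnorm n (icomb n b a)" using K(2)[OF that(2), of "\<lambda>j. real_of_int (a j)"] .
  also have "\<dots> \<le> K * r" using that K by simp
  finally show ?thesis unfolding B_def by simp linarith
 qed
 then have "{a \<in> {..<n} \<rightarrow>\<^sub>E UNIV. vnorm n (icomb n b a) \<le> r} \<subseteq> {..<n} \<rightarrow>\<^sub>E {-B..B}"
  unfolding PiE_def by blast
 then show ?thesis by (rule finite_subset) (auto intro: finite_PiE)
qed

lemma icomb_restrict: "icomb n b (restrict a {..<n}) = icomb n b a"
 by (rule ext) (simp add: rcomb_def)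

lemma icomb_if [simp]: "icomb n b (\<lambda>j. if j < n then a j else c j) = icomb n b a"
 by (rule ext) (simp add: rcomb_def)

text \<open>A crude form of Hadamard's inequality: the Leibniz expansion has \<open>fact n\<close>
  terms, each bounded by the product of the row bounds. Constant factors are harmless once
  logarithms are compared.\<close>

lemma det_bound:
 assumes "\<And>j k. j < n ==> k < n ==> cmod (f j k) \<le> r j"
 shows "cmod (Determinant.det (Matrix.mat n n (\<lambda>(j, k). f j k))) \<le> fact n * (\<Prod>j<n. r j)"
proof -
 have "Determinant.det (Matrix.mat n n (\<lambda>(j, k). f j k)) =
  (\<Sum>p | p permutes {0..<n}. of_int (sign p) * (\<Prod>i = 0..<n. f i (p i)))"
  by (subst Determinant.det_def'[of _ n]) (auto intro!: sum.cong prod.cong dest!: permutes_in_image)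
 also have "cmod \<dots> \<le> (\<Sum>p | p permutes {0..<n}. \<Prod>j<n. r j)"
 proof (rule norm_sum[THEN order_trans], rule sum_mono)
  fix p assume "p \<in> {p. p permutes {0..<n}}"
  then have p: "p permutes {0..<n}" by simp
  have "cmod (of_int (sign p) * (\<Prod>i = 0..<n. f i (p i))) = (\<Prod>i = 0..<n. cmod (f i (p i)))"
   by (simp add: norm_mult prod_norm sign_def)
  also have "\<dots> \<le> (\<Prod>i = 0..<n. r i)"
   using permutes_in_image[OF p] by (intro prod_mono) (auto intro: assms)
  finally show "cmod (of_int (sign p) * (\<Prod>i = 0..<n. f i (p i))) \<le> (\<Prod>j<n. r j)"
   by (simp add: atLeast0LessThan)
 qed
 also have "\<dots> = fact n * (\<Prod>j<n. r j)" by (simp add: card_permutations[of _ n])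
 finally show ?thesis .
qed

lemma edet_transpose: "edet n b = Determinant.det (Matrix.mat n n (\<lambda>(j, k). b j k))"
proof -
 have "emat n b = transpose_mat (Matrix.mat n n (\<lambda>(j, k). b j k))" by (auto simp: emat_def)
 then show ?thesis by (simp add: edet_def det_transpose[of _ n])
qed

lemma edet_le: "cmod (edet n b) \<le> fact n * (\<Prod>j<n. vnorm n (b j))"
 unfolding edet_transpose by (rule det_bound) (rule cmod_le_vnorm)

section \<open>Lattices closed under coordinatewise multiplication\<close>

locale mlattice =
 fixes n :: nat and b :: "nat => nat => complex"
 assumes n: "0 < n" "n \<le> 4"
  and nz: "edet n b ~= 0"
  and one_lat: "(\<lambda>_. 1) \<in> zlattice n b"
  and mult_basis: "\<And>i j. i < n ==> j < n ==> (\<lambda>k. b i k * b j k) \<in> zlattice n b"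
begin

lemma lat_mult:
 assumes "v \<in> zlattice n b" "w \<in> zlattice n b"
 shows "(\<lambda>k. v k * w k) \<in> zlattice n b"
proof -
 obtain a c where a: "\<And>k. k < n ==> v k = icomb n b a k" and c: "\<And>k. k < n ==> w k = icomb n b c k"
  using assms by (metis latticeE)
 have "(\<lambda>k. \<Sum>i<n. \<Sum>j<n. of_int (a i * c j) * (b i k * b j k)) \<in> zlattice n b"
  by (intro lattice_sum lattice_scale mult_basis) auto
 moreover have "v k * w k = (\<Sum>i<n. \<Sum>j<n. of_int (a i * c j) * (b i k * b j k))" if "k < n" for k
  by (simp add: a[OF that] c[OF that] rcomb_def sum_product mult_ac)
 ultimately show ?thesis by (subst lattice_cong) auto
qed

lemma lat_power: "v \<in> zlattice n b ==> (\<lambda>k. v k ^ m) \<in> zlattice n b"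
 by (induction m) (auto simp: one_lat lat_mult)

lemma lat_of_int: "(\<lambda>_. of_int s) \<in> zlattice n b"
 using lattice_scale[OF one_lat, of s] by simp

text \<open>All powers of a lattice vector of length below 1 would stay in a finite ball, so two of
  them coincide; a nonzero entry would then have absolute value 1, against the bound on the
  length.\<close>

lemma vnorm_ge_1:
 assumes v: "v \<in> zlattice n b" and k: "k < n" "v k ~= 0"
 shows "1 \<le> vnorm n v"
proof (rule ccontr)
 assume "\<not> 1 \<le> vnorm n v"
 then have lt: "vnorm n v < 1" by simp
 have lt1: "cmod (v k) < 1" if "k < n" for k using cmod_le_vnorm[OF that, of v] lt by simp
 define S where "S = {a \<in> {..<n} \<rightarrow>\<^sub>E (UNIV :: int set). vnorm n (icomb n b a) \<le> 1}"
 have fin: "finite S" unfolding S_def by (rule finite_lattice_ball[OF nz])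
 \<comment> \<open>Exponents start at 1, because the zeroth power has length \<open>sqrt n\<close>,
   which may exceed 1.\<close>
 have "\<exists>a\<in>S. \<forall>k<n. v k ^ Suc m = icomb n b a k" for m
 proof -
  obtain a where a: "\<And>k. k < n ==> v k ^ Suc m = icomb n b a k"
   using latticeE[OF lat_power[OF v, of "Suc m"]] by metis
  have "vnorm n (icomb n b a) = vnorm n (\<lambda>k. v k ^ Suc m)" using a by (intro vnorm_cong) auto
  also have "\<dots> \<le> vnorm n v"
   using lt1 by (intro vnorm_mono) (simp add: norm_mult norm_power mult_left_le power_le_one less_imp_le)
  finally have "restrict a {..<n} \<in> S" using lt by (auto simp: S_def icomb_restrict)
  then show ?thesis using a by (intro bexI[of _ "restrict a {..<n}"]) (auto simp: icomb_restrict)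
 qed
 then obtain f where f: "\<And>m. f m \<in> S" "\<And>m k. k < n ==> v k ^ Suc m = icomb n b (f m) k" by metis
 have "\<not> inj f" using fin f(1) by (metis finite_imageD finite_subset image_subsetI infinite_UNIV_nat)
 then obtain m m' where m: "m < m'" "f m = f m'" by (metis injI linorder_neqE_nat)
 have "v k ^ Suc m = v k ^ Suc m'" using f(2)[OF k(1)] m(2) by metis
 also have "\<dots> = v k ^ Suc m * v k ^ (m' - m)" using m(1) by (simp flip: power_add power_Suc)
 finally have "v k ^ (m' - m) = 1" using k(2) by simp
 then have "cmod (v k) ^ (m' - m) = 1" by (metis norm_one norm_power)
 moreover have "cmod (v k) ^ (m' - m) < 1" using lt1[OF k(1)] m(1) by (simp add: power_less_one_iff)
 ultimately show False by simp
qed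

text \<open>The sum of the entries is the trace of multiplication by \<open>v\<close>, which is
  diagonal in the standard basis and has an integral matrix \<open>A\<close> in the basis
  \<open>b\<close>. The second conclusion admits any such \<open>A\<close>, so that the trace
  defined through a ring basis can be inserted.\<close>

lemma trace_int:
 assumes v: "v \<in> zlattice n b"
 obtains t where "(\<Sum>k<n. v k) = of_int t" "\<And>A. (\<And>i k. i < n ==> k < n ==> v k * b i k = icomb n b (A i) k) ==> (\<Sum>i<n. A i i) = t"
proof -
 obtain Z where Z1: "\<And>k l. k < n ==> l < n ==> (\<Sum>j<n. b j k * Z j l) = (if k = l then 1 else 0)"
  and Z2: "\<And>i j. i < n ==> j < n ==> (\<Sum>k<n. Z i k * b j k) = (if i = j then 1 else 0)"
  using edet_inverse[OF nz] by metis
 have "\<exists>a. \<forall>k<n. v k * b i k = icomb n b a k" if "i < n" for i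
  using lat_mult[OF v lattice_basis[OF that]] by (auto simp: zlattice_def)
 then obtain A where A: "\<And>i k. i < n ==> k < n ==> v k * b i k = icomb n b (A i) k" by metis
 have tr: "(\<Sum>k<n. v k) = of_int (\<Sum>i<n. A i i)" if A: "\<And>i k. i < n ==> k < n ==> v k * b i k = icomb n b (A i) k" for A
 proof -
  have "of_int (A i i) = (\<Sum>k<n. Z i k * (v k * b i k))" if "i < n" for i
   using A[OF that] by (intro rcomb_inverse[OF Z2 that, of "\<lambda>k. v k * b i k" "\<lambda>j. of_int (A i j)"]) (auto simp: rcomb_def)
  then have "of_int (\<Sum>i<n. A i i) = (\<Sum>i<n. \<Sum>k<n. Z i k * (v k * b i k))" by simp
  also have "\<dots> = (\<Sum>k<n. v k * (\<Sum>i<n. b i k * Z i k))"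
   by (subst sum.swap) (simp add: sum_distrib_left mult_ac)
  also have "\<dots> = (\<Sum>k<n. v k)" using Z1 by (intro sum.cong) auto
  finally show ?thesis by simp
 qed
 show ?thesis
 proof (rule that[OF tr[OF A]])
  fix B assume "\<And>i k. i < n ==> k < n ==> v k * b i k = icomb n b (B i) k"
  from tr[OF this] have "of_int (\<Sum>i<n. B i i) = (of_int (\<Sum>i<n. A i i) :: complex)" using tr[OF A] by simp
  then show "(\<Sum>i<n. B i i) = (\<Sum>i<n. A i i)" by (simp only: of_int_eq_iff)
 qed
qed

text \<open>A Euclidean algorithm on the coordinates of \<open>1\<close>: while two coordinates are
  nonzero, a change of basis subtracts the smaller from the larger. It is phrased as minimality of
  the sum of absolute values.\<close>

lemma sparse_basis:
 "\<exists>b' u i. zlattice n b' = zlattice n b \<and> i < n \<and> (\<forall>k<n. 1 = of_int u * b' i k)"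
proof -
 define P where "P = (\<lambda>(b', u). zlattice n b' = zlattice n b \<and> (\<forall>k<n. (1::complex) = icomb n b' u k))"
 define f where "f = (\<lambda>(b' :: nat => nat => complex, u :: nat => int). nat (\<Sum>j<n. \<bar>u j\<bar>))"
 obtain u0 where "\<And>k. k < n ==> 1 = icomb n b u0 k" using latticeE[OF one_lat] by metis
 then have "P (b, u0)" by (simp add: P_def)
 then obtain b' u where P: "P (b', u)" and min: "\<And>b'' u'. P (b'', u') ==> f (b', u) \<le> f (b'', u')"
  using ex_has_least_nat[of P "(b, u0)" f] by (metis surj_pair)
 have lat: "zlattice n b' = zlattice n b" and u: "\<And>k. k < n ==> 1 = icomb n b' u k" using P by (auto simp: P_def)
 have "i = j" if ij: "i < n" "j < n" "u i ~= 0" "u j ~= 0" for i j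
 proof (rule ccontr)
  assume ne: "i ~= j"
  have *: False if ij: "i < n" "j < n" "u i ~= 0" "u j ~= 0" "i ~= j" "\<bar>u j\<bar> \<le> \<bar>u i\<bar>" for i j
  proof -
   \<comment> \<open>The sign is chosen so that \<open>u i - s * u j\<close> has absolute value
     \<open>\<bar>u i\<bar> - \<bar>u j\<bar>\<close>.\<close>
   define s where "s = sgn (u i) * sgn (u j)"
   define u' where "u' = u(i := u i - s * u j)"
   define c where "c = (\<lambda>l. if l = i then s else 0 :: int)"
   \<comment> \<open>Replacing \<open>b' j\<close> by \<open>b' j + s * b' i\<close> compensates for
     the changed coefficient at \<open>i\<close>, so that \<open>1\<close> is still
     represented.\<close>
   define b'' where "b'' = b'(j := \<lambda>k. b' j k + icomb n b' c k)"
   have ic: "icomb n b' c k = of_int s * b' i k" for k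
    using ij(1) by (simp add: rcomb_def c_def if_distrib[where f=of_int] if_distrib[where f=of_real] if_distrib[where f="\<lambda>c. c * _"] cong: if_cong)
   have "zlattice n b'' = zlattice n b'"
    by (rule lattice_modify[of j n c]) (use ij in \<open>auto simp: b''_def c_def\<close>)
   moreover have "1 = icomb n b'' u' k" if "k < n" for k
   proof -
    have "icomb n b'' u' k - icomb n b' u k = (\<Sum>l<n. (of_int (u' l) * b'' l k - of_int (u l) * b' l k))"
     by (simp add: rcomb_def sum_subtractf)
    also have "\<dots> = (\<Sum>l\<in>{i,j}. (of_int (u' l) * b'' l k - of_int (u l) * b' l k))"
     using ij by (intro sum.mono_neutral_right) (auto simp: u'_def b''_def)
    also have "\<dots> = 0" using ij(5) by (simp add: u'_def b''_def ic algebra_simps)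
    finally show ?thesis using u[OF that] by simp
   qed
   ultimately have "P (b'', u')" using lat by (simp add: P_def)
   then have le: "f (b', u) \<le> f (b'', u')" by (rule min)
   have "(\<Sum>l<n. \<bar>u' l\<bar>) < (\<Sum>l<n. \<bar>u l\<bar>)"
   proof (rule sum_strict_mono_ex1)
    have ui: "\<bar>u' i\<bar> < \<bar>u i\<bar>" 
    proof -
     have "u' i = sgn (u i) * (\<bar>u i\<bar> - \<bar>u j\<bar>)"
      by (simp add: u'_def s_def right_diff_distrib linordered_idom_class.abs_sgn mult_ac flip: mult_sgn_abs)
     then show ?thesis using ij by (simp add: abs_mult abs_sgn_eq)
    qed
    then show "\<exists>l\<in>{..<n}. \<bar>u' l\<bar> < \<bar>u l\<bar>" using ij(1) by auto
    show "\<forall>l\<in>{..<n}. \<bar>u' l\<bar> \<le> \<bar>u l\<bar>" using ui by (auto simp: u'_def)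
   qed auto
   moreover have "0 \<le> (\<Sum>l<n. \<bar>u' l\<bar>)" by (intro sum_nonneg) auto
   ultimately show False using le by (simp add: f_def zless_nat_conj flip: not_less)
  qed
  show False using *[of i j] *[of j i] ij ne by linarith
 qed
 moreover have "\<exists>i<n. u i ~= 0" 
 proof (rule ccontr)
  assume "\<not> ?thesis"
  then have "icomb n b' u 0 = 0" by (simp add: rcomb_def)
  then show False using u[of 0] n by simp
 qed
 then obtain i where i: "i < n" "u i ~= 0" by blast
 ultimately have z: "\<And>j. j < n ==> j ~= i ==> u j = 0" by blast
 have "1 = of_int (u i) * b' i k" if "k < n" for k
 proof -
  have "icomb n b' u k = (\<Sum>l\<in>{i}. of_int (u l) * b' l k)"
   unfolding rcomb_def using i z by (intro sum.mono_neutral_cong_right) auto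
  then show ?thesis using u[OF that] by simp
 qed
 then show ?thesis using lat i by blast
qed

text \<open>If \<open>1 = u * b' i\<close> with \<open>\<bar>u\<bar>\<close> at least 2, then a
  power of the constant vector \<open>1 / u\<close> would be a nonzero lattice vector shorter than
  1.\<close>

lemma unit_basis: "\<exists>b'. zlattice n b' = zlattice n b \<and> (\<forall>k<n. b' 0 k = 1)"
proof -
 obtain b' u i where b': "zlattice n b' = zlattice n b" "i < n" "\<And>k. k < n ==> 1 = of_int u * b' i k"
  using sparse_basis by metis
 have u0: "u ~= 0" using b'(3)[of 0] n by auto
 have bi: "b' i k = 1 / of_int u" if "k < n" for k using b'(3)[OF that] u0 by (simp add: field_simps)
 have "\<bar>u\<bar> = 1"
 proof (rule ccontr)
  assume "\<bar>u\<bar> ~= 1"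
  then have u2: "2 \<le> \<bar>u\<bar>" using u0 by linarith
  \<comment> \<open>The square is taken because \<open>1 / u\<close> itself has length
    \<open>sqrt n / \<bar>u\<bar>\<close>, which is not below 1 when \<open>n = 4\<close> and
    \<open>\<bar>u\<bar> = 2\<close>.\<close>
  have lat: "(\<lambda>k. b' i k ^ 2) \<in> zlattice n b" using lattice_basis[OF b'(2), of b'] b'(1) by (intro lat_power) auto
  have "1 \<le> vnorm n (\<lambda>k. b' i k ^ 2)" using n bi[of 0] u0 by (intro vnorm_ge_1[OF lat, of 0]) auto
  also have "\<dots> = vnorm n (\<lambda>k. 1 / of_int u ^ 2)" by (intro vnorm_cong) (simp add: bi power_divide)
  also have "\<dots> = sqrt (real n) * (1 / (real_of_int \<bar>u\<bar>)\<^sup>2)"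
   by (simp add: vnorm_const norm_divide norm_power)
  also have "\<dots> \<le> 2 * (1 / 4)"
  proof (intro mult_mono)
   have "sqrt (real n) \<le> sqrt 4" using n by (intro real_sqrt_le_mono) auto
   then show "sqrt (real n) \<le> 2" by simp
   have "(2::real)\<^sup>2 \<le> (real_of_int \<bar>u\<bar>)\<^sup>2" using u2 by (intro power_mono) linarith+
   then show "1 / (real_of_int \<bar>u\<bar>)\<^sup>2 \<le> 1 / 4" by (intro divide_left_mono) (auto simp: u0)
  qed auto
  finally show False by simp
 qed
 then have u: "u = 1 \<or> u = -1" by linarith
 define b1 where "b1 = (if u = 1 then b' else b'(i := \<lambda>k. - b' i k))"
 have lat1: "zlattice n b1 = zlattice n b'" using lattice_negate[OF b'(2), of b1 b'] by (auto simp: b1_def)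
 have b1i: "b1 i k = 1" if "k < n" for k using u bi[OF that] by (auto simp: b1_def)
 define p where "p = Transposition.transpose 0 i"
 have p: "p permutes {..<n}" unfolding p_def using b'(2) n by (intro permutes_swap_id) auto
 show ?thesis
  using lattice_permute[OF p, of b1] lat1 b'(1) b1i
  by (intro exI[of _ "\<lambda>j. b1 (p j)"]) (auto simp: p_def)
qed

end

section \<open>Reduced bases\<close>

text \<open>The squares absorb the cross term: twice \<open>\<bar>x * y\<bar>\<close> is at most the
  sum of the squares, and its coefficient is bounded by the smaller diagonal entry
  \<open>g11\<close>.\<close>

lemma binary_form_reduced:
 fixes g11 g22 g12 :: real
 assumes pos: "0 \<le> g11" "g11 \<le> g22" "2 * \<bar>g12\<bar> \<le> g11"
 shows "g11 * x\<^sup>2 + g22 * y\<^sup>2 \<le> 2 * (g11 * x\<^sup>2 + g22 * y\<^sup>2 + 2 * g12 * x * y)"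
proof -
 have "\<bar>4 * g12 * x * y\<bar> = 2 * \<bar>g12\<bar> * (2 * (\<bar>x\<bar> * \<bar>y\<bar>))" by (simp add: abs_mult)
 also have "\<dots> \<le> g11 * (2 * (\<bar>x\<bar> * \<bar>y\<bar>))" using pos by (intro mult_right_mono) auto
 also have "\<dots> \<le> g11 * (x\<^sup>2 + y\<^sup>2)"
  using sum_squares_bound[of "\<bar>x\<bar>" "\<bar>y\<bar>"] pos by (intro mult_left_mono) (auto simp: mult.assoc)
 also have "\<dots> \<le> g11 * x\<^sup>2 + g22 * y\<^sup>2" using pos by (simp add: distrib_left mult_right_mono)
 finally show ?thesis by (simp add: abs_le_iff algebra_simps)
qed

text \<open>Completing the square splits \<open>Q x y 1\<close> into its minimum over
  \<open>x\<close> and \<open>y\<close> and the binary form \<open>P\<close>. Rounding the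
  minimising point to integers and using \<open>min3\<close> shows that this minimum is at least
  \<open>g33 / 4\<close>, which controls \<open>z\<close>; the binary case then controls
  \<open>x\<close> and \<open>y\<close>.\<close>

lemma ternary_form_reduced:
 fixes g11 g22 g33 g12 g13 g23 :: real
 defines "Q \<equiv> \<lambda>x y z. g11 * x\<^sup>2 + g22 * y\<^sup>2 + g33 * z\<^sup>2 + 2 * g12 * x * y + 2 * g13 * x * z + 2 * g23 * y * z"
 assumes nonneg: "\<And>x y z. 0 \<le> Q x y z"
  and pos: "0 < g11" "g11 \<le> g22" "g22 \<le> g33"
  and min2: "\<And>s :: int. g22 \<le> Q (of_int s) 1 0"
  and min3: "\<And>s t :: int. g33 \<le> Q (of_int s) (of_int t) 1"
 shows "g11 * x\<^sup>2 \<le> 20 * Q x y z" "g22 * y\<^sup>2 \<le> 20 * Q x y z" "g33 * z\<^sup>2 \<le> 20 * Q x y z"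
proof -
 have g12: "2 * \<bar>g12\<bar> \<le> g11" using min2[of 1] min2[of "-1"] by (simp add: Q_def)
 define P where "P = (\<lambda>x y. g11 * x\<^sup>2 + g22 * y\<^sup>2 + 2 * g12 * x * y)"
 have P: "g11 * x\<^sup>2 + g22 * y\<^sup>2 \<le> 2 * P x y" for x y
  using binary_form_reduced[of g11 g22 g12 x y] pos g12 by (simp add: P_def)
 define D where "D = g11 * g22 - g12\<^sup>2"
 have "g12\<^sup>2 \<le> (g11 / 2)\<^sup>2" using g12 by (intro abs_le_square_iff[THEN iffD1]) auto
 also have "\<dots> < g11 * g22"
 proof -
  have "g11 * g11 \<le> g11 * g22" using pos by (intro mult_left_mono) auto
  moreover have "0 < g11 * g11" using pos by simp
  ultimately show ?thesis unfolding power2_eq_square by (simp add: field_simps)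
 qed
 finally have D: "D > 0" by (simp add: D_def)
 \<comment> \<open>\<open>(p, q)\<close> is the critical point of \<open>Q x y 1\<close> in
   \<open>x\<close> and \<open>y\<close>, found by Cramer's rule with determinant
   \<open>D\<close>.\<close>
 define p where "p = (g12 * g23 - g22 * g13) / D"
 define q where "q = (g12 * g13 - g11 * g23) / D"
 have "g11 * p + g12 * q + g13 = (g11 * (g12 * g23 - g22 * g13) + g12 * (g12 * g13 - g11 * g23) + g13 * D) / D"
  using D by (simp add: p_def q_def add_divide_distrib)
 also have "\<dots> = 0" by (simp add: D_def algebra_simps power2_eq_square)
 finally have pq1: "g11 * p + g12 * q + g13 = 0" .
 have "g12 * p + g22 * q + g23 = (g12 * (g12 * g23 - g22 * g13) + g22 * (g12 * g13 - g11 * g23) + g23 * D) / D"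
  using D by (simp add: p_def q_def add_divide_distrib)
 also have "\<dots> = 0" by (simp add: D_def algebra_simps power2_eq_square)
 finally have pq2: "g12 * p + g22 * q + g23 = 0" .
 have decomp: "Q x y 1 = Q p q 1 + P (x - p) (y - q)" for x y
 proof -
  have e1: "g13 = - g11 * p - g12 * q" and e2: "g23 = - g12 * p - g22 * q" using pq1 pq2 by auto
  show ?thesis unfolding Q_def P_def e1 e2 by (simp add: algebra_simps power2_eq_square)
 qed
 have Ppos: "0 \<le> P x y" for x y
 proof -
  have "0 \<le> g11 * x\<^sup>2 + g22 * y\<^sup>2" using pos by simp
  then show ?thesis using P[of x y] by linarith
 qed
 have "Q p q 1 \<ge> g33 / 4"
 proof -
  \<comment> \<open>The offsets are at most 1/2, so each of the three terms of \<open>P a c\<close>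
    is at most \<open>g33 / 4\<close>.\<close>
  define a where "a = of_int (round p) - p"
  define c where "c = of_int (round q) - q"
  have a: "\<bar>a\<bar> \<le> 1/2" and c: "\<bar>c\<bar> \<le> 1/2"
   unfolding a_def c_def by (rule of_int_round_abs_le)+
  have a2: "a\<^sup>2 \<le> 1/4" and c2: "c\<^sup>2 \<le> 1/4"
   using abs_le_square_iff[of a "1/2"] abs_le_square_iff[of c "1/2"] a c by (simp_all add: power2_eq_square)
  have ac: "\<bar>a * c\<bar> \<le> 1/4" using mult_mono[OF a c] by (simp add: abs_mult)
  have "2 * g12 * a * c \<le> \<bar>2 * g12 * a * c\<bar>" by (rule abs_ge_self)
  also have "\<dots> = (2 * \<bar>g12\<bar>) * \<bar>a * c\<bar>" by (simp add: abs_mult)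
  also have "\<dots> \<le> g11 * (1/4)" using g12 ac pos by (intro mult_mono) auto
  finally have 1: "2 * g12 * a * c \<le> g11 / 4" by simp
  have 2: "g11 * a\<^sup>2 \<le> g11 / 4" using mult_left_mono[OF a2, of g11] pos by simp
  have 3: "g22 * c\<^sup>2 \<le> g22 / 4" using mult_left_mono[OF c2, of g22] pos by simp
  have "P a c \<le> 3/4 * g33" unfolding P_def using 1 2 3 pos by linarith
  moreover have "g33 \<le> Q p q 1 + P a c"
   using min3[of "round p" "round q"] decomp[of "of_int (round p)" "of_int (round q)"] by (simp add: a_def c_def)
  ultimately show ?thesis by linarith
 qed
 then have Q1: "g33 / 4 \<le> Q x y 1" for x y using decomp[of x y] Ppos[of "x - p" "y - q"] by linarith
 have Qz: "g33 * z\<^sup>2 \<le> 4 * Q x y z" for x y z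
 proof (cases "z = 0")
  case True
  then show ?thesis using nonneg[of x y 0] by simp
 next
  case False
  have "Q x y z = z\<^sup>2 * Q (x / z) (y / z) 1" using False by (simp add: Q_def field_simps power2_eq_square)
  moreover have "z\<^sup>2 * (g33 / 4) \<le> z\<^sup>2 * Q (x / z) (y / z) 1" by (intro mult_left_mono Q1) auto
  ultimately show ?thesis by (simp add: mult_ac)
 qed
 show "g33 * z\<^sup>2 \<le> 20 * Q x y z" using Qz[of z x y] nonneg[of x y z] by linarith
 \<comment> \<open>Nonnegativity at \<open>(x, y, 2 * z)\<close> rearranges to this bound. With the
   factor 4 for \<open>z\<close> it gives \<open>P x y \<le> 10 * Q x y z\<close>, and the factor 2
   of the binary case makes 20.\<close>
 have "P x y \<le> 2 * Q x y z + 2 * (g33 * z\<^sup>2)"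
  using nonneg[of x y "2 * z"] by (simp add: P_def Q_def algebra_simps power2_eq_square)
 then have Pxy: "P x y \<le> 10 * Q x y z" using Qz[of z x y] by linarith
 have "0 \<le> g11 * x\<^sup>2" "0 \<le> g22 * y\<^sup>2" using pos by auto
 then show "g11 * x\<^sup>2 \<le> 20 * Q x y z" "g22 * y\<^sup>2 \<le> 20 * Q x y z" using P[of x y] Pxy by linarith+
qed

definition vmean :: "nat => (nat => complex) => complex" where
 "vmean n v = (\<Sum>k<n. v k) / of_nat n"

text \<open>The vector \<open>1\<close> has to stay in the basis, so reduction takes place in the
  projection orthogonal to it.\<close>

definition centred :: "nat => (nat => complex) => nat => complex" where
 "centred n v = (\<lambda>k. v k - vmean n v)"

definition cnorm :: "nat => (nat => complex) => real" where
 "cnorm n v = vnorm n (centred n v)"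

lemma vmean_cong: "(\<And>k. k < n ==> v k = w k) ==> vmean n v = vmean n w"
 by (simp add: vmean_def)

lemma cnorm_cong: "(\<And>k. k < n ==> v k = w k) ==> cnorm n v = cnorm n w"
 unfolding cnorm_def centred_def using vmean_cong[of n v w] by (intro vnorm_cong) simp

lemma cnorm_nonneg [simp]: "0 \<le> cnorm n v" by (simp add: cnorm_def)

text \<open>Pythagoras for the orthogonal projection onto the constant vectors.\<close>

lemma vnorm_split: "0 < n ==> (vnorm n v)\<^sup>2 = (cnorm n v)\<^sup>2 + real n * (cmod (vmean n v))\<^sup>2"
proof -
 assume n: "0 < n"
 define m where "m = vmean n v"
 have sm: "(\<Sum>k<n. v k) = of_nat n * m" using n by (simp add: m_def vmean_def)
 have *: "(cmod (z - m))\<^sup>2 = (cmod z)\<^sup>2 + (cmod m)\<^sup>2 - 2 * Re (z * cnj m)" for z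
  unfolding cmod_power2 by (simp add: algebra_simps power2_eq_square)
 have "(cnorm n v)\<^sup>2 = (\<Sum>k<n. (cmod (v k))\<^sup>2) + real n * (cmod m)\<^sup>2 - 2 * (\<Sum>k<n. Re (v k * cnj m))"
  by (simp add: cnorm_def centred_def vnorm_sq * sum.distrib sum_subtractf sum_distrib_left flip: m_def)
 also have "(\<Sum>k<n. Re (v k * cnj m)) = Re ((\<Sum>k<n. v k) * cnj m)" by (simp only: sum_distrib_right Re_sum)
 also have "\<dots> = real n * (cmod m)\<^sup>2" by (simp add: sm mult.assoc complex_mult_cnj cmod_power2)
 finally show ?thesis by (simp add: vnorm_sq m_def)
qed

lemma cnorm_le: "0 < n ==> cnorm n v \<le> vnorm n v"
 by (rule power2_le_imp_le) (simp_all add: vnorm_split)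

lemma cnorm_add_const: "0 < n ==> cnorm n (\<lambda>k. v k + c) = cnorm n v"
 by (simp add: cnorm_def centred_def vmean_def sum.distrib add_divide_distrib)

lemma centred_rcomb: "centred n (rcomb n b x) = rcomb n (\<lambda>j. centred n (b j)) x"
proof -
 have "vmean n (rcomb n b x) = (\<Sum>j<n. of_real (x j) * vmean n (b j))"
  unfolding vmean_def rcomb_def by (subst sum.swap) (simp add: sum_distrib_left sum_divide_distrib)
 then show ?thesis by (intro ext) (simp add: centred_def rcomb_def sum_subtractf right_diff_distrib)
qed

text \<open>Coordinates are real, so the real part of the Hermitian product carries the whole
  quadratic form.\<close>

definition gram :: "nat => (nat => nat => complex) => nat => nat => real" where
 "gram n b i j = (\<Sum>k<n. Re (b i k * cnj (b j k)))"

lemma gram_sym: "gram n b i j = gram n b j i"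
 unfolding gram_def by (intro sum.cong) (auto simp: algebra_simps)

lemma vnorm_rcomb_gram: "(vnorm n (rcomb n b x))\<^sup>2 = (\<Sum>i<n. \<Sum>j<n. x i * x j * gram n b i j)"
proof -
 have "(cmod (rcomb n b x k))\<^sup>2 = (\<Sum>i<n. \<Sum>j<n. x i * x j * Re (b i k * cnj (b j k)))" for k
 proof -
  have "complex_of_real ((cmod (rcomb n b x k))\<^sup>2) = rcomb n b x k * cnj (rcomb n b x k)"
   by (rule complex_norm_square)
  also have "\<dots> = (\<Sum>i<n. \<Sum>j<n. of_real (x i * x j) * (b i k * cnj (b j k)))"
   by (simp add: rcomb_def cnj_sum sum_product mult_ac)
  finally have "(cmod (rcomb n b x k))\<^sup>2 = Re (\<Sum>i<n. \<Sum>j<n. of_real (x i * x j) * (b i k * cnj (b j k)))"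
   by (metis Re_complex_of_real)
  also have "\<dots> = (\<Sum>i<n. \<Sum>j<n. x i * x j * Re (b i k * cnj (b j k)))"
   by (simp only: Re_sum Re_complex_of_real times_complex.sel Im_complex_of_real mult_zero_left diff_zero)
  finally show ?thesis .
 qed
 then have "(vnorm n (rcomb n b x))\<^sup>2 = (\<Sum>k<n. \<Sum>i<n. \<Sum>j<n. x i * x j * Re (b i k * cnj (b j k)))"
  by (simp add: vnorm_sq)
 also have "\<dots> = (\<Sum>i<n. \<Sum>k<n. \<Sum>j<n. x i * x j * Re (b i k * cnj (b j k)))" by (rule sum.swap)
 also have "\<dots> = (\<Sum>i<n. \<Sum>j<n. \<Sum>k<n. x i * x j * Re (b i k * cnj (b j k)))"
  by (intro sum.cong refl sum.swap)
 finally show ?thesis by (simp only: gram_def sum_distrib_left)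
qed

text \<open>Index 0 is left fixed because that position holds the vector \<open>1\<close>.\<close>

lemma sorting_permutation:
 fixes f :: "nat => real"
 obtains p where "p permutes {1..<n}" "\<And>i j. 1 \<le> i ==> i \<le> j ==> j < n ==> f (p i) \<le> f (p j)"
proof -
 define xs where "xs = sort_key f [1..<n]"
 have len: "length xs = n - 1" and dist: "distinct xs" and set: "set xs = {1..<n}" and sorted: "sorted (map f xs)"
  by (auto simp: xs_def)
 define p where "p = (\<lambda>i. if i \<in> {1..<n} then xs ! (i - 1) else i)"
 have "p permutes {1..<n}"
 proof (rule bij_imp_permutes)
  have "bij_betw (\<lambda>i. i - 1) {1..<n} {..<n - 1}"
   by (rule bij_betw_byWitness[of _ "\<lambda>i. i + 1"]) auto
  then have "bij_betw ((!) xs \<circ> (\<lambda>i. i - 1)) {1..<n} {1..<n}"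
   using bij_betw_nth[OF dist, of "{..<n-1}" "{1..<n}"] len set by (intro bij_betw_trans) auto
  then show "bij_betw p {1..<n} {1..<n}" by (rule bij_betw_cong[THEN iffD1, rotated]) (auto simp: p_def)
 qed (auto simp: p_def)
 moreover have "f (p i) \<le> f (p j)" if "1 \<le> i" "i \<le> j" "j < n" for i j
  using sorted_nth_mono[OF sorted, of "i - 1" "j - 1"] that len by (auto simp: p_def)
 ultimately show ?thesis using that by blast
qed

text \<open>The second condition is quantitative independence over the reals, the third says that
  lengths increase up to a constant. Together they make successive minima and covolume comparable
  with the lengths of the basis vectors.\<close>

definition reduced :: "real => nat => (nat => nat => complex) => bool" where
 "reduced K n b \<longleftrightarrow> (\<forall>k<n. b 0 k = 1) \<and>
   (\<forall>x. \<forall>j<n. \<bar>x j\<bar> * vnorm n (b j) \<le> K * vnorm n (rcomb n b x)) \<and>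
   (\<forall>i j. i \<le> j --> j < n --> vnorm n (b i) \<le> K * vnorm n (b j))"

context mlattice begin

lemma vmean_lattice:
 assumes "v \<in> zlattice n b" obtains t where "vmean n v = of_real t"
 using trace_int[OF assms] by (metis vmean_def of_real_divide of_real_of_int_eq of_real_of_nat_eq)

text \<open>With \<open>t\<close> the trace of \<open>v\<close>, the vector \<open>n * v - t\<close>
  lies in the lattice and is \<open>n\<close> times the centred vector, so \<open>vnorm_ge_1\<close>
  applies to it.\<close>

lemma cnorm_ge:
 assumes v: "v \<in> zlattice n b" and k: "k < n" "centred n v k ~= 0"
 shows "1 \<le> real n * cnorm n v"
proof -
 obtain t where t: "(\<Sum>k<n. v k) = of_int t" using trace_int[OF v] by metis
 let ?w = "\<lambda>k. of_int (int n) * v k - of_int t"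
 have w: "?w \<in> zlattice n b" by (intro lattice_diff lattice_scale v lat_of_int)
 have eq: "?w k = of_nat n * centred n v k" for k
  using n by (simp add: centred_def vmean_def t right_diff_distrib)
 have "1 \<le> vnorm n ?w" using k n eq by (intro vnorm_ge_1[OF w k(1)]) auto
 also have "vnorm n ?w = real n * cnorm n v"
  unfolding eq cnorm_def by (subst vnorm_scale) simp
 finally show ?thesis .
qed

text \<open>Adding multiples of \<open>1\<close> does not alter centred lengths. The bound on the
  means removes this freedom, so that bounded \<open>energy\<close> leaves only finitely many
  choices for the entries below \<open>n\<close>.\<close>

definition normalized :: "(nat => nat => complex) => bool" where
 "normalized b' \<longleftrightarrow> zlattice n b' = zlattice n b \<and> (\<forall>k<n. b' 0 k = 1) \<and>
   (\<forall>j\<in>{1..<n}. cmod (vmean n (b' j)) \<le> 1 / 2)"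

definition energy :: "(nat => nat => complex) => real" where
 "energy b' = (\<Sum>j\<in>{1..<n}. (cnorm n (b' j))\<^sup>2)"

lemma normalizedD:
 assumes "normalized b'"
 shows "zlattice n b' = zlattice n b" "\<And>k. k < n ==> b' 0 k = 1"
  "\<And>j. 1 \<le> j ==> j < n ==> cmod (vmean n (b' j)) \<le> 1 / 2"
 using assms by (auto simp: normalized_def)

lemma zlattice_cong_basis:
 assumes "\<And>j k. j < n ==> k < n ==> b1 j k = b2 j k"
 shows "zlattice n b1 = zlattice n b2"
proof -
 have "icomb n b1 a k = icomb n b2 a k" if "k < n" for a k
  using that assms by (auto simp: rcomb_def intro!: sum.cong)
 then show ?thesis by (auto simp: zlattice_def)
qed

lemma normalized_cong:
 assumes "\<And>j k. j < n ==> k < n ==> b1 j k = b2 j k"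
 shows "normalized b1 \<longleftrightarrow> normalized b2" "energy b1 = energy b2"
proof -
 have m: "vmean n (b1 j) = vmean n (b2 j)" and c: "cnorm n (b1 j) = cnorm n (b2 j)" if "j < n" for j
  using that assms by (auto intro: vmean_cong cnorm_cong)
 show "normalized b1 \<longleftrightarrow> normalized b2"
  using zlattice_cong_basis[of b1 b2] m assms n unfolding normalized_def by auto
 show "energy b1 = energy b2" unfolding energy_def using c by (intro sum.cong) auto
qed

text \<open>The combination \<open>a\<close> may shift the mean; subtracting the rounded mean as a
  multiple of \<open>b' 0 = 1\<close> restores the bound on it without changing the centred
  length.\<close>

lemma normalize_step:
 assumes b': "zlattice n b' = zlattice n b" "\<And>k. k < n ==> b' 0 k = 1"
  and j: "1 \<le> j" "j < n" and a: "a j = 0"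
 shows "\<exists>b''. zlattice n b'' = zlattice n b \<and> (\<forall>i. i ~= j --> b'' i = b' i) \<and>
  cmod (vmean n (b'' j)) \<le> 1 / 2 \<and> cnorm n (b'' j) = cnorm n (\<lambda>k. b' j k + icomb n b' a k)"
proof -
 let ?v = "\<lambda>k. b' j k + icomb n b' a k"
 have "?v \<in> zlattice n b'" using j by (intro lattice_add lattice_icomb lattice_basis) auto
 then have v: "?v \<in> zlattice n b" using b' by simp
 obtain t where t: "vmean n ?v = of_real t" using vmean_lattice[OF v] by metis
 define s where "s = round t"
 define a' where "a' = a(0 := a 0 - s)"
 define b'' where "b'' = b'(j := \<lambda>k. b' j k + icomb n b' a' k)"
 have ic: "icomb n b' a' k = icomb n b' a k - of_int s" if "k < n" for k
 proof -
  have "icomb n b' a' k - icomb n b' a k = (\<Sum>i<n. (of_int (a' i) - of_int (a i)) * b' i k)"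
   by (simp add: rcomb_def sum_subtractf left_diff_distrib)
  also have "\<dots> = (\<Sum>i\<in>{0}. (of_int (a' i) - of_int (a i)) * b' i k)"
   using n by (intro sum.mono_neutral_right) (auto simp: a'_def)
  also have "\<dots> = - of_int s" using b'(2)[OF that] by (simp add: a'_def)
  finally show ?thesis by (simp add: algebra_simps)
 qed
 have eq: "b'' j k = ?v k - of_int s" if "k < n" for k using ic[OF that] by (simp add: b''_def)
 show ?thesis
 proof (intro exI conjI allI impI)
  show "zlattice n b'' = zlattice n b"
   unfolding b'(1)[symmetric] by (rule lattice_modify[of j n a']) (use j a in \<open>auto simp: a'_def b''_def\<close>)
  show "b'' i = b' i" if "i ~= j" for i using that by (simp add: b''_def)
  have "vmean n (b'' j) = vmean n (\<lambda>k. ?v k - of_int s)" using eq by (intro vmean_cong) auto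
  also have "\<dots> = vmean n ?v - of_int s" using n by (simp add: vmean_def sum_subtractf diff_divide_distrib)
  also have "\<dots> = of_real (t - of_int s)" by (simp add: t)
  finally have "cmod (vmean n (b'' j)) = \<bar>of_int s - t\<bar>" by (simp only: norm_of_real abs_minus_commute)
  also have "\<dots> \<le> 1 / 2" unfolding s_def by (rule of_int_round_abs_le)
  finally show "cmod (vmean n (b'' j)) \<le> 1 / 2" .
  have "cnorm n (b'' j) = cnorm n (\<lambda>k. ?v k + (- of_int s))" using eq by (intro cnorm_cong) auto
  also have "\<dots> = cnorm n ?v" using n by (intro cnorm_add_const) auto
  finally show "cnorm n (b'' j) = cnorm n ?v" .
 qed
qed

lemma ex_normalized: "\<exists>b'. normalized b'"
proof -
 obtain b0 where b0: "zlattice n b0 = zlattice n b" "\<And>k. k < n ==> b0 0 k = 1" using unit_basis by metis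
 have "\<exists>b'. zlattice n b' = zlattice n b \<and> (\<forall>k<n. b' 0 k = 1) \<and> (\<forall>j\<in>{1..<n}. j < m --> cmod (vmean n (b' j)) \<le> 1 / 2)" for m
 proof (induction m)
  case 0
  then show ?case using b0 by auto
 next
  case (Suc m)
  then obtain b' where b': "zlattice n b' = zlattice n b" "\<And>k. k < n ==> b' 0 k = 1"
   "\<And>j. 1 \<le> j ==> j < n ==> j < m ==> cmod (vmean n (b' j)) \<le> 1 / 2" by auto
  show ?case
  proof (cases "1 \<le> m \<and> m < n")
   case True
   then have m: "1 \<le> m" "m < n" by auto
   obtain b'' where b'': "zlattice n b'' = zlattice n b" "\<And>i. i ~= m ==> b'' i = b' i"
    "cmod (vmean n (b'' m)) \<le> 1 / 2"
    using normalize_step[where a="\<lambda>_. 0", OF b'(1,2) m refl] by blast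
   have "b'' 0 k = 1" if "k < n" for k using b''(2)[of 0] b'(2)[OF that] m by simp
   moreover have "cmod (vmean n (b'' j)) \<le> 1 / 2" if "1 \<le> j" "j < n" "j < Suc m" for j
    using b''(2)[of j] b''(3) b'(3)[of j] that by (cases "j = m") auto
   ultimately show ?thesis using b''(1) by (intro exI[of _ b'']) simp
  next
   case False
   then show ?thesis using b' by (intro exI[of _ b']) (auto simp: less_Suc_eq)
  qed
 qed
 from this[of n] show ?thesis unfolding normalized_def by auto
qed

text \<open>A basis that does not exceed the energy of a given one has its vectors in a fixed ball
  of the lattice, so the minimum is taken over a finite set of coordinate tables.\<close>

lemma ex_min_energy: "\<exists>b'. normalized b' \<and> (\<forall>b''. normalized b'' --> energy b' \<le> energy b'')"
proof -
 obtain b0 where b0: "normalized b0" using ex_normalized by blast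
 \<comment> \<open>The squared length of a vector is its squared centred length, at most the energy,
   plus at most \<open>n\<close>; the vector \<open>1\<close> has squared length
   \<open>n\<close>.\<close>
 define r where "r = sqrt (energy b0 + real n)"
 define S where "S = {a \<in> {..<n} \<rightarrow>\<^sub>E (UNIV :: int set). vnorm n (icomb n b a) \<le> r}"
 define bb :: "(nat => nat => int) => nat => nat => complex" where "bb = (\<lambda>A j. icomb n b (A j))"
 define T where "T = {A \<in> {..<n} \<rightarrow>\<^sub>E S. normalized (bb A)}"
 have "finite S" unfolding S_def by (rule finite_lattice_ball[OF nz])
 then have finT: "finite T" unfolding T_def by (auto intro: finite_subset[OF _ finite_PiE[of "{..<n}" "\<lambda>_. S"]])
 have repr: "\<exists>A\<in>T. energy (bb A) = energy b''" if b'': "normalized b''" "energy b'' \<le> energy b0" for b''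
 proof -
  have "\<exists>a. \<forall>k<n. b'' j k = icomb n b a k" if "j < n" for j
   using lattice_basis[OF that, of b''] normalizedD(1)[OF b''(1)] by (auto simp: zlattice_def)
  then obtain A where A: "\<And>j k. j < n ==> k < n ==> b'' j k = icomb n b (A j) k" by metis
  define A' where "A' = (\<lambda>j\<in>{..<n}. restrict (A j) {..<n})"
  have A': "b'' j k = bb A' j k" if "j < n" "k < n" for j k
   using A[OF that] that by (simp add: bb_def A'_def)
  have "vnorm n (b'' j) \<le> r" if j: "j < n" for j
  proof -
   have "(vnorm n (b'' j))\<^sup>2 \<le> energy b0 + real n"
   proof (cases "j = 0")
    case True
    have "vnorm n (b'' j) = sqrt (real n)" unfolding True
     using vnorm_cong[of n "b'' 0" "\<lambda>_. 1"] normalizedD(2)[OF b''(1)] vnorm_const[of n 1] by simp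
    then show ?thesis by (simp add: energy_def sum_nonneg)
   next
    case False
    have "(cnorm n (b'' j))\<^sup>2 \<le> energy b''" unfolding energy_def
     using False j by (intro member_le_sum) auto
    moreover have "cmod (vmean n (b'' j)) \<le> 1" using normalizedD(3)[OF b''(1), of j] False j by linarith
    then have "real n * (cmod (vmean n (b'' j)))\<^sup>2 \<le> real n"
     by (intro mult_left_le power_le_one) auto
    ultimately show ?thesis using vnorm_split[OF n(1), of "b'' j"] b''(2) by linarith
   qed
   then show ?thesis unfolding r_def by (rule real_le_rsqrt)
  qed
  moreover have "vnorm n (bb A' j) = vnorm n (b'' j)" if "j < n" for j using A' that by (intro vnorm_cong) auto
  ultimately have vb: "vnorm n (bb A' j) \<le> r" if "j < n" for j using that by simp
  have "A' \<in> {..<n} \<rightarrow>\<^sub>E S"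
  proof (rule PiE_I)
   fix j assume "j \<in> {..<n}"
   then have j: "j < n" by simp
   have "A' j \<in> {..<n} \<rightarrow>\<^sub>E UNIV" using j by (simp add: A'_def)
   then show "A' j \<in> S" using vb[OF j] by (simp add: S_def bb_def)
  qed (simp add: A'_def)
  moreover have "normalized (bb A')" "energy (bb A') = energy b''"
   using normalized_cong[of b'' "bb A'"] A' b''(1) by simp_all
  ultimately show ?thesis by (auto simp: T_def)
 qed
 have "T ~= {}" using repr[OF b0] by auto
 then obtain A where A: "A \<in> T" "\<And>A'. A' \<in> T ==> energy (bb A) \<le> energy (bb A')"
  using arg_min_if_finite(1)[OF finT, of "\<lambda>A. energy (bb A)"] arg_min_least[OF finT, of _ "\<lambda>A. energy (bb A)"] by blast
 have "energy (bb A) \<le> energy b''" if "normalized b''" for b''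
 proof (cases "energy b'' \<le> energy b0")
  case True
  then show ?thesis using repr[OF that] A(2) by metis
 next
  case False
  then show ?thesis using repr[OF b0] A(2) by (metis linear order_trans order_refl)
 qed
 then show ?thesis using A(1) by (intro exI[of _ "bb A"]) (auto simp: T_def)
qed

text \<open>Replacing one vector changes only one summand of the energy, so in a basis of minimal
  energy no vector can be shortened modulo the others. Sorting preserves the energy.\<close>

lemma ex_minimal_basis:
 "\<exists>b'. normalized b' \<and>
  (\<forall>i j. 1 \<le> i --> i \<le> j --> j < n --> cnorm n (b' i) \<le> cnorm n (b' j)) \<and>
  (\<forall>j a. 1 \<le> j --> j < n --> a j = 0 --> cnorm n (b' j) \<le> cnorm n (\<lambda>k. b' j k + icomb n b' a k))"
proof -
 obtain b1 where b1: "normalized b1" "\<And>b''. normalized b'' ==> energy b1 \<le> energy b''"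
  using ex_min_energy by blast
 obtain p where p: "p permutes {1..<n}"
  "\<And>i j. 1 \<le> i ==> i \<le> j ==> j < n ==> cnorm n (b1 (p i)) \<le> cnorm n (b1 (p j))"
  using sorting_permutation[of n "\<lambda>j. cnorm n (b1 j)"] by metis
 define b' where "b' = (\<lambda>j. b1 (p j))"
 have p0: "p 0 = 0" using permutes_not_in[OF p(1), of 0] by simp
 have pn: "p permutes {..<n}" by (rule permutes_subset[OF p(1)]) auto
 have norm: "normalized b'"
 proof -
  have "p j \<in> {1..<n}" if "j \<in> {1..<n}" for j using permutes_in_image[OF p(1)] that by simp
  then show ?thesis using b1(1) lattice_permute[OF pn, of b1] by (auto simp: normalized_def b'_def p0)
 qed
 have en: "energy b' = energy b1" unfolding energy_def b'_def
  using sum.permute[OF p(1), of "\<lambda>j. (cnorm n (b1 j))\<^sup>2"] by (simp add: comp_def)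
 show ?thesis
 proof (intro exI conjI allI impI)
  show "normalized b'" by (rule norm)
  show "cnorm n (b' i) \<le> cnorm n (b' j)" if "1 \<le> i" "i \<le> j" "j < n" for i j
   using p(2)[OF that] by (simp add: b'_def)
  fix j a assume j: "1 \<le> j" "j < n" and a: "a j = (0::int)"
  obtain b'' where b'': "zlattice n b'' = zlattice n b" "\<And>i. i ~= j ==> b'' i = b' i"
   "cmod (vmean n (b'' j)) \<le> 1 / 2" "cnorm n (b'' j) = cnorm n (\<lambda>k. b' j k + icomb n b' a k)"
   using normalize_step[where a=a, OF normalizedD(1,2)[OF norm] j a] by blast
  have "cmod (vmean n (b'' i)) \<le> 1 / 2" if "i \<in> {1..<n}" for i
   using b''(2)[of i] b''(3) normalizedD(3)[OF norm, of i] that by (cases "i = j") auto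
  moreover have "b'' 0 k = 1" if "k < n" for k
   using b''(2)[of 0] normalizedD(2)[OF norm that] j by simp
  ultimately have "normalized b''" using b''(1) by (simp add: normalized_def)
  then have "energy b' \<le> energy b''" using b1(2) en by simp
  moreover have "energy b' = (cnorm n (b' j))\<^sup>2 + (\<Sum>i\<in>{1..<n}-{j}. (cnorm n (b' i))\<^sup>2)"
   unfolding energy_def using j by (intro sum.remove) auto
  moreover have "energy b'' = (cnorm n (b'' j))\<^sup>2 + (\<Sum>i\<in>{1..<n}-{j}. (cnorm n (b'' i))\<^sup>2)"
   unfolding energy_def using j by (intro sum.remove) auto
  moreover have "(\<Sum>i\<in>{1..<n}-{j}. (cnorm n (b'' i))\<^sup>2) = (\<Sum>i\<in>{1..<n}-{j}. (cnorm n (b' i))\<^sup>2)"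
   using b''(2) by (intro sum.cong) auto
  ultimately have "(cnorm n (b' j))\<^sup>2 \<le> (cnorm n (b'' j))\<^sup>2" by linarith
  then show "cnorm n (b' j) \<le> cnorm n (\<lambda>k. b' j k + icomb n b' a k)"
   unfolding b''(4)[symmetric] by (rule power2_le_imp_le) simp
 qed
qed

end

lemma sum_less_3: "(\<Sum>i<3. f i) = f 0 + f 1 + f (2::nat)"
 and sum_less_4: "(\<Sum>i<4. f i) = f 0 + f 1 + f 2 + f (3::nat)"
 by (simp_all add: numeral_eq_Suc)

lemma less_3_cases: "i < (3::nat) \<longleftrightarrow> i = 0 \<or> i = 1 \<or> i = 2"
 and less_4_cases: "i < (4::nat) \<longleftrightarrow> i = 0 \<or> i = 1 \<or> i = 2 \<or> i = 3"
 by auto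

context mlattice begin

text \<open>Otherwise the centred vector would vanish, making \<open>n * b' j\<close> an integer
  multiple of \<open>b' 0\<close>, against the independence of the basis.\<close>

lemma cnorm_basis_ge:
 assumes b': "zlattice n b' = zlattice n b" "\<And>k. k < n ==> b' 0 k = 1" and j: "1 \<le> j" "j < n"
 shows "1 \<le> real n * cnorm n (b' j)"
proof (rule ccontr)
 assume less: "\<not> ?thesis"
 have v: "b' j \<in> zlattice n b" using lattice_basis[OF j(2), of b'] b' by simp
 have z: "centred n (b' j) k = 0" if "k < n" for k using cnorm_ge[OF v that] less by blast
 obtain t where t: "(\<Sum>k<n. b' j k) = of_int t" using trace_int[OF v] by metis
 have nz': "edet n b' ~= 0" using edet_lattice_nz[of n b b'] nz b' by simp
 have "icomb n b' (\<lambda>i. if i = j then int n else 0) k = icomb n b' (\<lambda>i. if i = 0 then t else 0) k" if "k < n" for k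
 proof -
  have "of_nat n * b' j k = of_int t * b' 0 k"
   using z[OF that] b'(2)[OF that] n by (simp add: centred_def vmean_def t)
  then show ?thesis using j n
   by (simp add: rcomb_def if_distrib[where f=of_int] if_distrib[where f=of_real] if_distrib[where f="\<lambda>c. c * _"] cong: if_cong)
 qed
 from icomb_unique[OF nz' this j(2)] show False using j n by simp
qed

text \<open>Passing from centred to full lengths costs only a constant: a basis vector other than
  \<open>1\<close> has mean at most 1/2 and centred length at least 1/4.\<close>

lemma min_imp_reduced:
 assumes norm: "normalized b'"
  and mono: "\<And>i j. 1 \<le> i ==> i \<le> j ==> j < n ==> cnorm n (b' i) \<le> cnorm n (b' j)"
  and orth: "\<And>x j. 1 \<le> j ==> j < n ==> (x j)\<^sup>2 * (cnorm n (b' j))\<^sup>2 \<le> 20 * (cnorm n (rcomb n b' x))\<^sup>2"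
 shows "reduced 100 n b'"
proof -
 note b' = normalizedD[OF norm]
 have v0: "vnorm n (b' 0) = sqrt (real n)"
  using vnorm_cong[of n "b' 0" "\<lambda>_. 1"] b'(2) vnorm_const[of n 1] by simp
 have low: "1 \<le> 4 * cnorm n (b' j)" if "1 \<le> j" "j < n" for j
 proof -
  have "real n * cnorm n (b' j) \<le> 4 * cnorm n (b' j)" using n by (intro mult_right_mono) auto
  then show ?thesis using cnorm_basis_ge[OF b'(1,2) that] by linarith
 qed
 \<comment> \<open>The squared length exceeds the squared centred length by at most 1, hence is at
   most 17 times it, and 25 bounds 17.\<close>
 have vc: "vnorm n (b' j) \<le> 5 * cnorm n (b' j)" if j: "1 \<le> j" "j < n" for j
 proof (rule power2_le_imp_le)
  have "(cmod (vmean n (b' j)))\<^sup>2 \<le> (1/2)\<^sup>2" using b'(3)[OF j] by (intro power_mono) auto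
  then have "real n * (cmod (vmean n (b' j)))\<^sup>2 \<le> 4 * (1/2)\<^sup>2" using n by (intro mult_mono) auto
  moreover have "1\<^sup>2 \<le> (4 * cnorm n (b' j))\<^sup>2" using low[OF j] by (intro power_mono) auto
  ultimately show "(vnorm n (b' j))\<^sup>2 \<le> (5 * cnorm n (b' j))\<^sup>2"
   using vnorm_split[OF n(1), of "b' j"] unfolding power_mult_distrib by (simp add: power2_eq_square)
 qed simp
 have orth1: "\<bar>x j\<bar> * vnorm n (b' j) \<le> 25 * vnorm n (rcomb n b' x)" if j: "1 \<le> j" "j < n" for x j
 proof -
  have "(\<bar>x j\<bar> * cnorm n (b' j))\<^sup>2 \<le> (5 * cnorm n (rcomb n b' x))\<^sup>2"
   using orth[OF j, of x] zero_le_power2[of "cnorm n (rcomb n b' x)"] unfolding power_mult_distrib power2_abs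
   by (simp add: order_trans[OF _ mult_right_mono])
  then have "\<bar>x j\<bar> * cnorm n (b' j) \<le> 5 * cnorm n (rcomb n b' x)" by (rule power2_le_imp_le) simp
  moreover have "\<bar>x j\<bar> * vnorm n (b' j) \<le> \<bar>x j\<bar> * (5 * cnorm n (b' j))" using vc[OF j] by (intro mult_left_mono) auto
  ultimately show ?thesis using cnorm_le[OF n(1), of "rcomb n b' x"] by linarith
 qed
 \<comment> \<open>The component along \<open>1\<close> is the whole vector minus the other
   components, which costs \<open>1 + 3 * 25\<close>.\<close>
 have orth0: "\<bar>x 0\<bar> * vnorm n (b' 0) \<le> 100 * vnorm n (rcomb n b' x)" for x
 proof -
  let ?I = "{..<n} - {0}"
  have "\<bar>x 0\<bar> * vnorm n (b' 0) = vnorm n (\<lambda>k. of_real (x 0) * b' 0 k)" by (simp add: vnorm_scale)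
  also have "(\<lambda>k. of_real (x 0) * b' 0 k) = (\<lambda>k. rcomb n b' x k + (\<Sum>j\<in>?I. of_real (- x j) * b' j k))"
   using n by (intro ext) (simp add: rcomb_def sum.remove[of "{..<n}" 0] sum_negf)
  also have "vnorm n \<dots> \<le> vnorm n (rcomb n b' x) + vnorm n (\<lambda>k. \<Sum>j\<in>?I. of_real (- x j) * b' j k)"
   by (rule vnorm_add)
  also have "vnorm n (\<lambda>k. \<Sum>j\<in>?I. of_real (- x j) * b' j k) \<le> (\<Sum>j\<in>?I. vnorm n (\<lambda>k. of_real (- x j) * b' j k))"
   by (rule vnorm_sum) simp
  also have "\<dots> = (\<Sum>j\<in>?I. \<bar>x j\<bar> * vnorm n (b' j))" unfolding vnorm_scale by simp
  also have "\<dots> \<le> (\<Sum>j\<in>?I. 25 * vnorm n (rcomb n b' x))" by (intro sum_mono orth1) auto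
  also have "\<dots> \<le> 3 * (25 * vnorm n (rcomb n b' x))" using n by (simp add: mult_right_mono)
  finally show ?thesis using vnorm_nonneg[of n "rcomb n b' x"] by linarith
 qed
 have "vnorm n (b' i) \<le> 100 * vnorm n (b' j)" if ij: "i \<le> j" "j < n" for i j
 proof (cases "i = 0")
  case True
  show ?thesis
  proof (cases "j = 0")
   case True
   then show ?thesis using ij vnorm_nonneg[of n "b' 0"] by simp
  next
   case False
   have "sqrt (real n) \<le> sqrt 4" using n by (intro real_sqrt_le_mono) auto
   then show ?thesis using low[of j] cnorm_le[OF n(1), of "b' j"] False ij v0 True by simp
  qed
 next
  case False
  then show ?thesis using vc[of i] mono[of i j] cnorm_le[OF n(1), of "b' j"] ij vnorm_nonneg[of n "b' j"] by linarith
 qed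
 moreover have "\<bar>x j\<bar> * vnorm n (b' j) \<le> 100 * vnorm n (rcomb n b' x)" if "j < n" for x j
  using orth0[of x] orth1[of j x] that vnorm_nonneg[of n "rcomb n b' x"] by (cases "j = 0") (simp, linarith)
 ultimately show ?thesis using b'(2) by (simp add: reduced_def)
qed

text \<open>The centred vector of \<open>b' 0\<close> is zero, so the Gram form of the centred basis
  has two variables for \<open>n = 3\<close> and three for \<open>n = 4\<close>, and the two
  reduction lemmas apply.\<close>

theorem ex_reduced_basis:
 assumes n34: "n = 3 \<or> n = 4"
 obtains b' where "zlattice n b' = zlattice n b" "reduced 100 n b'"
proof -
 obtain b' where norm: "normalized b'" and
  mono: "\<And>i j. 1 \<le> i ==> i \<le> j ==> j < n ==> cnorm n (b' i) \<le> cnorm n (b' j)" and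
  min: "\<And>j a. 1 \<le> j ==> j < n ==> a j = 0 ==> cnorm n (b' j) \<le> cnorm n (\<lambda>k. b' j k + icomb n b' a k)"
  using ex_minimal_basis by blast
 note b' = normalizedD[OF norm]
 define g where "g = gram n (\<lambda>j. centred n (b' j))"
 have c0: "centred n (b' 0) k = 0" if "k < n" for k
  using b'(2) that n by (simp add: centred_def vmean_def)
 have g0: "g 0 j = 0" "g j 0 = 0" for j
  unfolding g_def gram_def using c0 by simp_all
 have gs: "g i j = g j i" for i j unfolding g_def by (rule gram_sym)
 have gg: "g j j = (cnorm n (b' j))\<^sup>2" for j
  unfolding g_def gram_def cnorm_def vnorm_sq by (simp add: cmod_power2 flip: power2_eq_square)
 have Q: "(cnorm n (rcomb n b' x))\<^sup>2 = (\<Sum>i<n. \<Sum>j<n. x i * x j * g i j)" for x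
  unfolding cnorm_def centred_rcomb vnorm_rcomb_gram g_def ..
 have pos: "0 < g j j" if "1 \<le> j" "j < n" for j
  using cnorm_basis_ge[OF b'(1,2) that] unfolding gg by (simp add: zero_less_power2) (metis mult_zero_right not_one_le_zero)
 have gmono: "g i i \<le> g j j" if "1 \<le> i" "i \<le> j" "j < n" for i j
  unfolding gg by (intro power_mono mono that) simp
 \<comment> \<open>Minimality of \<open>b' j\<close> modulo the other vectors, read as a lower bound
   for the form where the \<open>j\<close>-th coordinate is 1 and the others are integers.\<close>
 have gmin: "g j j \<le> (cnorm n (rcomb n b' (\<lambda>i. if i = j then 1 else of_int (a i))))\<^sup>2"
  if j: "1 \<le> j" "j < n" for j and a :: "nat => int"
 proof -
  have "icomb n b' (a(j := 0)) k + b' j k = rcomb n b' (\<lambda>i. if i = j then 1 else of_int (a i)) k" for k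
   using j(2) by (simp add: rcomb_def sum.remove[of "{..<n}" j])
  then have "(\<lambda>k. b' j k + icomb n b' (a(j := 0)) k) = rcomb n b' (\<lambda>i. if i = j then 1 else of_int (a i))"
   by (intro ext) (simp add: add.commute)
  then show ?thesis unfolding gg using min[OF j, of "a(j := 0)"] by (intro power_mono) auto
 qed
 have "(x j)\<^sup>2 * (cnorm n (b' j))\<^sup>2 \<le> 20 * (cnorm n (rcomb n b' x))\<^sup>2" if j: "1 \<le> j" "j < n" for x j
  using n34
 proof
  assume n: "n = 3"
  have Q3: "(cnorm n (rcomb n b' x))\<^sup>2 = g 1 1 * (x 1)\<^sup>2 + g 2 2 * (x 2)\<^sup>2 + 2 * g 1 2 * x 1 * x 2" for x
   unfolding Q unfolding n sum_less_3 by (simp add: g0 gs[of 2 "Suc 0"] power2_eq_square algebra_simps)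
  have "2 * \<bar>g 1 2\<bar> \<le> g 1 1"
   using gmin[of 2 "\<lambda>i. 1"] gmin[of 2 "\<lambda>i. -1"] n unfolding Q3 by simp
  then have *: "g 1 1 * (x 1)\<^sup>2 + g 2 2 * (x 2)\<^sup>2 \<le> 2 * (cnorm n (rcomb n b' x))\<^sup>2"
   unfolding Q3 using pos[of 1] gmono[of 1 2] n by (intro binary_form_reduced) auto
  have nn: "0 \<le> g 1 1 * (x 1)\<^sup>2" "0 \<le> g 2 2 * (x 2)\<^sup>2" using pos[of 1] pos[of 2] n by auto
  from j n have "j = 1 \<or> j = 2" by auto
  then show ?thesis using * nn zero_le_power2[of "cnorm n (rcomb n b' x)"] unfolding gg[symmetric]
   by (elim disjE; simp add: mult.commute[of _ "g _ _"])
 next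
  assume n: "n = 4"
  have Q4: "(cnorm n (rcomb n b' x))\<^sup>2 = g 1 1 * (x 1)\<^sup>2 + g 2 2 * (x 2)\<^sup>2 + g 3 3 * (x 3)\<^sup>2 +
   2 * g 1 2 * x 1 * x 2 + 2 * g 1 3 * x 1 * x 3 + 2 * g 2 3 * x 2 * x 3" for x
   unfolding Q unfolding n sum_less_4 by (simp add: g0 gs[of 2 "Suc 0"] gs[of 3 "Suc 0"] gs[of 3 2] power2_eq_square algebra_simps)
  have nn: "0 \<le> g 1 1 * u\<^sup>2 + g 2 2 * v\<^sup>2 + g 3 3 * w\<^sup>2 + 2 * g 1 2 * u * v + 2 * g 1 3 * u * w + 2 * g 2 3 * v * w" for u v w
   using Q4[of "\<lambda>i. if i = 1 then u else if i = 2 then v else w"] by (simp flip: Q4) (metis zero_le_power2)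
  have m2: "g 2 2 \<le> g 1 1 * (of_int s)\<^sup>2 + g 2 2 * 1\<^sup>2 + g 3 3 * 0\<^sup>2 + 2 * g 1 2 * of_int s * 1 + 2 * g 1 3 * of_int s * 0 + 2 * g 2 3 * 1 * 0" for s :: int
   using gmin[of 2 "\<lambda>i. if i = 1 then s else 0"] n unfolding Q4 by simp
  have m3: "g 3 3 \<le> g 1 1 * (of_int s)\<^sup>2 + g 2 2 * (of_int t)\<^sup>2 + g 3 3 * 1\<^sup>2 + 2 * g 1 2 * of_int s * of_int t + 2 * g 1 3 * of_int s * 1 + 2 * g 2 3 * of_int t * 1" for s t :: int
   using gmin[of 3 "\<lambda>i. if i = 1 then s else t"] n unfolding Q4 by simp
  note T = ternary_form_reduced[OF nn _ _ _ m2 m3, where x = "x 1" and y = "x 2" and z = "x 3"]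
  have p: "0 < g 1 1" "g 1 1 \<le> g 2 2" "g 2 2 \<le> g 3 3" using pos gmono n by auto
  from j n have "j = 1 \<or> j = 2 \<or> j = 3" by auto
  then show ?thesis using T[OF p] unfolding gg[symmetric] Q4
   by (elim disjE; simp only: mult.commute[of _ "g _ _"])
 qed
 from min_imp_reduced[OF norm mono this] that b'(1) show ?thesis by blast
qed

end

lemma basis_vnorm_pos:
 assumes "edet n b ~= 0" "j < n"
 shows "0 < vnorm n (b j)"
proof (rule ccontr)
 assume "\<not> ?thesis"
 then have "vnorm n (b j) = 0" using vnorm_nonneg[of n "b j"] by linarith
 then have "\<forall>k<n. b j k = 0" by (simp add: vnorm_zero_iff)
 then have "icomb n b (\<lambda>i. if i = j then 1 else 0) k = icomb n b (\<lambda>i. 0) k" if "k < n" for k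
  using that unfolding rcomb_def by (intro sum.cong) auto
 from icomb_unique[OF assms(1) this assms(2)] show False by simp
qed

text \<open>The real span of a lattice stable under complex conjugation of the embeddings is a real form of
 \<open>\<complex>\<^sup>n\<close>, so the dual basis can be bounded through real and imaginary parts.\<close>

lemma edet_ge:
 assumes nz: "edet n b ~= 0"
  and \<pi>: "\<pi> permutes {..<n}" and cnj: "\<And>j k. j < n ==> k < n ==> cnj (b j k) = b j (\<pi> k)"
  and orth: "\<And>x j. j < n ==> \<bar>x j\<bar> * vnorm n (b j) \<le> K * vnorm n (rcomb n b x)"
 shows "(\<Prod>j<n. vnorm n (b j)) \<le> fact n * (2 * K) ^ n * cmod (edet n b)"
proof -
 obtain Z where Z: "\<And>k l. k < n ==> l < n ==> (\<Sum>j<n. b j k * Z j l) = (if k = l then 1 else 0)"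
  and det: "Determinant.det (Matrix.mat n n (\<lambda>(j, k). Z j k)) * edet n b = 1"
  using edet_inverse[OF nz] by metis
 have \<pi>n: "\<pi> k < n" if "k < n" for k using permutes_in_image[OF \<pi>, of k] that by simp
 note pos = basis_vnorm_pos[OF nz]
 have K: "0 \<le> K" if "0 < n"
 proof -
  have "0 < vnorm n (b 0)" using pos that by simp
  also have "\<dots> \<le> K * vnorm n (rcomb n b (\<lambda>_. 1))" using orth[of 0 "\<lambda>_. 1"] that by simp
  finally show ?thesis using vnorm_nonneg[of n "rcomb n b (\<lambda>_. 1)"] by (simp add: zero_less_mult_iff)
 qed
 have Zb: "cmod (Z j l) \<le> 2 * K / vnorm n (b j)" if jl: "j < n" "l < n" for j l
 proof -
  define d where "d = (\<lambda>k. if k = l then 1 else 0 :: complex)"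
  have sd: "(\<Sum>k<n. cmod (d k) + cmod (d (\<pi> k))) = 2"
  proof -
   have "(\<Sum>k<n. cmod (d (\<pi> k))) = (\<Sum>k<n. cmod (d k))"
    using sum.permute[OF \<pi>, of "\<lambda>k. cmod (d k)"] by (simp add: comp_def)
   moreover have "(\<Sum>k<n. cmod (d k)) = 1" using jl by (simp add: d_def if_distrib[where f=norm] cong: if_cong)
   ultimately show ?thesis by (simp add: sum.distrib)
  qed
  have e1: "(\<Sum>j<n. Z j l * b j k) = d k" if "k < n" for k using Z[OF that jl(2)] by (simp add: d_def mult.commute)
  have e2: "(\<Sum>j<n. cnj (Z j l) * b j k) = d (\<pi> k)" if "k < n" for k
  proof -
   have "cnj (\<Sum>j<n. Z j l * b j (\<pi> k)) = (\<Sum>j<n. cnj (Z j l) * cnj (b j (\<pi> k)))" by (simp add: cnj_sum)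
   also have "\<dots> = (\<Sum>j<n. cnj (Z j l) * b j k)"
    using cnj that by (intro sum.cong) (auto simp flip: cnj)
   finally show ?thesis using e1[OF \<pi>n[OF that]] by (simp add: d_def split: if_splits)
  qed
  \<comment> \<open>\<open>d\<close> and its image under \<open>\<pi>\<close> are unit vectors, so
    half their sum or difference has length at most 1.\<close>
  have bound: "vnorm n u \<le> 1" if "\<And>k. k < n ==> cmod (u k) \<le> (cmod (d k) + cmod (d (\<pi> k))) / 2" for u
  proof -
   have "vnorm n u \<le> (\<Sum>k<n. cmod (u k))" by (rule vnorm_le_sum)
   also have "\<dots> \<le> (\<Sum>k<n. (cmod (d k) + cmod (d (\<pi> k))) / 2)" using that by (intro sum_mono) auto
   also have "\<dots> = 1" using sd by (simp flip: sum_divide_distrib)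
   finally show ?thesis .
  qed
  have re: "rcomb n b (\<lambda>j. Re (Z j l)) k = (d k + d (\<pi> k)) / 2" if "k < n" for k
   unfolding e1[OF that, symmetric] e2[OF that, symmetric] sum.distrib[symmetric] distrib_right[symmetric] complex_add_cnj
   by (simp add: rcomb_def sum_divide_distrib)
  have im: "rcomb n b (\<lambda>j. Im (Z j l)) k = (d k - d (\<pi> k)) / (2 * \<i>)" if "k < n" for k
   unfolding e1[OF that, symmetric] e2[OF that, symmetric] sum_subtractf[symmetric] left_diff_distrib[symmetric] complex_diff_cnj
    rcomb_def sum_divide_distrib
   by (intro sum.cong refl) (simp add: complex_eq_iff)
  have "vnorm n (rcomb n b (\<lambda>j. Re (Z j l))) \<le> 1"
   using norm_triangle_ineq by (intro bound) (simp add: re norm_divide divide_right_mono)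
  then have "\<bar>Re (Z j l)\<bar> * vnorm n (b j) \<le> K" 
   using orth[OF jl(1), of "\<lambda>j. Re (Z j l)"] mult_left_mono[OF _ K, of _ 1] jl by (fastforce intro: order_trans)
  moreover have "vnorm n (rcomb n b (\<lambda>j. Im (Z j l))) \<le> 1"
   using norm_triangle_ineq4 by (intro bound) (simp add: im norm_divide norm_mult divide_right_mono)
  then have "\<bar>Im (Z j l)\<bar> * vnorm n (b j) \<le> K"
   using orth[OF jl(1), of "\<lambda>j. Im (Z j l)"] mult_left_mono[OF _ K, of _ 1] jl by (fastforce intro: order_trans)
  moreover have "cmod (Z j l) * vnorm n (b j) \<le> (\<bar>Re (Z j l)\<bar> + \<bar>Im (Z j l)\<bar>) * vnorm n (b j)"
   by (intro mult_right_mono cmod_le) simp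
  ultimately have "cmod (Z j l) * vnorm n (b j) \<le> 2 * K" by (simp add: distrib_right)
  then show ?thesis using pos[OF jl(1)] by (simp add: field_simps)
 qed
 have P: "0 < (\<Prod>j<n. vnorm n (b j))" using pos by (intro prod_pos) auto
 have "1 = cmod (Determinant.det (Matrix.mat n n (\<lambda>(j, k). Z j k))) * cmod (edet n b)"
  using det by (metis norm_mult norm_one)
 also have "\<dots> \<le> (fact n * (\<Prod>j<n. 2 * K / vnorm n (b j))) * cmod (edet n b)"
  by (intro mult_right_mono det_bound Zb) auto
 also have "(\<Prod>j<n. 2 * K / vnorm n (b j)) = (2 * K) ^ n / (\<Prod>j<n. vnorm n (b j))" by (simp add: prod_dividef)
 finally show ?thesis using P by (simp add: field_simps)
qed

section \<open>The quadratic resolvent map on lattices\<close>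

text \<open>Keeps the index \<open>1\<close> literal, so that the explicit formulas below are
  indexed by \<open>0\<close>, \<open>1\<close>, \<open>2\<close>, \<open>3\<close>.\<close>

declare One_nat_def [simp del]

text \<open>\<open>D3\<close> and \<open>D4\<close> are determinants written out, so that the
  identities below become polynomial identities that normalisation decides.\<close>

definition D3 :: "(nat => complex) => (nat => complex) => (nat => complex) => complex" where
 "D3 a b c = a 0 * (b 1 * c 2 - b 2 * c 1) - a 1 * (b 0 * c 2 - b 2 * c 0) + a 2 * (b 0 * c 1 - b 1 * c 0)"

definition D4 :: "(nat => complex) => (nat => complex) => (nat => complex) => (nat => complex) => complex" where
 "D4 a b c d =
   a 0 * (b 1 * (c 2 * d 3 - c 3 * d 2) - b 2 * (c 1 * d 3 - c 3 * d 1) + b 3 * (c 1 * d 2 - c 2 * d 1))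
  - a 1 * (b 0 * (c 2 * d 3 - c 3 * d 2) - b 2 * (c 0 * d 3 - c 3 * d 0) + b 3 * (c 0 * d 2 - c 2 * d 0))
  + a 2 * (b 0 * (c 1 * d 3 - c 3 * d 1) - b 1 * (c 0 * d 3 - c 3 * d 0) + b 3 * (c 0 * d 1 - c 1 * d 0))
  - a 3 * (b 0 * (c 1 * d 2 - c 2 * d 1) - b 1 * (c 0 * d 2 - c 2 * d 0) + b 2 * (c 0 * d 1 - c 1 * d 0))"

text \<open>Laplace expansion along the first row, with the minors again written as explicit
  matrices so that it can be iterated.\<close>

lemma mat_det_Suc:
 fixes f :: "nat \<times> nat => complex"
 shows "Determinant.det (Matrix.mat (Suc n) (Suc n) f) =
  (\<Sum>j<Suc n. f (0, j) * ((-1) ^ j * Determinant.det (Matrix.mat n n (\<lambda>(i, k). f (Suc i, if k < j then k else Suc k)))))"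
proof (subst laplace_expansion_row[of _ "Suc n" 0], simp, simp, rule sum.cong[OF refl])
 fix j assume j: "j \<in> {..<Suc n}"
 have "mat_delete (Matrix.mat (Suc n) (Suc n) f) 0 j = Matrix.mat n n (\<lambda>(i, k). f (Suc i, if k < j then k else Suc k))"
  using j by (intro eq_matI) (auto simp: mat_delete_def)
 then show "Matrix.mat (Suc n) (Suc n) f $$ (0, j) * cofactor (Matrix.mat (Suc n) (Suc n) f) 0 j =
  f (0, j) * ((-1) ^ j * Determinant.det (Matrix.mat n n (\<lambda>(i, k). f (Suc i, if k < j then k else Suc k))))"
  using j by (simp add: cofactor_def)
qed

lemma mat_det_2: "Determinant.det (Matrix.mat 2 2 f) = f (0,0) * f (1,1) - f (0,1) * f (1,0 :: nat)"
 for f :: "nat \<times> nat => complex"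
 unfolding numeral_2_eq_2 mat_det_Suc by (simp add: One_nat_def algebra_simps)

lemma mat_det_3: "Determinant.det (Matrix.mat 3 3 f) =
  f (0,0) * (f (1,1) * f (2,2) - f (1,2) * f (2,1)) - f (0,1) * (f (1,0) * f (2,2) - f (1,2) * f (2,0))
  + f (0,2) * (f (1,0) * f (2,1) - f (1,1) * f (2,0))"
 for f :: "nat \<times> nat => complex"
 unfolding numeral_3_eq_3 mat_det_Suc[of 2, folded numeral_3_eq_3] mat_det_Suc[of "Suc (Suc 0)"] mat_det_2[unfolded numeral_2_eq_2]
 by (simp add: numeral_2_eq_2 One_nat_def algebra_simps)

lemma edet_3: "edet 3 b = D3 (b 0) (b 1) (b 2)"
 unfolding edet_transpose mat_det_3 by (simp add: D3_def)

lemma edet_4: "edet 4 b = D4 (b 0) (b 1) (b 2) (b 3)"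
proof -
 have e: "4 = Suc 3" by simp
 show ?thesis unfolding edet_transpose D4_def unfolding e mat_det_Suc mat_det_3
  by (simp add: numeral_2_eq_2 numeral_3_eq_3 One_nat_def algebra_simps)
qed

text \<open>One entry for each of the three ways to split four indices into two pairs: these are the
  values of the resolvent map.\<close>

definition phi :: "(nat => complex) => nat => complex" where
 "phi x m = (if m = 0 then x 0 * x 1 + x 2 * x 3 else if m = 1 then x 0 * x 2 + x 1 * x 3 else x 0 * x 3 + x 1 * x 2)"

text \<open>The polarisation of \<open>phi\<close>; on the diagonal it is twice
  \<open>phi\<close>.\<close>

definition phib :: "(nat => complex) => (nat => complex) => nat => complex" where
 "phib x y m = (if m = 0 then x 0 * y 1 + x 1 * y 0 + x 2 * y 3 + x 3 * y 2
   else if m = 1 then x 0 * y 2 + x 2 * y 0 + x 1 * y 3 + x 3 * y 1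
   else x 0 * y 3 + x 3 * y 0 + x 1 * y 2 + x 2 * y 1)"

text \<open>This identity links multiplication in the quartic ring to the resolvent: when
  \<open>x\<close> and \<open>y\<close> belong to a basis starting with \<open>1\<close>, the left
  side isolates the coefficient of their product at the remaining basis vector, and the right side
  depends only on resolvents.\<close>

lemma D4_mult: "D4 (\<lambda>_. 1) x y (\<lambda>k. x k * y k) = - D3 (\<lambda>_. 1) (phi x) (phi y)"
 unfolding D4_def D3_def phi_def by (simp add: algebra_simps)

lemma D4_square: "D4 (\<lambda>_. 1) x y (\<lambda>k. x k * x k) = - D3 (\<lambda>_. 1) (phi x) (phib x y)"
 unfolding D4_def D3_def phi_def phib_def by (simp add: algebra_simps)

lemma D3_mult:
 "D3 (\<lambda>k. a 0 * u k + a 1 * v k + a 2 * w k) (\<lambda>k. b 0 * u k + b 1 * v k + b 2 * w k)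
   (\<lambda>k. c 0 * u k + c 1 * v k + c 2 * w k) = D3 a b c * D3 u v w"
 unfolding D3_def by (simp add: algebra_simps)

text \<open>Up to a factor 2 the left side is the determinant of the Gram matrix of
  \<open>x\<close>, \<open>y\<close>, \<open>t\<close> for the polar form \<open>B\<close>, whose
  own matrix has determinant \<open>2 * p * q * r\<close>; the change of basis contributes a squared
  determinant.\<close>

lemma ternary_discriminant_transform:
 fixes p q r :: complex
 defines "Q \<equiv> \<lambda>x. p * x 1 * x 2 + q * x 0 * x 2 + r * x 0 * x (1::nat)"
  and "B \<equiv> \<lambda>x y. p * (x 1 * y 2 + x 2 * y 1) + q * (x 0 * y 2 + x 2 * y 0) + r * (x 0 * y 1 + x (1::nat) * y 0)"
 shows "4 * Q x * Q y * Q t + B x y * B x t * B y t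
  - Q x * (B y t)\<^sup>2 - Q y * (B x t)\<^sup>2 - Q t * (B x y)\<^sup>2 = p * q * r * (D3 x y t)\<^sup>2"
proof -
 define V where "V = (\<lambda>(a::complex) b c k. if k = 0 then a else if k = (1::nat) then b else c)"
 define N where "N = (\<lambda>i. V (x i) (y i) (t i))"
 \<comment> \<open>\<open>M\<close> is the matrix of \<open>B\<close> times \<open>N\<close>, whose
   columns are \<open>x\<close>, \<open>y\<close>, \<open>t\<close>.\<close>
 define M where "M = (\<lambda>i k. (if i = 0 then V 0 r q else if i = (1::nat) then V r 0 p else V q p 0) (0::nat) * N 0 k
  + (if i = 0 then V 0 r q else if i = (1::nat) then V r 0 p else V q p 0) 1 * N 1 k
  + (if i = 0 then V 0 r q else if i = (1::nat) then V r 0 p else V q p 0) 2 * N 2 k)"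
 have "2 * (4 * Q x * Q y * Q t + B x y * B x t * B y t
  - Q x * (B y t)\<^sup>2 - Q y * (B x t)\<^sup>2 - Q t * (B x y)\<^sup>2) =
  D3 (V (2 * Q x) (B x y) (B x t)) (V (B x y) (2 * Q y) (B y t)) (V (B x t) (B y t) (2 * Q t))"
  by (simp add: D3_def V_def power2_eq_square algebra_simps)
 also have "\<dots> = D3 (\<lambda>k. x 0 * M 0 k + x 1 * M 1 k + x 2 * M 2 k) (\<lambda>k. y 0 * M 0 k + y 1 * M 1 k + y 2 * M 2 k)
   (\<lambda>k. t 0 * M 0 k + t 1 * M 1 k + t 2 * M 2 k)"
  by (intro arg_cong3[where f=D3]; intro ext; simp add: M_def N_def V_def Q_def B_def algebra_simps)
 also have "\<dots> = D3 x y t * D3 (M 0) (M 1) (M 2)" by (rule D3_mult)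
 also have "D3 (M 0) (M 1) (M 2) = D3 (V 0 r q) (V r 0 p) (V q p 0) * D3 (N 0) (N 1) (N 2)"
  by (simp only: D3_mult[symmetric]) (simp add: M_def)
 also have "D3 (N 0) (N 1) (N 2) = D3 x y t" by (simp add: D3_def N_def V_def algebra_simps)
 also have "D3 (V 0 r q) (V r 0 p) (V q p 0) = 2 * (p * q * r)" by (simp add: D3_def V_def)
 finally have "2 * (4 * Q x * Q y * Q t + B x y * B x t * B y t
  - Q x * (B y t)\<^sup>2 - Q y * (B x t)\<^sup>2 - Q t * (B x y)\<^sup>2) = 2 * (p * q * r * (D3 x y t)\<^sup>2)"
  by (simp add: power2_eq_square mult_ac)
 then show ?thesis unfolding mult_cancel_left by simp
qed

text \<open>The index form of the cubic resolvent is four times the determinant of the pencil of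
 quadratic forms.\<close>

lemma D3_square:
 fixes z x y t :: "nat => complex"
 defines "q \<equiv> \<lambda>v. D3 (\<lambda>_. 1) z v"
 shows "D3 (\<lambda>_. 1) z (\<lambda>k. z k * z k) * (D4 (\<lambda>_. 1) x y t)\<^sup>2 =
  - (4 * q (phi x) * q (phi y) * q (phi t) + q (phib x y) * q (phib x t) * q (phib y t)
  - q (phi x) * (q (phib y t))\<^sup>2 - q (phi y) * (q (phib x t))\<^sup>2 - q (phi t) * (q (phib x y))\<^sup>2)"
proof -
 let ?p = "z 2 - z 1" and ?q = "z 0 - z 2" and ?r = "z 1 - z 0"
 have phi: "q (phi v) = ?p * (v 2 - v 0) * (v 3 - v 0) + ?q * (v 1 - v 0) * (v 3 - v 0) + ?r * (v 1 - v 0) * (v 2 - v 0)" for v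
  unfolding q_def D3_def phi_def by (simp add: algebra_simps)
 have phib: "q (phib v w) = ?p * ((v 2 - v 0) * (w 3 - w 0) + (v 3 - v 0) * (w 2 - w 0))
   + ?q * ((v 1 - v 0) * (w 3 - w 0) + (v 3 - v 0) * (w 1 - w 0))
   + ?r * ((v 1 - v 0) * (w 2 - w 0) + (v 2 - v 0) * (w 1 - w 0))" for v w
  unfolding q_def D3_def phib_def by (simp add: algebra_simps)
 have d4: "D4 (\<lambda>_. 1) x y t = (x 1 - x 0) * ((y 2 - y 0) * (t 3 - t 0) - (y 3 - y 0) * (t 2 - t 0))
   - (x 2 - x 0) * ((y 1 - y 0) * (t 3 - t 0) - (y 3 - y 0) * (t 1 - t 0))
   + (x 3 - x 0) * ((y 1 - y 0) * (t 2 - t 0) - (y 2 - y 0) * (t 1 - t 0))"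
  unfolding D4_def by (simp add: algebra_simps)
 have d3: "D3 (\<lambda>_. 1) z (\<lambda>k. z k * z k) = - (?p * ?q * ?r)"
  unfolding D3_def by (simp add: algebra_simps)
 \<comment> \<open>Modulo constant vectors, which \<open>q\<close> annihilates, a vector is given by
   three differences; in these, \<open>q (phi v)\<close> has no square terms.\<close>
 let ?d = "\<lambda>v k. v (Suc k) - v 0 :: complex"
 have phi': "q (phi v) = ?p * ?d v 1 * ?d v 2 + ?q * ?d v 0 * ?d v 2 + ?r * ?d v 0 * ?d v 1" for v
  unfolding phi by (simp add: numeral_2_eq_2 numeral_3_eq_3 One_nat_def)
 have phib': "q (phib v w) = ?p * (?d v 1 * ?d w 2 + ?d v 2 * ?d w 1) + ?q * (?d v 0 * ?d w 2 + ?d v 2 * ?d w 0)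
   + ?r * (?d v 0 * ?d w 1 + ?d v 1 * ?d w 0)" for v w
  unfolding phib by (simp add: numeral_2_eq_2 numeral_3_eq_3 One_nat_def)
 have d4': "D4 (\<lambda>_. 1) x y t = D3 (?d x) (?d y) (?d t)"
  unfolding d4 D3_def by (simp add: numeral_2_eq_2 numeral_3_eq_3 One_nat_def algebra_simps)
 show ?thesis
  using ternary_discriminant_transform[where p = ?p and q = ?q and r = ?r and x = "?d x" and y = "?d y" and t = "?d t"]
  unfolding phi' phib' d4' d3 by simp
qed

text \<open>Defined by choice, hence meaningful for lattice vectors only; the entries below
  \<open>n\<close> are unique when \<open>edet n b\<close> is nonzero.\<close>

definition coord :: "nat => (nat => nat => complex) => (nat => complex) => nat => int" where
 "coord n b v = (SOME a. \<forall>k<n. v k = icomb n b a k)"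

lemma coord: "v \<in> zlattice n b ==> k < n ==> v k = icomb n b (coord n b v) k"
 unfolding coord_def zlattice_def using someI_ex[of "\<lambda>a. \<forall>k<n. v k = icomb n b a k"] by blast

lemma coord_eqI:
 assumes "edet n b ~= 0" "\<And>k. k < n ==> v k = icomb n b a k" "j < n"
 shows "coord n b v j = a j"
 using icomb_unique[OF assms(1) _ assms(3), of "coord n b v" a] coord[OF latticeI[OF assms(2)]] assms(2) by metis

text \<open>The coefficient of the product of the \<open>i\<close>-th and \<open>j\<close>-th
  coordinates when \<open>phi\<close> is expanded in the basis, hence \<open>phi\<close> and not
  \<open>phib\<close> on the diagonal.\<close>

definition phic :: "(nat => nat => complex) => nat => nat => nat => complex" where
 "phic b i j = (if i = j then phi (b i) else phib (b i) (b j))"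

lemma phib_commute: "phib x y = phib y x"
 by (rule ext) (simp add: phib_def algebra_simps)

lemma phic_commute: "phic b i j = phic b j i"
 by (simp add: phic_def phib_commute)

lemma phib_eq: "phib x y k = phi (\<lambda>k. x k + y k) k - phi x k - phi y k"
 by (simp add: phib_def phi_def algebra_simps)

text \<open>Index 0 is left out in all three places: polarising against \<open>1\<close> yields only
  multiples of \<open>1\<close>, and a coefficient at \<open>w 0\<close> imposes no condition on
  lengths.\<close>

definition pattern :: "(nat => nat => complex) => (nat => nat => complex) => (nat \<times> nat \<times> nat) set" where
 "pattern b w = {(i, j, k) \<in> {1..3} \<times> {1..3} \<times> {1..2}. coord 3 w (phic b i j) k ~= 0}"

lemma phi_cong: "(\<And>k. k < 4 ==> v k = v' k) ==> phi v = phi v'"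
 by (intro ext) (simp add: phi_def)

lemma phi_icomb:
 "phi (icomb 4 b a) k = (\<Sum>i<4. of_int ((a i)\<^sup>2) * phi (b i) k) +
   (\<Sum>(i, j)\<in>{(0,1),(0,2),(0,3),(1,2),(1,3),(2,3)}. of_int (a i * a j) * phib (b i) (b j) k)"
 unfolding rcomb_def sum_less_4 phi_def phib_def by (simp add: algebra_simps power2_eq_square)

lemma phi_lattice:
 assumes "\<And>i j. i < 4 ==> j < 4 ==> phic b i j \<in> zlattice 3 w" and v: "v \<in> zlattice 4 b"
 shows "phi v \<in> zlattice 3 w"
proof -
 obtain a where a: "\<And>k. k < 4 ==> v k = icomb 4 b a k" using v by (metis latticeE)
 have "(\<lambda>k. (\<Sum>i<4. of_int ((a i)\<^sup>2) * phi (b i) k) +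
   (\<Sum>p\<in>{(0,1),(0,2),(0,3),(1,2),(1,3),(2,3)}. of_int (a (fst p) * a (snd p)) * phib (b (fst p)) (b (snd p)) k)) \<in> zlattice 3 w"
 proof (intro lattice_add lattice_sum lattice_scale)
  show "phi (b i) \<in> zlattice 3 w" if "i \<in> {..<4}" for i using assms(1)[of i i] that by (simp add: phic_def)
  fix p :: "nat \<times> nat" assume "p \<in> {(0,1),(0,2),(0,3),(1,2),(1,3),(2,3)}"
  then have "fst p < 4" "snd p < 4" "fst p ~= snd p" by auto
  then show "phib (b (fst p)) (b (snd p)) \<in> zlattice 3 w" using assms(1)[of "fst p" "snd p"] by (simp add: phic_def)
 qed auto
 also have "(\<lambda>k. (\<Sum>i<4. of_int ((a i)\<^sup>2) * phi (b i) k) +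
   (\<Sum>p\<in>{(0,1),(0,2),(0,3),(1,2),(1,3),(2,3)}. of_int (a (fst p) * a (snd p)) * phib (b (fst p)) (b (snd p)) k)) = phi v"
  using phi_cong[of v "icomb 4 b a", OF a] by (intro ext) (simp only: phi_icomb case_prod_unfold)
 finally show ?thesis .
qed

text \<open>Only the squares of the determinants are compared, since a ring has a discriminant but
  no oriented covolume.\<close>

locale qpair =
 fixes b w :: "nat => nat => complex"
 assumes L: "mlattice 4 b" and M: "mlattice 3 w"
  and b0: "\<And>k. k < 4 ==> b 0 k = 1" and w0: "\<And>k. k < 3 ==> w 0 k = 1"
  and phi: "\<And>v. v \<in> zlattice 4 b ==> phi v \<in> zlattice 3 w"
  and disc: "(edet 4 b)\<^sup>2 = (edet 3 w)\<^sup>2"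
begin

lemma nzb: "edet 4 b ~= 0" and nzw: "edet 3 w ~= 0"
 using L M by (auto simp: mlattice_def)

lemma phic_lattice: "i < 4 ==> j < 4 ==> phic b i j \<in> zlattice 3 w"
proof -
 assume ij: "i < 4" "j < 4"
 have "phib (b i) (b j) = (\<lambda>k. phi (\<lambda>k. b i k + b j k) k - phi (b i) k - phi (b j) k)"
  by (rule ext) (rule phib_eq)
 moreover have "\<dots> \<in> zlattice 3 w" using ij by (intro lattice_diff phi lattice_add lattice_basis)
 ultimately show ?thesis using phi[OF lattice_basis[OF ij(1), of b]] by (cases "i = j") (simp_all add: phic_def)
qed

abbreviation H :: "nat => nat => nat => int" where "H i j \<equiv> coord 3 w (phic b i j)"
abbreviation c :: "nat => nat => nat => int" where "c i j \<equiv> coord 4 b (\<lambda>k. b i k * b j k)"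
abbreviation e :: "nat => nat => nat => int" where "e i j \<equiv> coord 3 w (\<lambda>k. w i k * w j k)"

lemma H: "i < 4 ==> j < 4 ==> k < 3 ==> phic b i j k = of_int (H i j 0) + of_int (H i j 1) * w 1 k + of_int (H i j 2) * w 2 k"
 using coord[OF phic_lattice] w0 by (simp add: rcomb_def sum_less_3)

lemma c: "i < 4 ==> j < 4 ==> k < 4 ==> b i k * b j k = of_int (c i j 0) + of_int (c i j 1) * b 1 k + of_int (c i j 2) * b 2 k + of_int (c i j 3) * b 3 k"
 using coord[OF mlattice.mult_basis[OF L]] b0 by (simp add: rcomb_def sum_less_4)

lemma e: "i < 3 ==> j < 3 ==> k < 3 ==> w i k * w j k = of_int (e i j 0) + of_int (e i j 1) * w 1 k + of_int (e i j 2) * w 2 k"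
 using coord[OF mlattice.mult_basis[OF M]] w0 by (simp add: rcomb_def sum_less_3)

text \<open>Polarising against \<open>1\<close> gives the trace of \<open>b i\<close> in all three
  entries, an integer multiple of the constant vector.\<close>

lemma H_0: 
 assumes "i < 4" "k \<in> {1,2}"
 shows "H 0 i k = 0"
proof -
 interpret L: mlattice 4 b by (rule L)
 obtain t where t: "(\<Sum>k<4. b i k) = of_int t" using L.trace_int[OF lattice_basis[OF assms(1)]] by metis
 have "phic b 0 i k = icomb 3 w (\<lambda>j. if j = 0 then (if i = 0 then 2 else t) else 0) k" if "k < 3" for k
  using that t b0 w0 by (auto simp: phic_def phi_def phib_def rcomb_def sum_less_3 sum_less_4 less_3_cases algebra_simps)
 from coord_eqI[OF nzw this, of k] show ?thesis using assms(2) by auto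
qed

abbreviation "dw \<equiv> D3 (\<lambda>_. 1) (w 1) (w 2)"
abbreviation "db i j l \<equiv> D4 (\<lambda>_. 1) (b i) (b j) (b l)"

lemma dw_nz: "dw ~= 0"
proof -
 have "dw = D3 (w 0) (w 1) (w 2)" using w0 by (simp add: D3_def)
 then show ?thesis using nzw by (simp add: edet_3)
qed

lemma db_sq: "(db 1 2 3)\<^sup>2 = dw\<^sup>2"
proof -
 have "dw = D3 (w 0) (w 1) (w 2)" using w0 by (simp add: D3_def)
 moreover have "db 1 2 3 = D4 (b 0) (b 1) (b 2) (b 3)" using b0 by (simp add: D4_def)
 ultimately show ?thesis using disc by (simp add: edet_3 edet_4)
qed

lemma D3_phic:
 assumes "i < 4" "j < 4" "l < 4" "m < 4"
 shows "D3 (\<lambda>_. 1) (phic b i j) (phic b l m) = of_int (H i j 1 * H l m 2 - H i j 2 * H l m 1) * dw"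
 unfolding D3_def using H[OF assms(1,2), of 0] H[OF assms(1,2), of 1] H[OF assms(1,2), of 2]
  H[OF assms(3,4), of 0] H[OF assms(3,4), of 1] H[OF assms(3,4), of 2]
 by (simp add: algebra_simps)

lemma D4_comb:
 assumes "{i, j, l} = {1, 2, 3::nat}" "\<And>k. k < 4 ==> v k = of_int p + of_int q * b i k + of_int r * b j k + of_int s * b l k"
 shows "D4 (\<lambda>_. 1) (b i) (b j) v = of_int s * db i j l"
 unfolding D4_def assms(2)[of 0, simplified] assms(2)[of 1, simplified] assms(2)[of 2, simplified] assms(2)[of 3, simplified]
 by (simp add: algebra_simps)

lemma perm_distinct:
 assumes "{i, j, l} = {1, 2, 3::nat}"
 shows "i < 4" "j < 4" "l < 4" "i ~= j" "i ~= l" "j ~= l"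
proof -
 have "card {i, j, l} = 3" using assms by simp
 then show "i ~= j" "i ~= l" "j ~= l" by (auto simp: card_insert_if split: if_splits)
 have "i \<in> {1,2,3}" "j \<in> {1,2,3}" "l \<in> {1,2,3}" using assms by auto
 then show "i < 4" "j < 4" "l < 4" by auto
qed

lemma c_perm:
 assumes ijl: "{i, j, l} = {1, 2, 3::nat}" and lt: "m < 4" "m' < 4" "k < 4"
 shows "b m k * b m' k = of_int (c m m' 0) + of_int (c m m' i) * b i k + of_int (c m m' j) * b j k + of_int (c m m' l) * b l k"
proof -
 have "b m k * b m' k = of_int (c m m' 0) + (\<Sum>a\<in>{1,2,3}. of_int (c m m' a) * b a k)"
  using c[OF lt] by simp
 also have "{1,2,3} = {i, j, l}" using ijl ..
 finally show ?thesis using perm_distinct[OF ijl] by simp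
qed

text \<open>The coefficient of a product at a third basis vector is, up to sign, a 2 by 2 minor of
  the coefficients \<open>H\<close>: by \<open>db_sq\<close> and permutation of the arguments, the
  factors \<open>db i j l\<close> and \<open>dw\<close> agree up to sign.\<close>

lemma c_mixed:
 assumes ijl: "{i, j, l} = {1, 2, 3::nat}"
 shows "of_int (c i j l) * db i j l = - (of_int (H i i 1 * H j j 2 - H i i 2 * H j j 1) * dw)"
proof -
 note d = perm_distinct[OF ijl]
 from D4_comb[OF ijl c_perm[OF ijl d(1) d(2)]] have "of_int (c i j l) * db i j l = - D3 (\<lambda>_. 1) (phi (b i)) (phi (b j))" by (simp add: D4_mult)
 then show ?thesis using D3_phic[of i i j j] d by (simp add: phic_def)
qed

lemma c_square:
 assumes ijl: "{i, j, l} = {1, 2, 3::nat}"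
 shows "of_int (c i i l) * db i j l = - (of_int (H i i 1 * H i j 2 - H i i 2 * H i j 1) * dw)"
proof -
 note d = perm_distinct[OF ijl]
 from D4_comb[OF ijl c_perm[OF ijl d(1) d(1)]] have "of_int (c i i l) * db i j l = - D3 (\<lambda>_. 1) (phi (b i)) (phib (b i) (b j))" by (simp add: D4_square)
 then show ?thesis using D3_phic[of i i i j] d by (simp add: phic_def)
qed

text \<open>\<open>D3_square\<close> is applied with \<open>z = w 1\<close>, for which
  \<open>q\<close> extracts the coordinate at \<open>w 2\<close>. The right side is minus four times
  the determinant of the symmetric matrix of the second quadratic form.\<close>

lemma e_square:
 "e 1 1 2 = - (4 * H 1 1 2 * H 2 2 2 * H 3 3 2 + H 1 2 2 * H 1 3 2 * H 2 3 2
  - H 1 1 2 * (H 2 3 2)\<^sup>2 - H 2 2 2 * (H 1 3 2)\<^sup>2 - H 3 3 2 * (H 1 2 2)\<^sup>2)" (is "_ = ?r")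
proof -
 have q: "D3 (\<lambda>_. 1) (w 1) (phic b i j) = of_int (H i j 2) * dw" if "i < 4" "j < 4" for i j
  unfolding D3_def using H[OF that, of 0] H[OF that, of 1] H[OF that, of 2] by (simp add: algebra_simps)
 have "D3 (\<lambda>_. 1) (w 1) (\<lambda>k. w 1 k * w 1 k) = of_int (e 1 1 2) * dw"
  unfolding D3_def using e[of 1 1 0] e[of 1 1 1] e[of 1 1 2] by (simp add: algebra_simps)
 moreover have "D3 (\<lambda>_. 1) (w 1) (\<lambda>k. w 1 k * w 1 k) * dw\<^sup>2 = of_int ?r * dw ^ 3"
  using D3_square[of "w 1" "b 1" "b 2" "b 3"] unfolding db_sq
  using q[of 1 1] q[of 2 2] q[of 3 3] q[of 1 2] q[of 1 3] q[of 2 3]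
  by (simp add: phic_def algebra_simps power2_eq_square power3_eq_cube)
 ultimately have "of_int (e 1 1 2) * dw ^ 3 = of_int ?r * dw ^ 3" by (simp add: power2_eq_square power3_eq_cube mult_ac)
 then have "of_int (e 1 1 2) = (of_int ?r :: complex)" using dw_nz by simp
 then show ?thesis by (simp only: of_int_eq_iff)
qed

end

section \<open>Rescaled pairs of lattices\<close>

text \<open>Powers of a single base suffice, since only logarithms relative to that of the
  discriminant matter in the limit.\<close>

definition scaled :: "(nat => nat) => (nat => nat => complex) => nat => nat => complex" where
 "scaled x b j k = 2 ^ x j * b j k"

lemma edet_3_scaled: "edet 3 (scaled y w) = 2 ^ (y 0 + y 1 + y 2) * edet 3 w"
 by (simp add: edet_3 D3_def scaled_def power_add algebra_simps)

lemma edet_4_scaled: "edet 4 (scaled x b) = 2 ^ (x 0 + x 1 + x 2 + x 3) * edet 4 b"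
 by (simp add: edet_4 D4_def scaled_def power_add algebra_simps)

text \<open>In the rescaled basis the coordinates become \<open>2 ^ (m - x l) * a l\<close>; the
  exponent is nonnegative wherever \<open>a l\<close> does not vanish.\<close>

lemma scaled_lattice:
 assumes v: "\<And>k. k < n ==> v k = icomb n b a k" and z: "\<And>l. l < n ==> a l ~= 0 ==> x l \<le> m"
 shows "(\<lambda>k. 2 ^ m * v k) \<in> zlattice n (scaled x b)"
proof (rule latticeI[where a="\<lambda>l. 2 ^ (m - x l) * a l"])
 fix k assume "k < n"
 have "2 ^ m * v k = (\<Sum>l<n. 2 ^ m * (of_int (a l) * b l k))"
  using v[OF \<open>k < n\<close>] by (simp add: rcomb_def sum_distrib_left)
 also have "\<dots> = (\<Sum>l<n. of_int (2 ^ (m - x l) * a l) * (2 ^ x l * b l k))"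
 proof (rule sum.cong[OF refl])
  fix l assume "l \<in> {..<n}"
  show "2 ^ m * (of_int (a l) * b l k) = of_int (2 ^ (m - x l) * a l) * (2 ^ x l * b l k)"
  proof (cases "a l = 0")
   case False
   then have "m = (m - x l) + x l" using z \<open>l \<in> {..<n}\<close> by simp
   then have "(2::complex) ^ m = 2 ^ (m - x l) * 2 ^ x l" by (metis power_add)
   then show ?thesis by simp
  qed simp
 qed
 finally show "2 ^ m * v k = icomb n (scaled x b) (\<lambda>l. 2 ^ (m - x l) * a l) k"
  by (simp add: rcomb_def scaled_def)
qed

context qpair begin

lemma c_one: "i < 4 ==> l < 4 ==> c 0 i l = (if l = i then 1 else 0)" "i < 4 ==> l < 4 ==> c i 0 l = (if l = i then 1 else 0)"
proof -
 assume il: "i < 4" "l < 4"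
 have *: "b 0 k * b i k = icomb 4 b (\<lambda>l. if l = i then 1 else 0) k" "b i k * b 0 k = icomb 4 b (\<lambda>l. if l = i then 1 else 0) k" if "k < 4" for k
  using that il b0 by (simp_all add: rcomb_def if_distrib[where f=of_int] if_distrib[where f=of_real] if_distrib[where f="\<lambda>c. c * _"] cong: if_cong)
 show "c 0 i l = (if l = i then 1 else 0)" "c i 0 l = (if l = i then 1 else 0)"
  using coord_eqI[OF nzb *(1) il(2)] coord_eqI[OF nzb *(2) il(2)] by auto
qed

lemma e_one: "i < 3 ==> l < 3 ==> e 0 i l = (if l = i then 1 else 0)" "i < 3 ==> l < 3 ==> e i 0 l = (if l = i then 1 else 0)"
proof -
 assume il: "i < 3" "l < 3"
 have *: "w 0 k * w i k = icomb 3 w (\<lambda>l. if l = i then 1 else 0) k" "w i k * w 0 k = icomb 3 w (\<lambda>l. if l = i then 1 else 0) k" if "k < 3" for k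
  using that il w0 by (simp_all add: rcomb_def if_distrib[where f=of_int] if_distrib[where f=of_real] if_distrib[where f="\<lambda>c. c * _"] cong: if_cong)
 show "e 0 i l = (if l = i then 1 else 0)" "e i 0 l = (if l = i then 1 else 0)"
  using coord_eqI[OF nzw *(1) il(2)] coord_eqI[OF nzw *(2) il(2)] by auto
qed

lemma db_nz: "{i, j, l} = {1, 2, 3::nat} ==> db i j l ~= 0"
proof -
 assume ijl: "{i, j, l} = {1, 2, 3::nat}"
 note d = perm_distinct[OF ijl]
 have m: "i \<in> {1,2,3}" "j \<in> {1,2,3}" "l \<in> {1,2,3}" using ijl by auto
 have p: "(i, j, l) \<in> {(1,2,3), (1,3,2), (2,1,3), (2,3,1), (3,1,2), (3,2,1)}"
  using m d(4-6) by auto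
 have s: "db 1 3 2 = - db 1 2 3" "db 2 1 3 = - db 1 2 3" "db 2 3 1 = db 1 2 3"
  "db 3 1 2 = db 1 2 3" "db 3 2 1 = - db 1 2 3"
  by (simp_all add: D4_def algebra_simps)
 have "db 1 2 3 ~= 0" using db_sq dw_nz by auto
 then show ?thesis using p s by (elim insertE emptyE Pair_inject) simp_all
qed

lemma H_pattern: "i < 4 ==> j < 4 ==> k \<in> {1, 2} ==> H i j k ~= 0 ==> (i, j, k) \<in> pattern b w"
proof -
 assume a: "i < 4" "j < 4" "k \<in> {1, 2}" "H i j k ~= 0"
 have "i ~= 0" using a H_0[of j k] by metis
 moreover have "j ~= 0" using a H_0[of i k] phic_commute[of b i 0] by metis
 ultimately show ?thesis using a by (auto simp: pattern_def)
qed

section \<open>Exponents for which rescaling preserves both ring structures\<close>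

context
 fixes x y :: "nat => nat"
 assumes x0: "x 0 = 0" and y0: "y 0 = 0" and sum: "x 1 + x 2 + x 3 = y 1 + y 2" and y12: "y 1 \<le> y 2"
  and pat: "\<And>i j k. (i, j, k) \<in> pattern b w ==> y k \<le> x i + x j"
begin

lemma H_exp: "i < 4 ==> j < 4 ==> k < 3 ==> H i j k ~= 0 ==> y k \<le> x i + x j"
 using pat[of i j k] H_pattern[of i j k] y0 by (auto simp: less_3_cases)

lemma sum_perm: "{i, j, l} = {1, 2, 3::nat} ==> x i + x j + x l = y 1 + y 2"
proof -
 assume ijl: "{i, j, l} = {1, 2, 3::nat}"
 have "(\<Sum>m\<in>{i, j, l}. x m) = x 1 + x 2 + x 3" unfolding ijl by simp
 then show ?thesis using perm_distinct[OF ijl] sum by simp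
qed

text \<open>A nonzero structure constant makes one product in the minor nonzero. Adding the
  inequalities of its two factors bounds \<open>y 1 + y 2\<close>, which equals the sum of the three
  exponents \<open>x\<close>; cancelling leaves the claim.\<close>

lemma c_exp:
 assumes "i < 4" "j < 4" "l < 4" "c i j l ~= 0"
 shows "x l \<le> x i + x j"
proof (cases "i = 0 \<or> j = 0 \<or> l = 0 \<or> l = i \<or> l = j")
 case True
 then show ?thesis using c_one[of j l] c_one[of i l] assms x0 by (auto split: if_splits)
next
 case False
 note F = False
 show ?thesis
 proof (cases "i = j")
  case False
  have ijl: "{i, j, l} = {1, 2, 3::nat}" using assms F False by (auto simp: less_4_cases)
  have "H i i 1 * H j j 2 - H i i 2 * H j j 1 ~= 0"
  proof
   assume eq: "H i i 1 * H j j 2 - H i i 2 * H j j 1 = 0"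
   show False using c_mixed[OF ijl] db_nz[OF ijl] assms(4) unfolding eq by simp
  qed
  then have "H i i 1 ~= 0 \<and> H j j 2 ~= 0 \<or> H i i 2 ~= 0 \<and> H j j 1 ~= 0" by auto
  then have "y 1 + y 2 \<le> 2 * x i + 2 * x j"
   using H_exp[of i i 1] H_exp[of j j 2] H_exp[of i i 2] H_exp[of j j 1] assms by auto
  then show ?thesis using sum_perm[OF ijl] by linarith
 next
  case True
  \<comment> \<open>The third index, as \<open>1 + 2 + 3 = 6\<close>.\<close>
  define m where "m = 6 - i - l"
  have ijl: "{i, m, l} = {1, 2, 3::nat}" using assms F True by (auto simp: less_4_cases m_def)
  have m: "m < 4" using perm_distinct[OF ijl] by simp
  have "H i i 1 * H i m 2 - H i i 2 * H i m 1 ~= 0"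
  proof
   assume eq: "H i i 1 * H i m 2 - H i i 2 * H i m 1 = 0"
   show False using c_square[OF ijl] db_nz[OF ijl] assms(4) True unfolding eq by simp
  qed
  then have "H i i 1 ~= 0 \<and> H i m 2 ~= 0 \<or> H i i 2 ~= 0 \<and> H i m 1 ~= 0" by auto
  then have "y 1 + y 2 \<le> 3 * x i + x m"
   using H_exp[of i i 1] H_exp[of i m 2] H_exp[of i i 2] H_exp[of i m 1] assms m by auto
  then show ?thesis using sum_perm[OF ijl] unfolding True[symmetric] by linarith
 qed
qed

text \<open>Only \<open>e 1 1 2\<close> needs an argument. Each monomial in \<open>e_square\<close>
  involves each of the indices 1, 2, 3 twice, so its three inequalities add up to
  \<open>3 * y 2 \<le> 2 * (x 1 + x 2 + x 3)\<close>, and the covolume relation turns this into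
  \<open>y 2 \<le> 2 * y 1\<close>.\<close>

lemma e_exp:
 assumes "i < 3" "j < 3" "l < 3" "e i j l ~= 0"
 shows "y l \<le> y i + y j"
proof (cases "i = 0 \<or> j = 0 \<or> l = 0 \<or> l = i \<or> l = j \<or> l = 1")
 case True
 then show ?thesis using e_one[of j l] e_one[of i l] assms y0 y12 by (auto simp: less_3_cases split: if_splits)
next
 case False
 then have ijl: "i = 1" "j = 1" "l = 2" using assms by (auto simp: less_3_cases)
 have "H 1 1 2 ~= 0 \<and> H 2 2 2 ~= 0 \<and> H 3 3 2 ~= 0 \<or> H 1 2 2 ~= 0 \<and> H 1 3 2 ~= 0 \<and> H 2 3 2 ~= 0 \<or>
  H 1 1 2 ~= 0 \<and> H 2 3 2 ~= 0 \<or> H 2 2 2 ~= 0 \<and> H 1 3 2 ~= 0 \<or> H 3 3 2 ~= 0 \<and> H 1 2 2 ~= 0"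
  using assms(4) e_square unfolding ijl by auto
 then have "3 * y 2 \<le> 2 * (x 1 + x 2 + x 3)"
  using H_exp[of 1 1 2] H_exp[of 2 2 2] H_exp[of 3 3 2] H_exp[of 1 2 2] H_exp[of 1 3 2] H_exp[of 2 3 2] by auto
 then have "3 * y 2 \<le> 2 * (y 1 + y 2)" by (simp only: sum)
 then show ?thesis unfolding ijl by simp
qed

lemma phic_scaled: "phic (scaled x b) i j k = 2 ^ (x i + x j) * phic b i j k"
 by (simp add: phic_def phi_def phib_def scaled_def power_add algebra_simps)

theorem qpair_scaled: "qpair (scaled x b) (scaled y w)"
proof (rule qpair.intro)
 show "mlattice 4 (scaled x b)"
 proof
  show "edet 4 (scaled x b) ~= 0" using nzb by (simp add: edet_4_scaled)
  show "(\<lambda>_. 1) \<in> zlattice 4 (scaled x b)"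
   by (intro latticeI[where a="\<lambda>l. if l = 0 then 1 else 0"]) (simp add: rcomb_def sum_less_4 scaled_def x0 b0)
  fix i j :: nat assume ij: "i < 4" "j < 4"
  have "(\<lambda>k. 2 ^ (x i + x j) * (b i k * b j k)) \<in> zlattice 4 (scaled x b)"
   using coord[OF mlattice.mult_basis[OF L ij]] c_exp[OF ij] by (rule scaled_lattice)
  then show "(\<lambda>k. scaled x b i k * scaled x b j k) \<in> zlattice 4 (scaled x b)"
   by (simp add: scaled_def power_add mult_ac)
 qed auto
 show "mlattice 3 (scaled y w)"
 proof
  show "edet 3 (scaled y w) ~= 0" using nzw by (simp add: edet_3_scaled)
  show "(\<lambda>_. 1) \<in> zlattice 3 (scaled y w)"
   by (intro latticeI[where a="\<lambda>l. if l = 0 then 1 else 0"]) (simp add: rcomb_def sum_less_3 scaled_def y0 w0)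
  fix i j :: nat assume ij: "i < 3" "j < 3"
  have "(\<lambda>k. 2 ^ (y i + y j) * (w i k * w j k)) \<in> zlattice 3 (scaled y w)"
   using coord[OF mlattice.mult_basis[OF M ij]] e_exp[OF ij] by (rule scaled_lattice)
  then show "(\<lambda>k. scaled y w i k * scaled y w j k) \<in> zlattice 3 (scaled y w)"
   by (simp add: scaled_def power_add mult_ac)
 qed auto
 show "scaled x b 0 k = 1" if "k < 4" for k using b0[OF that] by (simp add: scaled_def x0)
 show "scaled y w 0 k = 1" if "k < 3" for k using w0[OF that] by (simp add: scaled_def y0)
 show "(edet 4 (scaled x b))\<^sup>2 = (edet 3 (scaled y w))\<^sup>2"
  using disc sum by (simp add: edet_4_scaled edet_3_scaled x0 y0 power_mult_distrib)
 fix v assume "v \<in> zlattice 4 (scaled x b)"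
 then show "Submission.phi v \<in> zlattice 3 (scaled y w)"
 proof (rule phi_lattice[rotated])
  fix i j :: nat assume ij: "i < 4" "j < 4"
  have "(\<lambda>k. 2 ^ (x i + x j) * phic b i j k) \<in> zlattice 3 (scaled y w)"
   using coord[OF phic_lattice[OF ij]] H_exp[OF ij] by (rule scaled_lattice)
  then show "phic (scaled x b) i j \<in> zlattice 3 (scaled y w)"
   by (simp add: phic_scaled[abs_def])
 qed
qed

end

end

section \<open>Rings of finite rank as lattices\<close>

lemma complex_ring_simps [simp]:
 "carrier complex_ring = UNIV" "x \<otimes>\<^bsub>complex_ring\<^esub> y = x * y" "x \<oplus>\<^bsub>complex_ring\<^esub> y = x + y"
 "\<one>\<^bsub>complex_ring\<^esub> = 1" "\<zero>\<^bsub>complex_ring\<^esub> = 0"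
 by (simp_all add: ring_of_type_algebra_def)

lemma cring_complex: "cring complex_ring" and field_complex: "field complex_ring"
 by blast+

lemma a_inv_complex [simp]: "\<ominus>\<^bsub>complex_ring\<^esub> x = - x"
 using abelian_group.minus_equality[of complex_ring "- x" x] cring_complex
 by (simp add: cring.axioms(1) ring.is_abelian_group)

section \<open>Homomorphisms to the complex numbers\<close>

context ring begin

lemma zlincomb_closed: "v \<in> I \<rightarrow> carrier R ==> zlincomb R I a v \<in> carrier R"
 unfolding zlincomb_def by (intro finsum_closed) (auto simp: Pi_iff)

lemma chom_simps:
 assumes "h \<in> Ring.ring_hom R complex_ring"
 shows "x \<in> carrier R ==> y \<in> carrier R ==> h (x \<oplus> y) = h x + h y"
  "x \<in> carrier R ==> y \<in> carrier R ==> h (x \<otimes> y) = h x * h y"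
  "h \<one> = 1"
 using assms by (auto simp: Ring.ring_hom_def)

lemma chom_zero: "h \<in> Ring.ring_hom R complex_ring ==> h \<zero> = 0"
 using chom_simps(1)[of h \<zero> \<zero>] by simp

lemma chom_minus: "h \<in> Ring.ring_hom R complex_ring ==> x \<in> carrier R ==> h (\<ominus> x) = - h x"
 using chom_simps(1)[of h x "\<ominus> x"] chom_zero[of h] by (simp add: r_neg eq_neg_iff_add_eq_0 add.commute)

lemma chom_add_pow:
 assumes h: "h \<in> Ring.ring_hom R complex_ring" and x: "x \<in> carrier R"
 shows "h ([(k::int)] \<cdot> x) = of_int k * h x"
proof -
 have nat: "h ([(m::nat)] \<cdot> x) = of_nat m * h x" for m
 proof (induction m)
  case 0
  then show ?case using chom_zero[OF h] by simp
 next
  case (Suc m)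
  then show ?case using chom_simps(1)[OF h, of "[m] \<cdot> x" x] x by (simp add: add.nat_pow_Suc algebra_simps)
 qed
 show ?thesis
 proof (cases "k \<ge> 0")
  case True
  then show ?thesis using nat[of "nat k"] by (simp add: add_pow_int_ge)
 next
  case False
  then show ?thesis using nat[of "nat (- k)"] chom_minus[OF h, of "[nat (- k)] \<cdot> x"] x by (simp add: add_pow_int_lt)
 qed
qed

lemma chom_zlincomb:
 assumes h: "h \<in> Ring.ring_hom R complex_ring" and "finite I" "v \<in> I \<rightarrow> carrier R"
 shows "h (zlincomb R I a v) = (\<Sum>i\<in>I. of_int (a i) * h (v i))"
 using assms(2,3)
proof (induction I rule: finite_induct)
 case empty
 then show ?case using chom_zero[OF h] by (simp add: zlincomb_def)
next
 case (insert i I)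
 have "zlincomb R (insert i I) a v = [a i] \<cdot> v i \<oplus> zlincomb R I a v"
  unfolding zlincomb_def using insert by (intro finsum_insert) (auto simp: Pi_iff)
 then show ?case using insert chom_simps(1)[OF h] chom_add_pow[OF h] zlincomb_closed[of v I a] by (simp add: Pi_iff)
qed

end

text \<open>\<open>h\<close> lists homomorphisms as total functions, without the extensionality of
  \<open>homs\<close>. The nonzero determinant makes them distinct and turns the ring into a lattice
  of full rank.\<close>

locale embedded = cring R for R (structure) +
 fixes n :: nat and h :: "nat => 'a => complex" and \<beta> :: "nat => 'a"
 assumes n: "0 < n" "n \<le> 4"
  and hom: "\<And>k. k < n ==> h k \<in> Ring.ring_hom R complex_ring"
  and basis: "zbasis R n \<beta>"
  and enz: "edet n (\<lambda>j k. h k (\<beta> j)) ~= 0"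
begin

definition vec :: "'a => nat => complex" where "vec x k = h k x"

abbreviation B :: "nat => nat => complex" where "B j \<equiv> vec (\<beta> j)"

lemma Bnz: "edet n B ~= 0"
 using enz by (simp add: vec_def[abs_def])

lemma basis_closed: "j < n ==> \<beta> j \<in> carrier R"
 using basis by (auto simp: zbasis_def)

lemma vec_simps:
 assumes "k < n" "x \<in> carrier R" "y \<in> carrier R"
 shows "vec (x \<oplus> y) k = vec x k + vec y k" "vec (x \<otimes> y) k = vec x k * vec y k" "vec \<one> k = 1" "vec \<zero> k = 0"
 using chom_simps[OF hom[OF assms(1)]] chom_zero[OF hom[OF assms(1)]] assms(2,3) by (auto simp: vec_def)

lemma vec_zlincomb:
 "finite I ==> v \<in> I \<rightarrow> carrier R ==> k < n ==> vec (zlincomb R I a v) k = (\<Sum>i\<in>I. of_int (a i) * vec (v i) k)"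
 unfolding vec_def using chom_zlincomb[OF hom] by blast

lemma vec_lincomb: "(\<And>j. j < n ==> v j \<in> carrier R) ==> k < n ==> vec (zlincomb R {..<n} a v) k = icomb n (\<lambda>j. vec (v j)) a k"
 using vec_zlincomb[of "{..<n}" v k a] by (auto simp: rcomb_def)

lemma ex_coord: "x \<in> carrier R ==> \<exists>a. a \<in> {..<n} \<rightarrow>\<^sub>E UNIV \<and> x = zlincomb R {..<n} a \<beta>"
 using basis unfolding zbasis_def by blast

lemma vec_lattice: "x \<in> carrier R ==> vec x \<in> zlattice n B"
proof -
 assume "x \<in> carrier R"
 then obtain a where "x = zlincomb R {..<n} a \<beta>" using ex_coord by blast
 then show ?thesis using vec_lincomb[of \<beta> _ a] basis_closed by (intro latticeI[of n _ B a]) auto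
qed

lemma vec_inj:
 assumes "x \<in> carrier R" "y \<in> carrier R" "\<And>k. k < n ==> vec x k = vec y k"
 shows "x = y"
proof -
 obtain a where a: "a \<in> {..<n} \<rightarrow>\<^sub>E UNIV" "x = zlincomb R {..<n} a \<beta>" using ex_coord[OF assms(1)] by blast
 obtain c where c: "c \<in> {..<n} \<rightarrow>\<^sub>E UNIV" "y = zlincomb R {..<n} c \<beta>" using ex_coord[OF assms(2)] by blast
 have "icomb n B a k = icomb n B c k" if "k < n" for k
  using assms(3)[OF that] vec_lincomb[of \<beta> k] basis_closed that unfolding a c by simp
 then have "a j = c j" if "j < n" for j using icomb_unique[OF Bnz] that by blast
 then have "a = c" using a c by (intro PiE_ext) auto
 then show ?thesis using a c by simp
qed

lemma vec_surj:
 assumes "v \<in> zlattice n B"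
 shows "\<exists>x\<in>carrier R. \<forall>k<n. vec x k = v k"
proof -
 obtain a where "\<And>k. k < n ==> v k = icomb n B a k" using assms by (metis latticeE)
 then show ?thesis using vec_lincomb[of \<beta>] basis_closed zlincomb_closed[of \<beta> "{..<n}" a]
  by (intro bexI[of _ "zlincomb R {..<n} a \<beta>"]) auto
qed

lemma mlattice: "mlattice n B"
proof (rule mlattice.intro)
 show "(\<lambda>_. 1) \<in> zlattice n B" using vec_lattice[OF one_closed] vec_simps(3)[of _ \<one> \<one>] lattice_cong[of n "vec \<one>" "\<lambda>_. 1"] by simp
 fix i j assume ij: "i < n" "j < n"
 have "vec (\<beta> i \<otimes> \<beta> j) \<in> zlattice n B" using ij basis_closed by (intro vec_lattice) auto
 then show "(\<lambda>k. B i k * B j k) \<in> zlattice n B"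
  using lattice_cong[of n "vec (\<beta> i \<otimes> \<beta> j)" "\<lambda>k. B i k * B j k"] vec_simps(2) ij basis_closed by simp
qed (use n Bnz in auto)

lemma zbasisI:
 assumes c: "\<And>j. j < n ==> \<gamma> j \<in> carrier R" and l: "zlattice n (\<lambda>j. vec (\<gamma> j)) = zlattice n B"
 shows "zbasis R n \<gamma>"
proof -
 have nz: "edet n (\<lambda>j. vec (\<gamma> j)) ~= 0" using edet_lattice_nz[of n B "\<lambda>j. vec (\<gamma> j)"] l Bnz by simp
 have "\<exists>!a. a \<in> {..<n} \<rightarrow>\<^sub>E (UNIV :: int set) \<and> x = zlincomb R {..<n} a \<gamma>" if x: "x \<in> carrier R" for x
 proof -
  have "vec x \<in> zlattice n (\<lambda>j. vec (\<gamma> j))" using vec_lattice[OF x] l by simp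
  then obtain a where a: "\<And>k. k < n ==> vec x k = icomb n (\<lambda>j. vec (\<gamma> j)) a k" by (metis latticeE)
  define a' where "a' = restrict a {..<n}"
  have "icomb n (\<lambda>j. vec (\<gamma> j)) a' = icomb n (\<lambda>j. vec (\<gamma> j)) a" unfolding a'_def by (rule icomb_restrict)
  then have x_eq: "x = zlincomb R {..<n} a' \<gamma>"
   using vec_lincomb[of \<gamma>] c a zlincomb_closed[of \<gamma> "{..<n}" a'] x by (intro vec_inj) auto
  moreover have "a'' = a'" if "a'' \<in> {..<n} \<rightarrow>\<^sub>E UNIV \<and> x = zlincomb R {..<n} a'' \<gamma>" for a''
  proof -
   have "icomb n (\<lambda>j. vec (\<gamma> j)) a'' k = icomb n (\<lambda>j. vec (\<gamma> j)) a' k" if "k < n" for k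
    using vec_lincomb[of \<gamma> k] c that x_eq \<open>a'' \<in> _ \<and> _\<close> by metis
   then have "a'' j = a' j" if "j < n" for j using icomb_unique[OF nz] that by blast
   then show ?thesis using that by (intro PiE_ext) (auto simp: a'_def)
  qed
  ultimately show ?thesis by (intro ex1I[of _ a']) (auto simp: a'_def)
 qed
 then show ?thesis using c by (auto simp: zbasis_def)
qed

text \<open>Carries a basis found for the lattice, such as a reduced one, back to a basis of the
  ring.\<close>

lemma rebase:
 assumes "zlattice n b' = zlattice n B"
 obtains \<gamma> where "embedded R n h \<gamma>" "\<And>j k. j < n ==> k < n ==> vec (\<gamma> j) k = b' j k"
proof -
 have "\<exists>x\<in>carrier R. \<forall>k<n. vec x k = b' j k" if "j < n" for j
  using vec_surj lattice_basis[OF that, of b'] assms by simp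
 then obtain \<gamma> where g: "\<And>j. j < n ==> \<gamma> j \<in> carrier R" "\<And>j k. j < n ==> k < n ==> vec (\<gamma> j) k = b' j k" by metis
 have l: "zlattice n (\<lambda>j. vec (\<gamma> j)) = zlattice n B"
  using mlattice.zlattice_cong_basis[OF mlattice, of "\<lambda>j. vec (\<gamma> j)" b'] g(2) assms by simp
 have "edet n (\<lambda>j. vec (\<gamma> j)) ~= 0" using edet_lattice_nz[of n B "\<lambda>j. vec (\<gamma> j)"] l Bnz by simp
 then have "embedded R n h \<gamma>"
  using n hom zbasisI[OF g(1) l] by unfold_locales (auto simp: vec_def[abs_def])
 then show ?thesis using that g(2) by blast
qed

lemma zbasis_lattice:
 assumes "zbasis R n \<gamma>"
 shows "zlattice n (\<lambda>j. vec (\<gamma> j)) = zlattice n B"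
proof
 have c: "\<And>j. j < n ==> \<gamma> j \<in> carrier R" using assms by (auto simp: zbasis_def)
 show "zlattice n (\<lambda>j. vec (\<gamma> j)) \<subseteq> zlattice n B" using c by (intro lattice_subset vec_lattice)
 show "zlattice n B \<subseteq> zlattice n (\<lambda>j. vec (\<gamma> j))"
 proof (rule lattice_subset)
  fix j assume "j < n"
  then obtain a where "\<beta> j = zlincomb R {..<n} a \<gamma>" using assms basis_closed unfolding zbasis_def by blast
  then show "B j \<in> zlattice n (\<lambda>j. vec (\<gamma> j))" using vec_lincomb[of \<gamma>] c by (intro latticeI) simp
 qed
qed

lemma zbasis_embedded: "zbasis R n \<gamma> ==> embedded R n h \<gamma>"
 using edet_lattice_nz[of n B "\<lambda>j. vec (\<gamma> j)"] zbasis_lattice[of \<gamma>] Bnz n hom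
 by unfold_locales (auto simp: vec_def[abs_def])

lemma zcoord_eq:
 assumes x: "x \<in> carrier R" and a: "\<And>k. k < n ==> vec x k = icomb n B a k" and j: "j < n"
 shows "zcoord R n \<beta> x j = a j"
proof -
 have "\<exists>!c. c \<in> {..<n} \<rightarrow>\<^sub>E UNIV \<and> x = zlincomb R {..<n} c \<beta>" using basis x by (auto simp: zbasis_def)
 from theI'[OF this] have c: "x = zlincomb R {..<n} (zcoord R n \<beta> x) \<beta>" unfolding zcoord_def by blast
 have "icomb n B (zcoord R n \<beta> x) k = icomb n B a k" if "k < n" for k
  using a[OF that] vec_lincomb[of \<beta> k "zcoord R n \<beta> x"] basis_closed that c by simp
 from icomb_unique[OF Bnz this j] show ?thesis .
qed

lemma zcoord: "x \<in> carrier R ==> k < n ==> vec x k = icomb n B (zcoord R n \<beta> x) k"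
proof -
 assume x: "x \<in> carrier R" and k: "k < n"
 obtain a where a: "\<And>k. k < n ==> vec x k = icomb n B a k" using vec_lattice[OF x] by (metis latticeE)
 show ?thesis using a[OF k] zcoord_eq[OF x a] by (simp add: rcomb_def)
qed

lemma ztrace_eq:
 assumes x: "x \<in> carrier R"
 shows "of_int (ztrace R n \<beta> x) = (\<Sum>k<n. vec x k)"
proof (rule mlattice.trace_int[OF mlattice vec_lattice[OF x]])
 fix t assume t: "(\<Sum>k<n. vec x k) = of_int t"
  "\<And>A. (\<And>i k. i < n ==> k < n ==> vec x k * B i k = icomb n B (A i) k) ==> (\<Sum>i<n. A i i) = t"
 have "vec x k * B i k = icomb n B (zcoord R n \<beta> (x \<otimes> \<beta> i)) k" if "i < n" "k < n" for i k
  using zcoord[of "x \<otimes> \<beta> i" k] vec_simps(2)[OF that(2), of x "\<beta> i"] x basis_closed that by simp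
 from t(2)[OF this] show ?thesis unfolding t(1) ztrace_def by simp
qed

text \<open>A trace is the sum over the embeddings, so the matrix of the trace form is the transpose
  of \<open>emat n B\<close> times \<open>emat n B\<close>.\<close>

lemma disc_basis:
 "of_int (Determinant.det (Matrix.mat n n (\<lambda>(i, j). ztrace R n \<beta> (\<beta> i \<otimes> \<beta> j)))) = (edet n B)\<^sup>2"
proof -
 let ?M = "Matrix.mat n n (\<lambda>(i, j). ztrace R n \<beta> (\<beta> i \<otimes> \<beta> j))"
 have "of_int_hom.mat_hom ?M = transpose_mat (emat n B) * emat n B"
  using ztrace_eq[of "\<beta> _ \<otimes> \<beta> _"] basis_closed vec_simps(2)
  by (intro eq_matI) (auto simp: emat_def scalar_prod_def atLeast0LessThan intro!: sum.cong)
 then have "Determinant.det (of_int_hom.mat_hom ?M :: complex mat) = (edet n B)\<^sup>2"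
  by (simp add: Determinant.det_mult[of _ n] det_transpose[of _ n] edet_def power2_eq_square)
 then show ?thesis by (simp only: of_int_hom.hom_det)
qed

text \<open>The discriminant refers to a basis chosen by \<open>SOME\<close>; it spans the same
  lattice as \<open>\<beta>\<close> and thus has the same squared determinant.\<close>

lemma ring_disc_eq: "of_int (ring_disc n R) = (edet n B)\<^sup>2"
proof -
 define \<gamma> where "\<gamma> = (SOME b. zbasis R n b)"
 have g: "zbasis R n \<gamma>" unfolding \<gamma>_def by (rule someI[of "zbasis R n", OF basis])
 interpret g: embedded R n h \<gamma> by (rule zbasis_embedded[OF g])
 have "of_int (ring_disc n R) = (edet n (\<lambda>j. vec (\<gamma> j)))\<^sup>2"
  using g.disc_basis unfolding ring_disc_def Let_def \<gamma>_def[symmetric] by (simp add: g.vec_def[abs_def] vec_def[abs_def])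
 then show ?thesis using edet_lattice_sq[of n B "\<lambda>j. vec (\<gamma> j)"] zbasis_lattice[OF g] Bnz by simp
qed

end

section \<open>Homomorphisms and successive minima\<close>

text \<open>Dedekind's argument: for \<open>y\<close> separating \<open>h k\<close> from
  \<open>h m\<close>, the relation at \<open>x \<otimes> y\<close> minus \<open>h m y\<close> times
  the relation at \<open>x\<close> no longer involves \<open>h m\<close>.\<close>

lemma (in ring) characters_independent:
 assumes "finite K" "\<And>k. k \<in> K ==> h k \<in> Ring.ring_hom R complex_ring"
  "\<And>k l. k \<in> K ==> l \<in> K ==> k ~= l ==> \<exists>x\<in>carrier R. h k x ~= h l x"
  "\<And>x. x \<in> carrier R ==> (\<Sum>k\<in>K. z k * h k x) = 0"
 shows "\<forall>k\<in>K. z k = 0"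
 using assms
proof (induction K arbitrary: z rule: finite_induct)
 case empty
 then show ?case by simp
next
 case (insert m K)
 have "z k = 0" if k: "k \<in> K" for k
 proof -
  obtain y where y: "y \<in> carrier R" "h k y ~= h m y" using insert.prems(2)[of k m] k insert.hyps by auto
  have "\<forall>k\<in>K. z k * (h k y - h m y) = 0"
  proof (rule insert.IH)
   fix x assume x: "x \<in> carrier R"
   have 1: "(\<Sum>k\<in>insert m K. z k * h k (x \<otimes> y)) = 0" using x y by (intro insert.prems) auto
   have 2: "h m y * (\<Sum>k\<in>insert m K. z k * h k x) = 0" using x insert.prems(3) by simp
   have "(\<Sum>k\<in>insert m K. z k * (h k y - h m y) * h k x) =
    (\<Sum>k\<in>insert m K. z k * h k (x \<otimes> y)) - h m y * (\<Sum>k\<in>insert m K. z k * h k x)"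
    using chom_simps(2)[OF insert.prems(1)] x y
    by (simp only: sum_distrib_left sum_subtractf[symmetric]) (intro sum.cong refl, simp add: algebra_simps)
   then have "(\<Sum>k\<in>insert m K. z k * (h k y - h m y) * h k x) = 0" using 1 2 by simp
   then show "(\<Sum>k\<in>K. z k * (h k y - h m y) * h k x) = 0" using insert.hyps by simp
  qed (use insert.prems in auto)
  then show ?thesis using k y(2) by auto
 qed
 moreover have "z m = 0"
  using insert.prems(3)[OF one_closed] insert.hyps calculation chom_simps(3)[OF insert.prems(1)[of m]] by simp
 ultimately show ?case by auto
qed

text \<open>A vanishing determinant would yield a linear relation among the distinct homomorphisms,
  at first on the basis and hence on the whole ring.\<close>

lemma embeddedI:
 assumes "cring R" "0 < n" "n \<le> 4" "zbasis R n \<beta>"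
  and hom: "\<And>k. k < n ==> h k \<in> Ring.ring_hom R complex_ring"
  and dist: "\<And>k l. k < n ==> l < n ==> k ~= l ==> \<exists>x\<in>carrier R. h k x ~= h l x"
 shows "embedded R n h \<beta>"
proof -
 interpret cring R by fact
 let ?A = "Matrix.mat n n (\<lambda>(j, k). h k (\<beta> j))"
 have bc: "\<beta> \<in> {..<n} \<rightarrow> carrier R" using assms(4) by (simp add: zbasis_def)
 have "edet n (\<lambda>j k. h k (\<beta> j)) ~= 0"
 proof
  assume "edet n (\<lambda>j k. h k (\<beta> j)) = 0"
  then have "Determinant.det ?A = 0" by (simp add: edet_transpose)
  then obtain v where v: "v \<in> carrier_vec n" "v ~= 0\<^sub>v n" "?A *\<^sub>v v = 0\<^sub>v n"
   using det_0_iff_vec_prod_zero[of ?A n] by auto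
  have s: "(\<Sum>k<n. vec_index v k * h k (\<beta> j)) = 0" if "j < n" for j
  proof -
   have "vec_index (?A *\<^sub>v v) j = 0" using v(3) that by simp
   then show ?thesis using v(1) that by (simp add: scalar_prod_def atLeast0LessThan mult.commute)
  qed
  have "\<forall>k\<in>{..<n}. vec_index v k = 0"
  proof (rule characters_independent[of "{..<n}" h])
   fix x assume "x \<in> carrier R"
   then obtain a where a: "x = zlincomb R {..<n} a \<beta>" using assms(4) unfolding zbasis_def by blast
   have "(\<Sum>k<n. vec_index v k * h k x) = (\<Sum>k<n. \<Sum>j<n. of_int (a j) * (vec_index v k * h k (\<beta> j)))"
    unfolding a using chom_zlincomb[OF hom _ bc] by (intro sum.cong) (auto simp: sum_distrib_left mult_ac)
   also have "\<dots> = (\<Sum>j<n. of_int (a j) * (\<Sum>k<n. vec_index v k * h k (\<beta> j)))"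
    by (subst sum.swap) (simp add: sum_distrib_left)
   finally show "(\<Sum>k<n. vec_index v k * h k x) = 0" using s by simp
  qed (use hom dist in auto)
  then have "v = 0\<^sub>v n" using v(1) by (intro eq_vecI) auto
  then show False using v(2) by simp
 qed
 then show ?thesis using assms by (intro embedded.intro embedded_axioms.intro) auto
qed

text \<open>Fraction-free Gaussian elimination: a pivot \<open>M p m\<close> clears one column at
  the cost of one row.\<close>

lemma int_dependence:
 fixes M :: "'i => nat => int"
 assumes "finite J" "m < card J"
 shows "\<exists>a. (\<exists>j\<in>J. a j ~= 0) \<and> (\<forall>l<m. (\<Sum>j\<in>J. a j * M j l) = 0)"
 using assms
proof (induction m arbitrary: J M)
 case 0
 then have "J ~= {}" by auto
 then show ?case by (intro exI[of _ "\<lambda>_. 1"]) auto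
next
 case (Suc m)
 show ?case
 proof (cases "\<exists>p\<in>J. M p m ~= 0")
  case False
  obtain a where "\<exists>j\<in>J. a j ~= 0" "\<forall>l<m. (\<Sum>j\<in>J. a j * M j l) = 0" using Suc.IH[of J M] Suc.prems by auto
  then show ?thesis using False by (intro exI[of _ a]) (auto simp: less_Suc_eq)
 next
  case True
  then obtain p where p: "p \<in> J" "M p m ~= 0" by blast
  define N where "N = (\<lambda>j l. M p m * M j l - M j m * M p l)"
  have "finite (J - {p})" "m < card (J - {p})" using Suc.prems p by auto
  from Suc.IH[OF this, of N]
  obtain a where a: "\<exists>j\<in>J-{p}. a j ~= 0" "\<And>l. l < m ==> (\<Sum>j\<in>J-{p}. a j * N j l) = 0" by blast
  define a' where "a' = (\<lambda>j. if j = p then - (\<Sum>j\<in>J-{p}. a j * M j m) else M p m * a j)"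
  have s: "(\<Sum>j\<in>J. a' j * M j l) = (\<Sum>j\<in>J-{p}. a j * N j l)" for l
  proof -
   have "(\<Sum>j\<in>J. a' j * M j l) = a' p * M p l + (\<Sum>j\<in>J-{p}. M p m * a j * M j l)"
    using p Suc.prems by (subst sum.remove[of J p]) (auto simp: a'_def)
   also have "a' p * M p l = (\<Sum>j\<in>J-{p}. - (a j * M j m * M p l))"
    by (simp add: a'_def sum_distrib_right sum_negf)
   also have "(\<Sum>j\<in>J-{p}. - (a j * M j m * M p l)) + (\<Sum>j\<in>J-{p}. M p m * a j * M j l) = (\<Sum>j\<in>J-{p}. a j * N j l)"
    unfolding sum.distrib[symmetric] by (intro sum.cong refl) (simp add: N_def algebra_simps)
   finally show ?thesis .
  qed
  have "(\<Sum>j\<in>J. a' j * M j l) = 0" if "l < Suc m" for l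
   using that a(2)[of l] s[of l] by (cases "l = m") (auto simp: N_def)
  moreover have "\<exists>j\<in>J. a' j ~= 0" using a(1) p by (auto simp: a'_def)
  ultimately show ?thesis by blast
 qed
qed

context embedded begin

lemma h_distinct:
 assumes "k < n" "l < n" "k ~= l"
 shows "\<exists>x\<in>carrier R. h k x ~= h l x"
proof (rule ccontr)
 assume "\<not> ?thesis"
 then have eq: "B j k = B j l" if "j < n" for j using basis_closed[OF that] by (auto simp: vec_def)
 obtain Z where Z: "\<And>k l. k < n ==> l < n ==> (\<Sum>j<n. B j k * Z j l) = (if k = l then 1 else 0)"
  using edet_inverse[OF Bnz] by metis
 have "(\<Sum>j<n. B j k * Z j l) = (\<Sum>j<n. B j l * Z j l)" using eq by simp
 then show False using Z[of k l] Z[of l l] assms by simp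
qed

text \<open>The dual basis expresses any homomorphism as a linear combination of the
  \<open>n\<close> given ones, so a further one would contradict independence.\<close>

lemma hom_cases:
 assumes t: "t \<in> Ring.ring_hom R complex_ring"
 shows "\<exists>k<n. \<forall>x\<in>carrier R. t x = h k x"
proof (rule ccontr)
 assume "\<not> ?thesis"
 then have ne: "\<And>k. k < n ==> \<exists>x\<in>carrier R. t x ~= h k x" by blast
 obtain Z where Z: "\<And>i j. i < n ==> j < n ==> (\<Sum>k<n. Z i k * B j k) = (if i = j then 1 else 0)"
  using edet_inverse[OF Bnz] by metis
 define z where "z = (\<lambda>k. if k = n then -1 else (\<Sum>j<n. t (\<beta> j) * Z j k))"
 define h' where "h' = (\<lambda>k. if k = n then t else h k)"
 have bc: "\<beta> \<in> {..<n} \<rightarrow> carrier R" using basis_closed by auto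
 have "\<forall>k\<in>{..n}. z k = 0"
 proof (rule characters_independent[of "{..n}" h'])
  fix k assume "k \<in> {..n}"
  then show "h' k \<in> Ring.ring_hom R complex_ring" using hom[of k] t by (simp add: h'_def)
 next
  fix k l assume "k \<in> {..n}" "l \<in> {..n}" "k ~= l"
  then show "\<exists>x\<in>carrier R. h' k x ~= h' l x"
   using ne[of k] ne[of l] h_distinct[of k l] by (auto simp: h'_def) metis
 next
  fix x assume x: "x \<in> carrier R"
  obtain a where a: "x = zlincomb R {..<n} a \<beta>" using ex_coord[OF x] by blast
  have "(\<Sum>k<n. z k * h k x) = (\<Sum>k<n. \<Sum>i<n. \<Sum>j<n. of_int (a i) * (t (\<beta> j) * (Z j k * B i k)))"
   unfolding a using chom_zlincomb[OF hom _ bc]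
   by (intro sum.cong refl) (simp add: z_def vec_def sum_product sum_distrib_left sum_distrib_right mult_ac)
  also have "\<dots> = (\<Sum>i<n. \<Sum>j<n. \<Sum>k<n. of_int (a i) * (t (\<beta> j) * (Z j k * B i k)))"
   by (subst sum.swap, intro sum.cong refl sum.swap)
  also have "\<dots> = (\<Sum>i<n. of_int (a i) * (\<Sum>j<n. t (\<beta> j) * (\<Sum>k<n. Z j k * B i k)))"
   by (simp add: sum_distrib_left)
  also have "\<dots> = (\<Sum>i<n. of_int (a i) * t (\<beta> i))"
   using Z by (intro sum.cong refl) (simp add: if_distrib[where f="\<lambda>c. _ * c"] cong: if_cong)
  also have "\<dots> = t x" unfolding a using chom_zlincomb[OF t _ bc] by simp
  finally show "(\<Sum>k\<le>n. z k * h' k x) = 0"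
   by (simp add: lessThan_Suc_atMost[symmetric] h'_def z_def)
 qed auto
 then have "z n = 0" by simp
 then show False by (simp add: z_def)
qed

definition rh :: "nat => 'a => complex" where "rh k = restrict (h k) (carrier R)"

lemma rh_apply: "x \<in> carrier R ==> rh k x = vec x k"
 by (simp add: rh_def vec_def)

lemma inj_rh: "inj_on rh {..<n}"
proof (rule inj_onI)
 fix k l assume kl: "k \<in> {..<n}" "l \<in> {..<n}" "rh k = rh l"
 show "k = l"
 proof (rule ccontr)
  assume "k ~= l"
  then obtain x where "x \<in> carrier R" "h k x ~= h l x" using h_distinct kl by blast
  then show False using fun_cong[OF kl(3), of x] by (simp add: rh_def)
 qed
qed

lemma homs_eq: "homs R = rh ` {..<n}"
proof (intro equalityI subsetI)
 fix t assume t: "t \<in> homs R"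
 then obtain k where k: "k < n" "\<forall>x\<in>carrier R. t x = h k x" using hom_cases by (auto simp: homs_def)
 have "t = rh k" using t k(2) by (intro extensionalityI[of _ "carrier R"]) (auto simp: homs_def rh_def)
 then show "t \<in> rh ` {..<n}" using k by blast
next
 fix t assume "t \<in> rh ` {..<n}"
 then obtain k where "k < n" "t = rh k" by blast
 then show "t \<in> homs R" using hom[of k] by (auto simp: homs_def rh_def Ring.ring_hom_def Pi_iff)
qed

lemma len_eq: "x \<in> carrier R ==> len n R x = vnorm n (vec x) / sqrt (real n)"
proof -
 assume x: "x \<in> carrier R"
 have "(\<Sum>s\<in>homs R. (cmod (s x))\<^sup>2) = (\<Sum>k<n. (cmod (vec x k))\<^sup>2)"
  unfolding homs_eq using x by (subst sum.reindex[OF inj_rh]) (simp add: rh_apply)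
 then show ?thesis unfolding len_def vnorm_def L2_set_def by (simp add: real_sqrt_divide)
qed

text \<open>A homomorphism followed by complex conjugation is again a homomorphism, so conjugation
  acts on the list, as an involution.\<close>

lemma conj_perm:
 obtains p where "p permutes {..<n}" "\<And>x k. x \<in> carrier R ==> k < n ==> cnj (vec x k) = vec x (p k)"
proof -
 have "\<exists>l<n. \<forall>x\<in>carrier R. cnj (h k x) = h l x" if "k < n" for k
  using hom[OF that] by (intro hom_cases[of "\<lambda>x. cnj (h k x)"]) (auto simp: Ring.ring_hom_def)
 then obtain q where q: "\<And>k. k < n ==> q k < n" "\<And>k x. k < n ==> x \<in> carrier R ==> cnj (h k x) = h (q k) x" by metis
 have qq: "q (q k) = k" if kn: "k < n" for k
 proof (rule ccontr)
  assume "q (q k) ~= k"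
  then obtain x where x: "x \<in> carrier R" "h (q (q k)) x ~= h k x"
   using h_distinct[OF q(1)[OF q(1)[OF kn]] kn] by blast
  have "h (q (q k)) x = cnj (cnj (h k x))" using q(2)[OF kn x(1)] q(2)[OF q(1)[OF kn] x(1)] by simp
  then show False using x(2) by simp
 qed
 define p where "p = (\<lambda>k. if k < n then q k else k)"
 have "p permutes {..<n}"
  by (rule bij_imp_permutes, rule bij_betw_byWitness[of _ p]) (auto simp: p_def q(1) qq)
 then show ?thesis using that[of p] q(2) by (simp add: p_def vec_def)
qed

lemma finite_len_ball: "finite {x \<in> carrier R. len n R x \<le> r}"
proof -
 define S where "S = {a \<in> {..<n} \<rightarrow>\<^sub>E (UNIV :: int set). vnorm n (icomb n B a) \<le> r * sqrt (real n)}"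
 have "finite S" unfolding S_def by (rule finite_lattice_ball[OF Bnz])
 moreover have "{x \<in> carrier R. len n R x \<le> r} \<subseteq> (\<lambda>a. zlincomb R {..<n} a \<beta>) ` S"
 proof
  fix x assume "x \<in> {x \<in> carrier R. len n R x \<le> r}"
  then have x: "x \<in> carrier R" "vnorm n (vec x) / sqrt (real n) \<le> r" using len_eq[of x] by auto
  then have vx: "vnorm n (vec x) \<le> r * sqrt (real n)" using n by (simp add: field_simps)
  obtain a where a: "a \<in> {..<n} \<rightarrow>\<^sub>E UNIV" "x = zlincomb R {..<n} a \<beta>" using ex_coord[OF x(1)] by blast
  have "vnorm n (icomb n B a) = vnorm n (vec x)" using vec_lincomb[of \<beta>] basis_closed a(2) by (intro vnorm_cong) simp
  then show "x \<in> (\<lambda>a. zlincomb R {..<n} a \<beta>) ` S" using a vx by (auto simp: S_def)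
 qed
 ultimately show ?thesis by (rule finite_surj)
qed

definition indep_below :: "nat => real => bool" where
 "indep_below i r \<longleftrightarrow> (\<exists>v. v \<in> {..i} \<rightarrow> carrier R \<and> zindep R {..i} v \<and> (\<forall>j\<le>i. len n R (v j) \<le> r))"

lemma indep_belowE:
 assumes "indep_below i r"
 obtains v where "v \<in> {..i} \<rightarrow> carrier R" "zindep R {..i} v" "\<forall>j\<le>i. len n R (v j) \<le> r"
proof -
 from assms obtain v where v: "v \<in> {..i} \<rightarrow> carrier R \<and> zindep R {..i} v \<and> (\<forall>j\<le>i. len n R (v j) \<le> r)"
  unfolding indep_below_def by (rule exE)
 show ?thesis by (rule that[of v]) (use v in simp_all)
qed

lemma basis_zindep: "i < n ==> zindep R {..i} \<beta>"
 unfolding zindep_def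
proof (intro allI impI)
 fix a assume i: "i < n" and "zlincomb R {..i} a \<beta> = \<zero>"
 then have z: "(\<Sum>j\<in>{..i}. of_int (a j) * B j k) = 0" if "k < n" for k
  using vec_zlincomb[of "{..i}" \<beta> k a] basis_closed vec_simps(4)[OF that, of \<zero> \<zero>] that by auto
 define a' where "a' = (\<lambda>j. if j \<le> i then a j else 0)"
 have "icomb n B a' k = icomb n B (\<lambda>_. 0) k" if "k < n" for k
 proof -
  have "icomb n B a' k = (\<Sum>j\<in>{..i}. of_int (a j) * B j k)"
   unfolding rcomb_def using i by (intro sum.mono_neutral_cong_right) (auto simp: a'_def)
  then show ?thesis using z[OF that] by (simp add: rcomb_def)
 qed
 from icomb_unique[OF Bnz this] have "a' j = 0" if "j < n" for j using that by simp
 then show "\<forall>j\<in>{..i}. a j = 0" using i by (auto simp: a'_def) (metis le_less_trans)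
qed

text \<open>\<open>LEAST\<close> over the reals denotes a minimum only if one is attained. A bound
  may be lowered to the largest length that occurs, and only finitely many lengths lie below the
  value \<open>r0\<close> coming from the basis.\<close>

lemma succ_min_least:
 assumes i: "i < n"
 shows "indep_below i (succ_min n R i)" "indep_below i r ==> succ_min n R i \<le> r"
proof -
 define r0 where "r0 = Max ((\<lambda>j. len n R (\<beta> j)) ` {..i})"
 have r0: "indep_below i r0" unfolding indep_below_def r0_def
  using basis_zindep[OF i] basis_closed i by (intro exI[of _ \<beta>]) auto
 define V where "V = len n R ` {x \<in> carrier R. len n R x \<le> r0}"
 have fin: "finite V" unfolding V_def using finite_len_ball by blast
 have *: "\<exists>s\<in>V. s \<le> r \<and> indep_below i s" if ib: "indep_below i r" "r \<le> r0" for r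
 proof -
  obtain v where v: "v \<in> {..i} \<rightarrow> carrier R" "zindep R {..i} v" "\<forall>j\<le>i. len n R (v j) \<le> r"
   by (rule indep_belowE[OF ib(1)])
  define s where "s = Max ((\<lambda>j. len n R (v j)) ` {..i})"
  have "s \<in> (\<lambda>j. len n R (v j)) ` {..i}" unfolding s_def by (intro Max_in) auto
  then have "s \<in> V" "s \<le> r" using v ib(2) by (auto simp: V_def Pi_iff intro!: imageI order_trans[OF v(3)[rule_format]])
  moreover have "indep_below i s" unfolding indep_below_def s_def using v by (intro exI[of _ v]) auto
  ultimately show ?thesis by blast
 qed
 define \<mu> where "\<mu> = Min {s \<in> V. indep_below i s}"
 have ne: "{s \<in> V. indep_below i s} ~= {}" using *[OF r0] by auto
 have mu: "indep_below i \<mu>" using Min_in[OF _ ne] fin by (auto simp: \<mu>_def)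
 have le: "\<mu> \<le> r" if ib: "indep_below i r" for r
 proof (cases "r \<le> r0")
  case True
  then obtain s where "s \<in> V" "s \<le> r" "indep_below i s" using *[OF ib True] by blast
  then show ?thesis unfolding \<mu>_def using fin by (intro order_trans[OF Min_le]) auto
 next
  case False
  obtain s where "s \<in> V" "s \<le> r0" "indep_below i s" using *[OF r0] by blast
  then have "\<mu> \<le> s" unfolding \<mu>_def using fin by (intro Min_le) auto
  then show ?thesis using False \<open>s \<le> r0\<close> by linarith
 qed
 have "succ_min n R i = \<mu>"
  unfolding succ_min_def using mu le by (intro Least_equality) (auto simp: indep_below_def)
 then show "indep_below i (succ_min n R i)" "indep_below i r ==> succ_min n R i \<le> r" using mu le by auto
qed

lemma succ_min_mono: "i \<le> j ==> j < n ==> succ_min n R i \<le> succ_min n R j"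
proof -
 assume ij: "i \<le> j" "j < n"
 obtain v where v: "v \<in> {..j} \<rightarrow> carrier R" "zindep R {..j} v" "\<forall>l\<le>j. len n R (v l) \<le> succ_min n R j"
  by (rule indep_belowE[OF succ_min_least(1)[OF ij(2)]])
 have "zindep R {..i} v" unfolding zindep_def
 proof (intro allI impI)
  fix a assume z: "zlincomb R {..i} a v = \<zero>"
  define a' where "a' = (\<lambda>l. if l \<le> i then a l else 0)"
  have vi: "v \<in> {..i} \<rightarrow> carrier R" using v(1) ij by auto
  have "zlincomb R {..j} a' v = zlincomb R {..i} a v"
  proof (rule vec_inj)
   fix k assume k: "k < n"
   have "(\<Sum>l\<in>{..j}. of_int (a' l) * vec (v l) k) = (\<Sum>l\<in>{..i}. of_int (a l) * vec (v l) k)"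
    using ij by (intro sum.mono_neutral_cong_right) (auto simp: a'_def)
   then show "vec (zlincomb R {..j} a' v) k = vec (zlincomb R {..i} a v) k"
    using vec_zlincomb[OF _ v(1) k] vec_zlincomb[OF _ vi k] by simp
  qed (use v(1) vi zlincomb_closed in auto)
  then have "\<forall>l\<in>{..j}. a' l = 0" using v(2) z by (simp add: zindep_def)
  then show "\<forall>l\<in>{..i}. a l = 0" using ij by (auto simp: a'_def split: if_splits)
 qed
 moreover have "v \<in> {..i} \<rightarrow> carrier R" using v(1) ij by auto
 ultimately have "indep_below i (succ_min n R j)" using v(3) ij by (auto simp: indep_below_def)
 then show ?thesis using succ_min_least(2)[of i] ij by simp
qed

text \<open>The basis vectors up to index \<open>i\<close> bound the minimum from above. Conversely,
  \<open>i + 1\<close> independent elements cannot have all their coordinates below index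
  \<open>i\<close>, so one of them has a nonzero coordinate at some \<open>j \<ge> i\<close>;
  \<open>orth\<close> and \<open>mono\<close> then cost one factor \<open>K\<close> each. The factor
  \<open>sqrt (real n)\<close> undoes the normalisation in \<open>len\<close>.\<close>

lemma succ_min_bounds:
 assumes i: "i < n" and K: "0 < K"
  and orth: "\<And>x j. j < n ==> \<bar>x j\<bar> * vnorm n (B j) \<le> K * vnorm n (rcomb n B x)"
  and mono: "\<And>i j. i \<le> j ==> j < n ==> vnorm n (B i) \<le> K * vnorm n (B j)"
 shows "sqrt (real n) * succ_min n R i \<le> K * vnorm n (B i)" "vnorm n (B i) \<le> K\<^sup>2 * (sqrt (real n) * succ_min n R i)"
proof -
 have sn: "0 < sqrt (real n)" using n by simp
 have "indep_below i (K * vnorm n (B i) / sqrt (real n))" unfolding indep_below_def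
  using basis_zindep[OF i] basis_closed i mono[OF _ i] len_eq sn
  by (intro exI[of _ \<beta>]) (auto intro!: divide_right_mono)
 from succ_min_least(2)[OF i this] show "sqrt (real n) * succ_min n R i \<le> K * vnorm n (B i)"
  using sn by (simp add: field_simps)
 obtain v where v: "v \<in> {..i} \<rightarrow> carrier R" "zindep R {..i} v" "\<forall>l\<le>i. len n R (v l) \<le> succ_min n R i"
  by (rule indep_belowE[OF succ_min_least(1)[OF i]])
 have "\<exists>l\<le>i. \<exists>j. i \<le> j \<and> j < n \<and> zcoord R n \<beta> (v l) j ~= 0"
 proof (rule ccontr)
  assume "\<not> ?thesis"
  then have z: "\<And>l j. l \<le> i ==> i \<le> j ==> j < n ==> zcoord R n \<beta> (v l) j = 0" by blast
  obtain a where a: "\<exists>l\<in>{..i}. a l ~= 0" "\<And>m. m < i ==> (\<Sum>l\<in>{..i}. a l * zcoord R n \<beta> (v l) m) = 0"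
   using int_dependence[of "{..i}" i "\<lambda>l. zcoord R n \<beta> (v l)"] by auto
  have a': "(\<Sum>l\<in>{..i}. a l * zcoord R n \<beta> (v l) m) = 0" if "m < n" for m
   using a(2)[of m] z[of _ m] that by (cases "m < i") auto
  have "zlincomb R {..i} a v = \<zero>"
  proof (rule vec_inj)
   fix k assume k: "k < n"
   have "vec (zlincomb R {..i} a v) k = (\<Sum>l\<in>{..i}. of_int (a l) * vec (v l) k)"
    by (rule vec_zlincomb[OF _ v(1) k]) simp
   also have "\<dots> = (\<Sum>l\<in>{..i}. \<Sum>m<n. of_int (a l * zcoord R n \<beta> (v l) m) * B m k)"
    using zcoord[OF _ k] v(1) by (intro sum.cong refl) (auto simp: rcomb_def sum_distrib_left mult_ac Pi_iff)
   also have "\<dots> = (\<Sum>m<n. of_int (\<Sum>l\<in>{..i}. a l * zcoord R n \<beta> (v l) m) * B m k)"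
    by (subst sum.swap) (simp add: sum_distrib_right)
   also have "\<dots> = 0" using a' by simp
   finally show "vec (zlincomb R {..i} a v) k = vec \<zero> k" using vec_simps(4)[OF k, of \<zero> \<zero>] by simp
  qed (use v(1) zlincomb_closed in auto)
  then show False using v(2) a(1) by (auto simp: zindep_def)
 qed
 then obtain l j where lj: "l \<le> i" "i \<le> j" "j < n" "zcoord R n \<beta> (v l) j ~= 0" by blast
 have vl: "v l \<in> carrier R" using v(1) lj by auto
 have "1 \<le> \<bar>real_of_int (zcoord R n \<beta> (v l) j)\<bar>" using lj(4) by linarith
 then have "vnorm n (B j) \<le> \<bar>real_of_int (zcoord R n \<beta> (v l) j)\<bar> * vnorm n (B j)"
  using mult_right_mono[of 1 _ "vnorm n (B j)"] by simp
 also have "\<dots> \<le> K * vnorm n (icomb n B (zcoord R n \<beta> (v l)))" by (rule orth[OF lj(3)])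
 also have "vnorm n (icomb n B (zcoord R n \<beta> (v l))) = vnorm n (vec (v l))"
  using zcoord[OF vl] by (intro vnorm_cong) simp
 also have "\<dots> = sqrt (real n) * len n R (v l)" using len_eq[OF vl] sn by simp
 finally have "vnorm n (B j) \<le> K * (sqrt (real n) * len n R (v l))" .
 also have "\<dots> \<le> K * (sqrt (real n) * succ_min n R i)" using v(3)[rule_format, OF lj(1)] K sn by simp
 finally have "K * vnorm n (B j) \<le> K * (K * (sqrt (real n) * succ_min n R i))" using K by simp
 then show "vnorm n (B i) \<le> K\<^sup>2 * (sqrt (real n) * succ_min n R i)"
  using mono[OF lj(2,3)] by (simp add: power2_eq_square mult.assoc)
qed

end

section \<open>Galois groups\<close>

abbreviation bas :: "(nat => 'a => complex) => (nat => 'a) => nat => nat => complex" where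
 "bas h \<beta> \<equiv> \<lambda>j k. h k (\<beta> j)"

lemma reduced_cong:
 assumes red: "reduced K n b" and eq: "\<And>j k. j < n ==> k < n ==> b' j k = b j k"
 shows "reduced K n b'"
proof -
 have v: "vnorm n (b' j) = vnorm n (b j)" if "j < n" for j using eq that by (intro vnorm_cong) auto
 have r: "vnorm n (rcomb n b' x) = vnorm n (rcomb n b x)" for x
  using eq by (intro vnorm_cong) (auto simp: rcomb_def intro!: sum.cong)
 have r0: "\<forall>k<n. b 0 k = 1" and r1: "\<And>x j. j < n ==> \<bar>x j\<bar> * vnorm n (b j) \<le> K * vnorm n (rcomb n b x)"
  and r2: "\<And>i j. i \<le> j ==> j < n ==> vnorm n (b i) \<le> K * vnorm n (b j)"
  using red by (auto simp: reduced_def)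
 show ?thesis unfolding reduced_def
 proof (intro conjI allI impI)
  show "b' 0 k = 1" if "k < n" for k using r0 eq[of 0 k] that by auto
  show "\<bar>x j\<bar> * vnorm n (b' j) \<le> K * vnorm n (rcomb n b' x)" if "j < n" for x j
   using r1[OF that] v[OF that] r by simp
  show "vnorm n (b' i) \<le> K * vnorm n (b' j)" if "i \<le> j" "j < n" for i j
   using r2[OF that] v that by simp
 qed
qed

definition lfield :: "(nat => nat => complex) => complex set" where
 "lfield b = generate_field complex_ring {b j k | j k. j < 4 \<and> k < 4}"

text \<open>An automorphism is tested on the entries of the basis only. The shift by 1 matches
  positions numbered from 0 with permutations of \<open>{1..4}\<close>.\<close>

definition lgal :: "(nat => nat => complex) => (nat => nat) set" where
 "lgal b = {p. p permutes {1..4} \<and>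
   (\<exists>\<alpha>\<in>ring_iso (complex_ring\<lparr>carrier := lfield b\<rparr>) (complex_ring\<lparr>carrier := lfield b\<rparr>).
    \<forall>i\<in>{1..4}. \<forall>j<4. b j (p i - 1) = \<alpha> (b j (i - 1)))}"

lemma inv_complex: "x ~= 0 ==> inv\<^bsub>complex_ring\<^esub> x = inverse x"
proof -
 assume x: "x ~= 0"
 interpret field complex_ring by (rule field_complex)
 show ?thesis using comm_inv_char[of x "inverse x"] x by simp
qed

lemma generate_field_closed:
 fixes S :: "complex set"
 defines "F \<equiv> generate_field complex_ring S"
 shows "s \<in> S ==> s \<in> F" "1 \<in> F" "0 \<in> F" "x \<in> F ==> y \<in> F ==> x + y \<in> F" "x \<in> F ==> y \<in> F ==> x * y \<in> F"
  "x \<in> F ==> - x \<in> F" "x \<in> F ==> inverse x \<in> F" "of_int m \<in> F"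
proof -
 show "s \<in> S ==> s \<in> F" unfolding F_def by (rule generate_field.incl)
 show one: "1 \<in> F" using generate_field.one[of complex_ring S] by (simp add: F_def)
 show add: "x + y \<in> F" if "x \<in> F" "y \<in> F" for x y
  using generate_field.eng_add[of x complex_ring S y] that by (simp add: F_def)
 show "x \<in> F ==> y \<in> F ==> x * y \<in> F"
  using generate_field.eng_mult[of x complex_ring S y] by (simp add: F_def)
 show neg: "- x \<in> F" if "x \<in> F" for x
  using generate_field.a_inv[of x complex_ring S] that by (simp add: F_def)
 show zero: "0 \<in> F" using add[OF one neg[OF one]] by simp
 show "inverse x \<in> F" if "x \<in> F"
  using generate_field.m_inv[of x complex_ring S] inv_complex[of x] zero that by (cases "x = 0") (auto simp: F_def)
 have "of_nat k \<in> F" for k by (induction k) (auto simp: zero one add)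
 then show "of_int m \<in> F" by (cases m) (auto intro: neg simp del: of_nat_Suc)
qed

lemma generate_field_subset:
 assumes "\<And>s. s \<in> S ==> s \<in> generate_field complex_ring T"
 shows "generate_field complex_ring S \<subseteq> generate_field complex_ring T"
proof -
 interpret field complex_ring by (rule field_complex)
 have "subfield (generate_field complex_ring T) complex_ring" by (rule generate_field_is_subfield) simp
 then show ?thesis using assms by (intro generate_field_min_subfield1) auto
qed

lemma icomb_in_field:
 "(\<And>j. j < n ==> b j k \<in> generate_field complex_ring S) ==> icomb n b a k \<in> generate_field complex_ring S"
proof -
 assume b: "\<And>j. j < n ==> b j k \<in> generate_field complex_ring S"
 have "m \<le> n ==> (\<Sum>j<m. of_int (a j) * b j k) \<in> generate_field complex_ring S" for m
  using b by (induction m) (auto intro!: generate_field_closed(3,4,5,8))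
 then show ?thesis by (simp add: rcomb_def)
qed

lemma field_auto_simps:
 fixes F :: "complex set"
 assumes "\<alpha> \<in> Ring.ring_hom (complex_ring\<lparr>carrier := F\<rparr>) (complex_ring\<lparr>carrier := F'\<rparr>)"
 shows "x \<in> F ==> y \<in> F ==> \<alpha> (x + y) = \<alpha> x + \<alpha> y" "x \<in> F ==> y \<in> F ==> \<alpha> (x * y) = \<alpha> x * \<alpha> y"
  "\<alpha> 1 = 1" "x \<in> F ==> \<alpha> x \<in> F'"
 using assms by (auto simp: Ring.ring_hom_def)

lemma field_auto_icomb:
 fixes S :: "complex set"
 defines "F \<equiv> generate_field complex_ring S"
 assumes \<alpha>: "\<alpha> \<in> Ring.ring_hom (complex_ring\<lparr>carrier := F\<rparr>) (complex_ring\<lparr>carrier := F'\<rparr>)"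
  and b: "\<And>j. j < n ==> b j k \<in> F"
 shows "\<alpha> (icomb n b a k) = (\<Sum>j<n. of_int (a j) * \<alpha> (b j k))"
proof -
 note h = field_auto_simps[OF \<alpha>] and F = generate_field_closed[where S = S, folded F_def]
 have z: "\<alpha> 0 = 0" using h(1)[of 0 0] F(3) by simp
 have neg: "\<alpha> (- x) = - \<alpha> x" if "x \<in> F" for x
  using h(1)[of x "- x"] that F(6)[of x] z by (simp add: eq_neg_iff_add_eq_0 add.commute)
 have natF: "of_nat m \<in> F" for m using F(8)[of "int m"] by simp
 have nat: "\<alpha> (of_nat m) = of_nat m" for m
  using z h(1)[OF F(2) natF] h(3) by (induction m) auto
 have int: "\<alpha> (of_int m) = of_int m" for m
  using nat natF neg by (cases m) (auto simp del: of_nat_Suc)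
 have mem: "m \<le> n ==> (\<Sum>j<m. of_int (a j) * b j k) \<in> F" for m
  using b by (induction m) (auto intro!: F(3,4,5,8))
 have "m \<le> n ==> \<alpha> (\<Sum>j<m. of_int (a j) * b j k) = (\<Sum>j<m. of_int (a j) * \<alpha> (b j k))" for m
  using b F(5,8) mem by (induction m) (auto simp: z h int)
 then show ?thesis by (simp add: rcomb_def)
qed

text \<open>Every element is an integral combination of the basis, so the entries of the basis
  generate the Galois closure and decide how an automorphism permutes the homomorphisms.\<close>

lemma (in embedded) galois_perms_eq:
 assumes n4: "n = 4" and e: "\<And>i. i \<in> {1..4} ==> e i = rh (i - 1)"
 shows "galois_perms 4 R e = lgal B"
proof -
 have f1: "vec x k \<in> lfield B" if "x \<in> carrier R" "k < 4" for x k
 proof -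
  have "vec x k = icomb 4 B (zcoord R n \<beta> x) k" using zcoord[OF that(1)] that n4 by simp
  moreover have "icomb 4 B (zcoord R n \<beta> x) k \<in> lfield B"
   unfolding lfield_def by (rule icomb_in_field, rule generate_field_closed(1)) (use that in auto)
  ultimately show ?thesis by simp
 qed
 have U: "(\<Union>s\<in>homs R. s ` carrier R) = {vec x k | x k. x \<in> carrier R \<and> k < 4}"
  unfolding homs_eq n4 by (auto simp: rh_apply)
 have fld: "generate_field complex_ring (\<Union>s\<in>homs R. s ` carrier R) = lfield B"
 proof
  show "generate_field complex_ring (\<Union>s\<in>homs R. s ` carrier R) \<subseteq> lfield B"
   unfolding U lfield_def by (rule generate_field_subset) (use f1 in \<open>auto simp: lfield_def\<close>)
  show "lfield B \<subseteq> generate_field complex_ring (\<Union>s\<in>homs R. s ` carrier R)"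
   unfolding U lfield_def
  proof (rule generate_field_subset, rule generate_field_closed(1))
   fix s assume "s \<in> {B j k |j k. j < 4 \<and> k < 4}"
   then obtain j k where "s = B j k" "j < 4" "k < 4" by auto
   moreover then have "\<beta> j \<in> carrier R" using basis_closed n4 by simp
   ultimately show "s \<in> {vec x k |x k. x \<in> carrier R \<and> k < 4}" by blast
  qed
 qed
 have "(\<forall>i\<in>{1..4}. e (p i) = (\<lambda>x\<in>carrier R. \<alpha> (e i x))) \<longleftrightarrow> (\<forall>i\<in>{1..4}. \<forall>j<4. B j (p i - 1) = \<alpha> (B j (i - 1)))"
  if p: "p permutes {1..4}" and \<alpha>: "\<alpha> \<in> ring_iso (complex_ring\<lparr>carrier := lfield B\<rparr>) (complex_ring\<lparr>carrier := lfield B\<rparr>)" for p \<alpha>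
 proof -
  have hom: "\<alpha> \<in> Ring.ring_hom (complex_ring\<lparr>carrier := lfield B\<rparr>) (complex_ring\<lparr>carrier := lfield B\<rparr>)"
   using \<alpha> by (simp add: ring_iso_def)
  have pi: "p i \<in> {1..4}" "p i - 1 < 4" "i - 1 < 4" if "i \<in> {1..4}" for i
   using permutes_in_image[OF p, of i] that by auto
  have "e (p i) = (\<lambda>x\<in>carrier R. \<alpha> (e i x)) \<longleftrightarrow> (\<forall>j<4. B j (p i - 1) = \<alpha> (B j (i - 1)))" if i: "i \<in> {1..4}" for i
  proof
   assume eq: "e (p i) = (\<lambda>x\<in>carrier R. \<alpha> (e i x))"
   show "\<forall>j<4. B j (p i - 1) = \<alpha> (B j (i - 1))"
   proof (intro allI impI)
    fix j :: nat assume "j < 4"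
    then have "\<beta> j \<in> carrier R" using basis_closed n4 by simp
    then show "B j (p i - 1) = \<alpha> (B j (i - 1))" using fun_cong[OF eq, of "\<beta> j"] e[OF i] e[OF pi(1)[OF i]] by (simp add: rh_apply)
   qed
  next
   assume eq: "\<forall>j<4. B j (p i - 1) = \<alpha> (B j (i - 1))"
   show "e (p i) = (\<lambda>x\<in>carrier R. \<alpha> (e i x))"
   proof (rule extensionalityI[of _ "carrier R"])
    show "e (p i) \<in> extensional (carrier R)" using e[OF pi(1)[OF i]] by (simp add: rh_def)
    show "(\<lambda>x\<in>carrier R. \<alpha> (e i x)) \<in> extensional (carrier R)" by simp
    fix x assume x: "x \<in> carrier R"
    have z: "vec x k = icomb 4 B (zcoord R n \<beta> x) k" if "k < 4" for k using zcoord[OF x] that n4 by simp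
    have "\<alpha> (vec x (i - 1)) = (\<Sum>j<4. of_int (zcoord R n \<beta> x j) * \<alpha> (B j (i - 1)))"
     unfolding z[OF pi(3)[OF i]] 
     by (rule field_auto_icomb[OF hom[unfolded lfield_def]])
       (use pi(3)[OF i] in \<open>auto intro!: generate_field_closed(1)\<close>)
    also have "\<dots> = (\<Sum>j<4. of_int (zcoord R n \<beta> x j) * B j (p i - 1))" using eq by simp
    also have "\<dots> = vec x (p i - 1)" using z[OF pi(2)[OF i]] by (simp add: rcomb_def)
    finally show "e (p i) x = (\<lambda>x\<in>carrier R. \<alpha> (e i x)) x"
     using e[OF i] e[OF pi(1)[OF i]] x by (simp add: rh_apply)
   qed
  qed
  then show ?thesis by blast
 qed
 then show ?thesis unfolding galois_perms_def lgal_def galois_closure_def fld by blast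
qed

lemma fun_ring_simps [simp]:
 "carrier (fun_ring I) = I \<rightarrow>\<^sub>E UNIV" "f \<otimes>\<^bsub>fun_ring I\<^esub> g = (\<lambda>i\<in>I. f i * g i)" "f \<oplus>\<^bsub>fun_ring I\<^esub> g = (\<lambda>i\<in>I. f i + g i)"
 "\<one>\<^bsub>fun_ring I\<^esub> = (\<lambda>i\<in>I. 1)" "\<zero>\<^bsub>fun_ring I\<^esub> = (\<lambda>i\<in>I. 0)"
 by (simp_all add: fun_ring_def)

lemma fun_ring_cring: "cring (fun_ring I)"
proof (rule cringI)
 show "abelian_group (fun_ring I)"
 proof (rule abelian_groupI)
  fix x assume "x \<in> carrier (fun_ring I)"
  then show "\<exists>y\<in>carrier (fun_ring I). y \<oplus>\<^bsub>fun_ring I\<^esub> x = \<zero>\<^bsub>fun_ring I\<^esub>"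
   by (intro bexI[of _ "\<lambda>i\<in>I. - x i"]) (auto intro!: restrict_ext)
 qed (auto intro!: restrict_ext simp: add_ac PiE_def extensional_def fun_eq_iff)
 show "Group.comm_monoid (fun_ring I)"
  by (rule comm_monoidI) (auto intro!: restrict_ext simp: mult_ac PiE_def extensional_def fun_eq_iff)
 show "\<And>x y z. x \<in> carrier (fun_ring I) ==> y \<in> carrier (fun_ring I) ==> z \<in> carrier (fun_ring I) ==>
   (x \<oplus>\<^bsub>fun_ring I\<^esub> y) \<otimes>\<^bsub>fun_ring I\<^esub> z = x \<otimes>\<^bsub>fun_ring I\<^esub> z \<oplus>\<^bsub>fun_ring I\<^esub> y \<otimes>\<^bsub>fun_ring I\<^esub> z"
  by (auto intro!: restrict_ext simp: distrib_right)
qed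

context embedded begin

text \<open>A group is not the union of two proper subgroups: if \<open>x\<close> works only for the
  first pair and \<open>y\<close> only for the second, their sum works for both.\<close>

lemma separating:
 assumes "i < n" "j < n" "i ~= j" "k < n" "l < n" "k ~= l"
 shows "\<exists>x\<in>carrier R. vec x i ~= vec x j \<and> vec x k ~= vec x l"
proof -
 obtain x where x: "x \<in> carrier R" "vec x i ~= vec x j" using h_distinct[OF assms(1-3)] by (auto simp: vec_def)
 obtain y where y: "y \<in> carrier R" "vec y k ~= vec y l" using h_distinct[OF assms(4-6)] by (auto simp: vec_def)
 have s: "vec (x \<oplus> y) m = vec x m + vec y m" if "m < n" for m using vec_simps(1)[OF that x(1) y(1)] .
 show ?thesis
 proof (cases "vec x k = vec x l")
  case False
  then show ?thesis using x by blast
 next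
  case xk: True
  show ?thesis
  proof (cases "vec y i = vec y j")
   case False
   then show ?thesis using y by blast
  next
   case True
   then show ?thesis using x y xk s assms by (intro bexI[of _ "x \<oplus> y"]) auto
  qed
 qed
qed

text \<open>One ordering for each splitting of the four homomorphisms into two pairs; at any other
  ordering the resolvent map takes the same value as at one of these.\<close>

definition ord :: "nat => ('a => complex) list" where
 "ord m = (if m = 0 then [rh 0, rh 1, rh 2, rh 3] else if m = 1 then [rh 0, rh 2, rh 1, rh 3] else [rh 0, rh 3, rh 1, rh 2])"

lemma rh_neq: "k < n ==> l < n ==> k ~= l ==> rh k ~= rh l"
 using inj_rh by (auto simp: inj_on_def)

lemma ord_mem: "n = 4 ==> ord m \<in> hom_orderings R"
 using rh_neq by (auto simp: hom_orderings_def ord_def homs_eq less_4_cases lessThan_def)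

lemma resolvent_ord: "n = 4 ==> x \<in> carrier R ==> m < 3 ==> resolvent_map R x (ord m) = phi (vec x) m"
 using ord_mem[of m] by (auto simp: resolvent_map_def ord_def phi_def rh_apply less_3_cases mult_ac)

end

section \<open>Pairs of rings as pairs of lattices\<close>

lemma embedded_rebase_reduced:
 assumes "embedded R n h \<beta>" "n = 3 \<or> n = 4"
 shows "\<exists>\<gamma>. embedded R n h \<gamma> \<and> reduced 100 n (bas h \<gamma>)"
proof -
 interpret embedded R n h \<beta> by fact
 show ?thesis
 proof (rule mlattice.ex_reduced_basis[OF mlattice assms(2)])
  fix b' assume b': "zlattice n b' = zlattice n B" "reduced 100 n b'"
  show ?thesis
  proof (rule rebase[OF b'(1)])
   fix \<gamma> assume g: "embedded R n h \<gamma>" "\<And>j k. j < n ==> k < n ==> vec (\<gamma> j) k = b' j k"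
   have "reduced 100 n (bas h \<gamma>)" using b'(2) by (rule reduced_cong) (use g(2) in \<open>auto simp: vec_def\<close>)
   then show ?thesis using g(1) by blast
  qed
 qed
qed

text \<open>The last clause ties the homomorphisms of \<open>C\<close> to those of \<open>R\<close>:
  they are numbered so that the resolvent map becomes \<open>phi\<close>.\<close>

definition pair_data :: "(nat => nat) set => nat ring => ((nat => complex) list => complex) ring =>
  (nat => nat => complex) => (nat => nat) => (nat => ((nat => complex) list => complex) => complex) =>
  (nat => (nat => complex) list => complex) => bool" where
 "pair_data G R C h \<beta> t \<omega> \<longleftrightarrow> embedded R 4 h \<beta> \<and> embedded C 3 t \<omega> \<and>
   qpair (bas h \<beta>) (bas t \<omega>) \<and> lgal (bas h \<beta>) = G \<and> ring_disc 3 C = ring_disc 4 R \<and>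
   (\<forall>x\<in>carrier R. resolvent_map R x \<in> carrier C \<and> (\<forall>m<3. t m (resolvent_map R x) = phi (\<lambda>k. h k x) m))"

lemma phi_sub: "phi x 0 - phi x 1 = (x 0 - x 3) * (x 1 - x 2)" "phi x 0 - phi x 2 = (x 0 - x 2) * (x 1 - x 3)"
 "phi x 1 - phi x 2 = (x 0 - x 1) * (x 2 - x 3)"
 by (simp_all add: phi_def algebra_simps)

text \<open>The homomorphisms of \<open>R\<close> are taken in the numbering that realises
  \<open>G\<close>, and those of \<open>C\<close> are the evaluations at the three orderings
  \<open>ord m\<close>. The latter are distinct because a difference of two entries of
  \<open>phi\<close> is a product of two differences of embeddings, and one element makes both
  factors nonzero.\<close>

theorem ex_pair_data:
 assumes "(R, C) \<in> G_pairs G"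
 shows "\<exists>h \<beta> t \<omega>. pair_data G R C h \<beta> t \<omega> \<and> reduced 100 4 (bas h \<beta>) \<and> reduced 100 3 (bas t \<omega>)"
proof -
 have nd: "nondeg_ring 4 R" and cr: "cubic_resolvent R C" and isG: "is_G_ring 4 G R"
  using assms by (auto simp: G_pairs_def)
 obtain e where e: "bij_betw e {1..4} (homs R)" "galois_perms 4 R e = G" using isG by (auto simp: is_G_ring_def)
 define h where "h = (\<lambda>k. e (k + 1))"
 obtain \<beta>0 where "zbasis R 4 \<beta>0" and crR: "cring R" using nd by (auto simp: nondeg_ring_def rank_ring_def)
 have hh: "h k \<in> homs R" if "k < 4" for k using bij_betwE[OF e(1)] that by (auto simp: h_def)
 have "embedded R 4 h \<beta>0"
 proof (rule embeddedI)
  show "h k \<in> Ring.ring_hom R complex_ring" if "k < 4" for k using hh[OF that] by (simp add: homs_def)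
  fix k l :: nat assume kl: "k < 4" "l < 4" "k ~= l"
  have "h k ~= h l" using inj_onD[OF bij_betw_imp_inj_on[OF e(1)], of "k + 1" "l + 1"] kl by (auto simp: h_def)
  then show "\<exists>x\<in>carrier R. h k x ~= h l x"
   using hh[OF kl(1)] hh[OF kl(2)] extensionalityI[of "h k" "carrier R" "h l"] by (auto simp: homs_def)
 qed (use crR \<open>zbasis R 4 \<beta>0\<close> in auto)
 then obtain \<beta> where \<beta>: "embedded R 4 h \<beta>" "reduced 100 4 (bas h \<beta>)" using embedded_rebase_reduced by blast
 interpret R: embedded R 4 h \<beta> by (rule \<beta>(1))
 have RB: "R.B = bas h \<beta>" by (intro ext) (simp add: R.vec_def)
 have rh: "R.rh k = h k" if "k < 4" for k
  using hh[OF that] unfolding R.rh_def homs_def by (auto intro: extensional_restrict)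
 have "galois_perms 4 R e = lgal R.B" using rh by (intro R.galois_perms_eq) (auto simp: h_def)
 then have lg: "lgal (bas h \<beta>) = G" using e(2) RB by simp
 obtain K where K: "subring K (conj_ring R)" "C = (conj_ring R)\<lparr>carrier := K\<rparr>"
  and rk: "rank_ring 3 C" and inc: "cubic_invariant_ring R \<subseteq> carrier C" and disc: "ring_disc 3 C = ring_disc 4 R"
  using cr by (auto simp: cubic_resolvent_def)
 have res: "resolvent_map R x \<in> carrier C" if "x \<in> carrier R" for x
  using inc that by (auto simp: cubic_invariant_ring_def intro!: generate_ring.incl)
 define t where "t = (\<lambda>m (f :: (nat => complex) list => complex). f (R.ord m))"
 have tres: "t m (resolvent_map R x) = phi (\<lambda>k. h k x) m" if "x \<in> carrier R" "m < 3" for x m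
  using R.resolvent_ord[OF refl that] phi_cong[of "R.vec x" "\<lambda>k. h k x"] by (simp add: t_def R.vec_def[abs_def])
 have thom: "t m \<in> Ring.ring_hom C complex_ring" for m
  unfolding K(2) t_def using R.ord_mem[OF refl, of m] by (auto simp: Ring.ring_hom_def)
 have tdist: "\<exists>c\<in>carrier C. t k c ~= t l c" if "k < 3" "l < 3" "k ~= l" for k l
 proof -
  have *: "\<exists>c\<in>carrier C. t k c ~= t l c"
   if "x \<in> carrier R" "phi (\<lambda>k. h k x) k - phi (\<lambda>k. h k x) l ~= 0" "k < 3" "l < 3" for x k l
   using res[OF that(1)] tres[OF that(1,3)] tres[OF that(1,4)] that(2)
   by (intro bexI[of _ "resolvent_map R x"]) auto
  obtain x where x: "x \<in> carrier R" "h 0 x ~= h 3 x" "h 1 x ~= h 2 x"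
   using R.separating[of 0 3 1 2] by (auto simp: R.vec_def)
  obtain y where y: "y \<in> carrier R" "h 0 y ~= h 2 y" "h 1 y ~= h 3 y"
   using R.separating[of 0 2 1 3] by (auto simp: R.vec_def)
  obtain z where z: "z \<in> carrier R" "h 0 z ~= h 1 z" "h 2 z ~= h 3 z"
   using R.separating[of 0 1 2 3] by (auto simp: R.vec_def)
  have 1: "\<exists>c\<in>carrier C. t 0 c ~= t 1 c" using x by (intro *[OF x(1)]) (auto simp: phi_sub)
  have 2: "\<exists>c\<in>carrier C. t 0 c ~= t 2 c" using y by (intro *[OF y(1)]) (auto simp: phi_sub)
  have 3: "\<exists>c\<in>carrier C. t 1 c ~= t 2 c" using z by (intro *[OF z(1)]) (auto simp: phi_sub)
  have 4: "\<exists>c\<in>carrier C. t 1 c ~= t 0 c" "\<exists>c\<in>carrier C. t 2 c ~= t 0 c" "\<exists>c\<in>carrier C. t 2 c ~= t 1 c"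
   using 1 2 3 by metis+
  show ?thesis using that(3) less_3_cases[THEN iffD1, OF that(1)] less_3_cases[THEN iffD1, OF that(2)] 1 2 3 4
   by (elim disjE; simp)
 qed
 obtain \<omega>0 where "cring C" "zbasis C 3 \<omega>0" using rk by (auto simp: rank_ring_def)
 then have "embedded C 3 t \<omega>0" using thom tdist by (intro embeddedI) auto
 then obtain \<omega> where \<omega>: "embedded C 3 t \<omega>" "reduced 100 3 (bas t \<omega>)" using embedded_rebase_reduced by blast
 interpret C: embedded C 3 t \<omega> by (rule \<omega>(1))
 have CB: "C.B = bas t \<omega>" by (intro ext) (simp add: C.vec_def)
 have "qpair (bas h \<beta>) (bas t \<omega>)"
 proof (rule qpair.intro)
  show "mlattice 4 (bas h \<beta>)" using R.mlattice RB by simp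
  show "mlattice 3 (bas t \<omega>)" using C.mlattice CB by simp
  show "h k (\<beta> 0) = 1" if "k < 4" for k using \<beta>(2) that by (auto simp: reduced_def)
  show "t k (\<omega> 0) = 1" if "k < 3" for k using \<omega>(2) that by (auto simp: reduced_def)
  show "(edet 4 (bas h \<beta>))\<^sup>2 = (edet 3 (bas t \<omega>))\<^sup>2"
   using R.ring_disc_eq C.ring_disc_eq disc RB CB by simp
  fix v assume "v \<in> zlattice 4 (bas h \<beta>)"
  then obtain x where x: "x \<in> carrier R" "\<forall>k<4. R.vec x k = v k" using R.vec_surj RB by auto
  have "C.vec (resolvent_map R x) \<in> zlattice 3 (bas t \<omega>)" using C.vec_lattice[OF res[OF x(1)]] CB by simp
  moreover have "C.vec (resolvent_map R x) m = phi v m" if "m < 3" for m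
   using tres[OF x(1) that] phi_cong[of v "\<lambda>k. h k x"] x(2) by (simp add: C.vec_def R.vec_def)
  ultimately show "phi v \<in> zlattice 3 (bas t \<omega>)" using lattice_cong[of 3 "C.vec (resolvent_map R x)" "phi v"] by blast
 qed
 then show ?thesis unfolding pair_data_def
  using \<beta> \<omega> lg disc res tres by blast
qed

section \<open>Rings constructed from lattices\<close>

lemma embedded_construct:
 assumes "cring R" "0 < n" "n \<le> 4" and hom: "\<And>k. k < n ==> h k \<in> Ring.ring_hom R complex_ring"
  and \<beta>: "\<And>j. j < n ==> \<beta> j \<in> carrier R" and nz: "edet n (bas h \<beta>) ~= 0"
  and inj: "\<And>x y. x \<in> carrier R ==> y \<in> carrier R ==> (\<And>k. k < n ==> h k x = h k y) ==> x = y"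
  and lat: "\<And>x. x \<in> carrier R ==> (\<lambda>k. h k x) \<in> zlattice n (bas h \<beta>)"
 shows "embedded R n h \<beta>"
proof -
 interpret cring R by fact
 have bc: "\<beta> \<in> {..<n} \<rightarrow> carrier R" using \<beta> by auto
 have l: "h k (zlincomb R {..<n} a \<beta>) = icomb n (bas h \<beta>) a k" if "k < n" for a k
  using chom_zlincomb[OF hom[OF that] _ bc] by (simp add: rcomb_def)
 have "\<exists>!a. a \<in> {..<n} \<rightarrow>\<^sub>E (UNIV :: int set) \<and> x = zlincomb R {..<n} a \<beta>" if x: "x \<in> carrier R" for x
 proof -
  obtain a where a: "\<And>k. k < n ==> h k x = icomb n (bas h \<beta>) a k" using latticeE[OF lat[OF x]] by metis
  define a' where "a' = restrict a {..<n}"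
  have aa: "icomb n (bas h \<beta>) a' = icomb n (bas h \<beta>) a" unfolding a'_def by (rule icomb_restrict)
  have x_eq: "x = zlincomb R {..<n} a' \<beta>"
   by (rule inj) (use x zlincomb_closed[OF bc] l a aa in auto)
  moreover have "c = a'" if c: "c \<in> {..<n} \<rightarrow>\<^sub>E UNIV \<and> x = zlincomb R {..<n} c \<beta>" for c
  proof -
   have "icomb n (bas h \<beta>) c k = icomb n (bas h \<beta>) a' k" if "k < n" for k
    using l[OF that, of c] l[OF that, of a'] c x_eq by simp
   then have "c j = a' j" if "j < n" for j using icomb_unique[OF nz] that by blast
   then show ?thesis using c by (intro PiE_ext) (auto simp: a'_def)
  qed
  ultimately show ?thesis by (intro ex1I[of _ a']) (auto simp: a'_def)
 qed
 then have "zbasis R n \<beta>" using bc by (auto simp: zbasis_def)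
 then show ?thesis using assms by (intro embedded.intro embedded_axioms.intro) auto
qed

lemma lgal_cong: "(\<And>j k. j < 4 ==> k < 4 ==> b j k = b' j k) ==> lgal b = lgal b'"
proof -
 assume eq: "\<And>j k. j < 4 ==> k < 4 ==> b j k = b' j k"
 then have "{b j k | j k. j < 4 \<and> k < 4} = {b' j k | j k. j < 4 \<and> k < 4}" by (auto; metis)
 then have f: "lfield b = lfield b'" by (simp add: lfield_def)
 have "(\<forall>i\<in>{1..4}. \<forall>j<4. b j (p i - 1) = \<alpha> (b j (i - 1))) \<longleftrightarrow> (\<forall>i\<in>{1..4}. \<forall>j<4. b' j (p i - 1) = \<alpha> (b' j (i - 1)))"
  if p: "p permutes {1..4}" for p \<alpha>
 proof -
  have "p i - 1 < 4 \<and> i - 1 < 4" if "i \<in> {1..4}" for i using permutes_in_image[OF p, of i] that by auto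
  then show ?thesis using eq by auto
 qed
 then show ?thesis unfolding lgal_def f by blast
qed

text \<open>A lattice is countably infinite, so its ring structure can be transported along a
  bijection with the natural numbers.\<close>

lemma ex_nat_ring:
 assumes m: "mlattice 4 b"
 shows "\<exists>(R :: nat ring) h \<beta>. embedded R 4 h \<beta> \<and> (\<forall>j<4. \<forall>k<4. h k (\<beta> j) = b j k)"
proof -
 interpret mlattice 4 b by fact
 let ?I = "{..<4::nat}"
 define L where "L = {v \<in> ?I \<rightarrow>\<^sub>E UNIV. v \<in> zlattice 4 b}"
 have Lr: "restrict v ?I \<in> L" if "v \<in> zlattice 4 b" for v
  using that lattice_cong[of 4 "restrict v ?I" v b] by (auto simp: L_def)
 have LI: "v \<in> zlattice 4 b" if "v \<in> L" for v using that by (simp add: L_def)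
 have Leq: "v = w" if "v \<in> L" "w \<in> L" "\<And>k. k < 4 ==> v k = w k" for v w
  using that by (intro PiE_ext[of v ?I "\<lambda>_. UNIV" w]) (auto simp: L_def)
 have "countable L"
 proof -
  have "L \<subseteq> (\<lambda>l. restrict (icomb 4 b (\<lambda>j. l ! j)) ?I) ` (UNIV :: int list set)"
  proof
   fix v assume v: "v \<in> L"
   then obtain a where a: "\<And>k. k < 4 ==> v k = icomb 4 b a k" using latticeE[OF LI] by metis
   have "v = restrict (icomb 4 b (\<lambda>j. map a [0..<4] ! j)) ?I"
    using v a by (intro PiE_ext[of v ?I "\<lambda>_. UNIV"]) (auto simp: L_def rcomb_def)
   then show "v \<in> (\<lambda>l. restrict (icomb 4 b (\<lambda>j. l ! j)) ?I) ` UNIV" by blast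
  qed
  then show ?thesis by (rule countable_subset) simp
 qed
 moreover have "infinite L"
 proof -
  have "inj (\<lambda>s :: int. restrict (\<lambda>_. of_int s :: complex) ?I)"
   by (rule injI) (drule fun_cong[of _ _ 0], simp)
  moreover have "range (\<lambda>s :: int. restrict (\<lambda>_. of_int s :: complex) ?I) \<subseteq> L" using Lr lat_of_int by blast
  ultimately show ?thesis using finite_imageD[of _ "UNIV :: int set"] infinite_UNIV_int finite_subset by blast
 qed
 ultimately obtain F where F: "bij_betw F (UNIV :: nat set) L" using countableE_infinite bij_betw_inv_into by metis
 define N where "N = inv_into UNIV F"
 have FN: "F (N v) = v" if "v \<in> L" for v using bij_betw_inv_into_right[OF F that] by (simp add: N_def)
 have FL: "F x \<in> L" for x using bij_betwE[OF F] by simp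
 have Fz: "F x \<in> zlattice 4 b" for x by (rule LI[OF FL])
 define R :: "nat ring" where "R = \<lparr>carrier = UNIV, monoid.mult = (\<lambda>x y. N (\<lambda>k\<in>?I. F x k * F y k)),
   monoid.one = N (\<lambda>k\<in>?I. 1), ring.zero = N (\<lambda>k\<in>?I. 0), ring.add = (\<lambda>x y. N (\<lambda>k\<in>?I. F x k + F y k))\<rparr>"
 have ops: "F (x \<otimes>\<^bsub>R\<^esub> y) k = F x k * F y k" "F (x \<oplus>\<^bsub>R\<^esub> y) k = F x k + F y k" "F \<one>\<^bsub>R\<^esub> k = 1" "F \<zero>\<^bsub>R\<^esub> k = 0"
  if "k < 4" for x y k
  using that by (simp_all add: R_def FN Lr lat_mult lattice_add one_lat lattice_zero Fz)
 have eqI: "x = y" if "\<And>k. k < 4 ==> F x k = F y k" for x y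
  using Leq[OF FL FL that] bij_betw_imp_inj_on[OF F] by (auto dest: injD)
 have car: "carrier R = UNIV" by (simp add: R_def)
 have cr: "cring R"
 proof (rule cringI)
  show "abelian_group R"
  proof (rule abelian_groupI)
   fix x assume "x \<in> carrier R"
   have neg: "(\<lambda>k. - F x k) \<in> zlattice 4 b" using lattice_scale[OF Fz, of "-1" x] by simp
   show "\<exists>y\<in>carrier R. y \<oplus>\<^bsub>R\<^esub> x = \<zero>\<^bsub>R\<^esub>"
    by (intro bexI[of _ "N (\<lambda>k\<in>?I. - F x k)"] eqI) (simp_all add: ops FN Lr neg car)
  qed (auto intro!: eqI simp: ops car)
  show "Group.comm_monoid R" by (rule comm_monoidI) (auto intro!: eqI simp: ops car)
  show "\<And>x y z. x \<in> carrier R ==> y \<in> carrier R ==> z \<in> carrier R ==>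
   (x \<oplus>\<^bsub>R\<^esub> y) \<otimes>\<^bsub>R\<^esub> z = x \<otimes>\<^bsub>R\<^esub> z \<oplus>\<^bsub>R\<^esub> y \<otimes>\<^bsub>R\<^esub> z"
   by (auto intro!: eqI simp: ops distrib_right)
 qed
 define h where "h = (\<lambda>k x. F x k)"
 define \<beta> where "\<beta> = (\<lambda>j. N (restrict (b j) ?I))"
 have hb: "h k (\<beta> j) = b j k" if "j < 4" "k < 4" for j k
  using that by (simp add: h_def \<beta>_def FN Lr lattice_basis)
 have "embedded R 4 h \<beta>"
 proof (rule embedded_construct[OF cr])
  show "h k \<in> Ring.ring_hom R complex_ring" if "k < 4" for k
   using that by (auto simp: Ring.ring_hom_def h_def ops)
  show "edet 4 (bas h \<beta>) ~= 0" using nz edet_cong[of 4 "bas h \<beta>" b] hb by simp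
  show "x = y" if "\<And>k. k < 4 ==> h k x = h k y" for x y using eqI that by (simp add: h_def)
  show "(\<lambda>k. h k x) \<in> zlattice 4 (bas h \<beta>)" for x
   using Fz[of x] zlattice_cong_basis[of "bas h \<beta>" b] hb by (simp add: h_def)
 qed (auto simp: car)
 then show ?thesis using hb by blast
qed

lemma fun_ring_a_inv: "f \<in> I \<rightarrow>\<^sub>E UNIV ==> \<ominus>\<^bsub>fun_ring I\<^esub> f = (\<lambda>i\<in>I. - f i)"
proof -
 assume f: "f \<in> I \<rightarrow>\<^sub>E UNIV"
 interpret cring "fun_ring I" by (rule fun_ring_cring)
 show ?thesis by (rule minus_equality) (use f in \<open>auto intro!: restrict_ext\<close>)
qed

text \<open>The sum of two distinct indices below 4 decides the splitting: 1 and 5 belong to one, 2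
  and 4 to another, 3 to the third.\<close>

definition pairing :: "nat => nat => nat" where
 "pairing a b = (if a + b = 1 \<or> a + b = 5 then 0 else if a + b = 2 \<or> a + b = 4 then 1 else 2)"

lemma phi_pairing:
 assumes "distinct [a, b, c, d]" "set [a, b, c, d] = {..<4}"
 shows "x a * x b + x c * x d = phi x (pairing a b)"
proof -
 have "a < 4" "b < 4" "c < 4" "d < 4" using assms(2) by auto
 then show ?thesis using assms(1) unfolding less_4_cases
  by (elim disjE) (simp_all add: pairing_def phi_def mult.commute add.commute)
qed

text \<open>The cubic ring is realised by functions on the 24 orderings that depend only on the
  splitting induced by the ordering, their three values being the entries of a vector of
  \<open>zlattice 3 w\<close>.\<close>

theorem realize:
 assumes "qpair b w"
 shows "\<exists>R C h \<beta> t \<omega>. (R, C) \<in> G_pairs (lgal b) \<and> pair_data (lgal b) R C h \<beta> t \<omega> \<and>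
  (\<forall>j<4. \<forall>k<4. h k (\<beta> j) = b j k) \<and> (\<forall>j<3. \<forall>k<3. t k (\<omega> j) = w j k)"
proof -
 interpret q: qpair b w by fact
 interpret L: mlattice 4 b by (rule q.L)
 interpret M: mlattice 3 w by (rule q.M)
 obtain R :: "nat ring" and h \<beta> where R: "embedded R 4 h \<beta>" and hb: "\<And>j k. j < 4 ==> k < 4 ==> h k (\<beta> j) = b j k"
  using ex_nat_ring[OF q.L] by blast
 interpret R: embedded R 4 h \<beta> by (rule R)
 have RB: "R.B j k = b j k" if "j < 4" "k < 4" for j k using hb that by (simp add: R.vec_def)
 define I where "I = hom_orderings R"
 define idx where "idx = inv_into {..<4} R.rh"
 \<comment> \<open>The first two positions of an ordering determine its splitting.\<close>
 define m where "m = (\<lambda>s. pairing (idx (s ! 0)) (idx (s ! 1)))"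
 have idx: "idx (R.rh k) = k" if "k < 4" for k using R.inj_rh that by (simp add: idx_def)
 have m3: "m s < 3" for s by (simp add: m_def pairing_def)
 have ord: "R.ord k \<in> I" for k using R.ord_mem by (simp add: I_def)
 have mord: "m (R.ord k) = k" if "k < 3" for k
  using that by (auto simp: m_def R.ord_def idx pairing_def less_3_cases)
 have res: "resolvent_map R x s = phi (R.vec x) (m s)" if x: "x \<in> carrier R" and s: "s \<in> I" for x s
 proof -
  have ds: "distinct s" "set s = R.rh ` {..<4}" using s by (auto simp: I_def hom_orderings_def R.homs_eq)
  have "length s = 4" using distinct_card[OF ds(1)] ds(2) card_image[OF R.inj_rh] by simp
  then have len: "length (map idx s) = 4" by simp
  have "distinct (map idx s)" "set (map idx s) = {..<4}"
   using ds by (auto simp: distinct_map inj_on_def idx image_image)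
  moreover obtain a b c d where abcd: "map idx s = [a, b, c, d]"
   using len by (auto simp: length_Suc_conv numeral_eq_Suc)
  ultimately have d: "distinct [a, b, c, d]" "set [a, b, c, d] = {..<4}" by auto
  have "map R.rh (map idx s) = s" unfolding map_map by (rule map_idI) (use ds(2) idx in auto)
  then have sl: "s = [R.rh a, R.rh b, R.rh c, R.rh d]" unfolding abcd by simp
  have lt: "a < 4" "b < 4" using d(2) by auto
  show ?thesis using s x phi_pairing[OF d, of "R.vec x"] idx lt
   by (simp add: resolvent_map_def I_def[symmetric] sl m_def R.rh_apply numeral_2_eq_2 numeral_3_eq_3)
 qed
 define E where "E = (\<lambda>v :: nat => complex. \<lambda>s\<in>I. v (m s))"
 have Eeq: "E v = E v'" if "\<And>k. k < 3 ==> v k = v' k" for v v' using that m3 by (auto simp: E_def)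
 define K where "K = E ` zlattice 3 w"
 have Kc: "K \<subseteq> I \<rightarrow>\<^sub>E UNIV" by (auto simp: K_def E_def)
 have KI: "E v \<in> K" if "v \<in> zlattice 3 w" for v using that by (simp add: K_def)
 interpret F: cring "fun_ring I" by (rule fun_ring_cring)
 have sub: "subring K (fun_ring I)"
 proof (rule F.subringI)
  show "K \<subseteq> carrier (fun_ring I)" using Kc by simp
  have "\<one>\<^bsub>fun_ring I\<^esub> = E (\<lambda>_. 1)" by (simp add: E_def)
  then show "\<one>\<^bsub>fun_ring I\<^esub> \<in> K" using KI[OF M.one_lat] by simp
  fix f assume "f \<in> K"
  then obtain v where v: "v \<in> zlattice 3 w" "f = E v" by (auto simp: K_def)
  have "\<ominus>\<^bsub>fun_ring I\<^esub> f = E (\<lambda>k. of_int (-1) * v k)"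
   using Kc \<open>f \<in> K\<close> by (subst fun_ring_a_inv) (auto simp: v(2) E_def)
  then show "\<ominus>\<^bsub>fun_ring I\<^esub> f \<in> K" using KI[OF lattice_scale[OF v(1), of "-1"]] by simp
  fix g assume "g \<in> K"
  then obtain u where u: "u \<in> zlattice 3 w" "g = E u" by (auto simp: K_def)
  have "f \<otimes>\<^bsub>fun_ring I\<^esub> g = E (\<lambda>k. v k * u k)" "f \<oplus>\<^bsub>fun_ring I\<^esub> g = E (\<lambda>k. v k + u k)"
   by (auto simp: v(2) u(2) E_def)
  then show "f \<otimes>\<^bsub>fun_ring I\<^esub> g \<in> K" "f \<oplus>\<^bsub>fun_ring I\<^esub> g \<in> K"
   using KI[OF M.lat_mult[OF v(1) u(1)]] KI[OF lattice_add[OF v(1) u(1)]] by simp_all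
 qed
 define C where "C = (fun_ring I)\<lparr>carrier := K\<rparr>"
 have crC: "cring C" unfolding C_def using F.subcring_iff[of K] F.subcringI'[OF sub] Kc by simp
 define t where "t = (\<lambda>k (c :: (nat => complex) list => complex). c (R.ord k))"
 define \<omega> where "\<omega> = (\<lambda>j. E (w j))"
 have tE: "t k (E v) = v k" if "k < 3" for k v using that ord mord by (simp add: t_def E_def)
 have tw: "t k (\<omega> j) = w j k" if "k < 3" for j k using tE[OF that] by (simp add: \<omega>_def)
 have latC: "zlattice 3 (bas t \<omega>) = zlattice 3 w" using M.zlattice_cong_basis[of "bas t \<omega>" w] tw by simp
 have emC: "embedded C 3 t \<omega>"
 proof (rule embedded_construct[OF crC])
  show "t k \<in> Ring.ring_hom C complex_ring" if "k < 3" for k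
   using ord by (auto simp: Ring.ring_hom_def C_def t_def)
  show "\<omega> j \<in> carrier C" if "j < 3" for j using KI[OF lattice_basis[OF that]] by (simp add: C_def \<omega>_def)
  show "edet 3 (bas t \<omega>) ~= 0" using M.nz edet_cong[of 3 "bas t \<omega>" w] tw by simp
  show "x = y" if xy: "x \<in> carrier C" "y \<in> carrier C" "\<And>k. k < 3 ==> t k x = t k y" for x y
  proof -
   obtain v u where vu: "x = E v" "y = E u" using xy(1,2) by (auto simp: C_def K_def)
   show ?thesis unfolding vu using xy(3) tE unfolding vu by (intro Eeq) auto
  qed
  show "(\<lambda>k. t k x) \<in> zlattice 3 (bas t \<omega>)" if xC: "x \<in> carrier C" for x
  proof -
   obtain v where v: "x = E v" "v \<in> zlattice 3 w" using xC by (auto simp: C_def K_def)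
   show ?thesis unfolding latC using v tE lattice_cong[of 3 "\<lambda>k. t k x" v w] by simp
  qed
 qed auto
 interpret C: embedded C 3 t \<omega> by (rule emC)
 have resK: "resolvent_map R x = E (phi (R.vec x))" "phi (R.vec x) \<in> zlattice 3 w" if x: "x \<in> carrier R" for x
 proof -
  show "resolvent_map R x = E (phi (R.vec x))"
   using res[OF x] by (auto simp: E_def resolvent_map_def I_def fun_eq_iff)
  have "R.vec x \<in> zlattice 4 b" using R.vec_lattice[OF x] L.zlattice_cong_basis[of R.B b] RB by simp
  then show "phi (R.vec x) \<in> zlattice 3 w" by (rule q.phi)
 qed
 have disc: "ring_disc 3 C = ring_disc 4 R"
 proof -
  have "(of_int (ring_disc 3 C) :: complex) = (edet 3 w)\<^sup>2"
   using C.ring_disc_eq edet_cong[of 3 C.B w] tw by (simp add: C.vec_def)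
  also have "\<dots> = of_int (ring_disc 4 R)" using R.ring_disc_eq edet_cong[of 4 R.B b] RB q.disc by simp
  finally show ?thesis by (simp only: of_int_eq_iff)
 qed
 have RK: "resolvent_map R ` carrier R \<subseteq> K"
 proof (rule image_subsetI)
  fix x assume "x \<in> carrier R"
  from KI[OF resK(2)[OF this]] show "resolvent_map R x \<in> K" unfolding resK(1)[OF \<open>x \<in> carrier R\<close>] .
 qed
 \<comment> \<open>\<open>K\<close> is a subring that contains the generators, because
   \<open>phi\<close> maps the quartic lattice into the cubic one.\<close>
 have "cubic_invariant_ring R \<subseteq> K" unfolding cubic_invariant_ring_def I_def[symmetric]
  using order_trans[OF RK Kc] by (intro F.generate_ring_min_subring1 sub RK) simp
 moreover have "rank_ring 3 C" using crC C.basis by (auto simp: rank_ring_def)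
 ultimately have cr: "cubic_resolvent R C" using sub disc by (auto simp: cubic_resolvent_def C_def I_def)
 have d0: "ring_disc 4 R ~= 0"
  using R.ring_disc_eq edet_cong[of 4 R.B b] RB q.nzb by auto
 have nd: "nondeg_ring 4 R" using d0 R.basis R.cring_axioms by (auto simp: nondeg_ring_def rank_ring_def)
 have lg1: "lgal (bas h \<beta>) = lgal b" by (rule lgal_cong) (rule hb)
 have lg2: "lgal R.B = lgal b" by (rule lgal_cong) (rule RB)
 note lg = lg1 lg2
 have isG: "is_G_ring 4 (lgal b) R" unfolding is_G_ring_def
 proof (intro exI[of _ "\<lambda>i. R.rh (i - 1)"] conjI)
  have "bij_betw (\<lambda>i. i - 1) {1..4} {..<4::nat}"
   by (rule bij_betw_byWitness[of _ "\<lambda>i. i + 1"]) auto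
  moreover have "bij_betw R.rh {..<4} (homs R)" using R.inj_rh by (simp add: bij_betw_def R.homs_eq)
  ultimately show "bij_betw (\<lambda>i. R.rh (i - 1)) {1..4} (homs R)" using bij_betw_trans by (fastforce simp: comp_def)
  show "galois_perms 4 R (\<lambda>i. R.rh (i - 1)) = lgal b" using R.galois_perms_eq[of "\<lambda>i. R.rh (i - 1)"] lg by simp
 qed
 have G: "(R, C) \<in> G_pairs (lgal b)" using nd cr isG by (auto simp: G_pairs_def)
 have "pair_data (lgal b) R C h \<beta> t \<omega>" unfolding pair_data_def
 proof (intro conjI ballI allI impI)
  have e4: "edet 4 (bas h \<beta>) = edet 4 b" and e3: "edet 3 (bas t \<omega>) = edet 3 w"
   using hb tw by (auto intro: edet_cong)
  have RBf: "R.B = bas h \<beta>" "C.B = bas t \<omega>" by (auto simp: R.vec_def C.vec_def fun_eq_iff)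
  show "qpair (bas h \<beta>) (bas t \<omega>)"
  proof (rule qpair.intro)
   show "mlattice 4 (bas h \<beta>)" "mlattice 3 (bas t \<omega>)" using R.mlattice C.mlattice RBf by auto
   show "h k (\<beta> 0) = 1" if "k < 4" for k using hb[of 0 k] q.b0 that by simp
   show "t k (\<omega> 0) = 1" if "k < 3" for k using tw[of k 0] q.w0 that by simp
   show "phi v \<in> zlattice 3 (bas t \<omega>)" if "v \<in> zlattice 4 (bas h \<beta>)" for v
    using that latC q.phi[of v] L.zlattice_cong_basis[of "bas h \<beta>" b] hb by simp
   show "(edet 4 (bas h \<beta>))\<^sup>2 = (edet 3 (bas t \<omega>))\<^sup>2" using q.disc e4 e3 by simp
  qed
  fix x assume x: "x \<in> carrier R"
  show "resolvent_map R x \<in> carrier C" using resK[OF x] KI by (simp add: C_def)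
  show "t k (resolvent_map R x) = phi (\<lambda>k. h k x) k" if "k < 3" for k
   using resK[OF x] tE[OF that] by (simp add: R.vec_def[abs_def])
 qed (use R emC lg disc in auto)
 then show ?thesis using G hb tw by blast
qed

section \<open>Isomorphisms and structure constants\<close>

lemma ring_disc_iso:
 assumes "embedded R' 4 h' \<beta>'" "cring R" and f: "f \<in> ring_iso R R'"
 shows "ring_disc 4 R = ring_disc 4 R'"
proof -
 interpret R': embedded R' 4 h' \<beta>' by fact
 have hom: "f \<in> Ring.ring_hom R R'" and bij: "bij_betw f (carrier R) (carrier R')" using f by (auto simp: ring_iso_def)
 have "\<exists>x\<in>carrier R. f x = \<beta>' j" if "j < 4" for j
  using R'.basis_closed[OF that] bij unfolding bij_betw_def by (metis imageE)
 then obtain \<beta> where \<beta>: "\<And>j. j < 4 ==> \<beta> j \<in> carrier R" "\<And>j. j < 4 ==> f (\<beta> j) = \<beta>' j" by metis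
 define h where "h = (\<lambda>k x. h' k (f x))"
 have b: "bas h \<beta> j k = R'.B j k" if "j < 4" for j k using \<beta>(2)[OF that] by (simp add: h_def R'.vec_def)
 have e: "edet 4 (bas h \<beta>) = edet 4 R'.B" using b by (intro edet_cong) auto
 have fc: "f x \<in> carrier R'" if "x \<in> carrier R" for x using bij_betwE[OF bij] that by blast
 have "embedded R 4 h \<beta>"
 proof (rule embedded_construct[OF assms(2)])
  show "h k \<in> Ring.ring_hom R complex_ring" if "k < 4" for k
   using R'.hom[OF that] hom fc by (auto simp: Ring.ring_hom_def h_def)
  show "x = y" if "x \<in> carrier R" "y \<in> carrier R" "\<And>k. k < 4 ==> h k x = h k y" for x y
   using R'.vec_inj[OF fc fc] that bij_betw_imp_inj_on[OF bij] by (auto simp: h_def R'.vec_def inj_on_def)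
  show "(\<lambda>k. h k x) \<in> zlattice 4 (bas h \<beta>)" if "x \<in> carrier R" for x
   using R'.vec_lattice[OF fc[OF that]] mlattice.zlattice_cong_basis[OF R'.mlattice, of "bas h \<beta>" R'.B] b
   by (simp add: h_def R'.vec_def[abs_def])
 qed (use \<beta> e R'.Bnz in auto)
 then interpret R: embedded R 4 h \<beta> .
 have "(of_int (ring_disc 4 R) :: complex) = of_int (ring_disc 4 R')"
  using R.ring_disc_eq R'.ring_disc_eq e by (simp add: R.vec_def[abs_def])
 then show ?thesis by (simp only: of_int_eq_iff)
qed

lemma pair_iso_disc: "((R, C), (R', C')) \<in> pair_iso G ==> ring_disc 4 R = ring_disc 4 R'"
proof -
 assume a: "((R, C), (R', C')) \<in> pair_iso G"
 then obtain f where f: "f \<in> ring_iso R R'" and G: "(R, C) \<in> G_pairs G" "(R', C') \<in> G_pairs G" by (auto simp: pair_iso_def)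
 have "cring R" using G(1) by (auto simp: G_pairs_def nondeg_ring_def rank_ring_def)
 moreover obtain h' \<beta>' where "embedded R' 4 h' \<beta>'" using ex_pair_data[OF G(2)] by (auto simp: pair_data_def)
 ultimately show ?thesis using f ring_disc_iso by blast
qed

lemma pair_iso_trans:
 assumes "(P, P') \<in> pair_iso G" "(P', P'') \<in> pair_iso G"
 shows "(P, P'') \<in> pair_iso G"
proof -
 obtain R C R' C' R'' C'' where P: "P = (R, C)" "P' = (R', C')" "P'' = (R'', C'')" by (metis surj_pair)
 obtain f g where f: "f \<in> ring_iso R R'" "g \<in> ring_iso C C'" "\<And>x. x \<in> carrier R ==> g (resolvent_map R x) = resolvent_map R' (f x)"
  and G: "(R, C) \<in> G_pairs G" using assms(1) unfolding P pair_iso_def by blast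
 obtain f' g' where f': "f' \<in> ring_iso R' R''" "g' \<in> ring_iso C' C''" "\<And>x. x \<in> carrier R' ==> g' (resolvent_map R' x) = resolvent_map R'' (f' x)"
  and G': "(R'', C'') \<in> G_pairs G" using assms(2) unfolding P pair_iso_def by blast
 have fc: "f x \<in> carrier R'" if "x \<in> carrier R" for x using ring_iso_memE(1)[OF f(1) that] .
 have "\<forall>x\<in>carrier R. (g' \<circ> g) (resolvent_map R x) = resolvent_map R'' ((f' \<circ> f) x)"
  using f(3) f'(3) fc by simp
 then show ?thesis unfolding P pair_iso_def
  using G G' ring_iso_set_trans[OF f(1) f'(1)] ring_iso_set_trans[OF f(2) f'(2)] by blast
qed

text \<open>Elements with equal coordinates are matched; as both bases begin with \<open>1\<close>,
  the identities correspond. The second conclusion keeps track of coordinates, which the comparison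
  of resolvent maps needs.\<close>

lemma table_iso:
 assumes R: "embedded R n h \<beta>" and R': "embedded R' n h' \<beta>'"
  and one: "\<And>k. k < n ==> h k (\<beta> 0) = 1" "\<And>k. k < n ==> h' k (\<beta>' 0) = 1"
  and tab: "\<And>i j l. i < n ==> j < n ==> l < n ==>
   coord n (bas h \<beta>) (\<lambda>k. h k (\<beta> i) * h k (\<beta> j)) l = coord n (bas h' \<beta>') (\<lambda>k. h' k (\<beta>' i) * h' k (\<beta>' j)) l"
 shows "\<exists>f\<in>ring_iso R R'. \<forall>x\<in>carrier R. \<forall>a. (\<forall>k<n. h k x = icomb n (bas h \<beta>) a k) --> (\<forall>k<n. h' k (f x) = icomb n (bas h' \<beta>') a k)"
proof -
 interpret R: embedded R n h \<beta> by fact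
 interpret R': embedded R' n h' \<beta>' by fact
 have B: "R.B = bas h \<beta>" "R'.B = bas h' \<beta>'" by (auto simp: R.vec_def R'.vec_def fun_eq_iff)
 define f where "f = (\<lambda>x. zlincomb R' {..<n} (zcoord R n \<beta> x) \<beta>')"
 have bc': "\<beta>' \<in> {..<n} \<rightarrow> carrier R'" using R'.basis_closed by auto
 have fc: "f x \<in> carrier R'" for x unfolding f_def by (rule R'.zlincomb_closed[OF bc'])
 have fv: "R'.vec (f x) k = icomb n R'.B (zcoord R n \<beta> x) k" if "k < n" for x k
  unfolding f_def using R'.vec_lincomb[of \<beta>' k] R'.basis_closed that by simp
 have fa: "R'.vec (f x) k = icomb n R'.B a k"
  if x: "x \<in> carrier R" and a: "\<And>k. k < n ==> R.vec x k = icomb n R.B a k" and k: "k < n" for x a k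
  using fv[OF k] R.zcoord_eq[OF x a] by (simp add: rcomb_def)
 have mono: "x = y" if "x \<in> carrier R" "y \<in> carrier R" "f x = f y" for x y
 proof -
  have "icomb n R'.B (zcoord R n \<beta> x) k = icomb n R'.B (zcoord R n \<beta> y) k" if "k < n" for k
   using fv[OF that] \<open>f x = f y\<close> by metis
  then have "zcoord R n \<beta> x j = zcoord R n \<beta> y j" if "j < n" for j using icomb_unique[OF R'.Bnz] that by blast
  then have "R.vec x k = R.vec y k" if "k < n" for k
   using R.zcoord[OF \<open>x \<in> carrier R\<close> that] R.zcoord[OF \<open>y \<in> carrier R\<close> that] by (simp add: rcomb_def)
  then show ?thesis using R.vec_inj that by blast
 qed
 have surj: "\<exists>x\<in>carrier R. f x = y" if y: "y \<in> carrier R'" for y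
 proof -
  let ?x = "zlincomb R {..<n} (zcoord R' n \<beta>' y) \<beta>"
  have xc: "?x \<in> carrier R" using R.basis_closed by (intro R.zlincomb_closed) auto
  have "R'.vec (f ?x) k = R'.vec y k" if "k < n" for k
   using fa[OF xc _ that, of "zcoord R' n \<beta>' y"] R.vec_lincomb[of \<beta>] R.basis_closed R'.zcoord[OF y that] by simp
  then show ?thesis using R'.vec_inj[OF fc y] xc by blast
 qed
 have add: "f (x \<oplus>\<^bsub>R\<^esub> y) = f x \<oplus>\<^bsub>R'\<^esub> f y" if "x \<in> carrier R" "y \<in> carrier R" for x y
 proof (rule R'.vec_inj)
  fix k assume k: "k < n"
  have "R'.vec (f (x \<oplus>\<^bsub>R\<^esub> y)) k = icomb n R'.B (\<lambda>j. zcoord R n \<beta> x j + zcoord R n \<beta> y j) k"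
   using that R.zcoord[OF that(1)] R.zcoord[OF that(2)]
   by (intro fa[OF _ _ k]) (auto simp: R.vec_simps rcomb_def sum.distrib distrib_right)
  also have "\<dots> = R'.vec (f x) k + R'.vec (f y) k" using fv[OF k] by (simp add: rcomb_def sum.distrib distrib_right)
  finally show "R'.vec (f (x \<oplus>\<^bsub>R\<^esub> y)) k = R'.vec (f x \<oplus>\<^bsub>R'\<^esub> f y) k" using R'.vec_simps(1)[OF k fc fc] by simp
 qed (use fc in auto)
 have mult: "f (x \<otimes>\<^bsub>R\<^esub> y) = f x \<otimes>\<^bsub>R'\<^esub> f y" if "x \<in> carrier R" "y \<in> carrier R" for x y
 proof (rule R'.vec_inj)
  fix k assume k: "k < n"
  let ?u = "zcoord R n \<beta> x" and ?v = "zcoord R n \<beta> y"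
  define T where "T = (\<lambda>i j. coord n R.B (\<lambda>k. R.B i k * R.B j k))"
  have T: "R.B i k * R.B j k = icomb n R.B (T i j) k" if "i < n" "j < n" "k < n" for i j k
   unfolding T_def using coord[OF mlattice.mult_basis[OF R.mlattice that(1,2)] that(3)] .
  have T': "R'.B i k * R'.B j k = icomb n R'.B (T i j) k" if "i < n" "j < n" "k < n" for i j k
  proof -
   have "icomb n R'.B (T i j) k = icomb n R'.B (coord n R'.B (\<lambda>k. R'.B i k * R'.B j k)) k"
    unfolding rcomb_def using tab[OF that(1,2)] by (intro sum.cong) (auto simp: T_def R.vec_def[abs_def] R'.vec_def[abs_def])
   then show ?thesis using coord[OF mlattice.mult_basis[OF R'.mlattice that(1,2)] that(3)] by simp
  qed
  define W where "W = (\<lambda>l. \<Sum>i<n. \<Sum>j<n. ?u i * ?v j * T i j l)"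
  have expand: "icomb n b ?u k * icomb n b ?v k = icomb n b W k"
   if "\<And>i j. i < n ==> j < n ==> b i k * b j k = icomb n b (T i j) k" for b and k
  proof -
   have "icomb n b ?u k * icomb n b ?v k = (\<Sum>i<n. \<Sum>j<n. of_int (?u i * ?v j) * (b i k * b j k))"
    by (simp add: rcomb_def sum_product mult_ac)
   also have "\<dots> = (\<Sum>i<n. \<Sum>j<n. \<Sum>l<n. of_int (?u i * ?v j * T i j l) * b l k)"
    using that by (intro sum.cong refl) (simp add: rcomb_def sum_distrib_left mult_ac)
   also have "\<dots> = (\<Sum>i<n. \<Sum>l<n. \<Sum>j<n. of_int (?u i * ?v j * T i j l) * b l k)"
    by (intro sum.cong refl sum.swap)
   also have "\<dots> = (\<Sum>l<n. \<Sum>i<n. \<Sum>j<n. of_int (?u i * ?v j * T i j l) * b l k)" by (rule sum.swap)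
   also have "\<dots> = icomb n b W k" by (simp add: rcomb_def W_def sum_distrib_right)
   finally show ?thesis .
  qed
  have "R'.vec (f (x \<otimes>\<^bsub>R\<^esub> y)) k = icomb n R'.B W k"
   using that R.zcoord[OF that(1)] R.zcoord[OF that(2)] expand[OF T]
   by (intro fa[OF _ _ k]) (auto simp: R.vec_simps)
  also have "\<dots> = R'.vec (f x) k * R'.vec (f y) k" using fv[OF k] expand[OF T'[OF _ _ k]] by simp
  finally show "R'.vec (f (x \<otimes>\<^bsub>R\<^esub> y)) k = R'.vec (f x \<otimes>\<^bsub>R'\<^esub> f y) k" using R'.vec_simps(2)[OF k fc fc] by simp
 qed (use fc that in auto)
 have onef: "f \<one>\<^bsub>R\<^esub> = \<one>\<^bsub>R'\<^esub>"
 proof (rule R'.vec_inj)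
  fix k assume k: "k < n"
  have o: "icomb n (bas g \<gamma>) (\<lambda>j. if j = 0 then 1 else 0) k = 1" if "g k (\<gamma> 0) = 1" for g k and \<gamma> :: "nat => 'z"
  proof -
   have "icomb n (bas g \<gamma>) (\<lambda>j. if j = 0 then 1 else 0) k = (\<Sum>j\<in>{0}. g k (\<gamma> j))"
    unfolding rcomb_def using R.n by (intro sum.mono_neutral_cong_right) auto
   then show ?thesis using that by simp
  qed
  have "R'.vec (f \<one>\<^bsub>R\<^esub>) k = icomb n R'.B (\<lambda>j. if j = 0 then 1 else 0) k"
   using o[of h _ \<beta>] one(1) R.vec_simps(3)[of _ "\<one>\<^bsub>R\<^esub>" "\<one>\<^bsub>R\<^esub>"] by (intro fa[OF _ _ k]) (auto simp: B)
  also have "\<dots> = 1" using o[of h' k \<beta>'] one(2)[OF k] by (simp add: B)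
  finally show "R'.vec (f \<one>\<^bsub>R\<^esub>) k = R'.vec \<one>\<^bsub>R'\<^esub> k" using R'.vec_simps(3)[OF k R'.one_closed R'.one_closed] by simp
 qed (use fc in auto)
 have "f ` carrier R = carrier R'"
 proof (intro equalityI subsetI)
  fix y assume "y \<in> carrier R'"
  from surj[OF this] show "y \<in> f ` carrier R" by blast
 qed (use fc in auto)
 then have "f \<in> ring_iso R R'" unfolding ring_iso_def Ring.ring_hom_def bij_betw_def
  using fc add mult onef mono by (auto simp: inj_on_def)
 moreover have "\<forall>x\<in>carrier R. \<forall>a. (\<forall>k<n. h k x = icomb n (bas h \<beta>) a k) --> (\<forall>k<n. h' k (f x) = icomb n (bas h' \<beta>') a k)"
  using fa unfolding B R.vec_def R'.vec_def by blast
 ultimately show ?thesis by blast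
qed

text \<open>The component \<open>s\<close> selects multiplication in \<open>R\<close>,
  multiplication in \<open>C\<close>, or the resolvent map. Gathering them in one function on a
  common finite index set, padded by 0, makes finiteness a statement about one product of
  intervals.\<close>

definition tables :: "(nat => nat => complex) => (nat => nat => complex) => nat \<times> nat \<times> nat \<times> nat => int" where
 "tables b w = (\<lambda>(s, i, j, l)\<in>{..<3} \<times> {..<4} \<times> {..<4} \<times> {..<4}.
   if s = 0 then coord 4 b (\<lambda>k. b i k * b j k) l
   else if s = 1 then (if i < 3 \<and> j < 3 \<and> l < 3 then coord 3 w (\<lambda>k. w i k * w j k) l else 0)
   else if l < 3 then coord 3 w (phic b i j) l else 0)"

lemma tables_iso:
 assumes P: "pair_data G R C h \<beta> t \<omega>" "(R, C) \<in> G_pairs G"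
  and P': "pair_data G R' C' h' \<beta>' t' \<omega>'" "(R', C') \<in> G_pairs G"
  and eq: "tables (bas h \<beta>) (bas t \<omega>) = tables (bas h' \<beta>') (bas t' \<omega>')"
 shows "((R, C), (R', C')) \<in> pair_iso G"
proof -
 interpret q: qpair "bas h \<beta>" "bas t \<omega>" using P(1) by (simp add: pair_data_def)
 interpret q': qpair "bas h' \<beta>'" "bas t' \<omega>'" using P'(1) by (simp add: pair_data_def)
 have R: "embedded R 4 h \<beta>" and R': "embedded R' 4 h' \<beta>'" and C: "embedded C 3 t \<omega>" and C': "embedded C' 3 t' \<omega>'"
  using P(1) P'(1) by (auto simp: pair_data_def)
 interpret C': embedded C' 3 t' \<omega>' by (rule C')
 interpret R: embedded R 4 h \<beta> by (rule R)
 note e = fun_cong[OF eq, unfolded tables_def]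
 have bt: "coord 4 (bas h \<beta>) (\<lambda>k. h k (\<beta> i) * h k (\<beta> j)) l = coord 4 (bas h' \<beta>') (\<lambda>k. h' k (\<beta>' i) * h' k (\<beta>' j)) l"
  if "i < 4" "j < 4" "l < 4" for i j l
  using e[of "(0, i, j, l)"] that by simp
 obtain f where f: "f \<in> ring_iso R R'"
  "\<forall>x\<in>carrier R. \<forall>a. (\<forall>k<4. h k x = icomb 4 (bas h \<beta>) a k) --> (\<forall>k<4. h' k (f x) = icomb 4 (bas h' \<beta>') a k)"
  using table_iso[OF R R' q.b0 q'.b0 bt] by blast
 have wt: "coord 3 (bas t \<omega>) (\<lambda>k. t k (\<omega> i) * t k (\<omega> j)) l = coord 3 (bas t' \<omega>') (\<lambda>k. t' k (\<omega>' i) * t' k (\<omega>' j)) l"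
  if "i < 3" "j < 3" "l < 3" for i j l
  using e[of "(1, i, j, l)"] that by simp
 obtain g where g: "g \<in> ring_iso C C'"
  "\<forall>x\<in>carrier C. \<forall>a. (\<forall>k<3. t k x = icomb 3 (bas t \<omega>) a k) --> (\<forall>k<3. t' k (g x) = icomb 3 (bas t' \<omega>') a k)"
  using table_iso[where n = 3 and h = t and h' = t' and \<beta> = \<omega> and \<beta>' = \<omega>', OF C C' q.w0 q'.w0 wt] by blast
 have H: "q.H i j l = q'.H i j l" if "i < 4" "j < 4" "l < 3" for i j l
  using e[of "(2, i, j, l)"] that by simp
 have "g (resolvent_map R x) = resolvent_map R' (f x)" if x: "x \<in> carrier R" for x
 proof -
  have fx: "f x \<in> carrier R'" using ring_iso_memE(1)[OF f(1) x] .
  have rx: "resolvent_map R x \<in> carrier C" "\<And>m. m < 3 ==> t m (resolvent_map R x) = phi (\<lambda>k. h k x) m"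
   using P(1) x by (auto simp: pair_data_def)
  have rfx: "resolvent_map R' (f x) \<in> carrier C'" "\<And>m. m < 3 ==> t' m (resolvent_map R' (f x)) = phi (\<lambda>k. h' k (f x)) m"
   using P'(1) fx by (auto simp: pair_data_def)
  define a where "a = zcoord R 4 \<beta> x"
  have a: "h k x = icomb 4 (bas h \<beta>) a k" if "k < 4" for k
   using R.zcoord[OF x that] by (simp add: a_def R.vec_def[abs_def])
  have a': "h' k (f x) = icomb 4 (bas h' \<beta>') a k" if "k < 4" for k using f(2) x a that by blast
  let ?S = "{(0,1),(0,2),(0,3),(1,2),(1,3),(2,3)} :: (nat \<times> nat) set"
  \<comment> \<open>The coordinates of the resolvent of \<open>x\<close>: \<open>phi\<close>
    expanded in the coordinates of \<open>x\<close>, with coefficients taken from the table.\<close>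
  define A where "A = (\<lambda>l. (\<Sum>i<4. (a i)\<^sup>2 * q.H i i l) + (\<Sum>(i, j)\<in>?S. a i * a j * q.H i j l))"
  have co: "phi (icomb 4 b a) k = icomb 3 w A k"
   if "\<And>i j k. i < 4 ==> j < 4 ==> k < 3 ==> phic b i j k = icomb 3 w (q.H i j) k" "k < 3" for b w k
  proof -
   have p1: "phi (b i) k = icomb 3 w (q.H i i) k" if "i \<in> {..<4}" for i using \<open>\<And>i j k. _ ==> _ ==> _ ==> phic b i j k = _\<close>[of i i k] that \<open>k < 3\<close> by (simp add: phic_def)
   have p2: "phib (b i) (b j) k = icomb 3 w (q.H i j) k" if "(i, j) \<in> ?S" for i j
    using \<open>\<And>i j k. _ ==> _ ==> _ ==> phic b i j k = _\<close>[of i j k] that \<open>k < 3\<close> by (auto simp: phic_def)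
   have "phi (icomb 4 b a) k = (\<Sum>i<4. of_int ((a i)\<^sup>2) * icomb 3 w (q.H i i) k) +
    (\<Sum>p\<in>?S. of_int (a (fst p) * a (snd p)) * icomb 3 w (q.H (fst p) (snd p)) k)"
    unfolding phi_icomb using p1 p2 by (intro arg_cong2[where f="(+)"] sum.cong refl) auto
   also have "\<dots> = (\<Sum>l<3. (of_int (\<Sum>i<4. (a i)\<^sup>2 * q.H i i l) + of_int (\<Sum>p\<in>?S. a (fst p) * a (snd p) * q.H (fst p) (snd p) l)) * w l k)"
    unfolding rcomb_def sum_distrib_left distrib_right sum.distrib of_int_sum sum_distrib_right
    by (subst (1 2) sum.swap) (simp add: mult.assoc del: sum.insert)
   finally show ?thesis by (simp add: rcomb_def A_def case_prod_unfold del: sum.insert)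
  qed
  have "phi (\<lambda>k. h k x) k = icomb 3 (bas t \<omega>) A k" if "k < 3" for k
   using phi_cong[of "\<lambda>k. h k x" "icomb 4 (bas h \<beta>) a", OF a] co[OF coord[OF q.phic_lattice] that] by simp
  then have gx: "\<forall>k<3. t' k (g (resolvent_map R x)) = icomb 3 (bas t' \<omega>') A k" using g(2) rx by simp
  have c': "phic (bas h' \<beta>') i j k = icomb 3 (bas t' \<omega>') (q.H i j) k" if "i < 4" "j < 4" "k < 3" for i j k
   using coord[OF q'.phic_lattice[OF that(1,2)] that(3)] H[OF that(1,2)] by (simp add: rcomb_def)
  have "phi (\<lambda>k. h' k (f x)) k = icomb 3 (bas t' \<omega>') A k" if "k < 3" for k
   using phi_cong[of "\<lambda>k. h' k (f x)" "icomb 4 (bas h' \<beta>') a", OF a'] co[OF c' that] by simp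
  then have "C'.vec (g (resolvent_map R x)) k = C'.vec (resolvent_map R' (f x)) k" if "k < 3" for k
   using gx rfx(2) that by (simp add: C'.vec_def)
  then show ?thesis using C'.vec_inj[OF ring_iso_memE(1)[OF g(1) rx(1)] rfx(1)] by blast
 qed
 then show ?thesis unfolding pair_iso_def using P(2) P'(2) f(1) g(1) by blast
qed

section \<open>Finiteness for bounded discriminant\<close>

text \<open>The constant \<open>fact n * (2 * K) ^ n\<close> of \<open>edet_ge\<close> for
  \<open>n = 4\<close> and \<open>K = 100\<close>; it covers \<open>n = 3\<close> as well.\<close>

abbreviation KD :: real where "KD \<equiv> 24 * 200 ^ 4"

lemma vnorm_mult_le: "vnorm n (\<lambda>k. x k * y k) \<le> real n * (vnorm n x * vnorm n y)"
 by (rule vnorm_le_bound) (auto simp: norm_mult intro!: mult_mono cmod_le_vnorm)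

text \<open>Each entry is a sum of at most four products, and the length is at most three times the
  largest entry.\<close>

lemma phic_le:
 assumes "vnorm 4 (b i) \<le> A" "vnorm 4 (b j) \<le> A'"
 shows "vnorm 3 (phic b i j) \<le> 12 * (A * A')"
proof -
 have A: "0 \<le> A" "0 \<le> A'" using assms vnorm_nonneg[of 4 "b i"] vnorm_nonneg[of 4 "b j"] by linarith+
 have m1: "cmod (b i k * b j l) \<le> A * A'" if "k < 4" "l < 4" for k l
  unfolding norm_mult using order_trans[OF cmod_le_vnorm assms(1)] order_trans[OF cmod_le_vnorm assms(2)] that A
  by (intro mult_mono) auto
 have m2: "cmod (b j k * b i l) \<le> A * A'" if "k < 4" "l < 4" for k l
  using m1[OF that(2,1)] by (simp add: mult.commute)
 note m = m1 m2
 have AA: "0 \<le> A * A'" using A by simp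
 have t2: "cmod (p + q) \<le> 2 * B" if "cmod p \<le> B" "cmod q \<le> B" for p q B
  using that norm_triangle_ineq[of p q] by linarith
 have t4: "cmod (p + q + r + s) \<le> 4 * B" if "cmod p \<le> B" "cmod q \<le> B" "cmod r \<le> B" "cmod s \<le> B" for p q r s B
  using that norm_triangle_ineq[of "p + q + r" s] norm_triangle_ineq[of "p + q" r] norm_triangle_ineq[of p q] by linarith
 have "cmod (phic b i j k) \<le> 4 * (A * A')" for k
 proof (cases "i = j")
  case True
  have mm: "cmod (b i k * b i l) \<le> A * A'" if "k < 4" "l < 4" for k l using m1[OF that] True by simp
  have "cmod (phi (b i) k) \<le> 2 * (A * A')" unfolding phi_def by (auto intro!: t2 mm)
  then show ?thesis using True AA by (simp add: phic_def)
 next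
  case False
  have m3: "cmod (b i k * b j l) \<le> A * A'" "cmod (b i l * b j k) \<le> A * A'" if "k < 4" "l < 4" for k l
   using m1[OF that] m1[OF that(2,1)] by auto
  have "cmod (phib (b i) (b j) k) \<le> 4 * (A * A')" unfolding phib_def by (auto intro!: t4 m3)
  then show ?thesis using False by (simp add: phic_def)
 qed
 then have "vnorm 3 (phic b i j) \<le> real 3 * (4 * (A * A'))" by (rule vnorm_le_bound)
 then show ?thesis by simp
qed

lemma prod_less_3: "(\<Prod>i<3. f i) = f 0 * f 1 * f (2::nat)"
 and prod_less_4: "(\<Prod>i<4. f i) = f 0 * f 1 * f 2 * f (3::nat)"
 by (simp_all add: numeral_eq_Suc One_nat_def)

lemma (in embedded) conj_perm_ex:
 "\<exists>p. p permutes {..<n} \<and> (\<forall>x\<in>carrier R. \<forall>k<n. cnj (vec x k) = vec x (p k))"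
 by (rule conj_perm) blast

lemma (in embedded) reduced_prod:
 assumes "reduced 100 n B"
 shows "(\<Prod>j<n. vnorm n (B j)) \<le> KD * cmod (edet n B)" "cmod (edet n B) \<le> 24 * (\<Prod>j<n. vnorm n (B j))"
  "\<And>j. j < n ==> 1 \<le> vnorm n (B j)"
proof -
 obtain p where p: "p permutes {..<n}" "\<forall>x\<in>carrier R. \<forall>k<n. cnj (vec x k) = vec x (p k)"
  using conj_perm_ex by blast
 have f: "(fact n :: real) \<le> 24" 
 proof -
  have "(fact n :: real) \<le> fact 4" using n by (intro fact_mono) auto
  then show ?thesis by (simp add: fact_numeral)
 qed
 have "(\<Prod>j<n. vnorm n (B j)) \<le> fact n * (2 * 100) ^ n * cmod (edet n B)"
  using assms p basis_closed by (intro edet_ge[OF Bnz p(1)]) (auto simp: reduced_def)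
 also have "\<dots> \<le> KD * cmod (edet n B)"
 proof -
  have "(2 * 100 :: real) ^ n \<le> 200 ^ 4" using n power_increasing[of n 4 "200::real"] by simp
  then have "fact n * (2 * 100 :: real) ^ n \<le> KD" using f by (intro mult_mono) auto
  then show ?thesis by (rule mult_right_mono) simp
 qed
 finally show "(\<Prod>j<n. vnorm n (B j)) \<le> KD * cmod (edet n B)" .
 have "cmod (edet n B) \<le> fact n * (\<Prod>j<n. vnorm n (B j))" by (rule edet_le)
 also have "\<dots> \<le> 24 * (\<Prod>j<n. vnorm n (B j))" using f by (intro mult_right_mono prod_nonneg) auto
 finally show "cmod (edet n B) \<le> 24 * (\<Prod>j<n. vnorm n (B j))" .
 fix j assume j: "j < n"
 have "\<exists>k<n. B j k ~= 0" using basis_vnorm_pos[OF Bnz j] vnorm_zero_iff[of n "B j"] by force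
 then show "1 \<le> vnorm n (B j)" using mlattice.vnorm_ge_1[OF mlattice lattice_basis[OF j]] by blast
qed

text \<open>Coordinates cost a factor 100 by reducedness and resolvents a factor 12 by
  \<open>phic_le\<close>, whence 1200; the minima cost 100 and its square. A nonzero integer has
  absolute value at least 1, so a nonzero coefficient of \<open>phi\<close> bounds the length
  \<open>m k\<close>.\<close>

lemma pair_bounds:
 assumes P: "pair_data G R C h \<beta> t \<omega>" and red: "reduced 100 4 (bas h \<beta>)" "reduced 100 3 (bas t \<omega>)"
 defines "D \<equiv> real_of_int \<bar>ring_disc 4 R\<bar>" and "a \<equiv> \<lambda>j. vnorm 4 (bas h \<beta> j)" and "m \<equiv> \<lambda>j. vnorm 3 (bas t \<omega> j)"
 shows "1 \<le> D" "\<And>j. j < 4 ==> 1 \<le> a j" "\<And>j. j < 3 ==> 1 \<le> m j"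
  "a 0 * a 1 * a 2 * a 3 \<le> KD * sqrt D" "sqrt D \<le> 24 * (a 0 * a 1 * a 2 * a 3)"
  "m 0 * m 1 * m 2 \<le> KD * sqrt D" "sqrt D \<le> 24 * (m 0 * m 1 * m 2)" "a 0 = 2" "m 0 = sqrt 3"
  "\<And>i j k. (i, j, k) \<in> pattern (bas h \<beta>) (bas t \<omega>) ==> m k \<le> 1200 * (a i * a j)"
  "\<And>i. i < 4 ==> 2 * succ_min 4 R i \<le> 100 * a i" "\<And>i. i < 4 ==> a i \<le> 10000 * (2 * succ_min 4 R i)"
  "\<And>i. i < 3 ==> sqrt 3 * succ_min 3 C i \<le> 100 * m i" "\<And>i. i < 3 ==> m i \<le> 10000 * (sqrt 3 * succ_min 3 C i)"
  "\<And>p. \<bar>tables (bas h \<beta>) (bas t \<omega>) p\<bar> \<le> 1200 * (KD * sqrt D)\<^sup>2 \<or> p \<notin> {..<3} \<times> {..<4} \<times> {..<4} \<times> {..<4}"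
proof -
 interpret R: embedded R 4 h \<beta> using P by (simp add: pair_data_def)
 interpret C: embedded C 3 t \<omega> using P by (simp add: pair_data_def)
 interpret q: qpair "bas h \<beta>" "bas t \<omega>" using P by (simp add: pair_data_def)
 have B: "R.B = bas h \<beta>" "C.B = bas t \<omega>" by (auto simp: R.vec_def C.vec_def fun_eq_iff)
 note Rb = R.reduced_prod[unfolded R.vec_def[abs_def], OF red(1)]
  and Cb = C.reduced_prod[unfolded C.vec_def[abs_def], OF red(2)]
 have rd: "ring_disc 3 C = ring_disc 4 R" using P by (simp add: pair_data_def)
 have sq: "sqrt (real_of_int \<bar>d\<bar>) = cmod z" if "of_int d = z\<^sup>2" for d z
 proof -
  have "real_of_int \<bar>d\<bar> = cmod (of_int d)" by simp
  also have "\<dots> = (cmod z)\<^sup>2" unfolding that by (simp add: norm_power)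
  finally show ?thesis by (simp add: real_sqrt_unique)
 qed
 have sR: "sqrt D = cmod (edet 4 (bas h \<beta>))" unfolding D_def using sq[OF R.ring_disc_eq] B by simp
 have sC: "sqrt D = cmod (edet 3 (bas t \<omega>))" unfolding D_def rd[symmetric] using sq[OF C.ring_disc_eq] B by simp
 have "sqrt D > 0" using sR q.nzb by simp
 then have "\<bar>ring_disc 4 R\<bar> > 0" by (simp add: D_def)
 then have "\<bar>ring_disc 4 R\<bar> \<ge> 1" by linarith
 then show "1 \<le> D" unfolding D_def by (metis of_int_1_le_iff)
 show a1: "1 \<le> a j" if "j < 4" for j using Rb(3)[OF that] by (simp add: a_def)
 show m1: "1 \<le> m j" if "j < 3" for j using Cb(3)[OF that] by (simp add: m_def)
 show pa: "a 0 * a 1 * a 2 * a 3 \<le> KD * sqrt D" "sqrt D \<le> 24 * (a 0 * a 1 * a 2 * a 3)"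
  using Rb(1,2) by (simp_all only: prod_less_4 sR a_def)
 show pm: "m 0 * m 1 * m 2 \<le> KD * sqrt D" "sqrt D \<le> 24 * (m 0 * m 1 * m 2)"
  using Cb(1,2) by (simp_all only: prod_less_3 sC m_def)
 have r4: "\<bar>x j\<bar> * a j \<le> 100 * vnorm 4 (rcomb 4 (bas h \<beta>) x)" if "j < 4" for x j
  using red(1) that by (simp add: reduced_def a_def)
 have r3: "\<bar>x j\<bar> * m j \<le> 100 * vnorm 3 (rcomb 3 (bas t \<omega>) x)" if "j < 3" for x j
  using red(2) that by (simp add: reduced_def m_def)
 have c4: "\<bar>real_of_int (coord 4 (bas h \<beta>) v j)\<bar> * a j \<le> 100 * vnorm 4 v" if "v \<in> zlattice 4 (bas h \<beta>)" "j < 4" for v j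
  using r4[OF that(2), of "\<lambda>j. real_of_int (coord 4 (bas h \<beta>) v j)"] vnorm_cong[of 4 v "icomb 4 (bas h \<beta>) (coord 4 (bas h \<beta>) v)"] coord[OF that(1)]
  by simp
 have c3: "\<bar>real_of_int (coord 3 (bas t \<omega>) v j)\<bar> * m j \<le> 100 * vnorm 3 v" if "v \<in> zlattice 3 (bas t \<omega>)" "j < 3" for v j
  using r3[OF that(2), of "\<lambda>j. real_of_int (coord 3 (bas t \<omega>) v j)"] vnorm_cong[of 3 v "icomb 3 (bas t \<omega>) (coord 3 (bas t \<omega>) v)"] coord[OF that(1)]
  by simp
 show "a 0 = 2"
  using vnorm_cong[of 4 "bas h \<beta> 0" "\<lambda>_. 1"] q.b0 vnorm_const[of 4 1] by (simp add: a_def)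
 show "m 0 = sqrt 3"
  using vnorm_cong[of 3 "bas t \<omega> 0" "\<lambda>_. 1"] q.w0 vnorm_const[of 3 1] by (simp add: m_def)
 have cH: "\<bar>real_of_int (q.H i j k)\<bar> * m k \<le> 1200 * (a i * a j)" if "i < 4" "j < 4" "k < 3" for i j k
  using c3[OF q.phic_lattice[OF that(1,2)] that(3)] phic_le[of "bas h \<beta>" i "a i" j "a j"] by (simp add: a_def)
 show "m k \<le> 1200 * (a i * a j)" if "(i, j, k) \<in> pattern (bas h \<beta>) (bas t \<omega>)" for i j k
 proof -
  have ijk: "i < 4" "j < 4" "k < 3" "q.H i j k ~= 0" using that by (auto simp: pattern_def)
  have "1 \<le> \<bar>real_of_int (q.H i j k)\<bar>" using ijk(4) by linarith
  then have "1 * m k \<le> \<bar>real_of_int (q.H i j k)\<bar> * m k" using m1[OF ijk(3)] by (intro mult_right_mono) auto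
  then show ?thesis using cH[OF ijk(1-3)] by linarith
 qed
 have rr4: "vnorm 4 (R.B i) \<le> 100 * vnorm 4 (R.B j)" if "i \<le> j" "j < 4" for i j using red(1) that by (simp add: reduced_def R.vec_def[abs_def])
 have rr3: "vnorm 3 (C.B i) \<le> 100 * vnorm 3 (C.B j)" if "i \<le> j" "j < 3" for i j using red(2) that by (simp add: reduced_def C.vec_def[abs_def])
 have s4: "sqrt (real 4) = 2" by simp
 show "2 * succ_min 4 R i \<le> 100 * a i" "a i \<le> 10000 * (2 * succ_min 4 R i)" if "i < 4" for i
  using R.succ_min_bounds[OF that, of 100] r4 rr4 unfolding B s4 a_def R.vec_def[abs_def] by simp_all
 show "sqrt 3 * succ_min 3 C i \<le> 100 * m i" "m i \<le> 10000 * (sqrt 3 * succ_min 3 C i)" if "i < 3" for i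
  using C.succ_min_bounds[OF that, of 100] r3 rr3 unfolding B m_def C.vec_def[abs_def] by simp_all
 \<comment> \<open>All lengths are at least 1, so each is bounded by their product and thus by
   \<open>E\<close>.\<close>
 define E where "E = KD * sqrt D"
 have aE: "a j \<le> E" if "j < 4" for j
 proof -
  have "a 0 \<le> a 0 * a 1 * a 2 * a 3 \<and> a 1 \<le> a 0 * a 1 * a 2 * a 3 \<and> a 2 \<le> a 0 * a 1 * a 2 * a 3 \<and> a 3 \<le> a 0 * a 1 * a 2 * a 3"
  proof -
   have p: "x \<le> x * y" "y \<le> x * y" "1 \<le> x * y" if "1 \<le> x" "1 \<le> y" for x y :: real
    using that mult_left_mono[of 1 y x] mult_right_mono[of 1 x y] mult_mono[of 1 x 1 y] by simp_all
   note q = a1[of 0, simplified] a1[of 1, simplified] a1[of 2, simplified] a1[of 3, simplified]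
   show ?thesis using p[OF q(1,2)] p[OF p(3)[OF q(1,2)] q(3)] p[OF p(3)[OF p(3)[OF q(1,2)] q(3)] q(4)] by linarith
  qed
  then show ?thesis using that pa(1) unfolding less_4_cases E_def by (elim disjE) (simp_all only:, linarith+)
 qed
 have mE: "m j \<le> E" if "j < 3" for j
 proof -
  have "m 0 \<le> m 0 * m 1 * m 2 \<and> m 1 \<le> m 0 * m 1 * m 2 \<and> m 2 \<le> m 0 * m 1 * m 2"
  proof -
   have p: "x \<le> x * y" "y \<le> x * y" "1 \<le> x * y" if "1 \<le> x" "1 \<le> y" for x y :: real
    using that mult_left_mono[of 1 y x] mult_right_mono[of 1 x y] mult_mono[of 1 x 1 y] by simp_all
   note q = m1[of 0, simplified] m1[of 1, simplified] m1[of 2, simplified]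
   show ?thesis using p[OF q(1,2)] p[OF p(3)[OF q(1,2)] q(3)] by linarith
  qed
  then show ?thesis using that pm(1) unfolding less_3_cases E_def by (elim disjE) (simp_all only:, linarith+)
 qed
 have E0: "1 \<le> E" using aE[of 0] a1[of 0] by simp
 have dl: "x \<le> 1200 * E\<^sup>2" if "x * y \<le> z" "1 \<le> y" "0 \<le> x" "z \<le> 1200 * (u * v)" "u \<le> E" "v \<le> E" "1 \<le> u" "1 \<le> v" for x y z u v :: real
 proof -
  have "x * 1 \<le> x * y" using that by (intro mult_left_mono) auto
  moreover have "u * v \<le> E * E" using that E0 by (intro mult_mono) auto
  ultimately show ?thesis using that unfolding power2_eq_square by linarith
 qed
 show "\<bar>tables (bas h \<beta>) (bas t \<omega>) p\<bar> \<le> 1200 * (KD * sqrt D)\<^sup>2 \<or> p \<notin> {..<3} \<times> {..<4} \<times> {..<4} \<times> {..<4}" for p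
 proof (cases "p \<in> {..<3} \<times> {..<4} \<times> {..<4} \<times> {..<4}")
  case True
  then obtain s i j l where p: "p = (s, i, j, l)" "s < 3" "i < 4" "j < 4" "l < 4" by auto
  have c: "\<bar>real_of_int (q.c i j l)\<bar> \<le> 1200 * E\<^sup>2"
  proof (rule dl)
   show "\<bar>real_of_int (q.c i j l)\<bar> * a l \<le> 100 * vnorm 4 (\<lambda>k. bas h \<beta> i k * bas h \<beta> j k)"
    using p by (intro c4 mlattice.mult_basis[OF q.L]) auto
   have "100 * vnorm 4 (\<lambda>k. bas h \<beta> i k * bas h \<beta> j k) \<le> 400 * (a i * a j)"
    using vnorm_mult_le[of 4 "bas h \<beta> i" "bas h \<beta> j"] by (simp add: a_def)
   also have "\<dots> \<le> 1200 * (a i * a j)" using a1[OF p(3)] a1[OF p(4)] by (intro mult_right_mono) auto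
   finally show "100 * vnorm 4 (\<lambda>k. bas h \<beta> i k * bas h \<beta> j k) \<le> 1200 * (a i * a j)" .
  qed (use p a1 aE in auto)
  have e: "\<bar>real_of_int (q.e i j l)\<bar> \<le> 1200 * E\<^sup>2" if "i < 3" "j < 3" "l < 3"
  proof (rule dl)
   show "\<bar>real_of_int (q.e i j l)\<bar> * m l \<le> 100 * vnorm 3 (\<lambda>k. bas t \<omega> i k * bas t \<omega> j k)"
    using that by (intro c3 mlattice.mult_basis[OF q.M]) auto
   have "100 * vnorm 3 (\<lambda>k. bas t \<omega> i k * bas t \<omega> j k) \<le> 300 * (m i * m j)"
    using vnorm_mult_le[of 3 "bas t \<omega> i" "bas t \<omega> j"] by (simp add: m_def)
   also have "\<dots> \<le> 1200 * (m i * m j)" using m1[OF that(1)] m1[OF that(2)] by (intro mult_right_mono) auto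
   finally show "100 * vnorm 3 (\<lambda>k. bas t \<omega> i k * bas t \<omega> j k) \<le> 1200 * (m i * m j)" .
  qed (use that m1 mE in auto)
  have H: "\<bar>real_of_int (q.H i j l)\<bar> \<le> 1200 * E\<^sup>2" if "l < 3"
   by (rule dl[OF cH[OF p(3,4) that]]) (use p that m1 a1 aE in auto)
  have "0 \<le> 1200 * E\<^sup>2" by simp
  then show ?thesis using c e H p unfolding E_def[symmetric] tables_def by auto
 qed simp
qed

text \<open>The structure constants of a pair in reduced bases are bounded in terms of the
  discriminant, and pairs with equal tables are isomorphic.\<close>

lemma finite_classes:
 "finite ({P \<in> G_pairs G. real_of_int \<bar>ring_disc 4 (fst P)\<bar> \<le> r} // pair_iso G)"
proof -
 define A where "A = {P \<in> G_pairs G. real_of_int \<bar>ring_disc 4 (fst P)\<bar> \<le> r}"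
 define good where "good = (\<lambda>P T. \<exists>h \<beta> t \<omega>. pair_data G (fst P) (snd P) h \<beta> t \<omega> \<and> reduced 100 4 (bas h \<beta>) \<and>
   reduced 100 3 (bas t \<omega>) \<and> T = tables (bas h \<beta>) (bas t \<omega>))"
 have "\<exists>T. good P T" if "P \<in> A" for P
  using ex_pair_data[of "fst P" "snd P" G] that unfolding A_def good_def by auto
 then obtain T where T: "\<And>P. P \<in> A ==> good P (T P)" by metis
 define U where "U = {..<3::nat} \<times> {..<4::nat} \<times> {..<4::nat} \<times> {..<4::nat}"
 define Y where "Y = \<lceil>1200 * (KD * sqrt r)\<^sup>2\<rceil>"
 have TY: "T P \<in> U \<rightarrow>\<^sub>E {-Y..Y}" if P: "P \<in> A" for P
 proof -
  obtain h \<beta> t \<omega> where d: "pair_data G (fst P) (snd P) h \<beta> t \<omega>" "reduced 100 4 (bas h \<beta>)" "reduced 100 3 (bas t \<omega>)"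
   and TP: "T P = tables (bas h \<beta>) (bas t \<omega>)" using T[OF P] by (auto simp: good_def)
  let ?D = "real_of_int \<bar>ring_disc 4 (fst P)\<bar>"
  have "?D \<le> r" using P by (simp add: A_def)
  then have "KD * sqrt ?D \<le> KD * sqrt r" by simp
  then have "(KD * sqrt ?D)\<^sup>2 \<le> (KD * sqrt r)\<^sup>2" by (intro power_mono) auto
  then have TB: "\<bar>T P p\<bar> \<le> Y" if "p \<in> U" for p
   using pair_bounds(15)[OF d, of p] that unfolding TP U_def Y_def by simp linarith
  have "T P p \<in> {-Y..Y}" if "p \<in> U" for p using TB[OF that] unfolding abs_le_iff by simp
  moreover have "T P p = undefined" if "p \<notin> U" for p using that unfolding TP tables_def U_def by (simp only: restrict_apply if_False)
  ultimately show ?thesis by (rule PiE_I)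
 qed
 have "finite (U \<rightarrow>\<^sub>E {-Y..Y})" by (rule finite_PiE) (simp_all add: U_def)
 then have "finite (T ` A)" by (rule finite_subset[rotated]) (rule image_subsetI, rule TY)
 moreover have "pair_iso G `` {P} = pair_iso G `` {P'}" if "P \<in> A" "P' \<in> A" "T P = T P'" for P P'
 proof -
  have *: "(P, P') \<in> pair_iso G" if P: "P \<in> A" "P' \<in> A" "T P = T P'" for P P'
  proof -
   obtain h \<beta> t \<omega> where d: "pair_data G (fst P) (snd P) h \<beta> t \<omega>" "T P = tables (bas h \<beta>) (bas t \<omega>)"
    using T[OF P(1)] by (auto simp: good_def)
   obtain h' \<beta>' t' \<omega>' where d': "pair_data G (fst P') (snd P') h' \<beta>' t' \<omega>'" "T P' = tables (bas h' \<beta>') (bas t' \<omega>')"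
    using T[OF P(2)] by (auto simp: good_def)
   have "((fst P, snd P), (fst P', snd P')) \<in> pair_iso G"
    using P d d' by (intro tables_iso[OF d(1) _ d'(1)]) (auto simp: A_def)
   then show ?thesis by simp
  qed
  have a: "(P, P') \<in> pair_iso G" "(P', P) \<in> pair_iso G" using *[OF that] *[OF that(2,1) that(3)[symmetric]] .
  show ?thesis
  proof (intro equalityI subsetI)
   fix Q assume "Q \<in> pair_iso G `` {P}"
   then show "Q \<in> pair_iso G `` {P'}" using pair_iso_trans[OF a(2), of Q] by (simp add: Image_singleton_iff)
  next
   fix Q assume "Q \<in> pair_iso G `` {P'}"
   then show "Q \<in> pair_iso G `` {P}" using pair_iso_trans[OF a(1), of Q] by (simp add: Image_singleton_iff)
  qed
 qed
 ultimately have "finite ((\<lambda>P. pair_iso G `` {P}) ` A)"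
 proof -
  assume fin: "finite (T ` A)" and eq: "\<And>P P'. P \<in> A ==> P' \<in> A ==> T P = T P' ==> pair_iso G `` {P} = pair_iso G `` {P'}"
  \<comment> \<open>A class depends only on the table, so a choice of one pair for each of the
    finitely many tables reaches every class.\<close>
  have "(\<lambda>P. pair_iso G `` {P}) ` A = (\<lambda>\<tau>. pair_iso G `` {SOME P. P \<in> A \<and> T P = \<tau>}) ` (T ` A)"
  proof -
   have "pair_iso G `` {P} = pair_iso G `` {SOME Q. Q \<in> A \<and> T Q = T P}" if "P \<in> A" for P
    using someI[of "\<lambda>Q. Q \<in> A \<and> T Q = T P" P] that by (intro eq) auto
   then show ?thesis by (auto simp: image_image)
  qed
  then show ?thesis using fin by simp
 qed
 moreover have "A // pair_iso G = (\<lambda>P. pair_iso G `` {P}) ` A" by (auto simp: quotient_def)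
 ultimately show ?thesis by (simp add: A_def)
qed

section \<open>The polytopes\<close>

no_notation Matrix.vec_index (infixl "$" 100)
no_notation fps_nth (infixl "$" 75)

lemma exhaust_5: "(x::5) = 1 \<or> x = 2 \<or> x = 3 \<or> x = 4 \<or> x = 5"
proof (induct x)
 case (of_int z)
 then have "0 \<le> z" and "z < 5" by simp_all
 then have "z = 0 \<or> z = 1 \<or> z = 2 \<or> z = 3 \<or> z = 4" by arith
 then show ?case by auto
qed

lemma forall_5: "(\<forall>i::5. P i) \<longleftrightarrow> P 1 \<and> P 2 \<and> P 3 \<and> P 4 \<and> P 5"
 by (metis exhaust_5)

lemma UNIV_5: "(UNIV :: 5 set) = {1, 2, 3, 4, 5}"
 using exhaust_5 by auto

lemma sum_5: "sum f (UNIV :: 5 set) = f 1 + f 2 + f 3 + f 4 + f 5"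
 unfolding UNIV_5 by (simp add: ac_simps)

lemma vector_5 [simp]:
 fixes a b c d e :: real
 shows "(vector [a, b, c, d, e] :: real^5) $ 1 = a" "(vector [a, b, c, d, e] :: real^5) $ 2 = b"
  "(vector [a, b, c, d, e] :: real^5) $ 3 = c" "(vector [a, b, c, d, e] :: real^5) $ 4 = d"
  "(vector [a, b, c, d, e] :: real^5) $ 5 = e"
 unfolding vector_def by simp_all

definition lc :: "real^5 => nat => real" where
 "lc p i = (if i = 1 then p $ 1 else if i = 2 then p $ 2 else p $ 3)"

definition mc :: "real^5 => nat => real" where
 "mc p k = (if k = 1 then p $ 4 else p $ 5)"

text \<open>The value 1/2 comes from the covolume: the square root of the absolute discriminant is
  comparable to the product of the lengths of a reduced basis.\<close>

definition cell :: "(nat \<times> nat \<times> nat) set => (real^5) set" where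
 "cell N = {p. 0 \<le> p $ 1 \<and> p $ 1 \<le> p $ 2 \<and> p $ 2 \<le> p $ 3 \<and> 0 \<le> p $ 4 \<and> p $ 4 \<le> p $ 5 \<and>
   p $ 1 + p $ 2 + p $ 3 = 1 / 2 \<and> p $ 4 + p $ 5 = 1 / 2 \<and> (\<forall>(i, j, k)\<in>N. mc p k \<le> lc p i + lc p j)}"

lemma polyhedron_linear_le:
 fixes f :: "real^5 => real"
 assumes "linear f"
 shows "polyhedron {p. f p \<le> c}"
proof -
 have "f p = adjoint f 1 \<bullet> p" for p
  using adjoint_works[OF assms, of p 1] by (simp add: inner_commute)
 then show ?thesis using polyhedron_halfspace_le[of "adjoint f 1" c] by simp
qed

lemma linear_lc: "linear (\<lambda>p. lc p i)" and linear_mc: "linear (\<lambda>p. mc p k)"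
 by (auto simp: lc_def mc_def linear_iff)

lemma polytope_cell:
 assumes "finite N"
 shows "polytope (cell N)"
proof -
 let ?T = "\<lambda>(i, j, k). {p :: real^5. mc p k \<le> lc p i + lc p j}"
 have lin: "linear (\<lambda>p :: real^5. p $ i)" for i by (simp add: linear_iff)
 let ?S = "{p :: real^5. - (p $ 1) \<le> 0} \<inter> {p. p $ 1 - p $ 2 \<le> 0} \<inter> {p. p $ 2 - p $ 3 \<le> 0} \<inter> {p. - (p $ 4) \<le> 0} \<inter>
   {p. p $ 4 - p $ 5 \<le> 0} \<inter> {p. p $ 1 + p $ 2 + p $ 3 \<le> 1/2} \<inter> {p. - (p $ 1 + p $ 2 + p $ 3) \<le> - (1/2)} \<inter>
   {p. p $ 4 + p $ 5 \<le> 1/2} \<inter> {p. - (p $ 4 + p $ 5) \<le> - (1/2)} \<inter> \<Inter> (?T ` N)"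
 have "cell N = ?S"
 proof (intro equalityI subsetI)
  fix p assume p: "p \<in> cell N"
  then have "p \<in> ?T x" if "x \<in> N" for x using that by (cases x) (auto simp: cell_def)
  then show "p \<in> ?S" using p by (simp add: cell_def)
 next
  fix p assume p: "p \<in> ?S"
  then have "p \<in> ?T x" if "x \<in> N" for x using that by blast
  then have "\<forall>(i, j, k)\<in>N. mc p k \<le> lc p i + lc p j" by fastforce
  then show "p \<in> cell N" using p by (simp add: cell_def)
 qed
 moreover have "polyhedron ?S"
 proof (intro polyhedron_Int polyhedron_linear_le polyhedron_Inter)
  show "finite (?T ` N)" using assms by simp
  have "polyhedron {p :: real^5. mc p k \<le> lc p i + lc p j}" for i j k
   using polyhedron_linear_le[of "\<lambda>p. mc p k - (lc p i + lc p j)" 0]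
   by (simp add: linear_compose_sub linear_compose_add linear_lc linear_mc)
  then show "polyhedron S" if "S \<in> ?T ` N" for S using that by auto
 qed (auto intro!: linear_compose_sub linear_compose_add linear_compose_neg lin)
 moreover have "bounded (cell N)"
  unfolding bounded_iff
 proof (intro exI ballI)
  fix p assume "p \<in> cell N"
  then have "\<bar>p $ 1\<bar> \<le> 1" "\<bar>p $ 2\<bar> \<le> 1" "\<bar>p $ 3\<bar> \<le> 1" "\<bar>p $ 4\<bar> \<le> 1" "\<bar>p $ 5\<bar> \<le> 1" by (auto simp: cell_def)
  then show "norm p \<le> 5" using norm_le_l1_cart[of p] by (simp add: sum_5)
 qed
 ultimately show ?thesis by (simp add: polytope_eq_bounded_polyhedron)
qed

text \<open>A common interior point of all cells; the three directions around it span the hyperplane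
 sections \<open>p\<^sub>1 + p\<^sub>2 + p\<^sub>3 = 1/2\<close>, \<open>p\<^sub>4 + p\<^sub>5 = 1/2\<close>.\<close>

definition centre :: "real^5" where
 "centre = vector [1/6 - 1/100, 1/6, 1/6 + 1/100, 1/4 - 1/100, 1/4 + 1/100]"

text \<open>Translated by \<open>- centre\<close>, the cell lies in the span of three orthogonal
  vectors and contains a small multiple of each, whatever the pattern.\<close>

lemma aff_dim_cell:
 assumes "N \<subseteq> {1..3} \<times> {1..3} \<times> {1..2}"
 shows "aff_dim (cell N) = 3"
proof -
 define v1 :: "real^5" where "v1 = vector [-1, 0, 1, 0, 0]"
 define v2 :: "real^5" where "v2 = vector [-1, 2, -1, 0, 0]"
 define v3 :: "real^5" where "v3 = vector [0, 0, 0, -1, 1]"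
 have near: "centre + (1/1000) *\<^sub>R v \<in> cell N" if v: "v \<in> {0, v1, v2, v3}" for v
 proof -
  let ?p = "centre + (1/1000) *\<^sub>R v"
  \<comment> \<open>Sums of two \<open>lc\<close> values are at least 0.28 while \<open>mc\<close>
    values are at most 0.27, so every conceivable pattern inequality holds.\<close>
  have "0.14 \<le> ?p $ 1" "0.14 \<le> ?p $ 2" "0.14 \<le> ?p $ 3" "?p $ 4 \<le> 0.27" "?p $ 5 \<le> 0.27"
   using v by (auto simp: centre_def v1_def v2_def v3_def)
  then have "\<forall>(i, j, k)\<in>N. mc ?p k \<le> lc ?p i + lc ?p j" by (auto simp: lc_def mc_def)
  then show ?thesis using v by (auto simp: cell_def centre_def v1_def v2_def v3_def)
 qed
 have c: "centre \<in> cell N" using near[of 0] by simp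
 let ?T = "(\<lambda>x. - centre + x) ` cell N"
 have orth: "pairwise real_inner_class.orthogonal {v1, v2, v3}"
  by (auto simp: pairwise_def real_inner_class.orthogonal_def inner_vec_def sum_5 v1_def v2_def v3_def)
 have nz: "v1 $ 3 = 1" "v2 $ 2 = 2" "v3 $ 5 = 1" by (simp_all add: v1_def v2_def v3_def)
 have ne: "0 \<notin> {v1, v2, v3}" using nz by auto
 have ind: "independent {v1, v2, v3}" by (rule pairwise_orthogonal_independent[OF orth ne])
 have d1: "v1 $ 2 = 0" "v3 $ 2 = 0" "v3 $ 3 = 0" by (simp_all add: v1_def v3_def)
 have card: "card {v1, v2, v3} = 3" using nz d1 by (auto simp: card_insert_if)
 have "?T \<subseteq> span {v1, v2, v3}"
 proof
  fix y assume "y \<in> ?T"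
  then obtain x where x: "x \<in> cell N" "y = - centre + x" by auto
  have s: "y $ 1 + y $ 2 + y $ 3 = 0" "y $ 4 + y $ 5 = 0" using x by (auto simp: cell_def centre_def)
  have "y = (- y $ 1 - y $ 2 / 2) *\<^sub>R v1 + (y $ 2 / 2) *\<^sub>R v2 + (- y $ 4) *\<^sub>R v3"
   using s by (simp add: Finite_Cartesian_Product.vec_eq_iff forall_5 v1_def v2_def v3_def)
  moreover have "\<dots> \<in> span {v1, v2, v3}" by (intro span_add span_scale span_base) auto
  ultimately show "y \<in> span {v1, v2, v3}" by simp
 qed
 then have le: "dim ?T \<le> 3" using dim_le_card[of ?T "{v1, v2, v3}"] card by simp
 have "{v1, v2, v3} \<subseteq> span ?T"
 proof
  fix v assume v: "v \<in> {v1, v2, v3}"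
  have "(1/1000) *\<^sub>R v \<in> ?T" using near[of v] v by (intro image_eqI[of _ _ "centre + (1/1000) *\<^sub>R v"]) auto
  then have "1000 *\<^sub>R ((1/1000) *\<^sub>R v) \<in> span ?T" by (intro span_scale span_base)
  then show "v \<in> span ?T" by simp
 qed
 then have "3 \<le> dim (span ?T)" using independent_card_le_dim[OF _ ind] card by metis
 then have "dim ?T = 3" using le by (simp add: dim_span)
 then show ?thesis using aff_dim_eq_dim[of centre "cell N"] c hull_inc by fastforce
qed

section \<open>Limit points lie in the polytopes\<close>

definition realizable :: "(nat => nat) set => (nat \<times> nat \<times> nat) set set" where
 "realizable G = {N. \<exists>b w. qpair b w \<and> lgal b = G \<and> pattern b w = N}"

lemma pattern_subset: "pattern b w \<subseteq> {1..3} \<times> {1..3} \<times> {1..2}"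
 by (auto simp: pattern_def)

lemma realizable_subset: "N \<in> realizable G ==> N \<subseteq> {1..3} \<times> {1..3} \<times> {1..2}"
 using pattern_subset by (auto simp: realizable_def)

lemma finite_realizable: "finite (realizable G)"
proof (rule finite_subset)
 show "realizable G \<subseteq> Pow ({1..3} \<times> {1..3} \<times> {1..2})" using realizable_subset by blast
qed simp

text \<open>The relaxation absorbs multiplicative constants, which become errors of order
  \<open>1 / ln D\<close> after division by the logarithm of the discriminant
  \<open>D\<close>.\<close>

definition cell_approx :: "real => (nat \<times> nat \<times> nat) set => (real^5) set" where
 "cell_approx \<eta> N = {p. - \<eta> \<le> p $ 1 \<and> p $ 1 \<le> p $ 2 + \<eta> \<and> p $ 2 \<le> p $ 3 + \<eta> \<and> - \<eta> \<le> p $ 4 \<and> p $ 4 \<le> p $ 5 + \<eta> \<and>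
   \<bar>p $ 1 + p $ 2 + p $ 3 - 1 / 2\<bar> \<le> \<eta> \<and> \<bar>p $ 4 + p $ 5 - 1 / 2\<bar> \<le> \<eta> \<and>
   (\<forall>(i, j, k)\<in>N. mc p k \<le> lc p i + lc p j + \<eta>)}"

lemma cell_approx_mono:
 assumes "\<eta> \<le> \<eta>'"
 shows "cell_approx \<eta> N \<subseteq> cell_approx \<eta>' N"
proof
 fix p assume p: "p \<in> cell_approx \<eta> N"
 have "\<forall>(i, j, k)\<in>N. mc p k \<le> lc p i + lc p j + \<eta>'"
 proof clarify
  fix i j k assume "(i, j, k) \<in> N"
  then have "mc p k \<le> lc p i + lc p j + \<eta>" using p by (auto simp: cell_approx_def)
  then show "mc p k \<le> lc p i + lc p j + \<eta>'" using assms by linarith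
 qed
 then show "p \<in> cell_approx \<eta>' N" using p assms by (simp add: cell_approx_def)
qed

text \<open>Each coordinate moves by at most \<open>\<epsilon>\<close>, and no condition involves
  more than three coordinates.\<close>

lemma cell_approx_near:
 assumes "q \<in> cell_approx \<eta> N" "dist q p \<le> \<epsilon>"
 shows "p \<in> cell_approx (\<eta> + 4 * \<epsilon>) N"
proof -
 have d: "\<bar>q $ i - p $ i\<bar> \<le> \<epsilon>" for i
  using component_le_norm_cart[of "q - p" i] assms(2) by (simp add: dist_norm)
 have l: "\<bar>lc q i - lc p i\<bar> \<le> \<epsilon>" and m: "\<bar>mc q k - mc p k\<bar> \<le> \<epsilon>" for i k using d by (auto simp: lc_def mc_def)
 have "mc p k \<le> lc p i + lc p j + (\<eta> + 4 * \<epsilon>)" if "(i, j, k) \<in> N" for i j k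
 proof -
  have "mc q k \<le> lc q i + lc q j + \<eta>" using assms(1) that by (auto simp: cell_approx_def)
  then show ?thesis using l[of i] l[of j] m[of k] by linarith
 qed
 then show ?thesis using assms(1) d[of 1] d[of 2] d[of 3] d[of 4] d[of 5]
  unfolding cell_approx_def by (auto simp: abs_le_iff)
qed

lemma cell_approx_limit:
 assumes "\<And>\<eta>. 0 < \<eta> ==> p \<in> cell_approx \<eta> N"
 shows "p \<in> cell N"
proof -
 have le: "x \<le> y" if "\<And>\<eta>. 0 < \<eta> ==> x \<le> y + \<eta>" for x y :: real using that by (rule field_le_epsilon)
 have a: "\<And>\<eta>. 0 < \<eta> ==> - \<eta> \<le> p $ 1 \<and> p $ 1 \<le> p $ 2 + \<eta> \<and> p $ 2 \<le> p $ 3 + \<eta> \<and> - \<eta> \<le> p $ 4 \<and> p $ 4 \<le> p $ 5 + \<eta> \<and>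
   \<bar>p $ 1 + p $ 2 + p $ 3 - 1 / 2\<bar> \<le> \<eta> \<and> \<bar>p $ 4 + p $ 5 - 1 / 2\<bar> \<le> \<eta> \<and>
   (\<forall>(i, j, k)\<in>N. mc p k \<le> lc p i + lc p j + \<eta>)"
  using assms by (simp add: cell_approx_def)
 have "0 \<le> p $ 1" "0 \<le> p $ 4" by (rule le, use a in force)+
 moreover have "p $ 1 \<le> p $ 2" "p $ 2 \<le> p $ 3" "p $ 4 \<le> p $ 5" by (rule le, use a in blast)+
 moreover have "\<bar>p $ 1 + p $ 2 + p $ 3 - 1 / 2\<bar> \<le> 0" "\<bar>p $ 4 + p $ 5 - 1 / 2\<bar> \<le> 0" by (rule le, use a in force)+
 moreover have "\<forall>(i, j, k)\<in>N. mc p k \<le> lc p i + lc p j"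
 proof (clarify)
  fix i j k assume N: "(i, j, k) \<in> N"
  show "mc p k \<le> lc p i + lc p j"
  proof (rule le)
   fix \<eta> :: real assume "0 < \<eta>"
   from assms[OF this] have "\<forall>(i, j, k)\<in>N. mc p k \<le> lc p i + lc p j + \<eta>" by (simp add: cell_approx_def)
   from bspec[OF this N] show "mc p k \<le> lc p i + lc p j + \<eta>" by simp
  qed
 qed
 ultimately show ?thesis by (simp add: cell_def)
qed

text \<open>The single constant \<open>10 ^ 30\<close> exceeds every factor in
  \<open>pair_bounds\<close>, so that each comparison there costs the same additive error.\<close>

lemma ln_le_add: "0 < x ==> 0 < y ==> x \<le> M * y ==> M \<le> 10 ^ 30 ==> ln x \<le> ln y + ln (10 ^ 30)" for x y M :: real
proof -
 assume a: "0 < x" "0 < y" "x \<le> M * y" "M \<le> 10 ^ 30"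
 have "M * y \<le> 10 ^ 30 * y" using a by (intro mult_right_mono) auto
 with a(3) have "x \<le> 10 ^ 30 * y" by (rule order_trans)
 then have "ln x \<le> ln (10 ^ 30 * y)" using a by (subst ln_le_cancel_iff) auto
 then show ?thesis using a by (subst (asm) ln_mult) auto
qed

lemma min_point_simps:
 fixes R C
 defines "D \<equiv> real_of_int \<bar>ring_disc 4 R\<bar>"
 shows "min_point (R, C) $ 1 = ln (succ_min 4 R 1) / ln D" "min_point (R, C) $ 2 = ln (succ_min 4 R 2) / ln D"
  "min_point (R, C) $ 3 = ln (succ_min 4 R 3) / ln D" "min_point (R, C) $ 4 = ln (succ_min 3 C 1) / ln D"
  "min_point (R, C) $ 5 = ln (succ_min 3 C 2) / ln D"
 by (simp_all add: min_point_def Let_def D_def log_def)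

text \<open>Every condition that defines the cell follows from at most eight comparisons of
  logarithms, each with error \<open>ln (10 ^ 30)\<close>.\<close>

lemma min_point_approx:
 assumes "(R, C) \<in> G_pairs G" and D: "1 < real_of_int \<bar>ring_disc 4 R\<bar>"
 shows "\<exists>N\<in>realizable G. min_point (R, C) \<in> cell_approx (8 * ln (10 ^ 30) / ln (real_of_int \<bar>ring_disc 4 R\<bar>)) N"
proof -
 obtain h \<beta> t \<omega> where d: "pair_data G R C h \<beta> t \<omega>" "reduced 100 4 (bas h \<beta>)" "reduced 100 3 (bas t \<omega>)"
  using ex_pair_data[OF assms(1)] by blast
 define D where "D = real_of_int \<bar>ring_disc 4 R\<bar>"
 define a where "a = (\<lambda>j. vnorm 4 (bas h \<beta> j))"
 define m where "m = (\<lambda>j. vnorm 3 (bas t \<omega> j))"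
 define N where "N = pattern (bas h \<beta>) (bas t \<omega>)"
 have a2: "vnorm 4 (bas h \<beta> j) = a j" and m2: "vnorm 3 (bas t \<omega> j) = m j" for j by (simp_all add: a_def m_def)
 note pb = pair_bounds[OF d, folded D_def N_def, unfolded a2 m2]
 define \<kappa> :: real where "\<kappa> = ln (10 ^ 30)"
 define L where "L = ln D"
 have L: "0 < L" using D by (simp add: L_def D_def)
 have D0: "0 < D" using pb(1) by linarith
 have NG: "N \<in> realizable G" using d(1) unfolding pair_data_def realizable_def N_def by blast
 interpret R: embedded R 4 h \<beta> using d(1) by (simp add: pair_data_def)
 interpret C: embedded C 3 t \<omega> using d(1) by (simp add: pair_data_def)
 have "(1::real) \<le> 10 ^ 30" by simp
 then have \<kappa>0: "0 \<le> \<kappa>" unfolding \<kappa>_def by (subst ln_ge_zero_iff) auto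
 have a0: "0 < a i" and s0: "0 < succ_min 4 R i" if "i < 4" for i
  using pb(2)[OF that] pb(12)[OF that] by (linarith, linarith)
 have m0: "0 < m i" and t0: "0 < succ_min 3 C i" if "i < 3" for i
 proof -
  show "0 < m i" using pb(3)[OF that] by linarith
  have "0 < 10000 * (sqrt 3 * succ_min 3 C i)" using pb(3)[OF that] pb(14)[OF that] by linarith
  then show "0 < succ_min 3 C i" by (simp add: zero_less_mult_iff)
 qed
 note lea = ln_le_add[folded \<kappa>_def]
 have sq3: "1 \<le> sqrt 3" "sqrt 3 \<le> 2" by (auto intro: real_le_lsqrt)
 have la: "ln (succ_min 4 R i) \<le> ln (a i) + \<kappa>" "ln (a i) \<le> ln (succ_min 4 R i) + \<kappa>" if "i < 4" for i
  using lea[OF s0[OF that] a0[OF that], of 50] lea[OF a0[OF that] s0[OF that], of 20000] pb(11)[OF that] pb(12)[OF that] by auto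
 have lm: "ln (succ_min 3 C i) \<le> ln (m i) + \<kappa>" "ln (m i) \<le> ln (succ_min 3 C i) + \<kappa>" if "i < 3" for i
 proof -
  have "succ_min 3 C i \<le> sqrt 3 * succ_min 3 C i" using sq3 t0[OF that] by simp
  then show "ln (succ_min 3 C i) \<le> ln (m i) + \<kappa>" using lea[OF t0[OF that] m0[OF that], of 100] pb(13)[OF that] by auto
  have "sqrt 3 * succ_min 3 C i \<le> 2 * succ_min 3 C i" using sq3 t0[OF that] by (intro mult_right_mono) auto
  then show "ln (m i) \<le> ln (succ_min 3 C i) + \<kappa>" using lea[OF m0[OF that] t0[OF that], of 20000] pb(14)[OF that] by auto
 qed
 have am: "ln (a i) \<ge> 0" if "i < 4" for i using pb(2)[OF that] by (subst ln_ge_zero_iff) auto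
 have mm: "ln (m i) \<ge> 0" if "i < 3" for i using pb(3)[OF that] by (subst ln_ge_zero_iff) auto
 have lsq: "ln (sqrt D) = L / 2" using D0 by (simp add: ln_sqrt L_def)
 have KDle: "KD \<le> 10 ^ 30" "(24 :: real) \<le> 10 ^ 30" by simp_all
 have pa0: "0 < a 0 * a 1 * a 2 * a 3" using a0[of 0] a0[of 1] a0[of 2] a0[of 3] by simp
 have pm0: "0 < m 0 * m 1 * m 2" using m0[of 0] m0[of 1] m0[of 2] by simp
 have sD: "0 < sqrt D" using D0 by simp
 have pa: "ln (a 0 * a 1 * a 2 * a 3) \<le> L / 2 + \<kappa>" "L / 2 \<le> ln (a 0 * a 1 * a 2 * a 3) + \<kappa>"
  using lea[OF pa0 sD pb(4) KDle(1)] lea[OF sD pa0 pb(5) KDle(2)] unfolding lsq by auto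
 have pm: "ln (m 0 * m 1 * m 2) \<le> L / 2 + \<kappa>" "L / 2 \<le> ln (m 0 * m 1 * m 2) + \<kappa>"
  using lea[OF pm0 sD pb(6) KDle(1)] lea[OF sD pm0 pb(7) KDle(2)] unfolding lsq by auto
 have lna: "ln (a 0 * a 1 * a 2 * a 3) = ln (a 0) + ln (a 1) + ln (a 2) + ln (a 3)"
  using a0[of 0] a0[of 1] a0[of 2] a0[of 3] by (simp add: ln_mult)
 have lnm: "ln (m 0 * m 1 * m 2) = ln (m 0) + ln (m 1) + ln (m 2)"
  using m0[of 0] m0[of 1] m0[of 2] by (simp add: ln_mult)
 have a00: "ln (a 0) \<le> \<kappa>" using lea[of "a 0" 1 2] a0[of 0] pb(8) by simp
 have m00: "ln (m 0) \<le> \<kappa>" using lea[of "m 0" 1 2] m0[of 0] pb(9) sq3 by simp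
 define p where "p = min_point (R, C)"
 note ps = min_point_simps[of R C, folded D_def, folded L_def p_def]
 define \<eta> where "\<eta> = 8 * \<kappa> / L"
 have \<eta>: "\<eta> * L = 8 * \<kappa>" using L by (simp add: \<eta>_def)
 define z where "z = (\<lambda>i. ln (succ_min 4 R i))"
 define y where "y = (\<lambda>i. ln (succ_min 3 C i))"
 have pz: "p $ 1 = z 1 / L" "p $ 2 = z 2 / L" "p $ 3 = z 3 / L" "p $ 4 = y 1 / L" "p $ 5 = y 2 / L"
  using ps by (simp_all add: z_def y_def)
 have dv: "u / L \<le> v / L + \<eta>" if "u \<le> v + 8 * \<kappa>" for u v
 proof -
  have "u / L \<le> (v + 8 * \<kappa>) / L" using that L by (intro divide_right_mono) auto
  then show ?thesis by (simp add: \<eta>_def add_divide_distrib)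
 qed
 have zl: "- \<kappa> \<le> z i" if "i < 4" for i using la[OF that] am[OF that] by (simp add: z_def)
 have yl: "- \<kappa> \<le> y i" if "i < 3" for i using lm[OF that] mm[OF that] by (simp add: y_def)
 have zm: "z i \<le> z j" if "i \<le> j" "j < 4" for i j
  unfolding z_def using R.succ_min_mono[OF that] s0 that by (subst ln_le_cancel_iff) auto
 have ym: "y i \<le> y j" if "i \<le> j" "j < 3" for i j
  unfolding y_def using C.succ_min_mono[OF that] t0 that by (subst ln_le_cancel_iff) auto
 have zs: "z 1 + z 2 + z 3 \<le> L / 2 + 8 * \<kappa>" "L / 2 \<le> z 1 + z 2 + z 3 + 8 * \<kappa>"
  using la[of 1] la[of 2] la[of 3] pa lna a00 am[of 0] \<kappa>0 by (simp_all add: z_def)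
 have ys: "y 1 + y 2 \<le> L / 2 + 8 * \<kappa>" "L / 2 \<le> y 1 + y 2 + 8 * \<kappa>"
  using lm[of 1] lm[of 2] pm lnm m00 mm[of 0] \<kappa>0 by (simp_all add: y_def)
 have half: "L / 2 / L = 1 / 2" using L by simp
 have "p \<in> cell_approx \<eta> N" unfolding cell_approx_def mem_Collect_eq pz
 proof (intro conjI)
  show "- \<eta> \<le> z 1 / L" using dv[of 0 "z 1"] zl[of 1] \<kappa>0 by simp
  show "- \<eta> \<le> y 1 / L" using dv[of 0 "y 1"] yl[of 1] \<kappa>0 by simp
  show "z 1 / L \<le> z 2 / L + \<eta>" "z 2 / L \<le> z 3 / L + \<eta>" "y 1 / L \<le> y 2 / L + \<eta>"
   using zm[of 1 2] zm[of 2 3] ym[of 1 2] \<kappa>0 by (auto intro!: dv)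
  show "\<bar>z 1 / L + z 2 / L + z 3 / L - 1 / 2\<bar> \<le> \<eta>"
   using dv[OF zs(1)] dv[OF zs(2)] unfolding half add_divide_distrib abs_le_iff by linarith
  show "\<bar>y 1 / L + y 2 / L - 1 / 2\<bar> \<le> \<eta>"
   using dv[OF ys(1)] dv[OF ys(2)] unfolding half add_divide_distrib abs_le_iff by linarith
  show "\<forall>(i, j, k)\<in>N. mc p k \<le> lc p i + lc p j + \<eta>"
  proof clarify
   fix i j k assume N: "(i, j, k) \<in> N"
   have ijk: "i \<in> {1,2,3}" "j \<in> {1,2,3}" "k \<in> {1,2}" using realizable_subset[OF NG] N by auto
   have lt: "i < 4" "j < 4" "k < 3" using ijk by auto
   have lp: "lc p i = z i / L" if "i \<in> {1,2,3}" for i using that pz by (auto simp: lc_def)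
   have mp: "mc p k = y k / L" using ijk(3) pz by (auto simp: mc_def)
   have "0 < a i * a j" using a0 lt by simp
   from lea[OF m0[OF lt(3)] this pb(10)[OF N]] have "ln (m k) \<le> ln (a i) + ln (a j) + \<kappa>"
    using a0[OF lt(1)] a0[OF lt(2)] by (simp add: ln_mult)
   then have "y k \<le> z i + z j + 8 * \<kappa>" using la[OF lt(1)] la[OF lt(2)] lm[OF lt(3)] \<kappa>0 by (simp add: y_def z_def)
   then show "mc p k \<le> lc p i + lc p j + \<eta>" using dv lp[OF ijk(1)] lp[OF ijk(2)] mp by (metis add_divide_distrib)
  qed
 qed
 then show ?thesis using NG unfolding p_def \<eta>_def \<kappa>_def L_def D_def by blast
qed

text \<open>Infinitely many classes lie near \<open>p\<close> while only finitely many have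
  discriminant at most \<open>r\<close>, so some pair near \<open>p\<close> has large discriminant.
  This puts \<open>p\<close> into an approximate cell for every \<open>\<eta>\<close>; as there are
  finitely many patterns, one of them serves all \<open>\<eta>\<close>.\<close>

theorem P4_upper: "P4 G \<subseteq> \<Union> (cell ` realizable G)"
proof
 fix p assume p: "p \<in> P4 G"
 have ex: "\<exists>N\<in>realizable G. p \<in> cell_approx \<eta> N" if \<eta>: "0 < \<eta>" for \<eta>
 proof -
  define \<kappa> :: real where "\<kappa> = ln (10 ^ 30)"
  have \<kappa>0: "0 < \<kappa>" unfolding \<kappa>_def by (subst ln_gt_zero_iff) auto
  \<comment> \<open>Chosen so that \<open>8 * \<kappa> / ln D \<le> \<eta> / 2\<close> beyond
    \<open>r\<close>; the distance \<open>\<eta> / 8\<close> contributes the other half through the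
    factor 4 in \<open>cell_approx_near\<close>.\<close>
  define r where "r = exp (16 * \<kappa> / \<eta>)"
  define A where "A = {P \<in> G_pairs G. dist (min_point P) p < \<eta> / 8}"
  define A' where "A' = {P \<in> G_pairs G. real_of_int \<bar>ring_disc 4 (fst P)\<bar> \<le> r}"
  have "0 < \<eta> / 8" using \<eta> by simp
  then have "infinite (A // pair_iso G)" using p unfolding P4_def A_def by blast
  moreover have "finite (A' // pair_iso G)" unfolding A'_def by (rule finite_classes)
  moreover have "A // pair_iso G \<subseteq> A' // pair_iso G" if "A \<subseteq> A'" using that by (auto simp: quotient_def)
  ultimately have "\<not> A \<subseteq> A'" using finite_subset by blast
  then obtain P where P: "P \<in> A" "P \<notin> A'" by blast
  obtain R C where PRC: "P = (R, C)" by (cases P)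
  have RC: "(R, C) \<in> G_pairs G" "dist (min_point (R, C)) p < \<eta> / 8" "r < real_of_int \<bar>ring_disc 4 R\<bar>"
   using P unfolding PRC A_def A'_def mem_Collect_eq fst_conv not_le[symmetric] by blast+
  define D where "D = real_of_int \<bar>ring_disc 4 R\<bar>"
  have r1: "1 < r" using \<kappa>0 \<eta> by (simp add: r_def)
  have rD: "r < D" "0 < D" using RC(3) r1 by (simp_all add: D_def)
  have "ln r < ln D" using rD r1 by (subst ln_less_cancel_iff) auto
  then have "16 * \<kappa> / \<eta> < ln D" by (simp add: r_def)
  then have "16 * \<kappa> < ln D * \<eta>" using \<eta> by (simp add: pos_divide_less_eq)
  moreover have "0 < ln D" using RC(3) r1 unfolding D_def[symmetric] by (subst ln_gt_zero_iff) auto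
  ultimately have "8 * \<kappa> / ln D \<le> \<eta> / 2" by (simp add: pos_divide_le_eq mult.commute)
  moreover obtain N where N: "N \<in> realizable G" "min_point (R, C) \<in> cell_approx (8 * \<kappa> / ln D) N"
   using min_point_approx[OF RC(1)] RC(3) r1 unfolding \<kappa>_def D_def by fastforce
  ultimately have "min_point (R, C) \<in> cell_approx (\<eta> / 2) N" using cell_approx_mono by blast
  from cell_approx_near[OF this less_imp_le[OF RC(2)]] N(1) show ?thesis by auto
 qed
 show "p \<in> \<Union> (cell ` realizable G)"
 proof (rule ccontr)
  assume np: "p \<notin> \<Union> (cell ` realizable G)"
  have "\<exists>\<eta>>0. p \<notin> cell_approx \<eta> N" if "N \<in> realizable G" for N
   using cell_approx_limit[of p N] np that by blast
  then obtain e where e: "\<And>N. N \<in> realizable G ==> 0 < e N" "\<And>N. N \<in> realizable G ==> p \<notin> cell_approx (e N) N" by metis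
  have ne: "realizable G ~= {}" using ex[of 1] by auto
  \<comment> \<open>If every pattern failed at its own \<open>e N\<close>, all of them would fail at
    the minimum.\<close>
  define \<eta> where "\<eta> = Min (e ` realizable G)"
  have "0 < \<eta>" unfolding \<eta>_def using finite_realizable ne e(1) by (subst Min_gr_iff) auto
  then obtain N where N: "N \<in> realizable G" "p \<in> cell_approx \<eta> N" using ex by blast
  have "\<eta> \<le> e N" unfolding \<eta>_def using finite_realizable N(1) by (intro Min_le) auto
  then show False using cell_approx_mono N e(2) by blast
 qed
qed

section \<open>Points of the polytopes are limit points\<close>

lemma field_auto_scale:
 assumes \<alpha>: "\<alpha> \<in> Ring.ring_hom (complex_ring\<lparr>carrier := lfield b\<rparr>) (complex_ring\<lparr>carrier := F'\<rparr>)" and z: "z \<in> lfield b"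
 shows "\<alpha> (of_int m * z) = of_int m * \<alpha> z"
 using field_auto_icomb[OF \<alpha>[unfolded lfield_def], of 1 "\<lambda>_ _. z" 0 "\<lambda>_. m"] z
 by (simp add: rcomb_def lfield_def)

text \<open>Powers of 2 are rational, so they lie in the field and are fixed by its
  automorphisms.\<close>

lemma lgal_scaled: "lgal (scaled x b) = lgal b"
proof -
 have mem: "b j k \<in> lfield b" if "j < 4" "k < 4" for b :: "nat => nat => complex" and j k
  unfolding lfield_def by (rule generate_field_closed(1)) (use that in auto)
 have pow: "2 ^ m \<in> lfield b" for m and b :: "nat => nat => complex"
  unfolding lfield_def using generate_field_closed(8)[of "2 ^ m"] by simp
 have mult: "u * v \<in> lfield b" if "u \<in> lfield b" "v \<in> lfield b" for u v and b :: "nat => nat => complex"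
  using that unfolding lfield_def by (rule generate_field_closed(5))
 have inv: "inverse u \<in> lfield b" if "u \<in> lfield b" for u and b :: "nat => nat => complex"
  using that unfolding lfield_def by (rule generate_field_closed(7))
 have f: "lfield (scaled x b) = lfield b"
 proof
  show "lfield (scaled x b) \<subseteq> lfield b" unfolding lfield_def
  proof (rule generate_field_subset)
   fix s assume "s \<in> {scaled x b j k |j k. j < 4 \<and> k < 4}"
   then obtain j k where "s = 2 ^ x j * b j k" "j < 4" "k < 4" by (auto simp: scaled_def)
   then show "s \<in> generate_field complex_ring {b j k |j k. j < 4 \<and> k < 4}"
    using mult[OF pow mem] unfolding lfield_def by simp
  qed
  show "lfield b \<subseteq> lfield (scaled x b)"
   unfolding lfield_def[of b] lfield_def[of "scaled x b"]
  proof (rule generate_field_subset)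
   fix s assume "s \<in> {b j k |j k. j < 4 \<and> k < 4}"
   then obtain j k where jk: "s = b j k" "j < 4" "k < 4" by auto
   have "inverse (2 ^ x j) * scaled x b j k \<in> lfield (scaled x b)" using jk by (intro mult inv pow mem)
   then show "s \<in> generate_field complex_ring {scaled x b j k |j k. j < 4 \<and> k < 4}"
    unfolding lfield_def jk(1) by (simp add: scaled_def[of x b j k] mult.assoc[symmetric])
  qed
 qed
 have "(\<forall>i\<in>{1..4}. \<forall>j<4. scaled x b j (p i - 1) = \<alpha> (scaled x b j (i - 1))) \<longleftrightarrow> (\<forall>i\<in>{1..4}. \<forall>j<4. b j (p i - 1) = \<alpha> (b j (i - 1)))"
  if \<alpha>: "\<alpha> \<in> ring_iso (complex_ring\<lparr>carrier := lfield b\<rparr>) (complex_ring\<lparr>carrier := lfield b\<rparr>)" for p \<alpha>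
 proof -
  have "\<alpha> (scaled x b j (i - 1)) = 2 ^ x j * \<alpha> (b j (i - 1))" if "i \<in> {1..4}" "j < 4" for i j
   using field_auto_scale[of \<alpha> b "lfield b" "b j (i - 1)" "2 ^ x j"] \<alpha> mem[of j "i - 1" b] that
   by (auto simp: ring_iso_def scaled_def)
  then show ?thesis by (simp add: scaled_def)
 qed
 then show ?thesis unfolding lgal_def f by blast
qed

text \<open>The constant may depend on \<open>b\<close> but must be uniform in the exponents.
  Rescaling the basis amounts to rescaling the coordinates, so the bound on coordinates with respect
  to \<open>b\<close> serves all exponents at once.\<close>

lemma scaled_succ_min:
 assumes nz: "edet n b ~= 0"
 shows "\<exists>K>0. \<forall>R :: ('a, 'm) ring_scheme. \<forall>h \<beta> x. embedded R n h \<beta> --> (\<forall>i j. i \<le> j --> j < n --> x i \<le> x j) -->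
  (\<forall>j<n. \<forall>k<n. h k (\<beta> j) = scaled x b j k) -->
  (\<forall>i<n. sqrt (real n) * succ_min n R i \<le> K * 2 ^ x i \<and> 2 ^ x i \<le> K * (sqrt (real n) * succ_min n R i))"
proof -
 obtain K0 where K0: "K0 > 0" "\<And>x j. j < n ==> \<bar>x j\<bar> \<le> K0 * vnorm n (rcomb n b x)" using coord_bound[OF nz] by metis
 \<comment> \<open>\<open>A\<close> bounds both the lengths of the basis vectors and their
   inverses.\<close>
 define A where "A = 1 + (\<Sum>j<n. vnorm n (b j) + 1 / vnorm n (b j))"
 have pos: "0 < vnorm n (b j)" if "j < n" for j using basis_vnorm_pos[OF nz that] .
 have s0: "0 \<le> (\<Sum>j<n. vnorm n (b j) + 1 / vnorm n (b j))" by (intro sum_nonneg) auto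
 have le: "vnorm n (b j) + 1 / vnorm n (b j) \<le> A" if "j < n" for j
  using member_le_sum[of j "{..<n}" "\<lambda>j. vnorm n (b j) + 1 / vnorm n (b j)"] that by (simp add: A_def)
 have A1: "1 \<le> A" using s0 by (simp add: A_def)
 have bA: "vnorm n (b j) \<le> A" "1 / vnorm n (b j) \<le> A" if "j < n" for j
  using le[OF that] pos[OF that] by (auto intro: order_trans[rotated])
 have bA': "1 \<le> A * vnorm n (b j)" if "j < n" for j using bA(2)[OF that] pos[OF that] by (simp add: field_simps)
 define K where "K = max (K0 * A) (A * A)"
 have K: "0 < K" using A1 by (simp add: K_def less_max_iff_disj)
 have KK: "K0 * A \<le> K" "A * A \<le> K" by (auto simp: K_def)
 have A0: "0 \<le> A" using A1 by simp
 show ?thesis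
 proof (intro exI[of _ "K * A + K\<^sup>2 * A"] conjI allI impI)
  show "0 < K * A + K\<^sup>2 * A" using K A1 by (simp add: add_pos_pos)
  fix R :: "('a, 'm) ring_scheme" and h \<beta> x i
  assume em: "embedded R n h \<beta>" and mono: "\<forall>i j. i \<le> j --> j < n --> x i \<le> x j"
   and eq: "\<forall>j<n. \<forall>k<n. h k (\<beta> j) = scaled x b j k" and i: "i < n"
  interpret embedded R n h \<beta> by (rule em)
  have Bv: "vnorm n (B j) = 2 ^ x j * vnorm n (b j)" if "j < n" for j
  proof -
   have "vnorm n (B j) = vnorm n (\<lambda>k. 2 ^ x j * b j k)" using eq that by (intro vnorm_cong) (auto simp: vec_def scaled_def)
   then show ?thesis by (simp add: vnorm_scale norm_power)
  qed
  have Br: "vnorm n (rcomb n B z) = vnorm n (rcomb n b (\<lambda>j. 2 ^ x j * z j))" for z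
   using eq by (intro vnorm_cong) (auto simp: rcomb_def vec_def scaled_def mult_ac intro!: sum.cong)
  have orth: "\<bar>z j\<bar> * vnorm n (B j) \<le> K * vnorm n (rcomb n B z)" if j: "j < n" for z j
  proof -
   have "\<bar>z j\<bar> * vnorm n (B j) = \<bar>2 ^ x j * z j\<bar> * vnorm n (b j)" by (simp add: Bv[OF j] abs_mult)
   also have "\<dots> \<le> (K0 * vnorm n (rcomb n b (\<lambda>j. 2 ^ x j * z j))) * A"
    using K0(2)[OF j, of "\<lambda>j. 2 ^ x j * z j"] bA(1)[OF j] K0(1) by (intro mult_mono) auto
   also have "\<dots> = (K0 * A) * vnorm n (rcomb n B z)" unfolding Br by (simp only: mult_ac)
   also have "\<dots> \<le> K * vnorm n (rcomb n B z)" using KK(1) by (intro mult_right_mono) auto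
   finally show ?thesis .
  qed
  have mo: "vnorm n (B i) \<le> K * vnorm n (B j)" if ij: "i \<le> j" "j < n" for i j
  proof -
   have "vnorm n (b i) \<le> A * (A * vnorm n (b j))"
    using bA(1)[of i] bA'[OF ij(2)] ij A0 mult_left_mono[of 1 "A * vnorm n (b j)" A] by linarith
   also have "\<dots> = (A * A) * vnorm n (b j)" by (simp only: mult_ac)
   also have "\<dots> \<le> K * vnorm n (b j)" using KK(2) by (intro mult_right_mono) auto
   finally have "2 ^ x i * vnorm n (b i) \<le> 2 ^ x j * (K * vnorm n (b j))"
    using mono ij by (intro mult_mono power_increasing) auto
   then show ?thesis using Bv ij by (simp add: mult_ac)
  qed
  have sb: "sqrt (real n) * succ_min n R i \<le> K * vnorm n (B i)" "vnorm n (B i) \<le> K\<^sup>2 * (sqrt (real n) * succ_min n R i)"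
   by (rule succ_min_bounds(1)[OF i K orth mo], assumption+, rule succ_min_bounds(2)[OF i K orth mo], assumption+)
  have s: "0 \<le> sqrt (real n) * succ_min n R i"
  proof -
   have "0 \<le> K\<^sup>2 * (sqrt (real n) * succ_min n R i)" using sb(2) vnorm_nonneg[of n "B i"] by linarith
   then show ?thesis using K by (simp add: zero_le_mult_iff)
  qed
  have "sqrt (real n) * succ_min n R i \<le> K * (2 ^ x i * A)"
   using sb(1) K bA(1)[OF i] unfolding Bv[OF i] by (elim order_trans) simp
  moreover have "0 \<le> K\<^sup>2 * A * 2 ^ x i" using A0 by simp
  ultimately show "sqrt (real n) * succ_min n R i \<le> (K * A + K\<^sup>2 * A) * 2 ^ x i" by (simp add: algebra_simps)
  have "2 ^ x i * 1 \<le> 2 ^ x i * (A * vnorm n (b i))" using bA'[OF i] by (intro mult_left_mono) auto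
  also have "\<dots> = A * vnorm n (B i)" by (simp add: Bv[OF i])
  also have "\<dots> \<le> A * (K\<^sup>2 * (sqrt (real n) * succ_min n R i))" using sb(2) A0 by (intro mult_left_mono)
  finally have "2 ^ x i \<le> K\<^sup>2 * A * (sqrt (real n) * succ_min n R i)" by (simp add: mult_ac)
  moreover have "0 \<le> K * A * (sqrt (real n) * succ_min n R i)" using K A0 s by simp
  ultimately show "2 ^ x i \<le> (K * A + K\<^sup>2 * A) * (sqrt (real n) * succ_min n R i)" by (simp add: distrib_right)
 qed
qed

lemma ratio_limit:
 fixes u v :: "nat => real"
 assumes u: "\<And>t. t0 \<le> t ==> \<bar>u t - real t * A\<bar> \<le> c" and v: "\<And>t. t0 \<le> t ==> \<bar>v t - real t * B\<bar> \<le> c" and B: "0 < B"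
 shows "(\<lambda>t. u t / v t) \<longlonglongrightarrow> A / B"
proof -
 have lim: "(\<lambda>t. w t / real t) \<longlonglongrightarrow> E" if w: "\<And>t. t0 \<le> t ==> \<bar>w t - real t * E\<bar> \<le> c" for w :: "nat => real" and E
 proof -
  have "(\<lambda>t. w t / real t - E) \<longlonglongrightarrow> 0"
  proof (rule Lim_null_comparison)
   show "\<forall>\<^sub>F t in sequentially. norm (w t / real t - E) \<le> c / real t"
   proof (rule eventually_sequentiallyI[of "max 1 t0"])
    fix t :: nat assume t: "max 1 t0 \<le> t"
    have "w t / real t - E = (w t - real t * E) / real t" using t by (simp add: field_simps)
    then have "norm (w t / real t - E) = \<bar>w t - real t * E\<bar> / real t" by simp
    then show "norm (w t / real t - E) \<le> c / real t" using w[of t] t by (simp add: divide_right_mono)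
   qed
   show "(\<lambda>t. c / real t) \<longlonglongrightarrow> 0" by (rule lim_const_over_n)
  qed
  then show ?thesis by (simp add: LIM_zero_iff)
 qed
 have "(\<lambda>t. (u t / real t) / (v t / real t)) \<longlonglongrightarrow> A / B"
  using lim[OF u] lim[OF v] B by (intro tendsto_divide) auto
 moreover have "\<forall>\<^sub>F t in sequentially. (u t / real t) / (v t / real t) = u t / v t"
  by (rule eventually_sequentiallyI[of 1]) simp
 ultimately show ?thesis by (rule Lim_transform_eventually)
qed

lemma ln_close:
 fixes K c s :: real
 assumes K: "0 < K" and c: "0 < c" and s: "c * s \<le> K * 2 ^ x" "2 ^ x \<le> K * (c * s)" and r: "\<bar>real x - t * l\<bar> \<le> 4"
 shows "\<bar>ln s - t * (l * ln 2)\<bar> \<le> \<bar>ln K\<bar> + \<bar>ln c\<bar> + 4 * ln 2"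
proof -
 have "0 < K * (c * s)" using s(2) by (rule less_le_trans[rotated]) simp
 then have s0: "0 < s" using K c by (simp add: zero_less_mult_iff)
 have "ln (c * s) \<le> ln (K * 2 ^ x)" using s(1) s0 K c by (subst ln_le_cancel_iff) auto
 moreover have "ln (2 ^ x) \<le> ln (K * (c * s))" using s(2) s0 K c by (subst ln_le_cancel_iff) auto
 ultimately have "\<bar>ln s - real x * ln 2\<bar> \<le> \<bar>ln K\<bar> + \<bar>ln c\<bar>" using s0 K c by (simp add: ln_mult ln_realpow)
 moreover have "\<bar>real x * ln 2 - t * (l * ln 2)\<bar> \<le> 4 * ln 2"
 proof -
  have "real x * ln 2 - t * (l * ln 2) = (real x - t * l) * ln 2" by (simp add: algebra_simps)
  then show ?thesis using r by (simp add: abs_mult)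
 qed
 ultimately show ?thesis by linarith
qed

text \<open>At time \<open>t\<close> the discriminant has logarithm about \<open>t * ln 2\<close>,
  so dividing by it turns the other estimates into convergence to \<open>q\<close>.\<close>

definition tracks :: "(nat => nat) set => real^5 => real => nat => quartic_pair => bool" where
 "tracks G q c t P \<longleftrightarrow> P \<in> G_pairs G \<and> \<bar>ln (real_of_int \<bar>ring_disc 4 (fst P)\<bar>) - real t * ln 2\<bar> \<le> c \<and>
   (\<forall>i\<in>{1,2,3}. \<bar>ln (succ_min 4 (fst P) i) - real t * (lc q i * ln 2)\<bar> \<le> c) \<and>
   (\<forall>k\<in>{1,2}. \<bar>ln (succ_min 3 (snd P) k) - real t * (mc q k * ln 2)\<bar> \<le> c)"

text \<open>The exponents are the integer parts of \<open>t\<close> times the coordinates of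
  \<open>q\<close>, except that the last one is forced by the covolume relation. The slack
  \<open>\<delta>\<close> absorbs all rounding errors once \<open>t * \<delta>\<close> is at least
  8.\<close>

lemma ex_tracks:
 assumes qp: "qpair b w" and \<delta>: "0 < \<delta>" and q: "0 \<le> q $ 1" "q $ 1 \<le> q $ 2" "q $ 2 \<le> q $ 3" "0 \<le> q $ 4" "q $ 4 + \<delta> \<le> q $ 5"
  "q $ 1 + q $ 2 + q $ 3 = 1 / 2" "q $ 4 + q $ 5 = 1 / 2"
  and N: "\<And>i j k. (i, j, k) \<in> pattern b w ==> mc q k + \<delta> \<le> lc q i + lc q j"
 shows "\<exists>c t0. \<forall>t\<ge>t0. \<exists>P. tracks (lgal b) q c t P"
proof -
 interpret q: qpair b w by (rule qp)
 obtain K where K: "K > 0" "\<And>(R :: nat ring) h \<beta> x. embedded R 4 h \<beta> ==> (\<forall>i j. i \<le> j --> j < 4 --> x i \<le> x j) ==>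
   (\<forall>j<4. \<forall>k<4. h k (\<beta> j) = scaled x b j k) ==>
   (\<forall>i<4. sqrt (real 4) * succ_min 4 R i \<le> K * 2 ^ x i \<and> 2 ^ x i \<le> K * (sqrt (real 4) * succ_min 4 R i))"
  using scaled_succ_min[OF q.nzb, where ?'a = nat and ?'m = unit] by metis
 obtain K' where K': "K' > 0" "\<And>(C :: ((nat => complex) list => complex) ring) h \<beta> x. embedded C 3 h \<beta> ==> (\<forall>i j. i \<le> j --> j < 3 --> x i \<le> x j) ==>
   (\<forall>j<3. \<forall>k<3. h k (\<beta> j) = scaled x w j k) ==>
   (\<forall>i<3. sqrt (real 3) * succ_min 3 C i \<le> K' * 2 ^ x i \<and> 2 ^ x i \<le> K' * (sqrt (real 3) * succ_min 3 C i))"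
  using scaled_succ_min[OF q.nzw, where ?'a = "(nat => complex) list => complex" and ?'m = unit] by metis
 define E where "E = cmod ((edet 4 b)\<^sup>2)"
 have E: "0 < E" using q.nzb by (simp add: E_def)
 define c where "c = \<bar>ln K\<bar> + \<bar>ln (sqrt (real 4))\<bar> + 4 * ln 2 + (\<bar>ln K'\<bar> + \<bar>ln (sqrt (real 3))\<bar> + 4 * ln 2) + (\<bar>ln E\<bar> + 6 * ln 2)"
 define t0 where "t0 = nat \<lceil>8 / \<delta>\<rceil>"
 have "\<exists>P. tracks (lgal b) q c t P" if t: "t0 \<le> t" for t
 proof -
  have t\<delta>: "8 \<le> real t * \<delta>"
  proof -
   have "8 / \<delta> \<le> real t" using t by (simp add: t0_def nat_le_iff ceiling_le_iff)
   then show ?thesis using \<delta> by (simp add: pos_divide_le_eq)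
  qed
  define x where "x = (\<lambda>i::nat. if i = 0 then 0 else nat \<lfloor>real t * lc q i\<rfloor>)"
  have fl: "real (nat \<lfloor>r\<rfloor>) \<le> r" "r < real (nat \<lfloor>r\<rfloor>) + 1" if "0 \<le> r" for r :: real using that by linarith+
  have lq: "lc q i \<ge> 0" for i using q by (simp add: lc_def)
  have x: "real (x i) \<le> real t * lc q i" "real t * lc q i < real (x i) + 1" if "i ~= 0" for i
   using that fl[of "real t * lc q i"] lq[of i] by (simp_all add: x_def)
  define y1 where "y1 = nat \<lfloor>real t * q $ 4\<rfloor>"
  have y1: "real y1 \<le> real t * q $ 4" "real t * q $ 4 < real y1 + 1" using fl[of "real t * q $ 4"] q by (simp_all add: y1_def)
  have lq': "lc q 1 = q $ 1" "lc q 2 = q $ 2" "lc q 3 = q $ 3" "mc q 1 = q $ 4" "mc q 2 = q $ 5" by (simp_all add: lc_def mc_def)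
  have xs: "real (x 1) \<le> real t * q $ 1" "real t * q $ 1 < real (x 1) + 1" "real (x 2) \<le> real t * q $ 2" "real t * q $ 2 < real (x 2) + 1"
    "real (x 3) \<le> real t * q $ 3" "real t * q $ 3 < real (x 3) + 1"
   using x[of 1] x[of 2] x[of 3] unfolding lq' by auto
  have st: "real t * q $ 1 + real t * q $ 2 + real t * q $ 3 = real t / 2" "real t * q $ 4 + real t * q $ 5 = real t / 2"
   using arg_cong[OF q(6), of "\<lambda>z. real t * z"] arg_cong[OF q(7), of "\<lambda>z. real t * z"] by (simp_all add: distrib_left)
  have q45: "real t * q $ 4 + real t * \<delta> \<le> real t * q $ 5" using mult_left_mono[OF q(5), of "real t"] by (simp add: distrib_left)
  have y1x: "real y1 + 4 \<le> real (x 1 + x 2 + x 3) - real y1" using xs y1 st q45 t\<delta> by simp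
  \<comment> \<open>\<open>y 2\<close> is determined by the covolume relation; its error combines
    the rounding errors of the other four exponents and stays below 4.\<close>
  define y where "y = (\<lambda>k::nat. if k = 0 then 0 else if k = 1 then y1 else x 1 + x 2 + x 3 - y1)"
  have yy: "y 0 = 0" "y 1 = y1" "y 2 = x 1 + x 2 + x 3 - y1" by (simp_all add: y_def)
  have y2: "real (y 2) = real (x 1 + x 2 + x 3) - real y1" unfolding yy using y1x by (subst of_nat_diff) linarith+
  have yk: "\<bar>real (y k) - real t * mc q k\<bar> \<le> 4" if "k \<in> {1, 2}" for k
   using that y1 xs st y2 by (auto simp: lq' yy(2) simp del: yy(3))
  have xi: "\<bar>real (x i) - real t * lc q i\<bar> \<le> 4" if "i \<in> {1, 2, 3}" for i using x[of i] that by auto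
  have sum: "x 1 + x 2 + x 3 = y 1 + y 2" using y1x by (simp add: yy)
  have y12: "y 1 \<le> y 2" using y1x by (simp add: yy)
  have pat: "y k \<le> x i + x j" if ijk: "(i, j, k) \<in> pattern b w" for i j k
  proof -
   from ijk have m: "i \<in> {1, 2, 3}" "j \<in> {1, 2, 3}" "k \<in> {1, 2}" using pattern_subset[of b w] by auto
   have "real t * mc q k + real t * \<delta> \<le> real t * lc q i + real t * lc q j"
    using mult_left_mono[OF N[OF ijk], of "real t"] by (simp add: distrib_left)
   moreover have "real t * lc q i < real (x i) + 1" "real t * lc q j < real (x j) + 1" using x m by auto
   ultimately have "real (y k) \<le> real (x i) + real (x j)" using yk[OF m(3)] t\<delta> by linarith
   then show "y k \<le> x i + x j" by linarith
  qed
  have x0: "x 0 = 0" by (simp add: x_def)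
  have mon: "nat \<lfloor>real t * u\<rfloor> \<le> nat \<lfloor>real t * v\<rfloor>" if "u \<le> v" for u v
   using that by (intro nat_mono floor_mono mult_left_mono) auto
  have x12: "x 1 \<le> x 2" "x 2 \<le> x 3" using mon[OF q(2)] mon[OF q(3)] by (simp_all add: x_def lq')
  have xm: "\<forall>i j. i \<le> j --> j < 4 --> x i \<le> x j"
  proof (intro allI impI)
   fix i j :: nat assume "i \<le> j" "j < 4"
   then have "i = j \<or> i = 0 \<or> (i = 1 \<and> j = 2) \<or> (i = 1 \<and> j = 3) \<or> (i = 2 \<and> j = 3)" by arith
   then show "x i \<le> x j" using x0 x12 by auto
  qed
  have ym: "\<forall>i j. i \<le> j --> j < 3 --> y i \<le> y j"
  proof (intro allI impI)
   fix i j :: nat assume "i \<le> j" "j < 3"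
   then have "i = j \<or> i = 0 \<or> (i = 1 \<and> j = 2)" by arith
   then show "y i \<le> y j" using yy(1) y12 by auto
  qed
  have "qpair (scaled x b) (scaled y w)" using q.qpair_scaled[OF x0 yy(1) sum y12 pat] .
  from realize[OF this] obtain R C h \<beta> s \<omega> where r: "(R, C) \<in> G_pairs (lgal b)" "pair_data (lgal b) R C h \<beta> s \<omega>"
   "\<forall>j<4. \<forall>k<4. h k (\<beta> j) = scaled x b j k" "\<forall>j<3. \<forall>k<3. s k (\<omega> j) = scaled y w j k"
   unfolding lgal_scaled by blast
  interpret R: embedded R 4 h \<beta> using r(2) by (simp add: pair_data_def)
  interpret C: embedded C 3 s \<omega> using r(2) by (simp add: pair_data_def)
  note A = K(2)[OF R.embedded_axioms xm r(3)] and A' = K'(2)[OF C.embedded_axioms ym r(4)]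
  have "edet 4 R.B = edet 4 (scaled x b)" using r(3) by (intro edet_cong) (auto simp: R.vec_def)
  then have "of_int (ring_disc 4 R) = (2 ^ (x 1 + x 2 + x 3) * edet 4 b)\<^sup>2" using R.ring_disc_eq by (simp add: edet_4_scaled x0)
  then have "cmod (of_int (ring_disc 4 R)) = 2 ^ (2 * (x 1 + x 2 + x 3)) * E"
   by (simp add: E_def norm_mult norm_power power_mult_distrib power_mult[symmetric] mult.commute)
  then have D: "real_of_int \<bar>ring_disc 4 R\<bar> = 2 ^ (2 * (x 1 + x 2 + x 3)) * E" by simp
  have ab: "0 \<le> \<bar>ln K\<bar> + \<bar>ln (sqrt (real 4))\<bar> + 4 * ln 2" "0 \<le> \<bar>ln K'\<bar> + \<bar>ln (sqrt (real 3))\<bar> + 4 * ln 2" "0 \<le> \<bar>ln E\<bar> + 6 * ln 2" by simp_all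
  have lD: "ln (real_of_int \<bar>ring_disc 4 R\<bar>) = real (2 * (x 1 + x 2 + x 3)) * ln 2 + ln E"
   unfolding D using E by (simp add: ln_mult ln_realpow)
  \<comment> \<open>The discriminant is the square of the determinant, and this factor 2 cancels the
    coordinate sum 1/2 of \<open>q\<close>.\<close>
  have "\<bar>real (2 * (x 1 + x 2 + x 3)) - real t\<bar> \<le> 6" using xs st by simp
  then have "\<bar>(real (2 * (x 1 + x 2 + x 3)) - real t) * ln 2\<bar> \<le> 6 * ln 2" by (simp only: abs_mult) (simp add: mult_right_mono)
  then have "\<bar>ln (real_of_int \<bar>ring_disc 4 R\<bar>) - real t * ln 2\<bar> \<le> \<bar>ln E\<bar> + 6 * ln 2"
   unfolding lD left_diff_distrib by linarith
  then have 1: "\<bar>ln (real_of_int \<bar>ring_disc 4 R\<bar>) - real t * ln 2\<bar> \<le> c" unfolding c_def using ab by linarith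
  have 2: "\<bar>ln (succ_min 4 R i) - real t * (lc q i * ln 2)\<bar> \<le> c" if "i \<in> {1, 2, 3}" for i
  proof -
   have "i < 4" using that by auto
   then have "\<bar>ln (succ_min 4 R i) - real t * (lc q i * ln 2)\<bar> \<le> \<bar>ln K\<bar> + \<bar>ln (sqrt (real 4))\<bar> + 4 * ln 2"
    using A xi[OF that] K(1) by (intro ln_close) auto
   then show ?thesis unfolding c_def using ab by linarith
  qed
  have 3: "\<bar>ln (succ_min 3 C k) - real t * (mc q k * ln 2)\<bar> \<le> c" if "k \<in> {1, 2}" for k
  proof -
   have "k < 3" using that by auto
   then have "\<bar>ln (succ_min 3 C k) - real t * (mc q k * ln 2)\<bar> \<le> \<bar>ln K'\<bar> + \<bar>ln (sqrt (real 3))\<bar> + 4 * ln 2"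
    using A' yk[OF that] K'(1) by (intro ln_close) auto
   then show ?thesis unfolding c_def using ab by linarith
  qed
  have "tracks (lgal b) q c t (R, C)" unfolding tracks_def fst_conv snd_conv using r(1) 1 2 3 by blast
  then show ?thesis ..
 qed
 then show ?thesis by blast
qed

lemma tracks_limit:
 assumes P: "\<And>t. t0 \<le> t ==> tracks G q c t (P t)"
 shows "(\<lambda>t. min_point (P t)) \<longlonglongrightarrow> q"
proof (rule vec_tendstoI)
 fix i :: 5
 note T = P[unfolded tracks_def]
 note ps = min_point_simps[of "fst (P t)" "snd (P t)" for t, unfolded prod.collapse]
 have l: "(\<lambda>t. ln (succ_min 4 (fst (P t)) i) / ln (real_of_int \<bar>ring_disc 4 (fst (P t))\<bar>)) \<longlonglongrightarrow> (lc q i * ln 2) / ln 2" if "i \<in> {1, 2, 3}" for i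
  using T that by (intro ratio_limit[where c = c and ?t0.0 = t0]) auto
 have m: "(\<lambda>t. ln (succ_min 3 (snd (P t)) i) / ln (real_of_int \<bar>ring_disc 4 (fst (P t))\<bar>)) \<longlonglongrightarrow> (mc q i * ln 2) / ln 2" if "i \<in> {1, 2}" for i
  using T that by (intro ratio_limit[where c = c and ?t0.0 = t0]) auto
 have "\<forall>i::5. (\<lambda>t. min_point (P t) $ i) \<longlonglongrightarrow> q $ i"
  using l[of 1] l[of 2] l[of 3] m[of 1] m[of 2] unfolding forall_5 ps by (simp add: lc_def mc_def)
 then show "(\<lambda>t. min_point (P t) $ i) \<longlonglongrightarrow> q $ i" by blast
qed

lemma pair_iso_refl: "P \<in> G_pairs G ==> (P, P) \<in> pair_iso G"
proof -
 assume P: "P \<in> G_pairs G"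
 obtain R C where RC: "P = (R, C)" by (cases P)
 have id: "(\<lambda>x. x) \<in> ring_iso S S" for S :: "('a, 'b) ring_scheme" by (auto simp: ring_iso_def Ring.ring_hom_def bij_betw_def)
 have "\<exists>f\<in>ring_iso R R. \<exists>g\<in>ring_iso C C. \<forall>x\<in>carrier R. g (resolvent_map R x) = resolvent_map R (f x)"
  by (rule bexI[OF _ id[of R]], rule bexI[OF _ id[of C]]) simp
 then show ?thesis using P unfolding RC pair_iso_def by simp
qed

text \<open>The discriminant is constant on isomorphism classes, so it factors through the
  quotient.\<close>

lemma finite_discs:
 assumes A: "A \<subseteq> G_pairs G" and fin: "finite (A // pair_iso G)"
 shows "finite ((\<lambda>P. ring_disc 4 (fst P)) ` A)"
proof (rule finite_subset)
 define g where "g = (\<lambda>c. ring_disc 4 (fst (SOME Q :: quartic_pair. Q \<in> c)))"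
 show "finite (g ` (A // pair_iso G))" using fin by simp
 show "(\<lambda>P. ring_disc 4 (fst P)) ` A \<subseteq> g ` (A // pair_iso G)"
 proof (rule image_subsetI)
  fix P assume P: "P \<in> A"
  define Q where "Q = (SOME Q. Q \<in> pair_iso G `` {P})"
  have "P \<in> pair_iso G `` {P}" using pair_iso_refl A P by blast
  then have "Q \<in> pair_iso G `` {P}" unfolding Q_def by (rule someI)
  then have "ring_disc 4 (fst P) = ring_disc 4 (fst Q)" using pair_iso_disc by (cases P; cases Q) auto
  then have "ring_disc 4 (fst P) = g (pair_iso G `` {P})" by (simp add: g_def Q_def)
  then show "ring_disc 4 (fst P) \<in> g ` (A // pair_iso G)" using quotientI[OF P] by blast
 qed
qed

text \<open>The discriminants along the sequence are unbounded, whereas finitely many classes near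
  \<open>q\<close> would allow only finitely many discriminants.\<close>

lemma tracks_limit_point:
 assumes P: "\<And>t. t0 \<le> t ==> tracks G q c t (P t)"
 shows "q \<in> P4 G"
 unfolding P4_def mem_Collect_eq
proof (intro allI impI notI)
 fix \<epsilon> :: real assume \<epsilon>: "0 < \<epsilon>"
 let ?A = "{P \<in> G_pairs G. dist (min_point P) q < \<epsilon>}"
 assume "finite (?A // pair_iso G)"
 then have fin: "finite ((\<lambda>P. ln (real_of_int \<bar>ring_disc 4 (fst P)\<bar>)) ` ?A)"
  using finite_discs[of ?A G] finite_imageI[of "(\<lambda>P. ring_disc 4 (fst P)) ` ?A" "\<lambda>d. ln (real_of_int \<bar>d\<bar>)"]
  by (simp add: image_image)
 define M where "M = Max (insert 0 ((\<lambda>P. ln (real_of_int \<bar>ring_disc 4 (fst P)\<bar>)) ` ?A))"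
 have M: "ln (real_of_int \<bar>ring_disc 4 (fst P)\<bar>) \<le> M" if "P \<in> ?A" for P
  unfolding M_def using fin that by (intro Max_ge) auto
 obtain t1 where t1: "\<And>t. t1 \<le> t ==> dist (min_point (P t)) q < \<epsilon>"
  using tendstoD[OF tracks_limit[of t0 G q c P, OF P] \<epsilon>] by (auto simp: eventually_sequentially)
 obtain t2 :: nat where t2: "(M + c + 1) / ln 2 \<le> real t2" using real_arch_simple by blast
 define t where "t = max t0 (max t1 t2)"
 have t: "t0 \<le> t" "t1 \<le> t" "t2 \<le> t" by (auto simp: t_def)
 have T: "tracks G q c t (P t)" by (rule P[OF t(1)])
 have "P t \<in> ?A" using T t1[OF t(2)] by (simp add: tracks_def)
 from M[OF this] have "real t * ln 2 - c \<le> M" using T unfolding tracks_def by linarith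
 moreover have "M + c + 1 \<le> real t * ln 2"
 proof -
  have "(M + c + 1) / ln 2 \<le> real t" using t2 t(3) by linarith
  then show ?thesis by (simp add: pos_divide_le_eq)
 qed
 ultimately show False by linarith
qed

lemma centre_simps: "centre $ 1 = 1/6 - 1/100" "centre $ 2 = 1/6" "centre $ 3 = 1/6 + 1/100" "centre $ 4 = 1/4 - 1/100" "centre $ 5 = 1/4 + 1/100"
 by (simp_all add: centre_def)

text \<open>A limit of limit points is a limit point; here the approach to \<open>p\<close> is along
  a segment.\<close>

lemma P4_closed_ray:
 assumes "\<And>s. 0 < s ==> s \<le> 1 ==> p + s *\<^sub>R v \<in> P4 G"
 shows "p \<in> P4 G"
 unfolding P4_def mem_Collect_eq
proof (intro allI impI)
 fix \<epsilon> :: real assume \<epsilon>: "0 < \<epsilon>"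
 define s where "s = min 1 (\<epsilon> / (2 * (norm v + 1)))"
 have nv: "0 < norm v + 1" using norm_ge_zero[of v] by linarith
 have s: "0 < s" "s \<le> 1" using \<epsilon> nv by (simp_all add: s_def)
 have "s \<le> \<epsilon> / (2 * (norm v + 1))" by (simp add: s_def)
 then have "s * (2 * (norm v + 1)) \<le> \<epsilon>" using nv by (simp add: pos_le_divide_eq)
 then have d: "dist (p + s *\<^sub>R v) p \<le> \<epsilon> / 2" using s by (simp add: dist_norm algebra_simps)
 let ?q = "p + s *\<^sub>R v"
 let ?A = "{P \<in> G_pairs G. dist (min_point P) ?q < \<epsilon> / 2}" and ?B = "{P \<in> G_pairs G. dist (min_point P) p < \<epsilon>}"
 have "\<forall>e>0. infinite ({P \<in> G_pairs G. dist (min_point P) ?q < e} // pair_iso G)"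
  using assms[OF s] unfolding P4_def mem_Collect_eq .
 then have "infinite (?A // pair_iso G)" using \<epsilon> half_gt_zero by blast
 moreover have "?A \<subseteq> ?B"
 proof
  fix P assume "P \<in> ?A"
  then show "P \<in> ?B" using dist_triangle[of "min_point P" p ?q] d by simp
 qed
 then have "?A // pair_iso G \<subseteq> ?B // pair_iso G" unfolding quotient_def by blast
 ultimately show "infinite (?B // pair_iso G)" using finite_subset by blast
qed

text \<open>Every point of the cell is approached along the segment to \<open>centre\<close>, whose
  inner points have the positive slack that \<open>ex_tracks\<close> requires.\<close>

theorem P4_lower:
 assumes N: "N \<in> realizable G"
 shows "cell N \<subseteq> P4 G"
proof
 fix p assume p: "p \<in> cell N"
 obtain b w where bw: "qpair b w" "lgal b = G" "pattern b w = N" using N by (auto simp: realizable_def)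
 show "p \<in> P4 G"
 proof (rule P4_closed_ray[where v = "centre - p"])
  fix s :: real assume s: "0 < s" "s \<le> 1"
  define q where "q = p + s *\<^sub>R (centre - p)"
  have qi: "q $ i = (1 - s) * (p $ i) + s * (centre $ i)" for i by (simp add: q_def algebra_simps)
  have lm: "lc q i = (1 - s) * lc p i + s * lc centre i" "mc q i = (1 - s) * mc p i + s * mc centre i" for i
   by (auto simp: lc_def mc_def qi)
  \<comment> \<open>\<open>centre\<close> satisfies each inequality in question with slack at least
    1/100, so a convex combination with weight \<open>s\<close> keeps the slack
    \<open>s / 100\<close>.\<close>
  have mono: "(1 - s) * u + s * a + s / 100 \<le> (1 - s) * v + s * a'" if "u \<le> v" "a + 1 / 100 \<le> a'" for u v a a'
  proof -
   have "(1 - s) * u \<le> (1 - s) * v" using s that(1) by (intro mult_left_mono) auto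
   moreover have "s * (a + 1 / 100) \<le> s * a'" using s that(2) by (intro mult_left_mono) auto
   ultimately show ?thesis by (simp add: distrib_left)
  qed
  have pc: "0 \<le> p $ 1" "p $ 1 \<le> p $ 2" "p $ 2 \<le> p $ 3" "0 \<le> p $ 4" "p $ 4 \<le> p $ 5" "p $ 1 + p $ 2 + p $ 3 = 1 / 2" "p $ 4 + p $ 5 = 1 / 2"
   using p by (auto simp: cell_def)
  have s100: "0 < s / 100" using s by simp
  have 1: "0 \<le> q $ 1" using mono[of 0 "p $ 1" 0 "centre $ 1"] pc s unfolding qi by (simp add: centre_simps)
  have 4: "0 \<le> q $ 4" using mono[of 0 "p $ 4" 0 "centre $ 4"] pc s unfolding qi by (simp add: centre_simps)
  have 2: "q $ 1 \<le> q $ 2" using mono[of "p $ 1" "p $ 2" "centre $ 1" "centre $ 2"] pc s100 unfolding qi by (simp add: centre_simps)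
  have 3: "q $ 2 \<le> q $ 3" using mono[of "p $ 2" "p $ 3" "centre $ 2" "centre $ 3"] pc s100 unfolding qi by (simp add: centre_simps)
  have 5: "q $ 4 + s / 100 \<le> q $ 5" using mono[of "p $ 4" "p $ 5" "centre $ 4" "centre $ 5"] pc unfolding qi by (simp add: centre_simps)
  have 6: "q $ 1 + q $ 2 + q $ 3 = 1 / 2"
  proof -
   have "q $ 1 + q $ 2 + q $ 3 = (1 - s) * (p $ 1 + p $ 2 + p $ 3) + s * (1 / 2)" unfolding qi by (simp add: centre_simps algebra_simps)
   then show ?thesis unfolding pc(6) by (simp add: algebra_simps)
  qed
  have 7: "q $ 4 + q $ 5 = 1 / 2"
  proof -
   have "q $ 4 + q $ 5 = (1 - s) * (p $ 4 + p $ 5) + s * (1 / 2)" unfolding qi by (simp add: centre_simps algebra_simps)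
   then show ?thesis unfolding pc(7) by (simp add: algebra_simps)
  qed
  have 8: "mc q k + s / 100 \<le> lc q i + lc q j" if "(i, j, k) \<in> pattern b w" for i j k
  proof -
   have "mc p k \<le> lc p i + lc p j" using p that bw(3) by (auto simp: cell_def)
   moreover have "mc centre k + 1 / 100 \<le> lc centre i + lc centre j" by (simp add: lc_def mc_def centre_simps)
   ultimately have "(1 - s) * mc p k + s * mc centre k + s / 100 \<le> (1 - s) * (lc p i + lc p j) + s * (lc centre i + lc centre j)"
    by (rule mono)
   then show ?thesis unfolding lm by (simp add: algebra_simps)
  qed
  obtain c t0 where "\<forall>t\<ge>t0. \<exists>P. tracks G q c t P"
   using ex_tracks[OF bw(1) s100 1 2 3 4 5 6 7 8] unfolding bw(2) by blast
  then obtain P where "\<And>t. t0 \<le> t ==> tracks G q c t (P t)" by metis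
  then have "q \<in> P4 G" by (rule tracks_limit_point)
  then show "p + s *\<^sub>R (centre - p) \<in> P4 G" by (simp add: q_def)
 qed
qed

theorem P4_eq: "P4 G = \<Union> (cell ` realizable G)"
 using P4_upper P4_lower by blast

section \<open>Extension of field embeddings\<close>

text \<open>Closure under \<open>inverse\<close> can be stated for all elements, since
  \<open>inverse 0 = 0\<close>.\<close>

definition fld :: "complex set => bool" where
 "fld F \<longleftrightarrow> 1 \<in> F \<and> (\<forall>x\<in>F. \<forall>y\<in>F. x + y \<in> F \<and> x * y \<in> F) \<and> (\<forall>x\<in>F. - x \<in> F \<and> inverse x \<in> F)"

definition fhom :: "complex set => (complex => complex) => bool" where
 "fhom F \<tau> \<longleftrightarrow> \<tau> 1 = 1 \<and> (\<forall>x\<in>F. \<forall>y\<in>F. \<tau> (x + y) = \<tau> x + \<tau> y \<and> \<tau> (x * y) = \<tau> x * \<tau> y)"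

lemma fldD:
 assumes "fld F"
 shows "1 \<in> F" "x \<in> F ==> y \<in> F ==> x + y \<in> F" "x \<in> F ==> y \<in> F ==> x * y \<in> F" "x \<in> F ==> - x \<in> F"
  "x \<in> F ==> inverse x \<in> F" "0 \<in> F" "x \<in> F ==> y \<in> F ==> x - y \<in> F" "of_nat m \<in> F" "of_int k \<in> F"
proof -
 show 1: "1 \<in> F" and a: "\<And>x y. x \<in> F ==> y \<in> F ==> x + y \<in> F" and "x \<in> F ==> y \<in> F ==> x * y \<in> F" and n: "\<And>x. x \<in> F ==> - x \<in> F"
  and "x \<in> F ==> inverse x \<in> F" using assms by (auto simp: fld_def)
 show 0: "0 \<in> F" using a[OF 1 n[OF 1]] by simp
 show "x - y \<in> F" if "x \<in> F" "y \<in> F" using a[OF that(1) n[OF that(2)]] by simp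
 show nat: "of_nat m \<in> F" for m by (induction m) (auto intro: 0 1 a)
 show "of_int k \<in> F" using nat[of "nat k"] n[OF nat[of "nat (- k)"]] by (cases "0 \<le> k") auto
qed

lemma fld_sum: "fld F ==> (\<And>i. i \<in> A ==> f i \<in> F) ==> sum f A \<in> F"
 by (induction A rule: infinite_finite_induct) (auto intro: fldD)

lemma fld_power: "fld F ==> x \<in> F ==> x ^ n \<in> F"
 by (induction n) (auto intro: fldD)

lemma fhomD:
 assumes F: "fld F" and \<tau>: "fhom F \<tau>"
 shows "\<tau> 1 = 1" "x \<in> F ==> y \<in> F ==> \<tau> (x + y) = \<tau> x + \<tau> y" "x \<in> F ==> y \<in> F ==> \<tau> (x * y) = \<tau> x * \<tau> y"
  "\<tau> 0 = 0" "x \<in> F ==> \<tau> (- x) = - \<tau> x" "x \<in> F ==> y \<in> F ==> \<tau> (x - y) = \<tau> x - \<tau> y"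
  "\<tau> (of_int k) = of_int k" "x \<in> F ==> \<tau> (x ^ n) = \<tau> x ^ n" "x \<in> F ==> \<tau> x = 0 ==> x = 0"
  "x \<in> F ==> \<tau> (inverse x) = inverse (\<tau> x)"
proof -
 show 1: "\<tau> 1 = 1" and a: "\<And>x y. x \<in> F ==> y \<in> F ==> \<tau> (x + y) = \<tau> x + \<tau> y" and m: "\<And>x y. x \<in> F ==> y \<in> F ==> \<tau> (x * y) = \<tau> x * \<tau> y"
  using \<tau> by (auto simp: fhom_def)
 show z: "\<tau> 0 = 0" using a[OF fldD(6)[OF F] fldD(6)[OF F]] by simp
 show n: "\<tau> (- x) = - \<tau> x" if "x \<in> F" for x using a[OF that fldD(4)[OF F that]] z by (simp add: eq_neg_iff_add_eq_0 add.commute)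
 show "\<tau> (x - y) = \<tau> x - \<tau> y" if "x \<in> F" "y \<in> F" using a[OF that(1) fldD(4)[OF F that(2)]] n[OF that(2)] by simp
 have nat: "\<tau> (of_nat k) = of_nat k" for k by (induction k) (auto simp: z 1 a fldD[OF F])
 show "\<tau> (of_int k) = of_int k"
  using nat[of "nat k"] nat[of "nat (- k)"] n[OF fldD(8)[OF F, of "nat (- k)"]] by (cases "0 \<le> k") auto
 show "\<tau> (x ^ n) = \<tau> x ^ n" if "x \<in> F" using that by (induction n) (auto simp: 1 m fld_power[OF F])
 show i0: "x = 0" if "x \<in> F" "\<tau> x = 0" for x
 proof (rule ccontr)
  assume "x ~= 0"
  then have "\<tau> (x * inverse x) = 1" using 1 by simp
  then show False using m[OF that(1) fldD(5)[OF F that(1)]] that(2) by simp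
 qed
 show "\<tau> (inverse x) = inverse (\<tau> x)" if "x \<in> F"
 proof (cases "x = 0")
  case False
  then have "\<tau> x * \<tau> (inverse x) = 1" using m[OF that fldD(5)[OF F that]] 1 by simp
  then show ?thesis by (metis inverse_unique)
 qed (simp add: z)
qed

lemma fhom_sum: "fld F ==> fhom F \<tau> ==> (\<And>i. i \<in> A ==> f i \<in> F) ==> \<tau> (sum f A) = (\<Sum>i\<in>A. \<tau> (f i))"
 by (induction A rule: infinite_finite_induct) (auto simp: fhomD fld_sum)

definition FP :: "complex set => complex poly set" where
 "FP F = {P. \<forall>i. Polynomial.coeff P i \<in> F}"

lemma FP_closed:
 assumes F: "fld F"
 shows "0 \<in> FP F" "1 \<in> FP F" "P \<in> FP F ==> Q \<in> FP F ==> P + Q \<in> FP F" "P \<in> FP F ==> Q \<in> FP F ==> P - Q \<in> FP F"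
  "P \<in> FP F ==> Q \<in> FP F ==> P * Q \<in> FP F" "P \<in> FP F ==> - P \<in> FP F" "a \<in> F ==> [:a:] \<in> FP F" "[:0, 1:] \<in> FP F"
  "a \<in> F ==> Polynomial.monom a n \<in> FP F"
 using fldD[OF F] by (auto simp: FP_def Polynomial.coeff_mult Polynomial.coeff_pCons Polynomial.coeff_monom when_def coeff_1 intro!: fld_sum[OF F] fldD(3)[OF F] split: nat.splits)

lemma map_poly_fhom:
 assumes F: "fld F" and \<tau>: "fhom F \<tau>" and PQ: "P \<in> FP F" "Q \<in> FP F"
 shows "map_poly \<tau> (P + Q) = map_poly \<tau> P + map_poly \<tau> Q" "map_poly \<tau> (P * Q) = map_poly \<tau> P * map_poly \<tau> Q"
  "map_poly \<tau> (P - Q) = map_poly \<tau> P - map_poly \<tau> Q"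
 using PQ by (auto intro!: poly_eqI simp: coeff_map_poly fhomD[OF F \<tau>] FP_def Polynomial.coeff_mult fhom_sum[OF F \<tau>] fldD(3)[OF F])

text \<open>Long division is carried out explicitly to see that quotient and remainder keep their
  coefficients in \<open>F\<close>.\<close>

lemma FP_divide:
 assumes F: "fld F" and m: "m \<in> FP F" "m ~= 0" and P: "P \<in> FP F"
 shows "\<exists>q\<in>FP F. \<exists>r\<in>FP F. P = m * q + r \<and> (r = 0 \<or> Polynomial.degree r < Polynomial.degree m)"
 using P
proof (induction "Polynomial.degree P" arbitrary: P rule: less_induct)
 case less
 show ?case
 proof (cases "P = 0 \<or> Polynomial.degree P < Polynomial.degree m")
  case True
  then show ?thesis using FP_closed[OF F] less(2) by (intro bexI[of _ 0] bexI[of _ P]) auto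
 next
  case False
  define n where "n = Polynomial.degree P - Polynomial.degree m"
  define a where "a = Polynomial.lead_coeff P * inverse (Polynomial.lead_coeff m)"
  define M where "M = Polynomial.monom a n"
  have "a \<in> F" using less(2) m by (auto simp: a_def FP_def intro!: fldD[OF F])
  then have M: "M \<in> FP F" unfolding M_def by (rule FP_closed[OF F])
  have a0: "a ~= 0" using False m by (simp add: a_def)
  then have dM: "Polynomial.degree M = n" "Polynomial.lead_coeff M = a" "M ~= 0" by (auto simp: M_def degree_monom_eq)
  have dmM: "Polynomial.degree (m * M) = Polynomial.degree P" using dM m False by (simp add: degree_mult_eq n_def)
  moreover have "Polynomial.lead_coeff (m * M) = Polynomial.lead_coeff P" using m dM by (simp add: lead_coeff_mult a_def)
  ultimately have "Polynomial.coeff (P - m * M) (Polynomial.degree P) = 0" by simp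
  moreover have "Polynomial.degree (P - m * M) \<le> Polynomial.degree P" using dmM by (simp add: degree_diff_le)
  ultimately have lt: "P - m * M = 0 \<or> Polynomial.degree (P - m * M) < Polynomial.degree P" by (rule eq_zero_or_degree_less[rotated])
  have PM: "P - m * M \<in> FP F" using less(2) m M by (intro FP_closed[OF F])
  have "\<exists>q\<in>FP F. \<exists>r\<in>FP F. P - m * M = m * q + r \<and> (r = 0 \<or> Polynomial.degree r < Polynomial.degree m)"
  proof (cases "P - m * M = 0")
   case True
   then show ?thesis using FP_closed[OF F] by (intro bexI[of _ 0] bexI[of _ 0]) auto
  next
   case False
   then show ?thesis using less(1)[OF _ PM] lt by blast
  qed
  then obtain q r where qr: "q \<in> FP F" "r \<in> FP F" "P - m * M = m * q + r" "r = 0 \<or> Polynomial.degree r < Polynomial.degree m" by blast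
  have "P = m * (q + M) + r" using qr(3) by (simp add: algebra_simps)
  moreover have "q + M \<in> FP F" using qr(1) M by (rule FP_closed[OF F])
  ultimately show ?thesis using qr by blast
 qed
qed

lemma ex_minimal_FP:
 assumes "P0 \<in> FP F" "P0 ~= 0" "poly P0 \<alpha> = 0"
 shows "\<exists>m\<in>FP F. m ~= 0 \<and> poly m \<alpha> = 0 \<and> (\<forall>P\<in>FP F. poly P \<alpha> = 0 --> P ~= 0 --> Polynomial.degree m \<le> Polynomial.degree P)"
proof -
 let ?A = "\<lambda>P. P \<in> FP F \<and> P ~= 0 \<and> poly P \<alpha> = 0"
 have "?A (ARG_MIN Polynomial.degree P. ?A P) \<and> (\<forall>P. ?A P --> Polynomial.degree (ARG_MIN Polynomial.degree P. ?A P) \<le> Polynomial.degree P)"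
  by (rule arg_min_nat_lemma[of ?A P0]) (use assms in simp)
 then show ?thesis by blast
qed

text \<open>Let \<open>m\<close> have least degree among the nonzero polynomials vanishing at
  \<open>\<alpha>\<close>. Dividing, \<open>m = P * q + r\<close> shows that
  \<open>P * q = - r\<close> at \<open>\<alpha>\<close>, so an inverse of the value of
  \<open>r\<close> yields one for \<open>P\<close>, and the degree has dropped.\<close>

lemma extension_fld:
 assumes F: "fld F" and P0: "P0 \<in> FP F" "P0 ~= 0" "poly P0 \<alpha> = 0"
 shows "fld {poly P \<alpha> | P. P \<in> FP F}" (is "fld ?E")
proof -
 note cl = FP_closed[OF F]
 obtain m where m: "m \<in> FP F" "m ~= 0" "poly m \<alpha> = 0"
  and min: "\<And>P. P \<in> FP F ==> poly P \<alpha> = 0 ==> P ~= 0 ==> Polynomial.degree m \<le> Polynomial.degree P"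
  using ex_minimal_FP[OF P0] by blast
 have inv: "inverse (poly P \<alpha>) \<in> ?E" if "P \<in> FP F" "P ~= 0" "Polynomial.degree P < Polynomial.degree m" for P
  using that
 proof (induction "Polynomial.degree P" arbitrary: P rule: less_induct)
  case less
  show ?case
  proof (cases "Polynomial.degree P = 0")
   case True
   then obtain a where a: "P = [:a:]" by (rule degree_eq_zeroE)
   then have "a \<in> F" using less(2) by (auto simp: FP_def dest: spec[of _ 0])
   then have "[:inverse a:] \<in> FP F" by (intro cl fldD[OF F])
   moreover have "inverse (poly P \<alpha>) = poly [:inverse a:] \<alpha>" by (simp add: a)
   ultimately show ?thesis by blast
  next
   case False
   obtain q r where qr: "q \<in> FP F" "r \<in> FP F" "m = P * q + r" "r = 0 \<or> Polynomial.degree r < Polynomial.degree P"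
    using FP_divide[OF F less(2,3) m(1)] by blast
   have P\<alpha>: "poly P \<alpha> ~= 0" using min[OF less(2)] less(3,4) by auto
   have r0: "r ~= 0"
   proof
    assume r: "r = 0"
    then have mq: "m = P * q" using qr(3) by simp
    then have q0: "q ~= 0" "poly q \<alpha> = 0" using m P\<alpha> by auto
    have "Polynomial.degree m = Polynomial.degree P + Polynomial.degree q" using mq q0 less(3) by (simp add: degree_mult_eq)
    then show False using min[OF qr(1) q0(2,1)] False by simp
   qed
   then have dr: "Polynomial.degree r < Polynomial.degree P" using qr(4) by simp
   then have "inverse (poly r \<alpha>) \<in> ?E" using less(1)[OF dr qr(2) r0] less(4) by simp
   then obtain s where s: "s \<in> FP F" "inverse (poly r \<alpha>) = poly s \<alpha>" by auto
   have r\<alpha>: "poly r \<alpha> = - (poly P \<alpha> * poly q \<alpha>)" using m(3) qr(3) by (simp add: eq_neg_iff_add_eq_0 add.commute)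
   have "poly r \<alpha> ~= 0" using min[OF qr(2)] r0 dr less(4) by auto
   then have "inverse (poly P \<alpha>) = poly (- (q * s)) \<alpha>" using P\<alpha> unfolding poly_minus poly_mult s(2)[symmetric] r\<alpha> by (simp add: field_simps)
   moreover have "- (q * s) \<in> FP F" using qr(1) s(1) by (intro cl)
   ultimately show ?thesis by blast
  qed
 qed
 have E: "poly P \<alpha> \<in> ?E" if "P \<in> FP F" for P using that by blast
 have invE: "inverse (poly P \<alpha>) \<in> ?E" if P: "P \<in> FP F" for P
 proof (cases "poly P \<alpha> = 0")
  case True
  then show ?thesis using E[OF cl(1)] by simp
 next
  case False
  obtain q r where qr: "q \<in> FP F" "r \<in> FP F" "P = m * q + r" "r = 0 \<or> Polynomial.degree r < Polynomial.degree m"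
   using FP_divide[OF F m(1,2) P] by blast
  have Pr: "poly P \<alpha> = poly r \<alpha>" using qr(3) m(3) by simp
  then have "r ~= 0" using False by auto
  then show ?thesis unfolding Pr using inv qr by blast
 qed
 show ?thesis unfolding fld_def
 proof (intro conjI ballI)
  show "1 \<in> ?E" using E[OF cl(2)] by simp
  fix x assume "x \<in> ?E"
  then obtain P where P: "P \<in> FP F" "x = poly P \<alpha>" by blast
  show "- x \<in> ?E" "inverse x \<in> ?E" using E[OF cl(6)[OF P(1)]] invE[OF P(1)] P(2) by simp_all
  fix y assume "y \<in> ?E"
  then obtain Q where Q: "Q \<in> FP F" "y = poly Q \<alpha>" by blast
  show "x + y \<in> ?E" "x * y \<in> ?E" using E[OF cl(3)[OF P(1) Q(1)]] E[OF cl(5)[OF P(1) Q(1)]] P(2) Q(2) by simp_all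
 qed
qed

text \<open>A value of a polynomial at \<open>\<alpha>\<close> is sent to the value of the
  transported polynomial at \<open>\<beta>\<close>; the hypothesis on \<open>\<beta>\<close> makes
  this independent of the polynomial chosen.\<close>

lemma extend_hom:
 assumes F: "fld F" and \<tau>: "fhom F \<tau>" and P0: "P0 \<in> FP F" "P0 ~= 0" "poly P0 \<alpha> = 0"
  and \<beta>: "\<And>P. P \<in> FP F ==> poly P \<alpha> = 0 ==> poly (map_poly \<tau> P) \<beta> = 0"
 shows "\<exists>E \<sigma>'. fld E \<and> F \<subseteq> E \<and> \<alpha> \<in> E \<and> fhom E \<sigma>' \<and> (\<forall>x\<in>F. \<sigma>' x = \<tau> x) \<and> \<sigma>' \<alpha> = \<beta>"
proof -
 define E where "E = {poly P \<alpha> | P. P \<in> FP F}"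
 define g where "g x = (SOME P. P \<in> FP F \<and> poly P \<alpha> = x)" for x
 define s where "s x = poly (map_poly \<tau> (g x)) \<beta>" for x
 note cl = FP_closed[OF F] and mp = map_poly_fhom[OF F \<tau>]
 have sP: "s (poly P \<alpha>) = poly (map_poly \<tau> P) \<beta>" if P: "P \<in> FP F" for P
 proof -
  have g: "g (poly P \<alpha>) \<in> FP F \<and> poly (g (poly P \<alpha>)) \<alpha> = poly P \<alpha>" unfolding g_def by (rule someI) (use P in simp)
  have "poly (map_poly \<tau> (g (poly P \<alpha>) - P)) \<beta> = 0" using g P by (intro \<beta> cl) auto
  then show ?thesis using mp(3)[OF conjunct1[OF g] P] by (simp add: s_def)
 qed
 have E: "fld E" unfolding E_def by (rule extension_fld[OF F P0])
 moreover have cF: "poly [:a:] \<alpha> = a" "[:a:] \<in> FP F" if "a \<in> F" for a using cl(7)[OF that] by simp_all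
 moreover have "F \<subseteq> E"
 proof
  fix a assume "a \<in> F"
  then show "a \<in> E" unfolding E_def mem_Collect_eq using cF by (intro exI[of _ "[:a:]"]) simp
 qed
 moreover have "\<alpha> \<in> E" unfolding E_def mem_Collect_eq using cl(8) by (intro exI[of _ "[:0, 1:]"]) simp
 moreover have t0: "\<tau> 0 = 0" "\<tau> 1 = 1" using fhomD[OF F \<tau>] by auto
 moreover have "s a = \<tau> a" if "a \<in> F" for a using sP[OF cF(2)[OF that]] t0 by (simp add: map_poly_pCons)
 moreover have "s \<alpha> = \<beta>" using sP[OF cl(8)] t0 by (simp add: map_poly_pCons)
 moreover have "fhom E s" unfolding fhom_def
 proof (intro conjI ballI)
  show "s 1 = 1" using sP[OF cl(2)] t0 by simp
  fix x y assume "x \<in> E" "y \<in> E"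
  then obtain P Q where PQ: "P \<in> FP F" "x = poly P \<alpha>" "Q \<in> FP F" "y = poly Q \<alpha>" by (auto simp: E_def)
  show "s (x + y) = s x + s y"
   using sP[OF cl(3)[OF PQ(1,3)]] sP[OF PQ(1)] sP[OF PQ(3)] mp(1)[OF PQ(1,3)] PQ by simp
  show "s (x * y) = s x * s y"
   using sP[OF cl(5)[OF PQ(1,3)]] sP[OF PQ(1)] sP[OF PQ(3)] mp(2)[OF PQ(1,3)] PQ by simp
 qed
 ultimately show ?thesis by blast
qed

text \<open>The target is algebraically closed: transport a polynomial of least degree vanishing at
  \<open>\<alpha>\<close> along \<open>\<tau>\<close> and take any of its roots as the image of
  \<open>\<alpha>\<close>.\<close>

lemma ex_extension:
 assumes F: "fld F" and \<tau>: "fhom F \<tau>" and P0: "P0 \<in> FP F" "P0 ~= 0" "poly P0 \<alpha> = 0"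
 shows "\<exists>E s. fld E \<and> F \<subseteq> E \<and> \<alpha> \<in> E \<and> fhom E s \<and> (\<forall>x\<in>F. s x = \<tau> x)"
proof -
 obtain m where m: "m \<in> FP F" "m ~= 0" "poly m \<alpha> = 0"
  and min: "\<And>P. P \<in> FP F ==> poly P \<alpha> = 0 ==> P ~= 0 ==> Polynomial.degree m \<le> Polynomial.degree P"
  using ex_minimal_FP[OF P0] by blast
 have lc: "\<tau> (Polynomial.lead_coeff m) ~= 0" using fhomD(9)[OF F \<tau>, of "Polynomial.lead_coeff m"] m by (auto simp: FP_def)
 have dm: "Polynomial.degree m ~= 0"
 proof
  assume "Polynomial.degree m = 0"
  then obtain a where "m = [:a:]" by (rule degree_eq_zeroE)
  then show False using m by simp
 qed
 have "Polynomial.degree (map_poly \<tau> m) = Polynomial.degree m"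
  by (rule map_poly_degree_eq) (use lc in simp)
 then have "\<not> constant (poly (map_poly \<tau> m))" using dm by (simp add: constant_degree)
 then obtain \<beta> where \<beta>: "poly (map_poly \<tau> m) \<beta> = 0" using fundamental_theorem_of_algebra by blast
 have "poly (map_poly \<tau> P) \<beta> = 0" if P: "P \<in> FP F" "poly P \<alpha> = 0" for P
 proof -
  obtain q r where qr: "q \<in> FP F" "r \<in> FP F" "P = m * q + r" "r = 0 \<or> Polynomial.degree r < Polynomial.degree m"
   using FP_divide[OF F m(1,2) P(1)] by blast
  have "poly r \<alpha> = 0" using P(2) qr(3) m(3) by simp
  then have "r = 0" using min[OF qr(2)] qr(4) by (meson not_le)
  then show ?thesis using qr(3) map_poly_fhom(2)[OF F \<tau> m(1) qr(1)] \<beta> by simp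
 qed
 from extend_hom[OF F \<tau> P0 this] show ?thesis by blast
qed

text \<open>Let \<open>i\<close> be the first index at which \<open>p\<close> does not divide the
  coefficient of \<open>a\<close>. Modulo \<open>p\<close>, the coefficient of \<open>q\<close>
  there is that of \<open>a\<close> times the constant term of \<open>b\<close>, so \<open>i\<close>
  is at least the degree of \<open>q\<close>, which leaves degree 0 for \<open>b\<close>.\<close>

lemma eisenstein_aux:
 fixes q a b :: "int poly"
 assumes p: "normalization_semidom_class.prime p" and q: "Polynomial.lead_coeff q = 1" "\<And>i. i < Polynomial.degree q ==> p dvd Polynomial.coeff q i"
  and ab: "q = a * b" "p dvd Polynomial.coeff a 0" "\<not> p dvd Polynomial.coeff b 0"
 shows "b dvd 1"
proof -
 have lc: "Polynomial.lead_coeff a * Polynomial.lead_coeff b = 1" using q(1) ab(1) lead_coeff_mult[of a b] by simp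
 have nz: "a ~= 0" "b ~= 0" using lc by auto
 have "\<not> p dvd Polynomial.lead_coeff a"
 proof
  assume "p dvd Polynomial.lead_coeff a"
  then have "p dvd 1" using lc dvd_mult2 by metis
  then show False using p not_prime_unit by blast
 qed
 then have ex: "\<not> p dvd Polynomial.coeff a (Polynomial.degree a)" .
 define i where "i = (LEAST i. \<not> p dvd Polynomial.coeff a i)"
 have i: "\<not> p dvd Polynomial.coeff a i" "i \<le> Polynomial.degree a" unfolding i_def
  by (rule LeastI[of "\<lambda>i. \<not> p dvd Polynomial.coeff a i", OF ex], rule Least_le[of "\<lambda>i. \<not> p dvd Polynomial.coeff a i", OF ex])
 have lt: "p dvd Polynomial.coeff a j" if "j < i" for j using not_less_Least[OF that[unfolded i_def]] by simp
 have "Polynomial.coeff q i = (\<Sum>j\<le>i. Polynomial.coeff a j * Polynomial.coeff b (i - j))" by (simp add: ab(1) Polynomial.coeff_mult)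
 also have "\<dots> = (\<Sum>j<i. Polynomial.coeff a j * Polynomial.coeff b (i - j)) + Polynomial.coeff a i * Polynomial.coeff b 0"
  by (simp add: lessThan_Suc_atMost[symmetric])
 finally have eq: "Polynomial.coeff q i = \<dots>" .
 have "\<not> p dvd Polynomial.coeff q i"
 proof
  assume "p dvd Polynomial.coeff q i"
  moreover have "p dvd (\<Sum>j<i. Polynomial.coeff a j * Polynomial.coeff b (i - j))" using lt by (intro dvd_sum) auto
  ultimately have "p dvd Polynomial.coeff a i * Polynomial.coeff b 0" unfolding eq by (simp add: dvd_add_right_iff)
  then show False using p i(1) ab(3) by (simp add: prime_dvd_mult_iff)
 qed
 then have "Polynomial.degree q \<le> i" using q(2) by (meson not_le)
 moreover have "Polynomial.degree q = Polynomial.degree a + Polynomial.degree b" using ab(1) nz by (simp add: degree_mult_eq)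
 ultimately have "Polynomial.degree b = 0" using i(2) by linarith
 then obtain c where c: "b = [:c:]" by (rule degree_eq_zeroE)
 then have "Polynomial.lead_coeff a * c = 1" using lc by simp
 then have "c dvd 1" by (metis dvd_triv_right)
 then show ?thesis unfolding c by (simp add: is_unit_const_poly_iff)
qed

text \<open>Exactly one factor has a constant term divisible by \<open>p\<close>, and the other one
  is then a unit. Irreducible elements are prime because integer polynomials form a factorial
  ring.\<close>

lemma eisenstein_prime_elem:
 fixes q :: "int poly"
 assumes p: "normalization_semidom_class.prime p" and q: "Polynomial.lead_coeff q = 1" "0 < Polynomial.degree q" "\<And>i. i < Polynomial.degree q ==> p dvd Polynomial.coeff q i"
  "\<not> p\<^sup>2 dvd Polynomial.coeff q 0"
 shows "prime_elem q"
proof (rule factorial_semiring_class.irreducible_imp_prime_elem, rule comm_semiring_1_class.irreducibleI)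
 show "q ~= 0" using q(2) by auto
 show "\<not> q dvd 1" using q(2) by (auto simp: is_unit_poly_iff)
 fix a b assume ab: "q = a * b"
 then have c0: "Polynomial.coeff q 0 = Polynomial.coeff a 0 * Polynomial.coeff b 0" by (simp add: Polynomial.coeff_mult)
 then have "p dvd Polynomial.coeff a 0 * Polynomial.coeff b 0" using q(2,3) by metis
 then have "p dvd Polynomial.coeff a 0 \<or> p dvd Polynomial.coeff b 0" using p by (simp add: prime_dvd_mult_iff)
 moreover have "\<not> (p dvd Polynomial.coeff a 0 \<and> p dvd Polynomial.coeff b 0)"
  using q(4) unfolding c0 power2_eq_square by (auto intro: mult_dvd_mono)
 ultimately show "a dvd 1 \<or> b dvd 1"
  using eisenstein_aux[OF p q(1,3) ab] eisenstein_aux[OF p q(1,3) ab[unfolded mult.commute[of a b]]] by blast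
qed

abbreviation ipoly :: "int poly => complex => complex" where
 "ipoly P x \<equiv> poly (map_poly of_int P) x"

lemma ipoly_simps: "ipoly (P * Q) x = ipoly P x * ipoly Q x" "ipoly (P + Q) x = ipoly P x + ipoly Q x" "ipoly (Polynomial.smult c P) x = of_int c * ipoly P x"
proof -
 have "map_poly of_int (P * Q) = (map_poly of_int P * map_poly of_int Q :: complex poly)"
  by (rule poly_eqI) (simp add: coeff_map_poly Polynomial.coeff_mult)
 moreover have "map_poly of_int (P + Q) = (map_poly of_int P + map_poly of_int Q :: complex poly)"
  by (rule poly_eqI) (simp add: coeff_map_poly)
 moreover have "map_poly of_int (Polynomial.smult c P) = (Polynomial.smult (of_int c) (map_poly of_int P) :: complex poly)"
  by (rule poly_eqI) (simp add: coeff_map_poly)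
 ultimately show "ipoly (P * Q) x = ipoly P x * ipoly Q x" "ipoly (P + Q) x = ipoly P x + ipoly Q x" "ipoly (Polynomial.smult c P) x = of_int c * ipoly P x"
  by simp_all
qed

text \<open>An integer polynomial \<open>m\<close> of least degree with root \<open>z\<close>
  replaces the minimal polynomial, by pseudo-division. Primality and a count of degrees give
  \<open>q dvd m\<close>; hence \<open>q\<close> divides a constant multiple of \<open>P\<close>,
  and it cannot divide the constant.\<close>

lemma prime_elem_root:
 fixes q P :: "int poly"
 assumes q: "prime_elem q" "0 < Polynomial.degree q" and z: "ipoly q z = 0" and P: "ipoly P z = 0"
 shows "q dvd P"
proof -
 let ?A = "\<lambda>P :: int poly. P ~= 0 \<and> ipoly P z = 0"
 have A: "?A q" using q z by auto
 define m where "m = (ARG_MIN Polynomial.degree P. ?A P)"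
 have m: "?A m" and min: "\<And>P. ?A P ==> Polynomial.degree m \<le> Polynomial.degree P"
  using arg_min_nat_lemma[of ?A q, OF A] unfolding m_def by blast+
 have m0: "m ~= 0" and mz: "ipoly m z = 0" using m by auto
 have div: "\<exists>c g. c ~= 0 \<and> Polynomial.smult c f = m * g" if "ipoly f z = 0" for f
 proof -
  obtain g r where gr: "pseudo_divmod f m = (g, r)" by (cases "pseudo_divmod f m")
  define c where "c = Polynomial.lead_coeff m ^ (Suc (Polynomial.degree f) - Polynomial.degree m)"
  have d: "Polynomial.smult c f = m * g + r" "r = 0 \<or> Polynomial.degree r < Polynomial.degree m"
   using pseudo_divmod[OF m0 gr] by (simp_all add: c_def)
  have "ipoly (Polynomial.smult c f) z = ipoly (m * g + r) z" using d(1) by simp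
  then have "ipoly r z = 0" using that mz by (simp add: ipoly_simps)
  then have "r = 0" using min[of r] d(2) by (meson not_le)
  moreover have "c ~= 0" using m0 by (simp add: c_def)
  ultimately show ?thesis using d(1) by (intro exI[of _ c] exI[of _ g]) simp
 qed
 have cst: "\<not> q dvd [:c:]" if "c ~= 0" for c
  using dvd_imp_degree_le[of q "[:c:]"] q(2) that by auto
 obtain c g where cg: "c ~= 0" "Polynomial.smult c q = m * g" using div[OF z] by blast
 have "q dvd m * g" unfolding cg(2)[symmetric] by (rule dvd_smult) simp
 then have "q dvd m \<or> q dvd g" using q(1) by (simp add: prime_elem_dvd_mult_iff)
 moreover have "\<not> q dvd g"
 proof
  assume qg: "q dvd g"
  have g0: "g ~= 0" using cg q by auto
  have "Polynomial.degree q \<le> Polynomial.degree g" by (rule dvd_imp_degree_le[OF qg g0])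
  moreover have "Polynomial.degree q = Polynomial.degree m + Polynomial.degree g"
   using arg_cong[OF cg(2), of Polynomial.degree] cg(1) m0 g0 by (simp add: degree_mult_eq)
  ultimately have "Polynomial.degree m = 0" by simp
  then obtain a where "m = [:a:]" by (rule degree_eq_zeroE)
  then show False using m0 mz by (simp add: map_poly_pCons)
 qed
 ultimately have qm: "q dvd m" by blast
 obtain c g where cg: "c ~= 0" "Polynomial.smult c P = m * g" using div[OF P] by blast
 have "q dvd [:c:] * P" using qm cg(2) by simp
 then show ?thesis using q(1) cst[OF cg(1)] by (simp only: prime_elem_dvd_mult_iff) blast
qed

lemma fld_Rats: "fld (\<rat> :: complex set)"
 by (auto simp: fld_def)

lemma Rats_poly: "P \<in> FP \<rat> ==> \<exists>c Q. c ~= 0 \<and> Polynomial.smult (of_int c) P = map_poly of_int Q"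
proof (induction P)
 case 0
 then show ?case by (intro exI[of _ 1] exI[of _ 0]) simp
next
 case (pCons a P)
 have aP: "a \<in> \<rat>" "P \<in> FP \<rat>"
 proof -
  have *: "Polynomial.coeff (pCons a P) i \<in> \<rat>" for i using pCons(3) by (simp add: FP_def)
  show "a \<in> \<rat>" using *[of 0] by simp
  show "P \<in> FP \<rat>" unfolding FP_def using *[of "Suc i" for i] by simp
 qed
 obtain c Q where cQ: "c ~= 0" "Polynomial.smult (of_int c) P = map_poly of_int Q" using pCons(2)[OF aP(2)] by blast
 obtain u v :: int where uv: "v ~= 0" "a = of_int u / of_int v" using aP(1) by (metis Rats_cases' less_irrefl)
 have "Polynomial.smult (of_int (v * c)) (pCons a P) = pCons (of_int (c * u)) (Polynomial.smult (of_int v) (map_poly of_int Q))"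
  using uv cQ(2)[symmetric] by simp
 also have "\<dots> = map_poly of_int (pCons (c * u) (Polynomial.smult v Q))" by (simp add: map_poly_pCons map_poly_smult)
 finally show ?case using uv(1) cQ(1) by (intro exI[of _ "v * c"] exI) auto
qed

text \<open>After clearing denominators, a rational polynomial that vanishes at \<open>z\<close> is
  a multiple of \<open>q\<close>, so it vanishes at \<open>z'\<close> too; this is the condition for
  extending the identity of the rationals.\<close>

lemma conjugate_hom:
 assumes q: "prime_elem q" "0 < Polynomial.degree q" and z: "ipoly q z = 0" "ipoly q z' = 0"
 shows "\<exists>E s. fld E \<and> z \<in> E \<and> fhom E s \<and> s z = z'"
proof -
 have id: "fhom \<rat> (\<lambda>x. x)" by (simp add: fhom_def)
 have Fq: "map_poly of_int q \<in> FP \<rat>" by (simp add: FP_def coeff_map_poly)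
 have "map_poly of_int q ~= (0 :: complex poly)" 
 proof
  assume "map_poly of_int q = (0 :: complex poly)"
  then have "Polynomial.coeff (map_poly of_int q :: complex poly) (Polynomial.degree q) = 0" by simp
  then show False using q(2) by (auto simp: coeff_map_poly)
 qed
 moreover have "poly (map_poly (\<lambda>x. x) P) z' = 0" if "P \<in> FP \<rat>" "poly P z = 0" for P
 proof -
  obtain c Q where cQ: "c ~= 0" "Polynomial.smult (of_int c) P = map_poly of_int Q" using Rats_poly[OF \<open>P \<in> FP \<rat>\<close>] by blast
  have Q: "ipoly Q x = of_int c * poly P x" for x unfolding cQ(2)[symmetric] by simp
  then have "q dvd Q" using that by (intro prime_elem_root[OF q z(1)]) simp
  then obtain g where "Q = q * g" by (rule dvdE)
  then have "ipoly Q z' = 0" using z(2) by (simp add: ipoly_simps)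
  then show ?thesis using Q[of z'] cQ(1) by (simp add: map_poly_id')
 qed
 ultimately show ?thesis using extend_hom[OF fld_Rats id Fq _ z(1), of z'] by blast
qed

section \<open>Quartic polynomials\<close>

text \<open>The integers \<open>e1\<close> to \<open>e4\<close> are the elementary symmetric
  functions of the roots \<open>r\<close>.\<close>

definition quart :: "(nat => complex) => int => int => int => int => bool" where
 "quart r e1 e2 e3 e4 \<longleftrightarrow> inj_on r {..<4} \<and>
   (\<forall>x. (\<Prod>k<4. x - r k) = x ^ 4 - of_int e1 * x ^ 3 + of_int e2 * x\<^sup>2 - of_int e3 * x + of_int e4)"

lemma prod_less_four: "(\<Prod>i<4. f i) = f 0 * f 1 * f 2 * f (3::nat)" for f :: "nat => complex"
 by (simp add: numeral_eq_Suc One_nat_def)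

lemma vieta:
 assumes "quart r e1 e2 e3 e4"
 shows "r 0 + r 1 + r 2 + r 3 = of_int e1"
  "r 0 * r 1 + r 0 * r 2 + r 0 * r 3 + r 1 * r 2 + r 1 * r 3 + r 2 * r 3 = of_int e2"
  "r 0 * r 1 * r 2 + r 0 * r 1 * r 3 + r 0 * r 2 * r 3 + r 1 * r 2 * r 3 = of_int e3"
  "r 0 * r 1 * r 2 * r 3 = of_int e4"
proof -
 define u1 where "u1 = r 0 + r 1 + r 2 + r 3 - of_int e1"
 define u2 where "u2 = r 0 * r 1 + r 0 * r 2 + r 0 * r 3 + r 1 * r 2 + r 1 * r 3 + r 2 * r 3 - of_int e2"
 define u3 where "u3 = r 0 * r 1 * r 2 + r 0 * r 1 * r 3 + r 0 * r 2 * r 3 + r 1 * r 2 * r 3 - of_int e3"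
 define u4 where "u4 = r 0 * r 1 * r 2 * r 3 - of_int e4"
 have "- (u1 * x ^ 3) + u2 * x\<^sup>2 - u3 * x + u4 = 0" for x
 proof -
  have "(x - r 0) * (x - r 1) * (x - r 2) * (x - r 3) = x ^ 4 - of_int e1 * x ^ 3 + of_int e2 * x\<^sup>2 - of_int e3 * x + of_int e4"
   using assms prod_less_four[of "\<lambda>k. x - r k"] by (simp add: quart_def)
  moreover have "- (u1 * x ^ 3) + u2 * x\<^sup>2 - u3 * x + u4 = (x - r 0) * (x - r 1) * (x - r 2) * (x - r 3) -
    (x ^ 4 - of_int e1 * x ^ 3 + of_int e2 * x\<^sup>2 - of_int e3 * x + of_int e4)"
   unfolding u1_def u2_def u3_def u4_def power4_eq_xxxx power3_eq_cube power2_eq_square by (simp add: algebra_simps)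
  ultimately show ?thesis by simp
 qed
 \<comment> \<open>The difference of the two quartics has degree at most 3, so four evaluations
   determine its coefficients.\<close>
 from this[of 0] this[of 1] this[of "- 1"] this[of 2]
 have u: "u4 = 0" "- u1 + u2 - u3 + u4 = 0" "u1 + u2 + u3 + u4 = 0" "- (u1 * 8) + u2 * 4 - u3 * 2 + u4 = 0" by simp_all
 have "2 * u2 = (- u1 + u2 - u3 + u4) + (u1 + u2 + u3 + u4) - 2 * u4" by (simp add: algebra_simps)
 then have "2 * u2 = 0 + 0 - 2 * u4" by (simp only: u(2,3))
 then have 2: "u2 = 0" using u(1) by simp
 have "6 * u1 = - (- (u1 * 8) + u2 * 4 - u3 * 2 + u4) - 2 * (u1 + u2 + u3 + u4) + 6 * u2 + 3 * u4" by (simp add: algebra_simps)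
 then have "6 * u1 = - 0 - 2 * 0 + 6 * u2 + 3 * u4" by (simp only: u(3,4))
 then have 1: "u1 = 0" using u(1) 2 by simp
 have 3: "u3 = 0" using u 1 2 by simp
 show "r 0 + r 1 + r 2 + r 3 = of_int e1"
  "r 0 * r 1 + r 0 * r 2 + r 0 * r 3 + r 1 * r 2 + r 1 * r 3 + r 2 * r 3 = of_int e2"
  "r 0 * r 1 * r 2 + r 0 * r 1 * r 3 + r 0 * r 2 * r 3 + r 1 * r 2 * r 3 = of_int e3"
  "r 0 * r 1 * r 2 * r 3 = of_int e4"
  using u(1) 1 2 3 by (simp_all add: u1_def u2_def u3_def u4_def)
qed

text \<open>The first identity is the cubic resolvent equation of \<open>t\<close>. The others
  express \<open>phi\<close> and \<open>phib\<close> at powers of the roots as integral polynomials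
  in \<open>t\<close>, which places them in the lattice of powers of \<open>t\<close>.\<close>

lemma resolvent_identities:
 fixes a b c d :: complex
 assumes e1: "a + b + c + d = e1" and e2: "a * b + a * c + a * d + b * c + b * d + c * d = e2"
  and e3: "a * b * c + a * b * d + a * c * d + b * c * d = e3" and e4: "a * b * c * d = e4" and t: "a * b + c * d = t"
 shows "t ^ 3 = e2 * t\<^sup>2 - (e1 * e3 - 4 * e4) * t - (4 * e2 * e4 - e1\<^sup>2 * e4 - e3\<^sup>2)"
  "a\<^sup>2 * b\<^sup>2 + c\<^sup>2 * d\<^sup>2 = t\<^sup>2 - 2 * e4"
  "a ^ 3 * b ^ 3 + c ^ 3 * d ^ 3 = t ^ 3 - 3 * e4 * t"
  "a * b\<^sup>2 + b * a\<^sup>2 + c * d\<^sup>2 + d * c\<^sup>2 = e1 * t - e3"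
  "a * b ^ 3 + b * a ^ 3 + c * d ^ 3 + d * c ^ 3 = (e1 * t - e3) * e1 - (e2 - t) * t - 2 * (t\<^sup>2 - 2 * e4)"
  "a\<^sup>2 * b ^ 3 + b\<^sup>2 * a ^ 3 + c\<^sup>2 * d ^ 3 + d\<^sup>2 * c ^ 3 = (e1 * t - e3) * t - e4 * e1"
  "a\<^sup>2 + b\<^sup>2 + c\<^sup>2 + d\<^sup>2 = e1\<^sup>2 - 2 * e2"
  "a ^ 3 + b ^ 3 + c ^ 3 + d ^ 3 = e1 ^ 3 - 3 * e1 * e2 + 3 * e3"
 unfolding assms[symmetric] power3_eq_cube power2_eq_square by (simp_all add: algebra_simps)

lemma edet_3_powers: "edet 3 (\<lambda>j k. t k ^ j) = (t 1 - t 0) * (t 2 - t 0) * (t 2 - t 1)"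
 unfolding edet_3 D3_def by (simp add: algebra_simps power2_eq_square)

lemma edet_4_powers: "edet 4 (\<lambda>j k. r k ^ j) = (r 1 - r 0) * (r 2 - r 0) * (r 3 - r 0) * (r 2 - r 1) * (r 3 - r 1) * (r 3 - r 2)"
 unfolding edet_4 D4_def by (simp add: algebra_simps power2_eq_square power3_eq_cube)

text \<open>The monic recurrence reduces high powers to low ones. One form serves both degrees: for
  \<open>n = 3\<close> the last two terms are both constant.\<close>

lemma power_lattice:
 fixes t :: "nat => complex"
 assumes n: "n = 3 \<or> n = 4" and rec: "\<And>k. k < n ==> t k ^ n = of_int c3 * t k ^ (n - 1) + of_int c2 * t k ^ (n - 2) + of_int c1 * t k ^ (n - 3) + of_int c0"
 shows "(\<lambda>k. t k ^ m) \<in> zlattice n (\<lambda>j k. t k ^ j)"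
proof (induction m rule: less_induct)
 case (less m)
 show ?case
 proof (cases "m < n")
  case True
  then show ?thesis using lattice_basis[of m n "\<lambda>j k. t k ^ j"] by simp
 next
  case False
  define l where "l = m - n"
  have m: "m = n + l" using False by (simp add: l_def)
  let ?v = "\<lambda>k. of_int c3 * t k ^ (n - 1 + l) + of_int c2 * t k ^ (n - 2 + l) + of_int c1 * t k ^ (n - 3 + l) + of_int c0 * t k ^ l"
  have "?v \<in> zlattice n (\<lambda>j k. t k ^ j)"
   using n by (intro lattice_add lattice_scale less) (auto simp: m)
  moreover have "t k ^ m = ?v k" if "k < n" for k using rec[OF that] by (simp add: m power_add algebra_simps)
  ultimately show ?thesis using lattice_cong[of n "\<lambda>k. t k ^ m" ?v] by blast
 qed
qed

lemma mlattice_powers: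
 fixes t :: "nat => complex"
 assumes n: "n = 3 \<or> n = 4" and rec: "\<And>k. k < n ==> t k ^ n = of_int c3 * t k ^ (n - 1) + of_int c2 * t k ^ (n - 2) + of_int c1 * t k ^ (n - 3) + of_int c0"
  and nz: "edet n (\<lambda>j k. t k ^ j) ~= 0"
 shows "mlattice n (\<lambda>j k. t k ^ j)"
proof
 show "0 < n" "n \<le> 4" using n by auto
 show "(\<lambda>_. 1) \<in> zlattice n (\<lambda>j k. t k ^ j)" using power_lattice[OF n rec, where m = 0] by simp
 show "(\<lambda>k. t k ^ i * t k ^ j) \<in> zlattice n (\<lambda>j k. t k ^ j)" for i j
  using power_lattice[OF n rec, where m = "i + j"] by (simp add: power_add)
qed (fact nz)

text \<open>The pair consists of the rings generated by the roots and by the entries of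
  \<open>phi r\<close>. Their discriminants agree because each difference of resolvents is, up to
  sign, a product of two differences of roots, and every difference of roots occurs once.\<close>

theorem quart_qpair:
 assumes q: "quart r e1 e2 e3 e4"
 shows "qpair (\<lambda>j k. r k ^ j) (\<lambda>j k. phi r k ^ j)"
proof -
 note v = vieta[OF q]
 let ?t = "phi r"
 have t: "phi r 0 = r 0 * r 1 + r 2 * r 3" "phi r 1 = r 0 * r 2 + r 1 * r 3" "phi r 2 = r 0 * r 3 + r 1 * r 2" by (simp_all add: phi_def)
 note I0 = resolvent_identities[of "r 0" "r 1" "r 2" "r 3", OF v t(1)[symmetric]]
 \<comment> \<open>The other two splittings arise by permuting the roots, which leaves the symmetric
   functions unchanged.\<close>
 have v1: "r 0 + r 2 + r 1 + r 3 = of_int e1" "r 0 * r 2 + r 0 * r 1 + r 0 * r 3 + r 2 * r 1 + r 2 * r 3 + r 1 * r 3 = of_int e2"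
  "r 0 * r 2 * r 1 + r 0 * r 2 * r 3 + r 0 * r 1 * r 3 + r 2 * r 1 * r 3 = of_int e3" "r 0 * r 2 * r 1 * r 3 = of_int e4"
  unfolding v[symmetric] by (simp_all add: ac_simps)
 have v2: "r 0 + r 3 + r 1 + r 2 = of_int e1" "r 0 * r 3 + r 0 * r 1 + r 0 * r 2 + r 3 * r 1 + r 3 * r 2 + r 1 * r 2 = of_int e2"
  "r 0 * r 3 * r 1 + r 0 * r 3 * r 2 + r 0 * r 1 * r 2 + r 3 * r 1 * r 2 = of_int e3" "r 0 * r 3 * r 1 * r 2 = of_int e4"
  unfolding v[symmetric] by (simp_all add: ac_simps)
 note I1 = resolvent_identities[of "r 0" "r 2" "r 1" "r 3", OF v1 t(2)[symmetric]]
 note I2 = resolvent_identities[of "r 0" "r 3" "r 1" "r 2", OF v2 t(3)[symmetric]]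
 have dist: "r i ~= r j" if "i < 4" "j < 4" "i ~= j" for i j using q that by (auto simp: quart_def inj_on_def)
 have d4: "edet 4 (\<lambda>j k. r k ^ j) ~= 0" unfolding edet_4_powers using dist[of 0 1] dist[of 0 2] dist[of 0 3] dist[of 1 2] dist[of 1 3] dist[of 2 3] by simp
 have d: "edet 4 (\<lambda>j k. r k ^ j) = - edet 3 (\<lambda>j k. ?t k ^ j)"
 proof -
  have f: "?t 1 - ?t 0 = - ((r 3 - r 0) * (r 2 - r 1))" "?t 2 - ?t 0 = - ((r 2 - r 0) * (r 3 - r 1))" "?t 2 - ?t 1 = - ((r 1 - r 0) * (r 3 - r 2))"
   unfolding t by (simp_all add: algebra_simps)
  show ?thesis unfolding edet_4_powers edet_3_powers f by (simp add: mult_ac)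
 qed
 have d3: "edet 3 (\<lambda>j k. ?t k ^ j) ~= 0" using d4 d by simp
 have rec4: "r k ^ 4 = of_int e1 * r k ^ (4 - 1) + of_int (- e2) * r k ^ (4 - 2) + of_int e3 * r k ^ (4 - 3) + of_int (- e4)" if "k < 4" for k
 proof -
  have "(\<Prod>i<4. r k - r i) = 0" using that by (intro prod_zero) auto
  moreover have "(\<Prod>i<4. r k - r i) = r k ^ 4 - of_int e1 * r k ^ 3 + of_int e2 * (r k)\<^sup>2 - of_int e3 * r k + of_int e4"
   using q unfolding quart_def by blast
  ultimately have "r k ^ 4 - of_int e1 * r k ^ 3 + of_int e2 * (r k)\<^sup>2 - of_int e3 * r k + of_int e4 = 0" by (simp only:)
  then show ?thesis by (simp add: algebra_simps eq_neg_iff_add_eq_0 add_eq_0_iff)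
 qed
 have rec3: "?t k ^ 3 = of_int e2 * ?t k ^ (3 - 1) + of_int (- (e1 * e3 - 4 * e4)) * ?t k ^ (3 - 2) + of_int (- (4 * e2 * e4 - e1\<^sup>2 * e4 - e3\<^sup>2)) * ?t k ^ (3 - 3) + of_int 0"
  if "k < 3" for k
  using that I0(1) I1(1) I2(1) unfolding less_3_cases by (auto simp: left_diff_distrib)
 have L: "mlattice 4 (\<lambda>j k. r k ^ j)" by (rule mlattice_powers[OF _ rec4 d4]) simp
 have M: "mlattice 3 (\<lambda>j k. ?t k ^ j)" by (rule mlattice_powers[OF _ rec3 d3]) simp
 have pl: "(\<lambda>k. ?t k ^ m) \<in> zlattice 3 (\<lambda>j k. ?t k ^ j)" for m by (rule power_lattice[OF _ rec3]) simp
 have comb: "v \<in> zlattice 3 (\<lambda>j k. ?t k ^ j)"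
  if v: "\<And>k. k < 3 ==> v k = of_int a0 * ?t k ^ 0 + of_int a1 * ?t k ^ 1 + of_int a2 * ?t k ^ 2 + of_int a3 * ?t k ^ 3" for v a0 a1 a2 a3
 proof -
  have "(\<lambda>k. of_int a0 * ?t k ^ 0 + of_int a1 * ?t k ^ 1 + of_int a2 * ?t k ^ 2 + of_int a3 * ?t k ^ 3) \<in> zlattice 3 (\<lambda>j k. ?t k ^ j)"
   by (intro lattice_add lattice_scale pl)
  moreover have "v \<in> zlattice 3 (\<lambda>j k. ?t k ^ j) \<longleftrightarrow>
    (\<lambda>k. of_int a0 * ?t k ^ 0 + of_int a1 * ?t k ^ 1 + of_int a2 * ?t k ^ 2 + of_int a3 * ?t k ^ 3) \<in> zlattice 3 (\<lambda>j k. ?t k ^ j)"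
   by (rule lattice_cong) (rule v)
  ultimately show ?thesis by (simp only:)
 qed
 have all3: "P k" if "k < 3" "P 0" "P 1" "P 2" for P and k :: nat using that(1) unfolding less_3_cases by (elim disjE) (simp_all only: that)
 let ?b = "\<lambda>j k. r k ^ j"
 have c00: "phi (?b 0) \<in> zlattice 3 (\<lambda>j k. ?t k ^ j)" by (rule comb[of _ 2 0 0 0]) (simp add: phi_def)
 have c11: "phi (?b 1) \<in> zlattice 3 (\<lambda>j k. ?t k ^ j)" by (rule comb[of _ 0 1 0 0]) (simp add: phi_def)
 have c22: "phi (?b 2) \<in> zlattice 3 (\<lambda>j k. ?t k ^ j)"
  by (rule comb[of _ "- 2 * e4" 0 1 0], erule all3) (use I0(2) I1(2) I2(2) in \<open>simp_all add: phi_def[of "\<lambda>k. (r k)\<^sup>2"] mult_ac\<close>)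
 have c33: "phi (?b 3) \<in> zlattice 3 (\<lambda>j k. ?t k ^ j)"
  by (rule comb[of _ 0 "- 3 * e4" 0 1], erule all3) (use I0(3) I1(3) I2(3) in \<open>simp_all add: phi_def[of "\<lambda>k. r k ^ 3"] mult_ac\<close>)
 have c01: "phib (?b 0) (?b 1) \<in> zlattice 3 (\<lambda>j k. ?t k ^ j)"
  by (rule comb[of _ e1 0 0 0]) (use v(1) in \<open>simp add: phib_def ac_simps\<close>)
 have c02: "phib (?b 0) (?b 2) \<in> zlattice 3 (\<lambda>j k. ?t k ^ j)"
  by (rule comb[of _ "e1\<^sup>2 - 2 * e2" 0 0 0]) (use I0(7) in \<open>simp add: phib_def ac_simps\<close>)
 have c03: "phib (?b 0) (?b 3) \<in> zlattice 3 (\<lambda>j k. ?t k ^ j)"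
  by (rule comb[of _ "e1 ^ 3 - 3 * e1 * e2 + 3 * e3" 0 0 0]) (use I0(8) in \<open>simp add: phib_def ac_simps\<close>)
 have c12: "phib (?b 1) (?b 2) \<in> zlattice 3 (\<lambda>j k. ?t k ^ j)"
  by (rule comb[of _ "- e3" e1 0 0], erule all3) (use I0(4) I1(4) I2(4) in \<open>simp_all add: phib_def[of r] phib_def[of "\<lambda>k. r k"] algebra_simps\<close>)
 have c13: "phib (?b 1) (?b 3) \<in> zlattice 3 (\<lambda>j k. ?t k ^ j)"
  by (rule comb[of _ "- e3 * e1 + 4 * e4" "e1 * e1 - e2" "- 1" 0], erule all3)
   (use I0(5) I1(5) I2(5) in \<open>simp_all add: phib_def[of r] phib_def[of "\<lambda>k. r k"] algebra_simps power2_eq_square\<close>)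
 have c23: "phib (?b 2) (?b 3) \<in> zlattice 3 (\<lambda>j k. ?t k ^ j)"
  by (rule comb[of _ "- e4 * e1" "- e3" e1 0], erule all3)
   (use I0(6) I1(6) I2(6) in \<open>simp_all add: phib_def algebra_simps power2_eq_square\<close>)
 have phic: "phic ?b i j \<in> zlattice 3 (\<lambda>j k. ?t k ^ j)" if "i < 4" "j < 4" for i j
 proof -
  have sw: "phib v u \<in> zlattice 3 (\<lambda>j k. ?t k ^ j)" if "phib u v \<in> zlattice 3 (\<lambda>j k. ?t k ^ j)" for u v
   using that phib_commute[of u v] by (simp only:)
  have d: "phi (?b i) \<in> zlattice 3 (\<lambda>j k. ?t k ^ j)" if "i < 4" for i
   using that unfolding less_4_cases by (elim disjE) (simp_all only: c00 c11 c22 c33)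
  have o: "phib (?b i) (?b j) \<in> zlattice 3 (\<lambda>j k. ?t k ^ j)" if "i < j" "j < 4" for i j
  proof -
   have "(i = 0 \<and> j = 1) \<or> (i = 0 \<and> j = 2) \<or> (i = 0 \<and> j = 3) \<or> (i = 1 \<and> j = 2) \<or> (i = 1 \<and> j = 3) \<or> (i = 2 \<and> j = 3)"
    using that by arith
   then show ?thesis by (elim disjE conjE) (simp_all only: c01 c02 c03 c12 c13 c23)
  qed
  show ?thesis
  proof (cases i j rule: linorder_cases)
   case less
   then show ?thesis using o[OF less that(2)] by (simp only: phic_def) simp
  next
   case equal
   then show ?thesis using d[OF that(1)] by (simp only: phic_def) simp
  next
   case greater
   then show ?thesis using sw[OF o[OF greater that(1)]] by (simp only: phic_def) simp
  qed
 qed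
 show ?thesis
 proof (rule qpair.intro)
  show "mlattice 4 ?b" by (fact L)
  show "mlattice 3 (\<lambda>j k. ?t k ^ j)" by (fact M)
  show "(edet 4 ?b)\<^sup>2 = (edet 3 (\<lambda>j k. ?t k ^ j))\<^sup>2" unfolding d by simp
  show "phi v \<in> zlattice 3 (\<lambda>j k. ?t k ^ j)" if v: "v \<in> zlattice 4 ?b" for v by (rule phi_lattice[OF phic v])
 qed simp_all
qed

section \<open>Subgroups of the symmetric group\<close>

text \<open>Permutations of \<open>{0..3}\<close> are lists of values; \<open>cmp l m\<close> is
  \<open>l\<close> after \<open>m\<close>.\<close>

definition cmp :: "nat list => nat list => nat list" where
 "cmp l m = map (\<lambda>j. l ! j) m"

definition S4 :: "nat list set" where
 "S4 = {l. length l = 4 \<and> distinct l \<and> set l \<subseteq> {..<4}}"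

text \<open>Closure under inverses follows from finiteness, so these conditions describe the
  subgroups.\<close>

definition cclosed :: "nat list set => bool" where
 "cclosed A \<longleftrightarrow> A \<subseteq> S4 \<and> [0, 1, 2, 3] \<in> A \<and> (\<forall>l\<in>A. \<forall>m\<in>A. cmp l m \<in> A)"


text \<open>Representatives of the eleven conjugacy classes of subgroups: trivial, one
  transposition, a double transposition, two disjoint transpositions, cyclic of order 3, symmetric
  on three points, normal Klein group, cyclic of order 4, dihedral, alternating, symmetric.\<close>

definition std :: "nat list list list" where
 "std = [
  [[0,1,2,3]],
  [[0,1,2,3],[1,0,2,3]],
  [[0,1,2,3],[1,0,3,2]],
  [[0,1,2,3],[1,0,2,3],[0,1,3,2],[1,0,3,2]],
  [[0,1,2,3],[1,2,0,3],[2,0,1,3]],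
  [[0,1,2,3],[1,2,0,3],[0,2,1,3],[2,0,1,3],[2,1,0,3],[1,0,2,3]],
  [[0,1,2,3],[1,0,3,2],[2,3,0,1],[3,2,1,0]],
  [[0,1,2,3],[1,2,3,0],[2,3,0,1],[3,0,1,2]],
  [[0,1,2,3],[1,2,3,0],[0,3,2,1],[2,3,0,1],[3,2,1,0],[1,0,3,2],[3,0,1,2],[2,1,0,3]],
  [[0,1,2,3],[1,2,0,3],[1,0,3,2],[2,0,1,3],[0,3,1,2],[2,1,3,0],[3,1,0,2],[1,3,2,0],[0,2,3,1],[3,0,2,1],[3,2,1,
   0],[2,3,0,1]],
  [[0,1,2,3],[1,2,3,0],[1,0,2,3],[2,3,0,1],[0,2,3,1],[2,1,3,0],[3,0,1,2],[2,3,1,0],[1,3,0,2],[3,2,0,1],[2,0,3,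
   1],[3,1,0,2],[3,0,2,1],[2,0,1,3],[0,3,1,2],[3,2,1,0],[0,2,1,3],[0,1,3,2],[3,1,2,0],[2,1,0,3],[0,3,2,1],[1,3,2,
   0],[1,2,0,3],[1,0,3,2]]]"

type_synonym subgroup_record =
 "nat \<times> nat list \<times> nat list \<times> nat list list \<times> nat list list \<times> nat list list \<times>
  (nat list list \<times> nat \<times> (nat list \<times> nat list list) list) list"

text \<open>The 30 subgroups of \<open>S\<^sub>4\<close>. A record \<open>(s, c, d, H, gs, gw, ov)\<close> says that \<open>H\<close> is the conjugate by
 \<open>c\<close> (with inverse \<open>d\<close>) of the standard subgroup number \<open>s\<close>, is generated by \<open>gs\<close> (\<open>gw\<close> writes its elements as
 words in \<open>gs\<close>), and \<open>ov\<close> writes, for a representative \<open>g\<close> of every other coset of \<open>H\<close>, the generators of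
 a larger listed subgroup as words in \<open>g # gs\<close>.\<close>

definition subs :: "subgroup_record list" where
 "subs = [
  (0,[0,1,2,3],[0,1,2,3],[[0,1,2,3]],[],[[]],[([[1,0,2,3]],2,[([1,0,2,3],[[0]])]),([[2,1,0,3]],2,[([2,1,0,3],
   [[0]])]),([[3,1,2,0]],2,[([3,1,2,0],[[0]])]),([[0,2,1,3]],2,[([0,2,1,3],[[0]])]),([[0,3,2,1]],2,[([0,3,2,1],
   [[0]])]),([[0,1,3,2]],2,[([0,1,3,2],[[0]])]),([[1,0,3,2]],2,[([1,0,3,2],[[0]])]),([[2,3,0,1]],2,[([2,3,0,1],
   [[0]])]),([[3,2,1,0]],2,[([3,2,1,0],[[0]])]),([[1,2,0,3]],3,[([1,2,0,3],[[0]]),([2,0,1,3],[[0,0]])]),([[1,3,2,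
   0]],3,[([1,3,2,0],[[0]]),([3,0,2,1],[[0,0]])]),([[2,1,3,0]],3,[([2,1,3,0],[[0]]),([3,1,0,2],[[0,0]])]),([[0,2,
   3,1]],3,[([0,2,3,1],[[0]]),([0,3,1,2],[[0,0]])]),([[1,2,3,0]],4,[([1,2,3,0],[[0]]),([3,0,1,2],[[0,0,0]])]),
   ([[1,3,0,2]],4,[([1,3,0,2],[[0]]),([2,0,3,1],[[0,0,0]])]),([[2,3,1,0]],4,[([2,3,1,0],[[0]]),([3,2,0,1],[[0,0,
   0]])])]),
  (1,[0,1,2,3],[0,1,2,3],[[0,1,2,3],[1,0,2,3]],[[1,0,2,3]],[[],[0]],[([[1,0,2,3],[0,1,3,2]],4,[([0,1,3,2],[[1],
   [0]])]),([[1,2,0,3],[0,2,1,3]],6,[([0,2,1,3],[[1,0],[0]]),([2,0,1,3],[[0,0],[0,1]])]),([[1,3,2,0],[0,3,2,1]],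
   6,[([0,3,2,1],[[1,0],[0]]),([3,0,2,1],[[0,0],[0,1]])]),([[2,3,1,0],[0,1,3,2]],8,[([2,3,0,1],[[1,0],[0,1,0]]),
   ([3,2,0,1],[[0,0,0],[1,0,0]])]),([[1,2,3,0],[1,0,2,3]],24,[([0,2,3,1],[[1,0],[1]]),([0,3,1,2],[[1,0,0],[1]]),
   ([2,0,3,1],[[1,0,1],[1]]),([3,0,1,2],[[0,0,0],[1]])])]),
  (1,[0,2,1,3],[0,2,1,3],[[0,1,2,3],[2,1,0,3]],[[2,1,0,3]],[[],[0]],[([[2,1,0,3],[0,3,2,1]],4,[([0,3,2,1],[[1],
   [0]])]),([[1,2,0,3],[0,2,1,3]],6,[([0,2,1,3],[[0,1],[0]]),([1,0,2,3],[[1,0],[0,1,0]])]),([[2,1,3,0],[0,1,3,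
   2]],6,[([0,1,3,2],[[1,0],[0]]),([3,1,0,2],[[0,0],[0,1]])]),([[1,2,3,0],[0,3,2,1]],8,[([1,0,3,2],[[1,0],[0,1,
   0]]),([3,0,1,2],[[0,0,0],[1,0,0]])]),([[1,2,3,0],[1,0,2,3]],24,[([0,2,3,1],[[0,0,1,0,0],[0,0,1,0]]),([0,3,1,
   2],[[0,1,0],[0,1,0,0]]),([1,3,0,2],[[0,0,1],[0,1,0,0,0]]),([3,0,2,1],[[0,1,0],[1,0,0,1,0,1]])])]),
  (1,[0,2,3,1],[0,3,1,2],[[0,1,2,3],[3,1,2,0]],[[3,1,2,0]],[[],[0]],[([[3,1,2,0],[0,2,1,3]],4,[([0,2,1,3],[[1],
   [0]])]),([[1,3,2,0],[0,3,2,1]],6,[([0,3,2,1],[[0,1],[0]]),([1,0,2,3],[[1,0],[0,1,0]])]),([[2,1,3,0],[0,1,3,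
   2]],6,[([0,1,3,2],[[0,1],[0]]),([2,1,0,3],[[1,0],[0,1,0]])]),([[1,3,0,2],[0,2,1,3]],8,[([1,0,3,2],[[1,0],[0,1,
   0]]),([2,0,3,1],[[0,0,0],[1,0,0]])]),([[1,2,3,0],[1,0,2,3]],24,[([0,2,3,1],[[0,1],[0,1,0,0]]),([0,3,1,2],[[0,
   0,1],[0,0,1,0]]),([1,2,0,3],[[1,0],[1,0,1,0,0,1]]),([2,0,1,3],[[1,0,0],[1,0,0,1,0,1]])])]),
  (1,[2,0,1,3],[1,2,0,3],[[0,1,2,3],[0,2,1,3]],[[0,2,1,3]],[[],[0]],[([[3,1,2,0],[0,2,1,3]],4,[([3,1,2,0],[[0],
   [1]])]),([[1,2,0,3],[0,2,1,3]],6,[([1,0,2,3],[[0,1],[1]]),([1,2,0,3],[[0],[1]])]),([[0,2,3,1],[0,1,3,2]],6,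
   [([0,1,3,2],[[1,0],[0]]),([0,3,1,2],[[0,0],[0,1]])]),([[1,3,0,2],[0,2,1,3]],8,[([1,0,3,2],[[0,1],[1]]),([1,3,
   0,2],[[0],[1]])]),([[1,2,3,0],[1,0,2,3]],24,[([1,2,3,0],[[0],[1,0,1,0,0]]),([1,3,2,0],[[0,1],[1,0,0,1,0,1]]),
   ([3,0,1,2],[[0,0,0],[0,1,0,0,0]]),([3,1,0,2],[[1,0,0],[0,1,0,0]])])]),
  (1,[2,0,3,1],[1,3,0,2],[[0,1,2,3],[0,3,2,1]],[[0,3,2,1]],[[],[0]],[([[2,1,0,3],[0,3,2,1]],4,[([2,1,0,3],[[0],
   [1]])]),([[1,3,2,0],[0,3,2,1]],6,[([1,0,2,3],[[0,1],[1]]),([1,3,2,0],[[0],[1]])]),([[0,2,3,1],[0,1,3,2]],6,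
   [([0,1,3,2],[[0,1],[0]]),([0,2,1,3],[[1,0],[0,1,0]])]),([[1,2,3,0],[0,3,2,1]],8,[([1,0,3,2],[[0,1],[1]]),([1,
   2,3,0],[[0],[1]])]),([[1,2,3,0],[1,0,2,3]],24,[([1,2,0,3],[[0,0,1,0,0],[1,0,0,1,0,1]]),([1,3,0,2],[[1,0,0],[1,
   0,1,0,0]]),([2,0,1,3],[[0,1,0],[1,0,1,0,0,1]]),([2,1,3,0],[[0,0,1,0,0],[0,1,0,0]])])]),
  (1,[2,3,0,1],[2,3,0,1],[[0,1,2,3],[0,1,3,2]],[[0,1,3,2]],[[],[0]],[([[1,0,2,3],[0,1,3,2]],4,[([1,0,2,3],[[0],
   [1]])]),([[2,1,3,0],[0,1,3,2]],6,[([2,1,0,3],[[0,1],[1]]),([2,1,3,0],[[0],[1]])]),([[0,2,3,1],[0,1,3,2]],6,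
   [([0,2,1,3],[[0,1],[1]]),([0,2,3,1],[[0],[1]])]),([[2,3,1,0],[0,1,3,2]],8,[([2,3,0,1],[[0,1],[1]]),([2,3,1,0],
   [[0],[1]])]),([[1,2,3,0],[1,0,2,3]],24,[([1,2,0,3],[[0,1],[1,0,1,0,0,1,0]]),([1,2,3,0],[[0],[0,0,1,0,0]]),([2,
   0,1,3],[[0,0,1],[1,0,1,0,0,1,0]]),([2,0,3,1],[[0,1,0],[0,0,1,0,0]])])]),
  (2,[0,1,2,3],[0,1,2,3],[[0,1,2,3],[1,0,3,2]],[[1,0,3,2]],[[],[0]],[([[1,0,2,3],[0,1,3,2]],4,[([0,1,3,2],[[1,
   0],[0]])]),([[1,0,3,2],[2,3,0,1]],4,[([2,3,0,1],[[1],[0]])]),([[2,3,1,0]],4,[([2,3,1,0],[[0]])]),([[1,2,3,0],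
   [0,3,2,1]],8,[([0,3,2,1],[[1,0],[0]]),([2,1,0,3],[[0,1],[1,0,1]])]),([[1,3,0,2],[0,2,1,3]],8,[([0,2,1,3],[[1,
   0],[0]]),([2,0,3,1],[[0,0,0],[0,1]])]),([[1,2,0,3],[1,0,3,2]],12,[([0,2,3,1],[[1,0,0],[1]]),([0,3,1,2],[[1,0],
   [1]]),([2,0,1,3],[[0,0],[1]]),([2,1,3,0],[[0,1],[1]])])]),
  (2,[0,2,1,3],[0,2,1,3],[[0,1,2,3],[2,3,0,1]],[[2,3,0,1]],[[],[0]],[([[2,1,0,3],[0,3,2,1]],4,[([0,3,2,1],[[1,
   0],[0]])]),([[1,0,3,2],[2,3,0,1]],4,[([1,0,3,2],[[0],[1]])]),([[1,2,3,0]],4,[([1,2,3,0],[[0]])]),([[1,3,0,2],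
   [0,2,1,3]],8,[([0,2,1,3],[[0,1],[0]]),([1,3,0,2],[[0],[0,1]])]),([[2,3,1,0],[0,1,3,2]],8,[([0,1,3,2],[[1,0],
   [0]]),([1,0,2,3],[[0,1],[1,0,1]])]),([[1,2,0,3],[1,0,3,2]],12,[([0,2,3,1],[[0,0,1],[0,0,1,0]]),([0,3,1,2],[[0,
   1],[0,1,0,0]]),([1,2,0,3],[[0],[0,1,0,0]]),([1,3,2,0],[[1,0,0],[0,0,1,0]])])]),
  (2,[0,2,3,1],[0,3,1,2],[[0,1,2,3],[3,2,1,0]],[[3,2,1,0]],[[],[0]],[([[3,1,2,0],[0,2,1,3]],4,[([0,2,1,3],[[1,
   0],[0]])]),([[1,0,3,2],[2,3,0,1]],4,[([1,0,3,2],[[0],[1,0]])]),([[1,3,0,2]],4,[([1,3,0,2],[[0]])]),([[1,2,3,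
   0],[0,3,2,1]],8,[([0,3,2,1],[[0,1],[0]]),([1,2,3,0],[[0],[0,1]])]),([[2,3,1,0],[0,1,3,2]],8,[([0,1,3,2],[[0,
   1],[0]]),([1,0,2,3],[[1,0],[1,0,1]])]),([[1,2,0,3],[1,0,3,2]],12,[([0,2,3,1],[[0,1,0],[0,1,0,0]]),([0,3,1,2],
   [[1,0,1],[0,0,1,0]]),([1,2,0,3],[[0],[0,0,1,0]]),([1,3,2,0],[[0,0,1],[0,1,0,0]])])]),
  (3,[0,1,2,3],[0,1,2,3],[[0,1,2,3],[1,0,2,3],[0,1,3,2],[1,0,3,2]],[[1,0,2,3],[0,1,3,2]],[[],[0],[1],[1,0]],
   [([[2,3,1,0],[0,1,3,2]],8,[([2,3,0,1],[[1,0],[2]])]),([[1,2,3,0],[1,0,2,3]],24,[([0,2,1,3],[[1,0,2],[1]]),([0,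
   2,3,1],[[1,0],[1]]),([2,0,1,3],[[0,0,2],[1]]),([2,0,3,1],[[0,2,0],[1]])])]),
  (3,[0,2,1,3],[0,2,1,3],[[0,1,2,3],[2,1,0,3],[0,3,2,1],[2,3,0,1]],[[2,1,0,3],[0,3,2,1]],[[],[0],[1],[1,0]],
   [([[1,2,3,0],[0,3,2,1]],8,[([1,0,3,2],[[1,0],[2]])]),([[1,2,3,0],[1,0,2,3]],24,[([0,1,3,2],[[0,2,0,1,0],[1,0,
   2,0,1]]),([0,2,1,3],[[1,0,2,1,0],[0,1,0]]),([1,0,2,3],[[0,2,0,1,0],[0]]),([1,3,0,2],[[2,0,0],[1,0,2]])])]),
  (3,[0,2,3,1],[0,3,1,2],[[0,1,2,3],[3,1,2,0],[0,2,1,3],[3,2,1,0]],[[3,1,2,0],[0,2,1,3]],[[],[0],[1],[1,0]],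
   [([[1,3,0,2],[0,2,1,3]],8,[([1,0,3,2],[[1,0],[2]])]),([[1,2,3,0],[1,0,2,3]],24,[([0,1,3,2],[[2,0,1],[1,0,2,0,
   1]]),([0,3,1,2],[[0,0,1],[0,0,1,0]]),([1,0,2,3],[[1,0,2],[0]]),([1,2,0,3],[[1,0],[0,2]])])]),
  (4,[0,1,2,3],[0,1,2,3],[[0,1,2,3],[1,2,0,3],[2,0,1,3]],[[1,2,0,3]],[[],[0],[0,0]],[([[1,2,0,3],[0,2,1,3]],6,
   [([0,2,1,3],[[1],[0]])]),([[1,2,0,3],[1,0,3,2]],12,[([0,2,3,1],[[1],[1,0]]),([0,3,1,2],[[1],[1,0,0]]),([3,0,2,
   1],[[1],[0,1,0]])]),([[1,2,3,0],[1,0,2,3]],24,[([0,1,3,2],[[1,0],[1,0,1,1,0,1,0]]),([0,3,2,1],[[0,1,0,1,0],[0,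
   1,1,0,1,0]]),([3,0,1,2],[[0,0,0],[0,0,1,1,0]])])]),
  (4,[0,1,3,2],[0,1,3,2],[[0,1,2,3],[1,3,2,0],[3,0,2,1]],[[1,3,2,0]],[[],[0],[0,0]],[([[1,3,2,0],[0,3,2,1]],6,
   [([0,3,2,1],[[1],[0]])]),([[1,2,0,3],[1,0,3,2]],12,[([0,2,3,1],[[1,0],[1,0,0]]),([0,3,1,2],[[1,0,0],[1,0]]),
   ([2,0,1,3],[[0,0],[0,1,0]])]),([[1,2,3,0],[1,0,2,3]],24,[([0,1,3,2],[[0,1],[1,0,1,1,0,1,0]]),([0,2,1,3],[[1,
   0],[0,1,1,0,1,0]]),([2,0,3,1],[[0,1,1],[0,0,1,1,0]])])]),
  (4,[0,3,1,2],[0,2,3,1],[[0,1,2,3],[2,1,3,0],[3,1,0,2]],[[2,1,3,0]],[[],[0],[0,0]],[([[2,1,3,0],[0,1,3,2]],6,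
   [([0,1,3,2],[[1],[0]])]),([[1,2,0,3],[1,0,3,2]],12,[([0,2,3,1],[[0,1,1],[0,1,1,0]]),([0,3,1,2],[[0,1,0,0],[0,
   1,0]]),([1,0,3,2],[[1,0],[0]])]),([[1,2,3,0],[1,0,2,3]],24,[([0,2,1,3],[[0,1],[1,1,0,1]]),([0,3,2,1],[[0,1,0,
   1,0],[1,0,1,1]]),([1,0,2,3],[[1,0],[0]])])]),
  (4,[3,0,1,2],[1,2,3,0],[[0,1,2,3],[0,2,3,1],[0,3,1,2]],[[0,2,3,1]],[[],[0],[0,0]],[([[0,2,3,1],[0,1,3,2]],6,
   [([0,1,3,2],[[1],[0]])]),([[1,2,0,3],[1,0,3,2]],12,[([1,0,3,2],[[0,1,1],[0]]),([1,2,0,3],[[0],[0,1]]),([1,3,2,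
   0],[[0,1],[1,0,0]])]),([[1,2,3,0],[1,0,2,3]],24,[([1,0,2,3],[[0,1],[0]]),([1,2,3,0],[[0],[0,1,1]]),([1,3,0,2],
   [[0,1,1],[0,1]])])]),
  (5,[0,1,2,3],[0,1,2,3],[[0,1,2,3],[1,2,0,3],[0,2,1,3],[2,0,1,3],[2,1,0,3],[1,0,2,3]],[[1,2,0,3],[0,2,1,3]],
   [[],[0],[1],[0,0],[1,0],[0,1]],[([[1,2,3,0],[1,0,2,3]],24,[([0,1,3,2],[[1,0],[1,2]]),([0,3,1,2],[[1,0,2],[1,
   2]]),([3,0,1,2],[[0,0,0],[1,2]])])]),
  (5,[0,1,3,2],[0,1,3,2],[[0,1,2,3],[1,3,2,0],[0,3,2,1],[3,0,2,1],[3,1,2,0],[1,0,2,3]],[[1,3,2,0],[0,3,2,1]],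
   [[],[0],[1],[0,0],[1,0],[0,1]],[([[1,2,3,0],[1,0,2,3]],24,[([0,1,3,2],[[0,1],[1,2]]),([0,2,1,3],[[1,0],[1,
   2]]),([2,0,1,3],[[0,2,0],[1,2]])])]),
  (5,[0,3,1,2],[0,2,3,1],[[0,1,2,3],[2,1,3,0],[0,1,3,2],[3,1,0,2],[3,1,2,0],[2,1,0,3]],[[2,1,3,0],[0,1,3,2]],
   [[],[0],[1],[0,0],[1,0],[0,1]],[([[1,2,3,0],[1,0,2,3]],24,[([0,2,1,3],[[0,1],[0,1,2,0]]),([0,2,3,1],[[0,2,1],
   [0,2,1,0,0]]),([1,0,2,3],[[1,0],[0]])])]),
  (5,[3,0,1,2],[1,2,3,0],[[0,1,2,3],[0,2,3,1],[0,1,3,2],[0,3,1,2],[0,3,2,1],[0,2,1,3]],[[0,2,3,1],[0,1,3,2]],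
   [[],[0],[1],[0,0],[1,0],[0,1]],[([[1,2,3,0],[1,0,2,3]],24,[([1,0,2,3],[[0,1],[0]]),([1,2,0,3],[[0,2],[2,0,
   1]]),([1,2,3,0],[[0],[0,1,1]])])]),
  (6,[0,1,2,3],[0,1,2,3],[[0,1,2,3],[1,0,3,2],[2,3,0,1],[3,2,1,0]],[[1,0,3,2],[2,3,0,1]],[[],[0],[1],[1,0]],
   [([[1,2,3,0],[0,3,2,1]],8,[([0,3,2,1],[[1,0],[0]])]),([[1,3,0,2],[0,2,1,3]],8,[([0,2,1,3],[[1,0],[0]])]),([[2,
   3,1,0],[0,1,3,2]],8,[([0,1,3,2],[[2,0],[0]])]),([[1,2,0,3],[1,0,3,2]],12,[([0,2,3,1],[[1,0,0],[1]]),([0,3,1,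
   2],[[1,0],[1]])])]),
  (7,[0,1,2,3],[0,1,2,3],[[0,1,2,3],[1,2,3,0],[2,3,0,1],[3,0,1,2]],[[1,2,3,0]],[[],[0],[0,0],[0,0,0]],[([[1,2,3,
   0],[0,3,2,1]],8,[([0,3,2,1],[[1],[0]])]),([[1,2,3,0],[1,0,2,3]],24,[([0,1,3,2],[[1],[1,1,0,1,1]]),([0,2,1,3],
   [[1],[1,1,1,0,1]]),([0,2,3,1],[[1],[1,0,0]]),([0,3,1,2],[[1],[1,0]])])]),
  (7,[0,1,3,2],[0,1,3,2],[[0,1,2,3],[1,3,0,2],[3,2,1,0],[2,0,3,1]],[[1,3,0,2]],[[],[0],[0,0],[0,0,0]],[([[1,3,0,
   2],[0,2,1,3]],8,[([0,2,1,3],[[1],[0]])]),([[1,2,3,0],[1,0,2,3]],24,[([0,1,3,2],[[0,1,0],[1,1,0,1,1]]),([0,2,3,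
   1],[[1,0,0],[1,0]]),([0,3,1,2],[[1,0],[1,0,0]]),([0,3,2,1],[[0,1,1],[1,1,1,0,1]])])]),
  (7,[0,2,1,3],[0,2,1,3],[[0,1,2,3],[2,3,1,0],[1,0,3,2],[3,2,0,1]],[[2,3,1,0]],[[],[0],[0,0],[0,0,0]],[([[2,3,1,
   0],[0,1,3,2]],8,[([0,1,3,2],[[1],[0]])]),([[1,2,3,0],[1,0,2,3]],24,[([0,2,1,3],[[0,1,0],[1,0,1,1,0]]),([0,2,3,
   1],[[0,0,1],[0,0,1,0,0]]),([0,3,1,2],[[0,1],[0,1,0]]),([0,3,2,1],[[1,1,0],[0,1,1,0,1]])])]),
  (8,[0,1,2,3],[0,1,2,3],[[0,1,2,3],[1,2,3,0],[0,3,2,1],[2,3,0,1],[3,2,1,0],[1,0,3,2],[3,0,1,2],[2,1,0,3]],[[1,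
   2,3,0],[0,3,2,1]],[[],[0],[1],[0,0],[1,0],[0,1],[0,0,0],[1,0,0]],[([[1,2,3,0],[1,0,2,3]],24,[([0,1,3,2],[[1],
   [1,2,0]]),([0,2,1,3],[[1],[1,0,2]])])]),
  (8,[0,1,3,2],[0,1,3,2],[[0,1,2,3],[1,3,0,2],[0,2,1,3],[3,2,1,0],[2,3,0,1],[1,0,3,2],[2,0,3,1],[3,1,2,0]],[[1,
   3,0,2],[0,2,1,3]],[[],[0],[1],[0,0],[1,0],[0,1],[0,0,0],[1,0,0]],[([[1,2,3,0],[1,0,2,3]],24,[([0,1,3,2],[[0,1,
   0],[1,2,0]]),([0,3,1,2],[[1,0],[1,0,0]])])]),
  (8,[0,2,1,3],[0,2,1,3],[[0,1,2,3],[2,3,1,0],[0,1,3,2],[1,0,3,2],[3,2,1,0],[2,3,0,1],[3,2,0,1],[1,0,2,3]],[[2,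
   3,1,0],[0,1,3,2]],[[],[0],[1],[0,0],[1,0],[0,1],[0,0,0],[1,0,0]],[([[1,2,3,0],[1,0,2,3]],24,[([0,2,1,3],[[0,1,
   0],[2,1,1]]),([0,2,3,1],[[0,0,1],[2,1,1]])])]),
  (9,[0,1,2,3],[0,1,2,3],[[0,1,2,3],[1,2,0,3],[1,0,3,2],[2,0,1,3],[0,3,1,2],[2,1,3,0],[3,1,0,2],[1,3,2,0],[0,2,
   3,1],[3,0,2,1],[3,2,1,0],[2,3,0,1]],[[1,2,0,3],[1,0,3,2]],[[],[0],[1],[0,0],[1,0],[0,1],[1,0,0],[0,1,0],[0,0,
   1],[1,0,1],[0,1,0,0],[0,0,1,0]],[([[1,2,3,0],[1,0,2,3]],24,[([0,1,3,2],[[1,0],[2,0]])])]),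
  (10,[0,1,2,3],[0,1,2,3],[[0,1,2,3],[1,2,3,0],[1,0,2,3],[2,3,0,1],[0,2,3,1],[2,1,3,0],[3,0,1,2],[2,3,1,0],[1,3,
   0,2],[3,2,0,1],[2,0,3,1],[3,1,0,2],[3,0,2,1],[2,0,1,3],[0,3,1,2],[3,2,1,0],[0,2,1,3],[0,1,3,2],[3,1,2,0],[2,1,
   0,3],[0,3,2,1],[1,3,2,0],[1,2,0,3],[1,0,3,2]],[[1,2,3,0],[1,0,2,3]],[[],[0],[1],[0,0],[1,0],[0,1],[0,0,0],[1,
   0,0],[0,1,0],[0,0,1],[1,0,1],[1,0,0,0],[0,1,0,0],[0,0,1,0],[1,0,1,0],[1,0,0,1],[0,1,0,0,0],[0,0,1,0,0],[1,0,1,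
   0,0],[1,0,0,1,0],[0,1,0,0,1],[0,0,1,0,0,0],[1,0,1,0,0,0],[1,0,0,1,0,0]],[])]"

definition S4list :: "nat list list" where
 "S4list = [[0,1,2,3],[0,1,3,2],[0,2,1,3],[0,2,3,1],[0,3,1,2],[0,3,2,1],[1,0,2,3],[1,0,3,2],[1,2,0,3],[1,2,3,0],[1,3,0,
  2],[1,3,2,0],[2,0,1,3],[2,0,3,1],[2,1,0,3],[2,1,3,0],[2,3,0,1],[2,3,1,0],[3,0,1,2],[3,0,2,1],[3,1,0,2],[3,1,2,
  0],[3,2,0,1],[3,2,1,0]]"

definition gens_of :: "subgroup_record => nat list list \<times> nat" where
 "gens_of = (\<lambda>(s, c, d, H, gs, gw, ov). (gs, length H))"

definition elems :: "subgroup_record => nat list list" where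
 "elems = (\<lambda>(s, c, d, H, gs, gw, ov). H)"

definition wd :: "nat list list => nat list => nat list" where
 "wd gs w = foldr (\<lambda>i x. cmp (gs ! i) x) w [0, 1, 2, 3]"

section \<open>Verification of the list of subgroups\<close>

definition check_std :: "subgroup_record => bool" where
 "check_std = (\<lambda>(s, c, d, H, gs, gw, ov). cmp c d = [0, 1, 2, 3] \<and> cmp d c = [0, 1, 2, 3] \<and>
   list_ex ((=) c) S4list \<and> list_ex ((=) d) S4list \<and> s < 11 \<and> H = map (\<lambda>m. cmp d (cmp m c)) (std ! s))"

definition check_gen :: "subgroup_record => bool" where
 "check_gen = (\<lambda>(s, c, d, H, gs, gw, ov). map (wd gs) gw = H \<and> list_all (list_all (\<lambda>i. i < length gs)) gw)"

definition check_cover :: "subgroup_record => bool" where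
 "check_cover = (\<lambda>(s, c, d, H, gs, gw, ov).
   list_all (\<lambda>g. list_ex ((=) g) H \<or> list_ex (\<lambda>(gs', n, xs). list_ex (\<lambda>(g', ws). list_ex (\<lambda>h. cmp h g = g') H) xs) ov) S4list)"

definition check_over :: "subgroup_record => bool" where
 "check_over = (\<lambda>(s, c, d, H, gs, gw, ov). list_all (\<lambda>(gs', n, xs). length H < n \<and>
   list_all (\<lambda>(g, ws). map (wd (g # gs)) ws = gs' \<and> list_all (list_all (\<lambda>i. i < Suc (length gs))) ws) xs) ov \<and>
   list_all (list_ex (\<lambda>h. h = [0, 1, 2, 3])) [H] \<and> list_all (\<lambda>g. list_ex ((=) g) H) gs)"

text \<open>A shortened copy of \<open>subs\<close>, identified with it by \<open>subidx_eq\<close>,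
  so that the search for a larger subgroup does not run through whole records.\<close>

definition subidx :: "(nat list list \<times> nat) list" where
 "subidx = [([],1),([[1,0,2,3]],2),([[2,1,0,3]],2),([[3,1,2,0]],2),([[0,2,1,3]],2),([[0,3,2,1]],2),([[0,1,3,2]],2),([[1,
  0,3,2]],2),([[2,3,0,1]],2),([[3,2,1,0]],2),([[1,0,2,3],[0,1,3,2]],4),([[2,1,0,3],[0,3,2,1]],4),([[3,1,2,0],[0,
  2,1,3]],4),([[1,2,0,3]],3),([[1,3,2,0]],3),([[2,1,3,0]],3),([[0,2,3,1]],3),([[1,2,0,3],[0,2,1,3]],6),([[1,3,2,
  0],[0,3,2,1]],6),([[2,1,3,0],[0,1,3,2]],6),([[0,2,3,1],[0,1,3,2]],6),([[1,0,3,2],[2,3,0,1]],4),([[1,2,3,0]],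
  4),([[1,3,0,2]],4),([[2,3,1,0]],4),([[1,2,3,0],[0,3,2,1]],8),([[1,3,0,2],[0,2,1,3]],8),([[2,3,1,0],[0,1,3,2]],
  8),([[1,2,0,3],[1,0,3,2]],12),([[1,2,3,0],[1,0,2,3]],24)]"

definition check_idx :: "subgroup_record => bool" where
 "check_idx = (\<lambda>(s, c, d, H, gs, gw, ov). list_all (\<lambda>(gs', n, xs). list_ex ((=) (gs', n)) subidx) ov)"

lemma checked_std: "list_all check_std subs" by code_simp
lemma checked_gen: "list_all check_gen subs" by code_simp
lemma checked_cover: "list_all check_cover subs" by code_simp
lemma checked_over: "list_all check_over subs" by code_simp
lemma checked_idx: "list_all check_idx subs" by code_simp
lemma subidx_eq: "subidx = map gens_of subs" by code_simp
lemma trivial_sub: "list_ex (\<lambda>E. elems E = [[0, 1, 2, 3]]) subs" by code_simp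
lemma length_subs: "list_all (\<lambda>E. length (elems E) \<le> 24) subs" by code_simp

lemma check_S4list: "list_all (\<lambda>l. \<not> List.distinct l \<or> list_ex ((=) l) S4list) (List.n_lists 4 [0, 1, 2, 3])"
 by code_simp

lemma check_S4list': "list_all (\<lambda>l. length l = 4 \<and> List.distinct l \<and> list_all (\<lambda>x. x < 4) l) S4list"
 by code_simp

lemma S4_eq: "S4 = set S4list"
proof (intro equalityI subsetI)
 fix l assume l: "l \<in> S4"
 have "{..<4} = set [0, 1, 2, 3 :: nat]" by auto
 then have "l \<in> set (List.n_lists 4 [0, 1, 2, 3])" using l unfolding S4_def set_n_lists by simp
 then show "l \<in> set S4list" using check_S4list l unfolding S4_def list_all_iff list_ex_iff by auto
next
 fix l assume "l \<in> set S4list"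
 then show "l \<in> S4" using check_S4list' unfolding S4_def list_all_iff by auto
qed

lemma wd_closed:
 assumes A: "cclosed A" and gs: "set gs \<subseteq> A" and w: "\<forall>i\<in>set w. i < length gs"
 shows "wd gs w \<in> A"
 using w
proof (induction w)
 case Nil
 then show ?case using A by (simp add: wd_def cclosed_def)
next
 case (Cons i w)
 have "gs ! i \<in> set gs" using Cons(2) by (intro nth_mem) simp
 then have "gs ! i \<in> A" using gs by blast
 moreover have "wd gs w \<in> A" using Cons by simp
 ultimately show ?case using A by (simp add: wd_def cclosed_def)
qed

lemma gens_elems:
 assumes A: "cclosed A" and E: "E \<in> set subs" and gs: "set (fst (gens_of E)) \<subseteq> A"
 shows "set (elems E) \<subseteq> A"
proof -
 obtain s c d H gs gw ov where e: "E = (s, c, d, H, gs, gw, ov)" by (cases E)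
 have chk: "map (wd gs) gw = H" "\<forall>w\<in>set gw. \<forall>i\<in>set w. i < length gs"
  using checked_gen E unfolding list_all_iff e check_gen_def by auto
 have "set gs \<subseteq> A" using assms(3) by (simp add: e gens_of_def)
 then have "wd gs w \<in> A" if "w \<in> set gw" for w using wd_closed[OF A] chk(2) that by blast
 then have "set (map (wd gs) gw) \<subseteq> A" by auto
 then show ?thesis unfolding chk(1) by (simp add: e elems_def)
qed

text \<open>A largest listed subgroup inside \<open>A\<close> is all of \<open>A\<close>, since adjoining a further element
 generates a larger listed subgroup.\<close>

theorem subgroup_listed:
 assumes A: "cclosed A"
 shows "\<exists>E\<in>set subs. A = set (elems E)"
proof -
 let ?P = "\<lambda>E. E \<in> set subs \<and> set (elems E) \<subseteq> A"
 obtain E0 where "E0 \<in> set subs" "elems E0 = [[0, 1, 2, 3]]" using trivial_sub unfolding list_ex_iff by blast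
 then have P0: "?P E0" using A by (simp add: cclosed_def)
 \<comment> \<open>The orders are at most 24; the existence of a maximum is derived from a strict
   bound.\<close>
 have b: "\<forall>E. ?P E --> length (elems E) < 25" using length_subs unfolding list_all_iff by fastforce
 obtain E where E: "?P E" and max: "\<forall>E'. ?P E' --> length (elems E') \<le> length (elems E)"
  using ex_has_greatest_nat[of ?P E0 "\<lambda>E. length (elems E)" 25, OF P0 b] by blast
 have "A \<subseteq> set (elems E)"
 proof (rule ccontr)
  assume "\<not> A \<subseteq> set (elems E)"
  then obtain g where g: "g \<in> A" "g \<notin> set (elems E)" by blast
  obtain s c d H gs gw ov where e: "E = (s, c, d, H, gs, gw, ov)" by (cases E)
  have Es: "E \<in> set subs" and HA: "set H \<subseteq> A" using E by (simp_all add: e elems_def)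
  have gH: "g \<notin> set H" using g by (simp add: e elems_def)
  have "g \<in> set S4list" using g A by (auto simp: cclosed_def S4_eq)
  moreover have "check_cover E" using checked_cover Es unfolding list_all_iff by blast
  ultimately obtain gs' n xs ws g' h where ov: "(gs', n, xs) \<in> set ov" "(g', ws) \<in> set xs" and h: "h \<in> set H" "cmp h g = g'"
   using gH unfolding e check_cover_def list_all_iff list_ex_iff by fastforce
  have "check_over E" using checked_over Es unfolding list_all_iff by blast
  then have o: "length H < n" "map (wd (g' # gs)) ws = gs'" "\<forall>w\<in>set ws. \<forall>i\<in>set w. i < length (g' # gs)" "set gs \<subseteq> set H"
   using ov unfolding e check_over_def list_all_iff list_ex_iff by fastforce+
  have "check_idx E" using checked_idx Es unfolding list_all_iff by blast
  then have "(gs', n) \<in> set subidx" using ov(1) unfolding e check_idx_def list_all_iff list_ex_iff by fastforce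
  then obtain K where K: "K \<in> set subs" "gens_of K = (gs', n)" unfolding subidx_eq by auto
  \<comment> \<open>\<open>g'\<close> lies in \<open>A\<close> together with \<open>g\<close>, as it
    differs from \<open>g\<close> by the element \<open>h\<close> of \<open>H\<close>.\<close>
  have "g' \<in> A" using A g(1) h HA unfolding cclosed_def by blast
  have "set (g' # gs) \<subseteq> A" using \<open>g' \<in> A\<close> o(4) HA by auto
  then have "wd (g' # gs) w \<in> A" if "w \<in> set ws" for w using wd_closed[OF A] o(3) that by blast
  then have "set (fst (gens_of K)) \<subseteq> A" unfolding K(2) fst_conv o(2)[symmetric] by auto
  then have "?P K" using gens_elems[OF A K(1)] K(1) by blast
  moreover have "length (elems K) = n" using K(2) by (cases K) (auto simp: gens_of_def elems_def)
  moreover have "length (elems E) = length H" by (simp add: e elems_def)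
  ultimately show False using max o(1) by fastforce
 qed
 then show ?thesis using E by blast
qed

section \<open>Galois groups of quartic polynomials\<close>

text \<open>\<open>dec\<close> and \<open>enc\<close> translate between lists on
  \<open>{0..3}\<close> and permutations of \<open>{1..4}\<close> that are the identity elsewhere,
  as in \<open>sym_group\<close>.\<close>

definition dec :: "nat list => nat => nat" where
 "dec l i = (if i \<in> {1..4} then Suc (l ! (i - 1)) else i)"

definition enc :: "(nat => nat) => nat list" where
 "enc p = map (\<lambda>i. p (Suc i) - 1) [0..<4]"

lemma S4_nth: "l \<in> S4 ==> i < 4 ==> l ! i < 4"
proof -
 assume l: "l \<in> S4" "i < 4"
 then have "i < length l" by (simp add: S4_def)
 then have "l ! i \<in> set l" by (rule nth_mem)
 moreover have "set l \<subseteq> {..<4}" using l by (simp add: S4_def)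
 ultimately have "l ! i \<in> {..<4}" by (rule rev_subsetD)
 then show ?thesis by simp
qed

lemma S4_inj: "l \<in> S4 ==> i < 4 ==> j < 4 ==> l ! i = l ! j ==> i = j"
 by (auto simp: S4_def nth_eq_iff_index_eq)

lemma S4_I: "length l = 4 ==> (\<And>i. i < 4 ==> l ! i < 4) ==> (\<And>i j. i < 4 ==> j < 4 ==> l ! i = l ! j ==> i = j) ==> l \<in> S4"
 unfolding S4_def by (auto simp: distinct_conv_nth in_set_conv_nth)

lemma cmp_nth: "m \<in> S4 ==> i < 4 ==> cmp l m ! i = l ! (m ! i)"
 by (simp add: cmp_def S4_def)

lemma cmp_S4: "l \<in> S4 ==> m \<in> S4 ==> cmp l m \<in> S4"
proof (rule S4_I)
 assume l: "l \<in> S4" and m: "m \<in> S4"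
 show "length (cmp l m) = 4" using m by (simp add: cmp_def S4_def)
 show "cmp l m ! i < 4" if "i < 4" for i using that l m by (simp add: cmp_nth S4_nth)
 show "i = j" if ij: "i < 4" "j < 4" "cmp l m ! i = cmp l m ! j" for i j
 proof -
  have "l ! (m ! i) = l ! (m ! j)" using ij by (simp add: cmp_nth[OF m])
  then have "m ! i = m ! j" by (rule S4_inj[OF l S4_nth[OF m ij(1)] S4_nth[OF m ij(2)]])
  then show ?thesis by (rule S4_inj[OF m ij(1,2)])
 qed
qed

lemma S4_eqI: "l \<in> S4 ==> m \<in> S4 ==> (\<And>i. i < 4 ==> l ! i = m ! i) ==> l = m"
 by (rule nth_equalityI) (auto simp: S4_def)

lemma S4_less_surj: "l \<in> S4 ==> j < 4 ==> \<exists>i<4. l ! i = j"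
proof -
 assume l: "l \<in> S4" and j: "j < 4"
 have "card (set l) = 4" using l by (simp add: S4_def distinct_card)
 then have "set l = {..<4}" using l by (intro card_subset_eq) (auto simp: S4_def)
 then show ?thesis using j l by (auto simp: S4_def in_set_conv_nth set_eq_iff)
qed

lemma enc_S4: assumes p: "p permutes {1..4}" shows "enc p \<in> S4" "dec (enc p) = p"
proof -
 have r: "p i \<in> {1..4}" if "i \<in> {1..4}" for i using permutes_in_image[OF p] that by blast
 show "enc p \<in> S4"
 proof (rule S4_I)
  show "length (enc p) = 4" by (simp add: enc_def)
  show "enc p ! i < 4" if "i < 4" for i using r[of "Suc i"] that by (simp add: enc_def) linarith
  show "i = j" if "i < 4" "j < 4" "enc p ! i = enc p ! j" for i j
  proof -
   have "p (Suc i) - 1 = p (Suc j) - 1" using that by (simp add: enc_def)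
   then have "p (Suc i) = p (Suc j)" using r[of "Suc i"] r[of "Suc j"] that by simp linarith
   then show ?thesis using permutes_inj[OF p] by (simp add: inj_eq)
  qed
 qed
 show "dec (enc p) = p"
 proof
  fix i
  show "dec (enc p) i = p i"
  proof (cases "i \<in> {1..4}")
   case True
   then have "i - 1 < 4" "Suc (i - 1) = i" by auto
   then show ?thesis using r[OF True] True by (simp add: dec_def enc_def)
  next
   case False
   then show ?thesis using permutes_not_in[OF p False] by (simp add: dec_def del: atLeastAtMost_iff)
  qed
 qed
qed

lemma dec_permutes: assumes l: "l \<in> S4" shows "dec l permutes {1..4}"
proof (rule bij_imp_permutes)
 have s: "dec l i - 1 < 4" "dec l i \<ge> 1" if "i \<in> {1..4}" for i using that S4_nth[OF l, of "i - 1"] by (auto simp: dec_def)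
 have "inj_on (dec l) {1..4}"
 proof (rule inj_onI)
  fix i j :: nat assume ij: "i \<in> {1..4}" "j \<in> {1..4}" "dec l i = dec l j"
  then have e: "l ! (i - 1) = l ! (j - 1)" by (simp add: dec_def)
  have "i - 1 < 4" "j - 1 < 4" using ij by auto
  then have "i - 1 = j - 1" using e by (rule S4_inj[OF l])
  then show "i = j" using ij by auto
 qed
 moreover have sub: "dec l ` {1..4} \<subseteq> {1..4}"
 proof (rule image_subsetI)
  fix i :: nat assume "i \<in> {1..4}"
  from s[OF this] show "dec l i \<in> {1..4}" by simp
 qed
 ultimately have "dec l ` {1..4} = {1..4}" by (intro card_subset_eq) (auto simp: card_image)
 then show "bij_betw (dec l) {1..4} {1..4}" using \<open>inj_on (dec l) {1..4}\<close> by (simp add: bij_betw_def)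
 show "dec l x = x" if "x \<notin> {1..4}" for x using that by (simp add: dec_def del: atLeastAtMost_iff)
qed

lemma dec_inj: "l \<in> S4 ==> m \<in> S4 ==> dec l = dec m ==> l = m"
proof (rule S4_eqI)
 fix i :: nat assume e: "dec l = dec m" and i: "i < 4"
 have "dec l (Suc i) = dec m (Suc i)" using e by simp
 then show "l ! i = m ! i" using i by (simp add: dec_def)
qed

lemma dec_cmp: "l \<in> S4 ==> m \<in> S4 ==> dec (cmp l m) = dec l \<circ> dec m"
proof
 fix i assume lm: "l \<in> S4" "m \<in> S4"
 show "dec (cmp l m) i = (dec l \<circ> dec m) i"
 proof (cases "i \<in> {1..4}")
  case True
  then have "m ! (i - 1) < 4" using S4_nth[OF lm(2), of "i - 1"] by auto
  moreover have "cmp l m ! (i - 1) = l ! (m ! (i - 1))" using lm True by (intro cmp_nth) auto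
  ultimately show ?thesis using True by (simp add: dec_def)
 next
  case False
  then show ?thesis by (simp add: dec_def del: atLeastAtMost_iff)
 qed
qed

definition Qr :: "(nat => complex) => complex set" where
 "Qr r = generate_field complex_ring (r ` {..<4})"

lemma fld_Qr: "fld (Qr r)" and Qr_incl: "i < 4 ==> r i \<in> Qr r"
 unfolding Qr_def fld_def by (auto intro: generate_field_closed)

lemma Qr_min:
 assumes F: "fld F" and r: "\<And>i. i < 4 ==> r i \<in> F"
 shows "Qr r \<subseteq> F"
proof
 fix x assume "x \<in> Qr r"
 then have "x \<in> generate_field complex_ring (r ` {..<4})" by (simp add: Qr_def)
 then show "x \<in> F"
 proof induction
  case (a_inv h)
  then show ?case using fldD(4)[OF F] by simp
 next
  case (m_inv h)
  then show ?case using fldD(5)[OF F] inv_complex[of h] by simp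
 qed (use r fldD[OF F] in auto)
qed

text \<open>Only a homomorphism is required; that it is an automorphism of the field follows, see
  \<open>fhom_iso\<close>.\<close>

definition galc :: "(nat => complex) => nat list set" where
 "galc r = {l \<in> S4. \<exists>\<alpha>. fhom (Qr r) \<alpha> \<and> (\<forall>i<4. \<alpha> (r i) = r (l ! i))}"

lemma galcI: "l \<in> S4 ==> fhom (Qr r) \<alpha> ==> (\<And>i. i < 4 ==> \<alpha> (r i) = r (l ! i)) ==> l \<in> galc r"
 by (auto simp: galc_def)

lemma galcD: "l \<in> galc r ==> l \<in> S4 \<and> (\<exists>\<alpha>. fhom (Qr r) \<alpha> \<and> (\<forall>i<4. \<alpha> (r i) = r (l ! i)))"
 by (simp add: galc_def)

lemma lfield_powers: "lfield (\<lambda>j k. r k ^ j) = Qr r"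
proof
 show "lfield (\<lambda>j k. r k ^ j) \<subseteq> Qr r" unfolding lfield_def Qr_def
 proof (rule generate_field_subset)
  fix s assume "s \<in> {r k ^ j |j k. j < 4 \<and> k < 4}"
  then obtain j k where "s = r k ^ j" "k < 4" by auto
  then show "s \<in> generate_field complex_ring (r ` {..<4})"
   using fld_power[OF fld_Qr Qr_incl] unfolding Qr_def by simp
 qed
 show "Qr r \<subseteq> lfield (\<lambda>j k. r k ^ j)" unfolding lfield_def Qr_def
 proof (rule generate_field_subset)
  fix s assume "s \<in> r ` {..<4}"
  then obtain k where k: "s = r k" "k < 4" by auto
  then have "s \<in> {r k ^ j |j k. j < 4 \<and> k < 4}" by (intro CollectI exI[of _ 1] exI[of _ k]) simp
  then show "s \<in> generate_field complex_ring {r k ^ j |j k. j < 4 \<and> k < 4}" by (rule generate_field_closed(1))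
 qed
qed

lemma fhom_subset: "F \<subseteq> E ==> fhom E s ==> fhom F s"
 unfolding fhom_def by blast

text \<open>The elements mapped into \<open>Qr r\<close> form a field with all the roots, and so
  does the image, because \<open>l\<close> permutes the roots; minimality of \<open>Qr r\<close>
  gives both inclusions.\<close>

lemma fhom_iso:
 assumes h: "fhom (Qr r) \<alpha>" and l: "l \<in> S4" and r: "\<And>i. i < 4 ==> \<alpha> (r i) = r (l ! i)"
 shows "\<alpha> ` Qr r = Qr r" "inj_on \<alpha> (Qr r)"
proof -
 note F = fld_Qr[of r] and D = fhomD[OF fld_Qr h]
 show "inj_on \<alpha> (Qr r)"
 proof (rule inj_onI)
  fix x y assume xy: "x \<in> Qr r" "y \<in> Qr r" "\<alpha> x = \<alpha> y"
  then have "\<alpha> (x - y) = 0" by (simp add: D(6))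
  from D(9)[OF fldD(7)[OF F xy(1,2)] this] have "x - y = 0" .
  then show "x = y" by simp
 qed
 have "fld {x \<in> Qr r. \<alpha> x \<in> Qr r}"
  unfolding fld_def mem_Collect_eq by (intro conjI ballI) (simp_all add: fldD(1-5)[OF F] D(1,2,3,5,10))
 from Qr_min[OF this, of r] have 1: "\<alpha> ` Qr r \<subseteq> Qr r" using r Qr_incl S4_nth[OF l] by auto
 have "fld (\<alpha> ` Qr r)" unfolding fld_def
 proof (intro conjI ballI)
  show "1 \<in> \<alpha> ` Qr r" using D(1) fldD(1)[OF F] by (intro image_eqI[of _ _ "1"]) simp_all
  fix x assume "x \<in> \<alpha> ` Qr r"
  then obtain u where u: "u \<in> Qr r" "x = \<alpha> u" by blast
  show "- x \<in> \<alpha> ` Qr r" using u D(5)[OF u(1)] fldD(4)[OF F u(1)] by (intro image_eqI[of _ _ "- u"]) simp_all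
  show "inverse x \<in> \<alpha> ` Qr r" using u D(10)[OF u(1)] fldD(5)[OF F u(1)] by (intro image_eqI[of _ _ "inverse u"]) simp_all
  fix y assume "y \<in> \<alpha> ` Qr r"
  then obtain v where v: "v \<in> Qr r" "y = \<alpha> v" by blast
  show "x + y \<in> \<alpha> ` Qr r" using u v D(2)[OF u(1) v(1)] fldD(2)[OF F u(1) v(1)] by (intro image_eqI[of _ _ "u + v"]) simp_all
  show "x * y \<in> \<alpha> ` Qr r" using u v D(3)[OF u(1) v(1)] fldD(3)[OF F u(1) v(1)] by (intro image_eqI[of _ _ "u * v"]) simp_all
 qed
 moreover have "r j \<in> \<alpha> ` Qr r" if j: "j < 4" for j
 proof -
  obtain i where i: "i < 4" "l ! i = j" using S4_less_surj[OF l j] by blast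
  then show ?thesis using r[OF i(1)] Qr_incl[OF i(1), of r] by (intro image_eqI[of _ _ "r i"]) simp_all
 qed
 ultimately have "Qr r \<subseteq> \<alpha> ` Qr r" by (rule Qr_min)
 with 1 show "\<alpha> ` Qr r = Qr r" by blast
qed

text \<open>The powers with exponent 1 are the roots themselves; the other powers follow by
  multiplicativity.\<close>

lemma lgal_powers: "lgal (\<lambda>j k. r k ^ j) = dec ` galc r"
proof (intro equalityI subsetI)
 fix p assume "p \<in> lgal (\<lambda>j k. r k ^ j)"
 then obtain \<alpha> where p: "p permutes {1..4}" and \<alpha>: "\<alpha> \<in> ring_iso (complex_ring\<lparr>carrier := Qr r\<rparr>) (complex_ring\<lparr>carrier := Qr r\<rparr>)"
  and e: "\<forall>i\<in>{1..4}. \<forall>j<4. r (p i - 1) ^ j = \<alpha> (r (i - 1) ^ j)" unfolding lgal_def lfield_powers by blast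
 have "\<alpha> \<in> Ring.ring_hom (complex_ring\<lparr>carrier := Qr r\<rparr>) (complex_ring\<lparr>carrier := Qr r\<rparr>)" using \<alpha> by (simp add: ring_iso_def)
 note h = field_auto_simps[OF this]
 have "fhom (Qr r) \<alpha>" unfolding fhom_def using h by blast
 moreover have "\<alpha> (r i) = r (enc p ! i)" if "i < 4" for i
 proof -
  have "r (p (Suc i) - 1) ^ 1 = \<alpha> (r (Suc i - 1) ^ 1)" using e[rule_format, of "Suc i" 1] that by simp
  then show ?thesis using that by (simp add: enc_def)
 qed
 ultimately have "enc p \<in> galc r" by (rule galcI[OF enc_S4(1)[OF p]])
 then show "p \<in> dec ` galc r" using enc_S4(2)[OF p] by (intro image_eqI[of _ _ "enc p"]) simp_all
next
 fix p assume "p \<in> dec ` galc r"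
 then obtain l where l0: "l \<in> galc r" "p = dec l" by blast
 from galcD[OF l0(1)] l0(2) obtain \<alpha> where l: "p = dec l" "l \<in> S4" and \<alpha>: "fhom (Qr r) \<alpha>" and e: "\<And>i. i < 4 ==> \<alpha> (r i) = r (l ! i)" by auto
 note D = fhomD[OF fld_Qr \<alpha>] and I = fhom_iso[OF \<alpha> l(2) e]
 have "\<alpha> \<in> ring_iso (complex_ring\<lparr>carrier := Qr r\<rparr>) (complex_ring\<lparr>carrier := Qr r\<rparr>)"
  using I D(1,2,3) by (auto simp: ring_iso_def Ring.ring_hom_def bij_betw_def)
 moreover have "r (p i - 1) ^ j = \<alpha> (r (i - 1) ^ j)" if "i \<in> {1..4}" for i j
 proof -
  have i: "i - 1 < 4" using that by auto
  show ?thesis using e[OF i] D(8)[OF Qr_incl[OF i]] that by (simp add: l dec_def)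
 qed
 ultimately show "p \<in> lgal (\<lambda>j k. r k ^ j)" unfolding lgal_def lfield_powers l(1) using dec_permutes[OF l(2)]
  by (intro CollectI conjI bexI[of _ \<alpha>]) auto
qed

lemma id_S4: "[0, 1, 2, 3] \<in> S4"
 by (simp add: S4_def)

lemma id_nth: "i < 4 ==> [0, 1, 2, 3] ! i = i"
 unfolding less_4_cases by (elim disjE) (simp_all add: One_nat_def numeral_2_eq_2 numeral_3_eq_3)

lemma galc_closed: "cclosed (galc r)"
 unfolding cclosed_def
proof (intro conjI ballI)
 show "galc r \<subseteq> S4" by (auto simp: galc_def)
 have "fhom (Qr r) (\<lambda>x. x)" by (simp add: fhom_def)
 from galcI[OF id_S4 this] show "[0, 1, 2, 3] \<in> galc r" by (simp only: id_nth)
 fix l m assume "l \<in> galc r" "m \<in> galc r"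
 from galcD[OF this(1)] galcD[OF this(2)] obtain \<alpha> \<beta> where l: "l \<in> S4" "fhom (Qr r) \<alpha>" "\<And>i. i < 4 ==> \<alpha> (r i) = r (l ! i)"
  and m: "m \<in> S4" "fhom (Qr r) \<beta>" "\<And>i. i < 4 ==> \<beta> (r i) = r (m ! i)" by auto
 have b: "\<beta> x \<in> Qr r" if "x \<in> Qr r" for x using fhom_iso(1)[OF m(2,1,3)] that by blast
 have "fhom (Qr r) (\<lambda>x. \<alpha> (\<beta> x))" using l(2) m(2) b unfolding fhom_def by simp
 moreover have "\<alpha> (\<beta> (r i)) = r (cmp l m ! i)" if "i < 4" for i
  using that l(3) m(3) S4_nth[OF m(1)] cmp_nth[OF m(1)] by simp
 ultimately show "cmp l m \<in> galc r" by (rule galcI[OF cmp_S4[OF l(1) m(1)]])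
qed

text \<open>Relabelling the roots conjugates the group, so one polynomial for each conjugacy class
  is enough.\<close>

lemma galc_conj:
 assumes c: "c \<in> S4" "d \<in> S4" "cmp c d = [0, 1, 2, 3]" "cmp d c = [0, 1, 2, 3]"
 shows "galc (\<lambda>i. r (c ! i)) = (\<lambda>m. cmp d (cmp m c)) ` galc r"
proof -
 have Q: "Qr (\<lambda>i. r (c ! i)) = Qr r"
 proof -
  have "(!) c ` {..<4} = {..<4}" using S4_nth[OF c(1)] S4_less_surj[OF c(1)] by fastforce
  then have "(\<lambda>i. r (c ! i)) ` {..<4} = r ` {..<4}" using image_image[of r "(!) c" "{..<4}"] by simp
  then show ?thesis by (simp add: Qr_def)
 qed
 have cd: "c ! (d ! i) = i" "d ! (c ! i) = i" if "i < 4" for i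
  using cmp_nth[OF c(2) that, of c] cmp_nth[OF c(1) that, of d] id_nth[OF that] c(3,4) by simp_all
 show ?thesis
 proof (intro equalityI subsetI)
  fix l assume "l \<in> galc (\<lambda>i. r (c ! i))"
  from galcD[OF this, unfolded Q] obtain \<alpha> where l: "l \<in> S4" "fhom (Qr r) \<alpha>" "\<And>i. i < 4 ==> \<alpha> (r (c ! i)) = r (c ! (l ! i))" by auto
  let ?m = "cmp c (cmp l d)"
  have m: "?m \<in> S4" by (intro cmp_S4 c l)
  have "\<alpha> (r i) = r (?m ! i)" if "i < 4" for i
   using l(3)[OF S4_nth[OF c(2) that]] cd(1)[OF that] that c l S4_nth[OF c(2) that] by (simp add: cmp_nth cmp_S4)
  then have "?m \<in> galc r" by (rule galcI[OF m l(2)])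
  moreover have "l = cmp d (cmp ?m c)"
  proof (rule S4_eqI)
   show "cmp d (cmp ?m c) \<in> S4" by (intro cmp_S4 c l)
   fix i :: nat assume i: "i < 4"
   show "l ! i = cmp d (cmp ?m c) ! i"
    using i c l cd S4_nth[OF c(1) i] S4_nth[OF l(1) i] S4_nth[OF c(2)] by (simp add: cmp_nth cmp_S4)
  qed (rule l)
  ultimately show "l \<in> (\<lambda>m. cmp d (cmp m c)) ` galc r" by blast
 next
  fix l assume "l \<in> (\<lambda>m. cmp d (cmp m c)) ` galc r"
  then obtain m where m0: "m \<in> galc r" "l = cmp d (cmp m c)" by blast
  from galcD[OF m0(1)] m0(2) obtain \<alpha> where m: "m \<in> S4" "l = cmp d (cmp m c)" "fhom (Qr r) \<alpha>" "\<And>i. i < 4 ==> \<alpha> (r i) = r (m ! i)" by auto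
  have "\<alpha> (r (c ! i)) = r (c ! (l ! i))" if "i < 4" for i
   using m(4)[OF S4_nth[OF c(1) that]] that c m(1) cd S4_nth[OF m(1) S4_nth[OF c(1) that]] S4_nth[OF c(1) that]
   by (simp add: cmp_nth cmp_S4 m(2))
  moreover have "l \<in> S4" unfolding m(2) by (intro cmp_S4 c m)
  ultimately show "l \<in> galc (\<lambda>i. r (c ! i))" using m(3) by (intro galcI[where \<alpha> = \<alpha>]) (simp_all add: Q)
 qed
qed

lemma quart_relabel:
 assumes q: "quart r e1 e2 e3 e4" and c: "c \<in> S4"
 shows "quart (\<lambda>i. r (c ! i)) e1 e2 e3 e4"
proof -
 have i: "inj_on ((!) c) {..<4}" using S4_inj[OF c] by (auto intro!: inj_onI)
 have im: "(!) c ` {..<4} = {..<4}" using S4_nth[OF c] S4_less_surj[OF c] by fastforce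
 have "(\<Prod>k<4. x - r (c ! k)) = (\<Prod>k<4. x - r k)" for x
  using prod.reindex[OF i, of "\<lambda>k. x - r k"] im by (simp add: o_def)
 moreover have "inj_on (\<lambda>i. r (c ! i)) {..<4}"
  using comp_inj_on[OF i, of r] q im by (simp add: quart_def o_def)
 ultimately show ?thesis using q by (simp add: quart_def)
qed

lemma galc_cnj:
 assumes "l \<in> S4" "\<And>i. i < 4 ==> cnj (r i) = r (l ! i)"
 shows "l \<in> galc r"
 using assms by (intro galcI[where \<alpha> = cnj]) (simp_all add: fhom_def)

lemma poly_fhom:
 assumes F: "fld F" and h: "fhom F s" and P: "P \<in> FP F" and x: "x \<in> F"
 shows "poly P x \<in> F \<and> poly (map_poly s P) (s x) = s (poly P x)"
 using P
proof (induction P)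
 case 0
 then show ?case using fhomD(4)[OF F h] fldD(6)[OF F] by simp
next
 case (pCons a P)
 have *: "Polynomial.coeff (pCons a P) i \<in> F" for i using pCons(3) by (simp add: FP_def)
 have a: "a \<in> F" using *[of 0] by simp
 have "P \<in> FP F" unfolding FP_def using *[of "Suc i" for i] by simp
 with pCons(2) have IH: "poly P x \<in> F" "poly (map_poly s P) (s x) = s (poly P x)" by auto
 show ?case using IH a x fhomD[OF F h] fldD[OF F] by (simp add: map_poly_pCons)
qed

lemma ipoly_fhom:
 assumes F: "fld F" and h: "fhom F s" and x: "x \<in> F"
 shows "ipoly P (s x) = s (ipoly P x)"
proof -
 have "map_poly of_int P \<in> FP F" using fldD(9)[OF F] by (simp add: FP_def coeff_map_poly)
 moreover have "map_poly s (map_poly of_int P) = map_poly of_int P"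
  by (rule poly_eqI) (simp add: coeff_map_poly fhomD[OF F h])
 ultimately show ?thesis using poly_fhom[OF F h _ x, of "map_poly of_int P"] by simp
qed

lemma quart_root:
 assumes q: "quart r e1 e2 e3 e4"
 shows "ipoly [:e4, - e3, e2, - e1, 1:] x = 0 \<longleftrightarrow> (\<exists>k<4. x = r k)"
proof -
 have "ipoly [:e4, - e3, e2, - e1, 1:] x = x ^ 4 - of_int e1 * x ^ 3 + of_int e2 * x\<^sup>2 - of_int e3 * x + of_int e4"
  by (simp add: map_poly_pCons power4_eq_xxxx power3_eq_cube power2_eq_square algebra_simps)
 also have "\<dots> = (\<Prod>k<4. x - r k)" using q by (simp add: quart_def)
 finally show ?thesis by (auto simp: prod_zero_iff)
qed

text \<open>A homomorphism fixes the integral coefficients, hence maps roots to roots, and it is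
  injective.\<close>

lemma galc_of_hom:
 assumes quart: "quart r e1 e2 e3 e4" and h: "fhom (Qr r) s"
 shows "\<exists>l\<in>galc r. \<forall>i<4. s (r i) = r (l ! i)"
proof -
 let ?f = "[:e4, - e3, e2, - e1, 1:]"
 have "\<exists>k<4. s (r i) = r k" if i: "i < 4" for i
 proof -
  have "ipoly ?f (r i) = 0" unfolding quart_root[OF quart] using i by blast
  then have "ipoly ?f (s (r i)) = 0" using ipoly_fhom[OF fld_Qr h Qr_incl[OF i], of ?f] fhomD(4)[OF fld_Qr h] by simp
  then show ?thesis unfolding quart_root[OF quart] .
 qed
 then obtain k where k: "\<And>i. i < 4 ==> k i < 4 \<and> s (r i) = r (k i)" by metis
 define l where "l = map k [0..<4]"
 have ln: "l ! i = k i" if "i < 4" for i using that by (simp add: l_def)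
 have "l \<in> S4"
 proof (rule S4_I)
  show "length l = 4" by (simp add: l_def)
  show "l ! i < 4" if "i < 4" for i using that k ln by simp
  fix i j :: nat assume ij: "i < 4" "j < 4" "l ! i = l ! j"
  then have "s (r i) = s (r j)" using k[of i] k[of j] ln by simp
  then have "s (r i - r j) = 0" using fhomD(6)[OF fld_Qr h Qr_incl[OF ij(1)] Qr_incl[OF ij(2)]] by simp
  from fhomD(9)[OF fld_Qr h fldD(7)[OF fld_Qr Qr_incl[OF ij(1)] Qr_incl[OF ij(2)]] this] have "r i = r j" by simp
  then show "i = j" using quart ij by (auto simp: quart_def inj_on_def)
 qed
 moreover have e: "s (r i) = r (l ! i)" if "i < 4" for i using k ln that by simp
 ultimately have "l \<in> galc r" using h by (intro galcI)
 then show ?thesis using e by blast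
qed

text \<open>A map from \<open>z\<close> to \<open>z'\<close> exists on a field containing
  \<open>z\<close> and is extended root by root until it is defined on all of
  \<open>Qr r\<close>.\<close>

lemma galc_transitive:
 assumes quart: "quart r e1 e2 e3 e4" and q: "prime_elem q" "0 < Polynomial.degree q" and z: "ipoly q z = 0" "ipoly q z' = 0" "z \<in> Qr r"
 shows "\<exists>l\<in>galc r. \<exists>\<alpha>. fhom (Qr r) \<alpha> \<and> (\<forall>i<4. \<alpha> (r i) = r (l ! i)) \<and> \<alpha> z = z'"
proof -
 let ?f = "[:e4, - e3, e2, - e1, 1:]"
 have f0: "map_poly of_int ?f ~= (0 :: complex poly)" by (simp add: map_poly_pCons)
 have "n \<le> 4 ==> \<exists>E s. fld E \<and> z \<in> E \<and> (\<forall>i<n. r i \<in> E) \<and> fhom E s \<and> s z = z'" for n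
 proof (induction n)
  case 0
  then show ?case using conjugate_hom[OF q z(1,2)] by blast
 next
  case (Suc n)
  then obtain E s where E: "fld E" "z \<in> E" "\<forall>i<n. r i \<in> E" "fhom E s" "s z = z'" by auto
  have "map_poly of_int ?f \<in> FP E" using fldD(9)[OF E(1)] by (simp add: FP_def coeff_map_poly)
  moreover have "ipoly ?f (r n) = 0" unfolding quart_root[OF quart] using Suc(2) by (intro exI[of _ n]) simp
  ultimately obtain E' s' where E': "fld E'" "E \<subseteq> E'" "r n \<in> E'" "fhom E' s'" "\<forall>x\<in>E. s' x = s x"
   using ex_extension[OF E(1,4) _ f0, of "r n"] by blast
  have "\<forall>i<Suc n. r i \<in> E'" using E(3) E'(2,3) less_Suc_eq by auto
  then show ?case using E E' by (intro exI[of _ E'] exI[of _ s']) auto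
 qed
 from this[of 4] obtain E s where E: "fld E" "\<forall>i<4. r i \<in> E" "fhom E s" "s z = z'" by auto
 have "Qr r \<subseteq> E" using E by (intro Qr_min) auto
 then have h: "fhom (Qr r) s" using E(3) fhom_subset by blast
 obtain l where "l \<in> galc r" "\<forall>i<4. s (r i) = r (l ! i)" using galc_of_hom[OF quart h] by blast
 then show ?thesis using h E(4) by blast
qed

section \<open>Realisation of all permutation groups\<close>

text \<open>The entry \<open>std ! 9\<close> lists the alternating group.\<close>

definition evn :: "nat list => bool" where
 "evn l \<longleftrightarrow> list_ex ((=) l) (std ! 9)"

text \<open>The splitting to which \<open>l\<close> carries the one with pairs \<open>{0, 1}\<close>
  and \<open>{2, 3}\<close>, in the numbering of \<open>phi\<close>.\<close>

definition pr :: "nat list => nat" where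
 "pr l = (if l ! 0 + l ! 1 = 1 \<or> l ! 0 + l ! 1 = 5 then 0 else if l ! 0 + l ! 1 = 3 then 2 else 1)"

text \<open>The Galois group is one of the listed subgroups. \<open>U\<close> restricts all of its
  elements, while each member of \<open>Qs\<close> is a property of some element; a finite check
  confirms that only the wanted subgroup meets both.\<close>

lemma galc_stdI:
 assumes chk: "list_all (\<lambda>E. list_all U (elems E) \<and> list_all (\<lambda>Q. list_ex Q (elems E)) Qs --> elems E = std ! i) subs"
  and U: "\<And>l. l \<in> galc r ==> U l" and Qs: "\<forall>Q\<in>set Qs. \<exists>l\<in>galc r. Q l"
 shows "galc r = set (std ! i)"
proof -
 obtain E where E: "E \<in> set subs" "galc r = set (elems E)" using subgroup_listed[OF galc_closed] by blast
 have "list_all U (elems E)" using U E(2) unfolding list_all_iff by blast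
 moreover have "list_all (\<lambda>Q. list_ex Q (elems E)) Qs" using Qs E(2) unfolding list_all_iff list_ex_iff by simp
 ultimately have "elems E = std ! i" using chk E(1) unfolding list_all_iff[of _ subs] by blast
 then show ?thesis using E(2) by simp
qed

definition mk4 :: "'a => 'a => 'a => 'a => nat => 'a" where
 "mk4 a b c d k = (if k = 0 then a else if k = 1 then b else if k = 2 then c else d)"

lemma mk4_simps [simp]: "mk4 a b c d 0 = a" "mk4 a b c d 1 = b" "mk4 a b c d 2 = c" "mk4 a b c d 3 = d"
 by (simp_all add: mk4_def)

lemma quart_mk4:
 assumes d: "a ~= b" "a ~= c" "a ~= d" "b ~= c" "b ~= d" "c ~= d"
  and p: "\<And>x. (x - a) * (x - b) * (x - c) * (x - d) = x ^ 4 - of_int e1 * x ^ 3 + of_int e2 * x\<^sup>2 - of_int e3 * x + of_int e4"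
 shows "quart (mk4 a b c d) e1 e2 e3 e4"
proof -
 have "inj_on (mk4 a b c d) {..<4}"
 proof (rule inj_onI)
  fix i j :: nat assume ij: "i \<in> {..<4}" "j \<in> {..<4}" "mk4 a b c d i = mk4 a b c d j"
  then have "i < 4" "j < 4" by auto
  then show "i = j" using ij(3) d d[symmetric] unfolding less_4_cases by (elim disjE) simp_all
 qed
 then show ?thesis unfolding quart_def using p by (simp add: prod_less_four)
qed

lemma galc_rel:
 assumes "l \<in> galc r"
 shows "\<exists>\<alpha>. fhom (Qr r) \<alpha> \<and> \<alpha> (r 0) = r (l ! 0) \<and> \<alpha> (r 1) = r (l ! 1) \<and> \<alpha> (r 2) = r (l ! 2) \<and> \<alpha> (r 3) = r (l ! 3) \<and>
  l ! 0 < 4 \<and> l ! 1 < 4 \<and> l ! 2 < 4 \<and> l ! 3 < 4"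
proof -
 obtain \<alpha> where "l \<in> S4" "fhom (Qr r) \<alpha>" "\<forall>i<4. \<alpha> (r i) = r (l ! i)" using galcD[OF assms] by blast
 then show ?thesis using S4_nth[of l] by (intro exI[of _ \<alpha>]) simp
qed

lemma Qr_incl4: "r 0 \<in> Qr r" "r 1 \<in> Qr r" "r 2 \<in> Qr r" "r 3 \<in> Qr r"
 by (rule Qr_incl, simp)+

lemma quart_inj: "quart r e1 e2 e3 e4 ==> i < 4 ==> j < 4 ==> r i = r j ==> i = j"
 by (auto simp: quart_def inj_on_def)

lemma trans_at:
 assumes q: "quart r e1 e2 e3 e4" and f: "prime_elem f" "0 < Polynomial.degree f" and ij: "i < 4" "j < 4"
  and z: "ipoly f (r i) = 0" "ipoly f (r j) = 0"
 shows "\<exists>l\<in>galc r. l ! i = j"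
proof -
 obtain l \<alpha> where l: "l \<in> galc r" "\<forall>i<4. \<alpha> (r i) = r (l ! i)" "\<alpha> (r i) = r j"
  using galc_transitive[OF q f z Qr_incl[OF ij(1)]] by blast
 have "l ! i < 4" using l(1) ij(1) S4_nth by (simp add: galc_def)
 moreover have "r (l ! i) = r j" using l(2,3) ij(1) by simp
 ultimately have "l ! i = j" using quart_inj[OF q] ij(2) by blast
 then show ?thesis using l(1) by blast
qed

lemma eisenstein_2: "normalization_semidom_class.prime p ==> p dvd a ==> p dvd b ==> \<not> p\<^sup>2 dvd a ==> prime_elem [:a, b, 1 :: int:]"
 and eisenstein_3: "normalization_semidom_class.prime p ==> p dvd a ==> p dvd b ==> p dvd c ==> \<not> p\<^sup>2 dvd a ==> prime_elem [:a, b, c, 1 :: int:]"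
 and eisenstein_4: "normalization_semidom_class.prime p ==> p dvd a ==> p dvd b ==> p dvd c ==> p dvd d ==> \<not> p\<^sup>2 dvd a ==> prime_elem [:a, b, c, d, 1 :: int:]"
 by (rule eisenstein_prime_elem[of p]; auto simp: Polynomial.coeff_pCons split: nat.splits)+

text \<open>Eisenstein's criterion makes the quartic irreducible, so its group is
  transitive.\<close>

lemma trans_all:
 assumes q: "quart r e1 e2 e3 e4" and p: "normalization_semidom_class.prime p" "p dvd e1" "p dvd e2" "p dvd e3" "p dvd e4" "\<not> p\<^sup>2 dvd e4" and ij: "i < 4" "j < 4"
 shows "\<exists>l\<in>galc r. l ! i = j"
proof (rule trans_at[OF q, of "[:e4, - e3, e2, - e1, 1:]"])
 show "prime_elem [:e4, - e3, e2, - e1, 1:]" using p by (intro eisenstein_4[OF p(1)]) auto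
 show "ipoly [:e4, - e3, e2, - e1, 1:] (r i) = 0" "ipoly [:e4, - e3, e2, - e1, 1:] (r j) = 0"
  unfolding quart_root[OF q] using ij by blast+
qed (use ij in simp_all)

section \<open>One quartic polynomial for each conjugacy class\<close>

lemma gal_trivial: "\<exists>r e1 e2 e3 e4. quart r e1 e2 e3 e4 \<and> galc r = set (std ! 0)"
proof -
 let ?r = "mk4 0 1 2 3 :: nat => complex"
 have q: "quart ?r 6 11 6 0"
  by (rule quart_mk4) (simp_all add: algebra_simps power2_eq_square power3_eq_cube power4_eq_xxxx)
 have "galc ?r = set (std ! 0)"
 proof (rule galc_stdI[where U = "\<lambda>l. l = [0, 1, 2, 3]" and Qs = "[]"])
  fix l assume l: "l \<in> galc ?r"
  then have S: "l \<in> S4" by (simp add: galc_def)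
  obtain \<alpha> where \<alpha>: "fhom (Qr ?r) \<alpha>" "\<alpha> (?r 0) = ?r (l ! 0)" "\<alpha> (?r 1) = ?r (l ! 1)" "\<alpha> (?r 2) = ?r (l ! 2)" "\<alpha> (?r 3) = ?r (l ! 3)"
   "l ! 0 < 4" "l ! 1 < 4" "l ! 2 < 4" "l ! 3 < 4" using galc_rel[OF l] by blast
  note D = fhomD[OF fld_Qr \<alpha>(1)]
  have a: "\<alpha> 0 = 0" "\<alpha> 1 = 1" "\<alpha> 2 = 2" "\<alpha> 3 = 3" using D(4,1) D(7)[of 2] D(7)[of 3] by simp_all
  have e: "?r (l ! 0) = ?r 0" "?r (l ! 1) = ?r 1" "?r (l ! 2) = ?r 2" "?r (l ! 3) = ?r 3"
   using \<alpha>(2-5) a by simp_all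
  have v: "l ! 0 = 0" "l ! 1 = 1" "l ! 2 = 2" "l ! 3 = 3"
   by (rule quart_inj[OF q _ _ e(1)] quart_inj[OF q _ _ e(2)] quart_inj[OF q _ _ e(3)] quart_inj[OF q _ _ e(4)]; use \<alpha> in simp)+
  show "l = [0, 1, 2, 3]"
   by (rule S4_eqI[OF S id_S4]) (auto simp: less_4_cases v id_nth)
 qed (code_simp, simp)
 then show ?thesis using q by blast
qed

text \<open>The polynomial is \<open>x * (x - 1) * (x\<^sup>2 + 1)\<close>: the rational roots are
  fixed and complex conjugation exchanges the other two.\<close>

lemma gal_transposition: "\<exists>r e1 e2 e3 e4. quart r e1 e2 e3 e4 \<and> galc r = set (std ! 1)"
proof -
 let ?r = "mk4 \<i> (- \<i>) 0 1"
 have q: "quart ?r 1 1 1 0"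
  by (rule quart_mk4) (simp_all add: complex_eq_iff algebra_simps power2_eq_square power3_eq_cube power4_eq_xxxx)
 have "galc ?r = set (std ! 1)"
 proof (rule galc_stdI[where U = "\<lambda>l. l ! 2 = 2 \<and> l ! 3 = 3" and Qs = "[(=) [1, 0, 2, 3]]"])
  fix l assume l: "l \<in> galc ?r"
  obtain \<alpha> where \<alpha>: "fhom (Qr ?r) \<alpha>" "\<alpha> (?r 2) = ?r (l ! 2)" "\<alpha> (?r 3) = ?r (l ! 3)" "l ! 2 < 4" "l ! 3 < 4" using galc_rel[OF l] by blast
  note D = fhomD[OF fld_Qr \<alpha>(1)]
  have e: "?r (l ! 2) = ?r 2" "?r (l ! 3) = ?r 3" using \<alpha>(2,3) D(4,1) by simp_all
  show "l ! 2 = 2 \<and> l ! 3 = 3"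
   using quart_inj[OF q \<alpha>(4) _ e(1)] quart_inj[OF q \<alpha>(5) _ e(2)] by simp
 next
  have "[1, 0, 2, 3] \<in> galc ?r"
   by (rule galc_cnj) (auto simp: S4_def less_4_cases numeral_2_eq_2 numeral_3_eq_3 One_nat_def mk4_def)
  then show "\<forall>Q\<in>set [(=) [1, 0, 2, 3]]. \<exists>l\<in>galc ?r. Q l" by simp
 qed code_simp
 then show ?thesis using q by blast
qed

text \<open>For \<open>(x\<^sup>2 + 1) * (x\<^sup>2 + 4)\<close> the second pair of roots is twice
  the first, so both pairs are swapped simultaneously.\<close>

lemma gal_double_transposition: "\<exists>r e1 e2 e3 e4. quart r e1 e2 e3 e4 \<and> galc r = set (std ! 2)"
proof -
 let ?r = "mk4 \<i> (- \<i>) (2 * \<i>) (- 2 * \<i>)"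
 have q: "quart ?r 0 5 0 4"
  by (rule quart_mk4) (simp_all add: complex_eq_iff algebra_simps power2_eq_square power3_eq_cube power4_eq_xxxx)
 have "galc ?r = set (std ! 2)"
 proof (rule galc_stdI[where U = "\<lambda>l. (l ! 0 = 0 \<and> l ! 2 = 2) \<or> (l ! 0 = 1 \<and> l ! 2 = 3)" and Qs = "[(=) [1, 0, 3, 2]]"])
  fix l assume l: "l \<in> galc ?r"
  obtain \<alpha> where \<alpha>: "fhom (Qr ?r) \<alpha>" "\<alpha> (?r 0) = ?r (l ! 0)" "\<alpha> (?r 2) = ?r (l ! 2)" "l ! 0 < 4" "l ! 2 < 4" using galc_rel[OF l] by blast
  note D = fhomD[OF fld_Qr \<alpha>(1)]
  have "\<alpha> (of_int 2 * ?r 0) = of_int 2 * \<alpha> (?r 0)" using D(3)[OF fldD(9)[OF fld_Qr, where k = 2] Qr_incl4(1)] D(7)[where k = 2] by simp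
  then have "?r (l ! 2) = 2 * ?r (l ! 0)" using \<alpha>(2,3) by simp
  then show "(l ! 0 = 0 \<and> l ! 2 = 2) \<or> (l ! 0 = 1 \<and> l ! 2 = 3)"
   using \<alpha>(4,5) unfolding less_4_cases by (elim disjE) (simp_all add: complex_eq_iff)
 next
  have "[1, 0, 3, 2] \<in> galc ?r"
   by (rule galc_cnj) (auto simp: S4_def less_4_cases numeral_2_eq_2 numeral_3_eq_3 One_nat_def mk4_def)
  then show "\<forall>Q\<in>set [(=) [1, 0, 3, 2]]. \<exists>l\<in>galc ?r. Q l" by simp
 qed code_simp
 then show ?thesis using q by blast
qed

text \<open>For \<open>(x\<^sup>2 + 1) * (x\<^sup>2 - 2)\<close> complex conjugation acts on the
  imaginary pair only, and irreducibility of \<open>x\<^sup>2 - 2\<close> moves the real pair;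
  squares of roots keep the pairs apart.\<close>

lemma gal_two_transpositions: "\<exists>r e1 e2 e3 e4. quart r e1 e2 e3 e4 \<and> galc r = set (std ! 3)"
proof -
 define s where "s = complex_of_real (sqrt 2)"
 have ss: "s * s = 2" and cs: "cnj s = s" by (simp_all add: s_def flip: of_real_mult)
 have sr: "Re s = sqrt 2" "Im s = 0" by (simp_all add: s_def)
 let ?r = "mk4 \<i> (- \<i>) s (- s)"
 have p: "(x - \<i>) * (x - (- \<i>)) * (x - s) * (x - (- s)) = x ^ 4 - of_int 0 * x ^ 3 + of_int (- 1) * x\<^sup>2 - of_int 0 * x + of_int (- 2)" for x
 proof -
  have "(x - \<i>) * (x - (- \<i>)) = x * x + 1" "(x - s) * (x - (- s)) = x * x - 2" using ss by (simp_all add: algebra_simps)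
  then have "(x - \<i>) * (x - (- \<i>)) * ((x - s) * (x - (- s))) = (x * x + 1) * (x * x - 2)" by (simp only:)
  then show ?thesis by (simp add: algebra_simps power2_eq_square power4_eq_xxxx)
 qed
 have q: "quart ?r 0 (- 1) 0 (- 2)"
  by (rule quart_mk4[OF _ _ _ _ _ _ p]) (simp_all add: complex_eq_iff sr)
 have "galc ?r = set (std ! 3)"
 proof (rule galc_stdI[where U = "\<lambda>l. l ! 0 < 2 \<and> l ! 1 < 2" and Qs = "[(=) [1, 0, 2, 3], \<lambda>l. l ! 2 = 3]"])
  fix l assume l: "l \<in> galc ?r"
  obtain \<alpha> where \<alpha>: "fhom (Qr ?r) \<alpha>" "\<alpha> (?r 0) = ?r (l ! 0)" "\<alpha> (?r 1) = ?r (l ! 1)" "l ! 0 < 4" "l ! 1 < 4" using galc_rel[OF l] by blast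
  note D = fhomD[OF fld_Qr \<alpha>(1)]
  have "\<alpha> (?r 0 * ?r 0) = \<alpha> (?r 0) * \<alpha> (?r 0)" "\<alpha> (?r 1 * ?r 1) = \<alpha> (?r 1) * \<alpha> (?r 1)" by (intro D(3) Qr_incl4)+
  then have e: "?r (l ! 0) * ?r (l ! 0) = - 1" "?r (l ! 1) * ?r (l ! 1) = - 1" using \<alpha>(2,3) D(7)[of "- 1"] by simp_all
  have "k < 2" if "k < 4" "?r k * ?r k = - 1" for k using that unfolding less_4_cases by (elim disjE) (simp_all add: ss)
  then show "l ! 0 < 2 \<and> l ! 1 < 2" using e \<alpha>(4,5) by blast
 next
  have "[1, 0, 2, 3] \<in> galc ?r"
   by (rule galc_cnj) (auto simp: S4_def less_4_cases numeral_2_eq_2 numeral_3_eq_3 One_nat_def mk4_def cs)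
  moreover have "\<exists>l\<in>galc ?r. l ! 2 = 3"
  proof (rule trans_at[OF q, of "[:- 2, 0, 1:]"])
   show "prime_elem [:- 2, 0, 1 :: int:]" by (rule eisenstein_2[of 2]) simp_all
  qed (simp_all add: map_poly_pCons ss)
  ultimately show "\<forall>Q\<in>set [(=) [1, 0, 2, 3], \<lambda>l. l ! 2 = 3]. \<exists>l\<in>galc ?r. Q l" by auto
 qed code_simp
 then show ?thesis using q by blast
qed

lemma ex_root: "0 < Polynomial.degree p ==> \<exists>z :: complex. poly p z = 0"
 using fundamental_theorem_of_algebra[of p] by (auto simp: constant_degree)

text \<open>The factor \<open>x ^ 3 - 3 * x\<^sup>2 + 3\<close> is \<open>y ^ 3 - 3 * y + 1\<close>
  at \<open>y = x - 1\<close>, whose roots are permuted cyclically by \<open>y\<^sup>2 - 2\<close>,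
  that is, by \<open>x\<^sup>2 - 2 * x\<close>. The shift makes Eisenstein's criterion at 3
  applicable; the fourth root is 0.\<close>

lemma gal_cyclic_3: "\<exists>r e1 e2 e3 e4. quart r e1 e2 e3 e4 \<and> galc r = set (std ! 4)"
proof -
 obtain a :: complex where "poly [:3, 0, - 3, 1:] a = 0" using ex_root[of "[:3, 0, - 3, 1:]"] by auto
 then have a: "a * a * a = 3 * (a * a) - 3" by (simp add: algebra_simps)
 define b where "b = a * a - 2 * a"
 define c where "c = 3 + a - a * a"
 have a1: "a * (a * a) = 3 * (a * a) - 3" using a by (simp only: mult.assoc)
 have a2: "a * (a * (a * u)) = 3 * (a * (a * u)) - 3 * u" for u
 proof -
  have "a * (a * (a * u)) = (a * a * a) * u" by (simp only: mult.assoc)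
  then show ?thesis unfolding a by (simp add: algebra_simps)
 qed
 have b: "b * b * b = 3 * (b * b) - 3" unfolding b_def by (simp add: algebra_simps a1 a2)
 have c: "c * c * c = 3 * (c * c) - 3" unfolding c_def by (simp add: algebra_simps a1 a2)
 have cb: "c = b * b - 2 * b" unfolding b_def c_def by (simp add: algebra_simps a1 a2)
 have ac: "a = c * c - 2 * c" unfolding c_def by (simp add: algebra_simps a1 a2)
 have nofix: "z * z - 2 * z ~= z" and nz: "z ~= 0" if z: "z * z * z = 3 * (z * z) - 3" for z :: complex
 proof -
  show "z ~= 0" using z by auto
  show "z * z - 2 * z ~= z"
  proof
   assume "z * z - 2 * z = z"
   then have "z * z = 3 * z" by (simp add: algebra_simps)
   then have "z * z * z = 3 * (z * z)" by simp
   then show False using z by simp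
  qed
 qed
 have s: "a + b + c = 3" "a * b + a * c + b * c = 0" "a * b * c = - 3"
  unfolding b_def c_def by (simp_all add: algebra_simps a1 a2)
 let ?r = "mk4 a b c 0"
 have p: "(x - a) * (x - b) * (x - c) * (x - 0) = x ^ 4 - of_int 3 * x ^ 3 + of_int 0 * x\<^sup>2 - of_int (- 3) * x + of_int 0" for x
 proof -
  have "(x - a) * (x - b) * (x - c) * (x - 0) = x * x * x * x - (a + b + c) * (x * x * x) + (a * b + a * c + b * c) * (x * x) - (a * b * c) * x"
   by (simp add: algebra_simps)
  then show ?thesis unfolding s by (simp add: power2_eq_square power3_eq_cube power4_eq_xxxx)
 qed
 have ne: "a ~= b" "b ~= c" "a ~= c" using nofix[OF a] nofix[OF b] nofix[OF c] cb ac unfolding b_def[symmetric] by auto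
 have q: "quart ?r 3 0 (- 3) 0"
  by (rule quart_mk4[OF _ _ _ _ _ _ p]) (use ne nz[OF a] nz[OF b] nz[OF c] in auto)
 have "galc ?r = set (std ! 4)"
 proof (rule galc_stdI[where U = "\<lambda>l. l ! 3 = 3 \<and> ((l ! 0 = 0 \<and> l ! 1 = 1) \<or> (l ! 0 = 1 \<and> l ! 1 = 2) \<or> (l ! 0 = 2 \<and> l ! 1 = 0))" and Qs = "[\<lambda>l. l ! 0 = 1]"])
  fix l assume l: "l \<in> galc ?r"
  obtain \<alpha> where \<alpha>: "fhom (Qr ?r) \<alpha>" "\<alpha> (?r 0) = ?r (l ! 0)" "\<alpha> (?r 1) = ?r (l ! 1)" "\<alpha> (?r 3) = ?r (l ! 3)" "l ! 0 < 4" "l ! 1 < 4" "l ! 3 < 4"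
   using galc_rel[OF l] by blast
  note D = fhomD[OF fld_Qr \<alpha>(1)] and I = Qr_incl4[of ?r] and F = fldD[OF fld_Qr[of ?r]]
  have "?r (l ! 3) = ?r 3" using \<alpha>(4) D(4) by simp
  then have l3: "l ! 3 = 3" using quart_inj[OF q \<alpha>(7)] by simp
  have "\<alpha> (?r 0 * ?r 0 - of_int 2 * ?r 0) = \<alpha> (?r 0) * \<alpha> (?r 0) - of_int 2 * \<alpha> (?r 0)"
   by (simp only: D(6)[OF F(3)[OF I(1) I(1)] F(3)[OF F(9) I(1)]] D(3)[OF I(1) I(1)] D(3)[OF F(9) I(1)] D(7))
  then have r1: "?r (l ! 1) = ?r (l ! 0) * ?r (l ! 0) - 2 * ?r (l ! 0)" using \<alpha>(2,3) by (simp add: b_def)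
  have "l ! 0 ~= 3"
  proof
   assume "l ! 0 = 3"
   then have "\<alpha> (?r 0) = 0" using \<alpha>(2) by simp
   from D(9)[OF I(1) this] nz[OF a] show False by simp
  qed
  moreover have "l ! 1 = 1" if "l ! 0 = 0" using quart_inj[OF q \<alpha>(6), of 1] r1 that by (simp add: b_def)
  moreover have "l ! 1 = 2" if "l ! 0 = 1" using quart_inj[OF q \<alpha>(6), of 2] r1 that cb by simp
  moreover have "l ! 1 = 0" if "l ! 0 = 2" using quart_inj[OF q \<alpha>(6), of 0] r1 that ac[symmetric] by simp
  ultimately show "l ! 3 = 3 \<and> ((l ! 0 = 0 \<and> l ! 1 = 1) \<or> (l ! 0 = 1 \<and> l ! 1 = 2) \<or> (l ! 0 = 2 \<and> l ! 1 = 0))"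
   using l3 \<alpha>(5) unfolding less_4_cases by (elim disjE) simp_all
 next
  have "\<exists>l\<in>galc ?r. l ! 0 = 1"
  proof (rule trans_at[OF q, of "[:3, 0, - 3, 1:]"])
   show "prime_elem [:3, 0, - 3, 1 :: int:]" by (rule eisenstein_3[of 3]) simp_all
  qed (use a b in \<open>simp_all add: map_poly_pCons algebra_simps\<close>)
  then show "\<forall>Q\<in>set [\<lambda>l. l ! 0 = 1]. \<exists>l\<in>galc ?r. Q l" by simp
 qed code_simp
 then show ?thesis using q by blast
qed

text \<open>The polynomial is \<open>x * (x ^ 3 - 2)\<close>: the root 0 is fixed, complex
  conjugation is a transposition, and irreducibility of the cubic factor moves the real cube
  root.\<close>

lemma gal_sym_3: "\<exists>r e1 e2 e3 e4. quart r e1 e2 e3 e4 \<and> galc r = set (std ! 5)"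
proof -
 define t where "t = complex_of_real (root 3 2)"
 have "root 3 2 ^ 3 = (2 :: real)" by (rule real_root_pow_pos2) auto
 then have "t ^ 3 = 2" by (simp add: t_def flip: of_real_power)
 then have t: "t * t * t = 2" by (simp add: power3_eq_cube)
 have ct: "cnj t = t" by (simp add: t_def)
 have t0: "t ~= 0" using t by auto
 define w where "w = Complex (- 1 / 2) (sqrt 3 / 2)"
 have ww: "w * w = - 1 - w" by (simp add: w_def complex_eq_iff)
 have cw: "cnj w = - 1 - w" by (simp add: w_def complex_eq_iff)
 have w1: "w ~= 1" "w ~= - 1 - w" "w ~= 0" "- 1 - w ~= 1" "- 1 - w ~= 0" by (simp_all add: w_def complex_eq_iff)
 let ?r = "mk4 t (t * w) (t * (- 1 - w)) 0"
 have p: "(x - t) * (x - t * w) * (x - t * (- 1 - w)) * (x - 0) = x ^ 4 - of_int 0 * x ^ 3 + of_int 0 * x\<^sup>2 - of_int 2 * x + of_int 0" for x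
 proof -
  have "w + w * w = - 1" using ww by simp
  moreover have "(x - t * w) * (x - t * (- 1 - w)) = x * x + t * x - t * t * (w + w * w)" by (simp add: algebra_simps)
  ultimately have "(x - t * w) * (x - t * (- 1 - w)) = x * x + t * x + t * t" by simp
  moreover have "(x - t) * (x * x + t * x + t * t) = x * x * x - t * t * t" by (simp add: algebra_simps)
  ultimately have "(x - t) * ((x - t * w) * (x - t * (- 1 - w))) = x * x * x - 2" unfolding t by (simp only:)
  then have "(x - t) * ((x - t * w) * (x - t * (- 1 - w))) * (x - 0) = (x * x * x - 2) * x" by simp
  then show ?thesis by (simp add: algebra_simps power4_eq_xxxx)
 qed
 have ne: "t * u ~= t * v" if "u ~= v" for u v using t0 that by simp
 have q: "quart ?r 0 0 2 0"
  by (rule quart_mk4[OF _ _ _ _ _ _ p]) (use ne[of 1 w] ne[of 1 "- 1 - w"] ne[of w "- 1 - w"] w1 t0 in auto)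
 have "galc ?r = set (std ! 5)"
 proof (rule galc_stdI[where U = "\<lambda>l. l ! 3 = 3" and Qs = "[(=) [0, 2, 1, 3], \<lambda>l. l ! 0 = 1]"])
  fix l assume l: "l \<in> galc ?r"
  obtain \<alpha> where \<alpha>: "fhom (Qr ?r) \<alpha>" "\<alpha> (?r 3) = ?r (l ! 3)" "l ! 3 < 4" using galc_rel[OF l] by blast
  have "?r (l ! 3) = ?r 3" using \<alpha>(2) fhomD(4)[OF fld_Qr \<alpha>(1)] by simp
  then show "l ! 3 = 3" using quart_inj[OF q \<alpha>(3)] by simp
 next
  have "[0, 2, 1, 3] \<in> galc ?r"
   by (rule galc_cnj) (auto simp: S4_def less_4_cases numeral_2_eq_2 numeral_3_eq_3 One_nat_def mk4_def ct cw)
  moreover have "\<exists>l\<in>galc ?r. l ! 0 = 1"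
  proof (rule trans_at[OF q, of "[:- 2, 0, 0, 1:]"])
   show "prime_elem [:- 2, 0, 0, 1 :: int:]" by (rule eisenstein_3[of 2]) simp_all
   show "ipoly [:- 2, 0, 0, 1:] (?r 0) = 0" using t by (simp add: map_poly_pCons mult.assoc)
   have "w * w * w = (- 1 - w) * w" by (simp only: ww)
   also have "\<dots> = - w - w * w" by (simp add: algebra_simps)
   also have "\<dots> = 1" by (simp add: ww)
   finally have "w * w * w = 1" .
   moreover have "(t * w) * (t * w) * (t * w) = (t * t * t) * (w * w * w)" by (simp only: mult_ac)
   ultimately have "(t * w) * (t * w) * (t * w) = 2" using t by simp
   then show "ipoly [:- 2, 0, 0, 1:] (?r 1) = 0" by (simp add: map_poly_pCons mult.assoc)
  qed simp_all
  ultimately show "\<forall>Q\<in>set [(=) [0, 2, 1, 3], \<lambda>l. l ! 0 = 1]. \<exists>l\<in>galc ?r. Q l" by auto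
 qed code_simp
 then show ?thesis using q by blast
qed

text \<open>The roots are the primitive eighth roots of unity minus 1, zeros of
  \<open>(x + 1) ^ 4 + 1\<close>, which is Eisenstein at 2. Cubing and negating one root of unity
  give others, so the image of one root determines the permutation.\<close>

lemma gal_klein: "\<exists>r e1 e2 e3 e4. quart r e1 e2 e3 e4 \<and> galc r = set (std ! 6)"
proof -
 define s where "s = csqrt \<i>"
 have ss: "s * s = \<i>" using power2_csqrt[of \<i>] by (simp add: s_def power2_eq_square)
 have s0: "s ~= 0" using ss by auto
 have ne: "s * u - 1 ~= s * v - 1" if "u ~= v" for u v using s0 that by simp
 let ?r = "mk4 (s * 1 - 1) (s * \<i> - 1) (s * (- 1) - 1) (s * (- \<i>) - 1)"
 have p: "(x - (s * 1 - 1)) * (x - (s * \<i> - 1)) * (x - (s * (- 1) - 1)) * (x - (s * (- \<i>) - 1)) =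
   x ^ 4 - of_int (- 4) * x ^ 3 + of_int 6 * x\<^sup>2 - of_int (- 4) * x + of_int 2" for x
 proof -
  have y: "(y - s) * (y - s * \<i>) * (y + s) * (y + s * \<i>) = y * y * (y * y) + 1" for y
  proof -
   have "(y - s) * (y + s) = y * y - s * s" "(y - s * \<i>) * (y + s * \<i>) = y * y + s * s" by (simp_all add: algebra_simps)
   moreover have "(y - s) * (y - s * \<i>) * (y + s) * (y + s * \<i>) = ((y - s) * (y + s)) * ((y - s * \<i>) * (y + s * \<i>))" by (simp only: mult_ac)
   ultimately show ?thesis unfolding ss by (simp add: algebra_simps)
  qed
  have "(x - (s * 1 - 1)) * (x - (s * \<i> - 1)) * (x - (s * (- 1) - 1)) * (x - (s * (- \<i>) - 1)) =
    ((x + 1) - s) * ((x + 1) - s * \<i>) * ((x + 1) + s) * ((x + 1) + s * \<i>)" by (simp add: algebra_simps)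
  then show ?thesis unfolding y by (simp add: algebra_simps power2_eq_square power3_eq_cube power4_eq_xxxx)
 qed
 have q: "quart ?r (- 4) 6 (- 4) 2"
  by (rule quart_mk4[OF ne ne ne ne ne ne p]) (simp_all add: complex_eq_iff)
 let ?U = "\<lambda>l. (l ! 0 = 0 \<and> l ! 1 = 1 \<and> l ! 2 = 2) \<or> (l ! 0 = 1 \<and> l ! 1 = 0 \<and> l ! 2 = 3) \<or> (l ! 0 = 2 \<and> l ! 1 = 3 \<and> l ! 2 = 0) \<or> (l ! 0 = 3 \<and> l ! 1 = 2 \<and> l ! 2 = (1::nat))"
 have cube: "(s * u) * (s * u) * (s * u) = s * (\<i> * (u * u * u))" for u
 proof -
  have "(s * u) * (s * u) * (s * u) = s * ((s * s) * (u * u * u))" by (simp only: mult_ac)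
  then show ?thesis unfolding ss .
 qed
 have "galc ?r = set (std ! 6)"
 proof (rule galc_stdI[where U = ?U and Qs = "[\<lambda>l. l ! 0 = 1, \<lambda>l. l ! 0 = 2]"])
  fix l assume l: "l \<in> galc ?r"
  obtain \<alpha> where \<alpha>: "fhom (Qr ?r) \<alpha>" "\<alpha> (?r 0) = ?r (l ! 0)" "\<alpha> (?r 1) = ?r (l ! 1)" "\<alpha> (?r 2) = ?r (l ! 2)" "l ! 0 < 4" "l ! 1 < 4" "l ! 2 < 4"
   using galc_rel[OF l] by blast
  note D = fhomD[OF fld_Qr \<alpha>(1)] and I = Qr_incl4[of ?r] and F = fldD[OF fld_Qr[of ?r]]
  let ?z = "?r 0 + 1"
  have z: "?z \<in> Qr ?r" "?z * ?z \<in> Qr ?r" "?z * ?z * ?z \<in> Qr ?r" by (intro F(2,3) I F(1))+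
  have "\<alpha> ?z = ?r (l ! 0) + 1" unfolding D(2)[OF I(1) F(1)] D(1) \<alpha>(2) ..
  then have z3: "\<alpha> (?z * ?z * ?z) = (?r (l ! 0) + 1) * (?r (l ! 0) + 1) * (?r (l ! 0) + 1)"
   unfolding D(3)[OF z(2,1)] D(3)[OF z(1,1)] by (simp only:)
  have "?r 1 = ?z * ?z * ?z - 1" using cube[of 1] by (simp add: ss)
  then have "\<alpha> (?r 1) = \<alpha> (?z * ?z * ?z) - \<alpha> 1" using D(6)[OF z(3) F(1)] by (simp only:)
  then have e1: "?r (l ! 1) = (?r (l ! 0) + 1) * (?r (l ! 0) + 1) * (?r (l ! 0) + 1) - 1" unfolding z3 D(1) \<alpha>(3) .
  have "?r 2 = - ?z - 1" by simp
  then have "\<alpha> (?r 2) = - \<alpha> ?z - \<alpha> 1" using D(6)[OF F(4)[OF z(1)] F(1)] D(5)[OF z(1)] by (simp only:)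
  then have e2: "?r (l ! 2) = - (?r (l ! 0) + 1) - 1" unfolding \<alpha>(4) \<open>\<alpha> ?z = ?r (l ! 0) + 1\<close> D(1) .
  have c: "s * u * (s * u) * (s * u) = s * v" if "\<i> * (u * u * u) = v" for u v using cube[of u] that by simp
  have k0: "l ! 1 = 1 \<and> l ! 2 = 2" if "l ! 0 = 0"
   using quart_inj[OF q \<alpha>(6), of 1] quart_inj[OF q \<alpha>(7), of 2] e1 e2 that c[of 1 \<i>] by simp
  have k1: "l ! 1 = 0 \<and> l ! 2 = 3" if "l ! 0 = 1"
   using quart_inj[OF q \<alpha>(6), of 0] quart_inj[OF q \<alpha>(7), of 3] e1 e2 that c[of \<i> 1] by simp
  have k2: "l ! 1 = 3 \<and> l ! 2 = 0" if "l ! 0 = 2"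
   using quart_inj[OF q \<alpha>(6), of 3] quart_inj[OF q \<alpha>(7), of 0] e1 e2 that c[of "- 1" "- \<i>"] by simp
  have k3: "l ! 1 = 2 \<and> l ! 2 = 1" if "l ! 0 = 3"
   using quart_inj[OF q \<alpha>(6), of 2] quart_inj[OF q \<alpha>(7), of 1] e1 e2 that c[of "- \<i>" "- 1"] by simp
  show "?U l" using k0 k1 k2 k3 \<alpha>(5) unfolding less_4_cases by (elim disjE) simp_all
 next
  show "\<forall>Q\<in>set [\<lambda>l. l ! 0 = 1, \<lambda>l. l ! 0 = 2]. \<exists>l\<in>galc ?r. Q l"
   using trans_all[OF q, of 2 0 1] trans_all[OF q, of 2 0 2] by simp
 qed code_simp
 then show ?thesis using q by blast
qed

text \<open>The roots are the primitive fifth roots of unity minus 1, ordered so that squaring moves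
  each to the next; the shift produces an Eisenstein polynomial at 5.\<close>

lemma gal_cyclic_4: "\<exists>r e1 e2 e3 e4. quart r e1 e2 e3 e4 \<and> galc r = set (std ! 7)"
proof -
 obtain z :: complex where "poly [:1, 1, 1, 1, 1:] z = 0" using ex_root[of "[:1, 1, 1, 1, 1:]"] by auto
 then have z: "1 + z + z * z + z * z * z + z * z * z * z = 0" by (simp add: algebra_simps)
 have z5: "z * z * z * z * z = 1"
 proof -
  have "z * z * z * z * z - 1 = (z - 1) * (1 + z + z * z + z * z * z + z * z * z * z)" by (simp add: algebra_simps)
  then show ?thesis unfolding z by simp
 qed
 have n0: "z ~= 0" using z by auto
 have n1: "z ~= 1" using z by auto
 have n2: "z * z ~= 1" using z5 n1 by auto
 have n3: "z * z * z ~= 1" using z5 n2 by auto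
 let ?r = "mk4 (z - 1) (z * z - 1) (z * z * z * z - 1) (z * z * z - 1)"
 have p: "(x - (z - 1)) * (x - (z * z - 1)) * (x - (z * z * z * z - 1)) * (x - (z * z * z - 1)) =
   x ^ 4 - of_int (- 5) * x ^ 3 + of_int 10 * x\<^sup>2 - of_int (- 10) * x + of_int 5" for x
 proof -
  define y where "y = x + 1"
  have 6: "z * z * z * z * z * u = u" for u using z5 by simp
  have "(x - (z - 1)) * (x - (z * z - 1)) * (x - (z * z * z * z - 1)) * (x - (z * z * z - 1)) =
    (y - z) * (y - z * z) * (y - z * z * z * z) * (y - z * z * z)" by (simp add: y_def algebra_simps)
  also have "\<dots> = y * y * y * y - (z + z * z + z * z * z + z * z * z * z) * (y * y * y)
    + (z * z * z + z * z * z * z + z * z * z * z * z * 1 + z * z * z * z * z * 1 + z * z * z * z * z * z + z * z * z * z * z * (z * z)) * (y * y)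
    - (z * z * z * z * z * z + z * z * z * z * z * (z * z) + z * z * z * z * z * (z * z * z) + z * z * z * z * z * (z * z * z * z)) * y + z * z * z * z * z * (z * z * z * z * z * 1)"
   by (simp add: algebra_simps)
  also have "\<dots> = y * y * y * y - (z + z * z + z * z * z + z * z * z * z) * (y * y * y)
    + (z * z * z + z * z * z * z + 1 + 1 + z + z * z) * (y * y) - (z + z * z + z * z * z + z * z * z * z) * y + 1" unfolding 6 ..
  also have "\<dots> = y * y * y * y + y * y * y + y * y + y + 1"
  proof -
   have "z + z * z + z * z * z + z * z * z * z = - 1" using z by (simp add: eq_neg_iff_add_eq_0 ac_simps)
   moreover have "z * z * z + z * z * z * z + 1 + 1 + z + z * z = (z + z * z + z * z * z + z * z * z * z) + 2" by simp
   ultimately show ?thesis by simp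
  qed
  finally show ?thesis by (simp add: y_def algebra_simps power2_eq_square power3_eq_cube power4_eq_xxxx)
 qed
 have z10: "z * z * z * z * u = 1 ==> u = z" for u
 proof -
  assume "z * z * z * z * u = 1"
  then have "z * z * z * z * u = z * z * z * z * z" using z5 by simp
  then show "u = z" using n0 by simp
 qed
 have q: "quart ?r (- 5) 10 (- 10) 5"
  by (rule quart_mk4[OF _ _ _ _ _ _ p]) (use n0 n1 n2 n3 in \<open>auto simp: mult.assoc\<close>)
 let ?U = "\<lambda>l. (l ! 0 = 0 \<and> l ! 1 = 1 \<and> l ! 2 = 2) \<or> (l ! 0 = 1 \<and> l ! 1 = 2 \<and> l ! 2 = 3) \<or> (l ! 0 = 2 \<and> l ! 1 = 3 \<and> l ! 2 = 0) \<or> (l ! 0 = 3 \<and> l ! 1 = 0 \<and> l ! 2 = (1::nat))"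
 have sq: "(?r k + 1) * (?r k + 1) - 1 = ?r (if k = 3 then 0 else k + 1)" if "k < 4" for k
 proof -
  have "z * z * z * z * (z * z * z * z) = z * z * z * z * z * (z * z * z)" "z * z * z * (z * z * z) = z * z * z * z * z * z" by (simp_all only: mult_ac)
  then have "z * z * z * z * (z * z * z * z) = z * z * z" "z * z * z * (z * z * z) = z" unfolding z5 by simp_all
  then show ?thesis using that unfolding less_4_cases by (elim disjE) (simp_all add: mult.assoc)
 qed
 have "galc ?r = set (std ! 7)"
 proof (rule galc_stdI[where U = ?U and Qs = "[\<lambda>l. l ! 0 = 1]"])
  fix l assume l: "l \<in> galc ?r"
  obtain \<alpha> where \<alpha>: "fhom (Qr ?r) \<alpha>" "\<alpha> (?r 0) = ?r (l ! 0)" "\<alpha> (?r 1) = ?r (l ! 1)" "\<alpha> (?r 2) = ?r (l ! 2)" "l ! 0 < 4" "l ! 1 < 4" "l ! 2 < 4"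
   using galc_rel[OF l] by blast
  note D = fhomD[OF fld_Qr \<alpha>(1)] and I = Qr_incl4[of ?r] and F = fldD[OF fld_Qr[of ?r]]
  have sqa: "\<alpha> ((u + 1) * (u + 1) - 1) = (\<alpha> u + 1) * (\<alpha> u + 1) - 1" if u: "u \<in> Qr ?r" for u
   unfolding D(6)[OF F(3)[OF F(2)[OF u F(1)] F(2)[OF u F(1)]] F(1)] D(3)[OF F(2)[OF u F(1)] F(2)[OF u F(1)]] D(2)[OF u F(1)] D(1) ..
  have "?r 1 = (?r 0 + 1) * (?r 0 + 1) - 1" "?r 2 = (?r 1 + 1) * (?r 1 + 1) - 1" using sq[of 0] sq[of 1] by simp_all
  then have "\<alpha> (?r 1) = (\<alpha> (?r 0) + 1) * (\<alpha> (?r 0) + 1) - 1" "\<alpha> (?r 2) = (\<alpha> (?r 1) + 1) * (\<alpha> (?r 1) + 1) - 1"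
   using sqa[OF I(1)] sqa[OF I(2)] by (simp_all only:)
  then have e: "?r (l ! 1) = ?r (if l ! 0 = 3 then 0 else l ! 0 + 1)" "?r (l ! 2) = ?r (if l ! 1 = 3 then 0 else l ! 1 + 1)"
   unfolding \<alpha>(2-4) sq[OF \<alpha>(5)] sq[OF \<alpha>(6)] .
  have "l ! 1 = (if l ! 0 = 3 then 0 else l ! 0 + 1)" "l ! 2 = (if l ! 1 = 3 then 0 else l ! 1 + 1)"
   by (rule quart_inj[OF q \<alpha>(6) _ e(1)], use \<alpha>(5) in simp, rule quart_inj[OF q \<alpha>(7) _ e(2)], use \<alpha>(6) in simp)
  then show "?U l" using \<alpha>(5) unfolding less_4_cases by (elim disjE) simp_all
 next
  show "\<forall>Q\<in>set [\<lambda>l. l ! 0 = 1]. \<exists>l\<in>galc ?r. Q l" using trans_all[OF q, of 5 0 1] by simp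
 qed code_simp
 then show ?thesis using q by blast
qed

text \<open>For \<open>x ^ 4 - 2\<close> opposite roots are negatives of each other, which bounds
  the group by the dihedral one; complex conjugation is the reflection that fixes the real
  roots.\<close>

lemma gal_dihedral: "\<exists>r e1 e2 e3 e4. quart r e1 e2 e3 e4 \<and> galc r = set (std ! 8)"
proof -
 define t where "t = complex_of_real (root 4 2)"
 have "root 4 2 ^ 4 = (2 :: real)" by (rule real_root_pow_pos2) auto
 then have "t ^ 4 = 2" by (simp add: t_def flip: of_real_power)
 then have t: "t * t * (t * t) = 2" by (simp add: power4_eq_xxxx mult.assoc)
 have ct: "cnj t = t" by (simp add: t_def)
 have t0: "t ~= 0" using t by auto
 have ne: "t * u ~= t * v" if "u ~= v" for u v using t0 that by simp
 let ?r = "mk4 (t * 1) (t * \<i>) (t * (- 1)) (t * (- \<i>))"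
 have p: "(x - t * 1) * (x - t * \<i>) * (x - t * (- 1)) * (x - t * (- \<i>)) =
   x ^ 4 - of_int 0 * x ^ 3 + of_int 0 * x\<^sup>2 - of_int 0 * x + of_int (- 2)" for x
 proof -
  have "(x - t) * (x + t) = x * x - t * t" "(x - t * \<i>) * (x + t * \<i>) = x * x + t * t" by (simp_all add: algebra_simps)
  moreover have "(x - t) * (x - t * \<i>) * (x + t) * (x + t * \<i>) = ((x - t) * (x + t)) * ((x - t * \<i>) * (x + t * \<i>))" by (simp only: mult_ac)
  ultimately have "(x - t) * (x - t * \<i>) * (x + t) * (x + t * \<i>) = x * x * (x * x) - t * t * (t * t)" by (simp add: algebra_simps)
  then show ?thesis unfolding t by (simp add: power4_eq_xxxx mult.assoc)
 qed
 have q: "quart ?r 0 0 0 (- 2)"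
  by (rule quart_mk4[OF ne ne ne ne ne ne p]) (simp_all add: complex_eq_iff)
 let ?opp = "\<lambda>a b. (a = 0 \<and> b = 2) \<or> (a = 1 \<and> b = 3) \<or> (a = 2 \<and> b = 0) \<or> (a = 3 \<and> b = (1::nat))"
 have opp: "?opp a b" if ab: "a < 4" "b < 4" "?r b = - ?r a" for a b
 proof -
  have "b = 2" if "a = 0" using quart_inj[OF q ab(2), of 2] ab(3) that by simp
  moreover have "b = 3" if "a = 1" using quart_inj[OF q ab(2), of 3] ab(3) that by simp
  moreover have "b = 0" if "a = 2" using quart_inj[OF q ab(2), of 0] ab(3) that by simp
  moreover have "b = 1" if "a = 3" using quart_inj[OF q ab(2), of 1] ab(3) that by simp
  ultimately show ?thesis using ab(1) unfolding less_4_cases by (elim disjE) auto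
 qed
 have "galc ?r = set (std ! 8)"
 proof (rule galc_stdI[where U = "\<lambda>l. ?opp (l ! 0) (l ! 2) \<and> ?opp (l ! 1) (l ! 3)" and Qs = "[(=) [0, 3, 2, 1], \<lambda>l. l ! 0 = 1]"])
  fix l assume l: "l \<in> galc ?r"
  obtain \<alpha> where \<alpha>: "fhom (Qr ?r) \<alpha>" "\<alpha> (?r 0) = ?r (l ! 0)" "\<alpha> (?r 1) = ?r (l ! 1)" "\<alpha> (?r 2) = ?r (l ! 2)" "\<alpha> (?r 3) = ?r (l ! 3)"
   "l ! 0 < 4" "l ! 1 < 4" "l ! 2 < 4" "l ! 3 < 4"
   using galc_rel[OF l] by blast
  note D = fhomD[OF fld_Qr \<alpha>(1)] and I = Qr_incl4[of ?r]
  have "?r 2 = - ?r 0" "?r 3 = - ?r 1" by simp_all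
  then have "?r (l ! 2) = - ?r (l ! 0)" "?r (l ! 3) = - ?r (l ! 1)"
   using D(5)[OF I(1)] D(5)[OF I(2)] \<alpha>(2-5) by (simp_all only:)
  then show "?opp (l ! 0) (l ! 2) \<and> ?opp (l ! 1) (l ! 3)" using opp \<alpha>(6-9) by blast
 next
  have "[0, 3, 2, 1] \<in> galc ?r"
   by (rule galc_cnj) (auto simp: S4_def less_4_cases numeral_2_eq_2 numeral_3_eq_3 One_nat_def mk4_def ct)
  then show "\<forall>Q\<in>set [(=) [0, 3, 2, 1], \<lambda>l. l ! 0 = 1]. \<exists>l\<in>galc ?r. Q l" using trans_all[OF q, of 2 0 1] by auto
 qed code_simp
 then show ?thesis using q by blast
qed

text \<open>The Vandermonde product, a square root of the discriminant, on which a permutation of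
  the roots acts by its sign.\<close>

definition vand :: "complex => complex => complex => complex => complex" where
 "vand a b c d = (b - a) * (c - a) * (d - a) * (c - b) * (d - b) * (d - c)"

lemma vand_swap: "vand b a c d = - vand a b c d" "vand a c b d = - vand a b c d" "vand a b d c = - vand a b c d"
proof -
 have n: "a - b = - (b - a)" "b - c = - (c - b)" "c - d = - (d - c)" by simp_all
 show "vand b a c d = - vand a b c d" "vand a c b d = - vand a b c d" "vand a b d c = - vand a b c d"
  unfolding vand_def by (subst n(1), simp only: mult_ac mult_minus_left mult_minus_right)
   (subst n(2), simp only: mult_ac mult_minus_left mult_minus_right, subst n(3), simp only: mult_ac mult_minus_left mult_minus_right)
qed

lemma evn_cases: "l \<in> S4 ==> if evn l then l \<in> set [[0, 1, 2, 3], [1, 2, 0, 3], [1, 0, 3, 2], [2, 0, 1, 3], [0, 3, 1, 2], [2, 1, 3, 0], [3, 1, 0, 2], [1, 3, 2, 0], [0, 2, 3, 1], [3, 0, 2, 1], [3, 2, 1, 0], [2, 3, 0, 1]] else l \<in> set [[0, 1, 3, 2], [0, 2, 1, 3], [0, 3, 2, 1], [1, 0, 2, 3], [1, 2, 3, 0], [1, 3, 0, 2], [2, 0, 3, 1], [2, 1, 0, 3], [2, 3, 1, 0], [3, 0, 1, 2], [3, 1, 2, 0], [3, 2, 0, 1]]"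
proof -
 have "list_all (\<lambda>l. if evn l then list_ex ((=) l) [[0, 1, 2, 3], [1, 2, 0, 3], [1, 0, 3, 2], [2, 0, 1, 3], [0, 3, 1, 2], [2, 1, 3, 0], [3, 1, 0, 2], [1, 3, 2, 0], [0, 2, 3, 1], [3, 0, 2, 1], [3, 2, 1, 0], [2, 3, 0, 1]] else list_ex ((=) l) [[0, 1, 3, 2], [0, 2, 1, 3], [0, 3, 2, 1], [1, 0, 2, 3], [1, 2, 3, 0], [1, 3, 0, 2], [2, 0, 3, 1], [2, 1, 0, 3], [2, 3, 1, 0], [3, 0, 1, 2], [3, 1, 2, 0], [3, 2, 0, 1]]) S4list" by code_simp
 then show "l \<in> S4 ==> ?thesis" unfolding S4_eq list_all_iff list_ex_iff by (cases "evn l") (auto 0 3)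
qed

lemma nth_1: "(x # y # zs) ! 1 = y"
 by (simp add: One_nat_def)

lemma vand_perm:
 assumes l: "l \<in> S4"
 shows "vand (r (l ! 0)) (r (l ! 1)) (r (l ! 2)) (r (l ! 3)) = (if evn l then vand (r 0) (r 1) (r 2) (r 3) else - vand (r 0) (r 1) (r 2) (r 3))"
proof -
 \<comment> \<open>Adjacent transpositions, restricted to decreasing indices so that rewriting with
   them sorts the arguments.\<close>
 have sw: "\<And>i j x y. j < i ==> vand (r i) (r j) x y = - vand (r j) (r i) x y"
  "\<And>i j x y. j < i ==> vand x (r i) (r j) y = - vand x (r j) (r i) y"
  "\<And>i j x y. j < i ==> vand x y (r i) (r j) = - vand x y (r j) (r i)"
  by (rule vand_swap)+
 show ?thesis
proof (cases "evn l")
 case True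
 then have "l \<in> set [[0, 1, 2, 3], [1, 2, 0, 3], [1, 0, 3, 2], [2, 0, 1, 3], [0, 3, 1, 2], [2, 1, 3, 0], [3, 1, 0, 2], [1, 3, 2, 0], [0, 2, 3, 1], [3, 0, 2, 1], [3, 2, 1, 0], [2, 3, 0, 1]]" using evn_cases[OF l] by (simp only: if_True)
 then have "vand (r (l ! 0)) (r (l ! 1)) (r (l ! 2)) (r (l ! 3)) = vand (r 0) (r 1) (r 2) (r 3)"
  unfolding list.set insert_iff empty_iff by (elim disjE FalseE; hypsubst) (simp_all add: sw nth_1)
 then show ?thesis using True by simp
next
 case False
 then have "l \<in> set [[0, 1, 3, 2], [0, 2, 1, 3], [0, 3, 2, 1], [1, 0, 2, 3], [1, 2, 3, 0], [1, 3, 0, 2], [2, 0, 3, 1], [2, 1, 0, 3], [2, 3, 1, 0], [3, 0, 1, 2], [3, 1, 2, 0], [3, 2, 0, 1]]" using evn_cases[OF l] by (simp only: if_False)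
 then have "vand (r (l ! 0)) (r (l ! 1)) (r (l ! 2)) (r (l ! 3)) = - vand (r 0) (r 1) (r 2) (r 3)"
  unfolding list.set insert_iff empty_iff by (elim disjE FalseE; hypsubst) (simp_all add: sw nth_1)
 then show ?thesis using False by simp
qed
qed

lemma phi_perm:
 assumes l: "l \<in> S4"
 shows "r (l ! 0) * r (l ! 1) + r (l ! 2) * r (l ! 3) = phi r (pr l)"
 using l unfolding S4_eq S4list_def list.set insert_iff empty_iff
 by (elim disjE FalseE; hypsubst) (simp_all add: phi_def pr_def nth_1 ac_simps)

lemma split_poly:
 fixes p :: "complex poly"
 assumes "Polynomial.degree p = n" "Polynomial.lead_coeff p = 1"
 shows "\<exists>as. length as = n \<and> p = prod_list (map (\<lambda>a. [:- a, 1:]) as)"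
 using assms
proof (induction n arbitrary: p)
 case 0
 then obtain a where "p = [:a:]" by (metis degree_eq_zeroE)
 then show ?case using 0 by (intro exI[of _ "[]"]) (simp add: one_pCons)
next
 case (Suc n)
 obtain a where "poly p a = 0" using ex_root[of p] Suc(2) by auto
 then obtain q where q: "p = [:- a, 1:] * q" by (auto simp: poly_eq_0_iff_dvd elim!: dvdE)
 then have q0: "q ~= 0" using Suc(2) by auto
 have "Polynomial.degree p = Polynomial.degree [:- a, 1:] + Polynomial.degree q" unfolding q by (rule degree_mult_eq) (use q0 in auto)
 then have "Polynomial.degree q = n" using Suc(2) by simp
 moreover have "Polynomial.lead_coeff q = 1" using Suc(3) unfolding q lead_coeff_mult by simp
 ultimately obtain as where "length as = n" "q = prod_list (map (\<lambda>a. [:- a, 1:]) as)" using Suc(1) by blast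
 then show ?case using q by (intro exI[of _ "a # as"]) simp
qed

lemma cubic_disc:
 fixes x y z :: complex
 shows "((y - x) * (z - x) * (z - y))\<^sup>2 = (x + y + z)\<^sup>2 * (x * y + x * z + y * z)\<^sup>2 - 4 * (x * y + x * z + y * z) ^ 3
   - 4 * (x + y + z) ^ 3 * (x * y * z) + 18 * (x + y + z) * (x * y + x * z + y * z) * (x * y * z) - 27 * (x * y * z)\<^sup>2"
 unfolding power2_eq_square power3_eq_cube by (simp add: algebra_simps)

text \<open>The discriminant of the quartic is that of its cubic resolvent.\<close>

lemma ex_quart:
 fixes e1 e2 e3 e4 :: int
 defines "u \<equiv> e1 * e3 - 4 * e4" and "v \<equiv> e1\<^sup>2 * e4 + e3\<^sup>2 - 4 * e2 * e4"
 defines "D \<equiv> e2\<^sup>2 * u\<^sup>2 - 4 * u ^ 3 - 4 * e2 ^ 3 * v + 18 * e2 * u * v - 27 * v\<^sup>2"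
 assumes D: "D ~= 0"
 shows "\<exists>r. quart r e1 e2 e3 e4 \<and> (vand (r 0) (r 1) (r 2) (r 3))\<^sup>2 = of_int D \<and>
  (phi r 0 + phi r 1 + phi r 2 = of_int e2 \<and> phi r 0 * phi r 1 + phi r 0 * phi r 2 + phi r 1 * phi r 2 = of_int u \<and> phi r 0 * phi r 1 * phi r 2 = of_int v)"
proof -
 let ?p = "[:of_int e4, - of_int e3, of_int e2, - of_int e1, 1:] :: complex poly"
 obtain as where as: "length as = 4" "?p = prod_list (map (\<lambda>a. [:- a, 1:]) as)" using split_poly[of ?p 4] by auto
 obtain a b c d where abcd: "as = [a, b, c, d]" using as(1) by (auto simp: numeral_eq_Suc length_Suc_conv)
 have e: "a + b + c + d = of_int e1" "a * b + a * c + a * d + b * c + b * d + c * d = of_int e2"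
  "a * b * c + a * b * d + a * c * d + b * c * d = of_int e3" "a * b * c * d = of_int e4"
 proof -
  have P: "?p = [:- a, 1:] * ([:- b, 1:] * ([:- c, 1:] * [:- d, 1:]))" using as(2) by (simp add: abcd)
  have "?p = [:a * b * c * d, - (a * b * c + a * b * d + a * c * d + b * c * d), a * b + a * c + a * d + b * c + b * d + c * d, - (a + b + c + d), 1:]"
   unfolding P by (simp add: algebra_simps)
  then show "a + b + c + d = of_int e1" "a * b + a * c + a * d + b * c + b * d + c * d = of_int e2"
   "a * b * c + a * b * d + a * c * d + b * c * d = of_int e3" "a * b * c * d = of_int e4" by (simp_all add: algebra_simps)
 qed
 let ?r = "mk4 a b c d"
 define x y z where xyz: "x = a * b + c * d" "y = a * c + b * d" "z = a * d + b * c"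
 have ph: "phi ?r 0 = x" "phi ?r 1 = y" "phi ?r 2 = z" by (simp_all add: phi_def xyz)
 have s: "x + y + z = of_int e2" "x * y + x * z + y * z = of_int u" "x * y * z = of_int v"
  unfolding xyz u_def v_def of_int_diff of_int_add of_int_mult of_int_power of_int_numeral e[symmetric]
  by (simp_all add: algebra_simps power2_eq_square)
 have "vand a b c d = - ((y - x) * (z - x) * (z - y))"
 proof -
  have f: "y - x = - ((d - a) * (c - b))" "z - x = - ((c - a) * (d - b))" "z - y = - ((b - a) * (d - c))" unfolding xyz by (simp_all add: algebra_simps)
  show ?thesis unfolding vand_def f by (simp add: mult_ac)
 qed
 then have "(vand a b c d)\<^sup>2 = ((y - x) * (z - x) * (z - y))\<^sup>2" by simp
 also have "\<dots> = of_int D" unfolding cubic_disc s D_def by simp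
 finally have V: "(vand a b c d)\<^sup>2 = of_int D" .
 then have V0: "vand a b c d ~= 0" using D by auto
 have "quart ?r e1 e2 e3 e4"
 proof (rule quart_mk4)
  show "a ~= b" "a ~= c" "a ~= d" "b ~= c" "b ~= d" "c ~= d" using V0 by (auto simp: vand_def)
  fix t
  have "(t - a) * (t - b) * (t - c) * (t - d) = t * t * t * t - (a + b + c + d) * (t * t * t) + (a * b + a * c + a * d + b * c + b * d + c * d) * (t * t)
   - (a * b * c + a * b * d + a * c * d + b * c * d) * t + a * b * c * d" by (simp add: algebra_simps)
  then show "(t - a) * (t - b) * (t - c) * (t - d) = t ^ 4 - of_int e1 * t ^ 3 + of_int e2 * t\<^sup>2 - of_int e3 * t + of_int e4"
   unfolding e by (simp add: power2_eq_square power3_eq_cube power4_eq_xxxx)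
 qed
 then show ?thesis using V s ph by (intro exI[of _ ?r]) simp
qed

lemma phi_Qr: "phi r m \<in> Qr r"
 using Qr_incl4[of r] fldD[OF fld_Qr[of r]] by (simp add: phi_def)

lemma galc_phi:
 assumes h: "fhom (Qr r) \<alpha>" and l: "l \<in> S4" "\<forall>i<4. \<alpha> (r i) = r (l ! i)"
 shows "\<alpha> (phi r 0) = phi r (pr l)"
proof -
 note D = fhomD[OF fld_Qr h] and I = Qr_incl4[of r] and F = fldD[OF fld_Qr[of r]]
 have "phi r 0 = r 0 * r 1 + r 2 * r 3" by (simp add: phi_def)
 then have "\<alpha> (phi r 0) = \<alpha> (r 0) * \<alpha> (r 1) + \<alpha> (r 2) * \<alpha> (r 3)"
  using D(2)[OF F(3)[OF I(1,2)] F(3)[OF I(3,4)]] D(3)[OF I(1,2)] D(3)[OF I(3,4)] by (simp only:)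
 then show ?thesis using l(2) phi_perm[OF l(1), of r] by simp
qed

lemma galc_vand:
 assumes h: "fhom (Qr r) \<alpha>" and l: "l \<in> S4" "\<forall>i<4. \<alpha> (r i) = r (l ! i)"
 shows "\<alpha> (vand (r 0) (r 1) (r 2) (r 3)) = (if evn l then vand (r 0) (r 1) (r 2) (r 3) else - vand (r 0) (r 1) (r 2) (r 3))"
proof -
 note D = fhomD[OF fld_Qr h] and I = Qr_incl4[of r] and F = fldD[OF fld_Qr[of r]]
 have "\<alpha> (vand (r 0) (r 1) (r 2) (r 3)) = vand (\<alpha> (r 0)) (\<alpha> (r 1)) (\<alpha> (r 2)) (\<alpha> (r 3))"
  unfolding vand_def by (simp only: D(3) D(6) F(3) F(7) I)
 then show ?thesis using l(2) vand_perm[OF l(1), of r] by simp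
qed

lemma phi_dist: "quart r e1 e2 e3 e4 ==> i < 3 ==> j < 3 ==> phi r i = phi r j ==> i = j"
proof (rule ccontr)
 assume q: "quart r e1 e2 e3 e4" and ij: "i < 3" "j < 3" "phi r i = phi r j" "i ~= j"
 have d: "r 0 ~= r 3" "r 1 ~= r 2" "r 0 ~= r 2" "r 1 ~= r 3" "r 0 ~= r 1" "r 2 ~= r 3"
  using quart_inj[OF q, of 0 3] quart_inj[OF q, of 1 2] quart_inj[OF q, of 0 2] quart_inj[OF q, of 1 3] quart_inj[OF q, of 0 1] quart_inj[OF q, of 2 3] by auto
 have "phi r 0 - phi r 1 ~= 0" "phi r 0 - phi r 2 ~= 0" "phi r 1 - phi r 2 ~= 0" unfolding phi_sub using d by auto
 then have "phi r 0 ~= phi r 1" "phi r 0 ~= phi r 2" "phi r 1 ~= phi r 2" by auto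
 then show False using ij unfolding less_3_cases by auto
qed

lemma pr_less: "pr l < 3"
 by (simp add: pr_def)

text \<open>The affine change by \<open>m\<close> and \<open>n\<close> serves to bring the cubic
  resolvent into Eisenstein form.\<close>

lemma trans_phi:
 assumes q: "quart r e1 e2 e3 e4" and f: "prime_elem f" "0 < Polynomial.degree f" and j: "j < 3"
  and z: "ipoly f ((phi r 0 - of_int m) / of_int n) = 0" "ipoly f ((phi r j - of_int m) / of_int n) = 0" and n: "n ~= 0"
 shows "\<exists>l\<in>galc r. pr l = j"
proof -
 note F = fldD[OF fld_Qr[of r]]
 have I: "phi r 0 - of_int m \<in> Qr r" by (intro F(7) phi_Qr F(9))
 have in_Q: "(phi r 0 - of_int m) / of_int n \<in> Qr r" unfolding divide_inverse by (intro F(3) F(5) I F(9))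
 obtain l \<alpha> where l: "l \<in> galc r" "fhom (Qr r) \<alpha>" "\<forall>i<4. \<alpha> (r i) = r (l ! i)"
  "\<alpha> ((phi r 0 - of_int m) / of_int n) = (phi r j - of_int m) / of_int n"
  using galc_transitive[OF q f z in_Q] by blast
 have S: "l \<in> S4" using l(1) by (simp add: galc_def)
 note D = fhomD[OF fld_Qr l(2)]
 have "\<alpha> ((phi r 0 - of_int m) / of_int n) = (\<alpha> (phi r 0) - of_int m) / of_int n"
  unfolding divide_inverse D(3)[OF I F(5)[OF F(9)]] D(6)[OF phi_Qr F(9)] D(10)[OF F(9)] D(7) ..
 then have "\<alpha> (phi r 0) = phi r j" using l(4) n by simp
 then have "phi r (pr l) = phi r j" using galc_phi[OF l(2) S l(3)] by simp
 then have "pr l = j" using phi_dist[OF q pr_less j] by blast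
 then show ?thesis using l(1) by blast
qed

text \<open>The discriminant of \<open>x ^ 4 - 2 * x ^ 3 + 2 * x\<^sup>2 + 2\<close> is the square
  of 56, so only even permutations occur. Eisenstein's criterion at 2 gives transitivity, and
  irreducibility of the cubic resolvent excludes the Klein group.\<close>

lemma gal_alternating: "\<exists>r e1 e2 e3 e4. quart r e1 e2 e3 e4 \<and> galc r = set (std ! 9)"
proof -
 obtain r where q: "quart r 2 2 0 2" and V: "(vand (r 0) (r 1) (r 2) (r 3))\<^sup>2 = of_int (56 * 56)"
  and ph: "phi r 0 + phi r 1 + phi r 2 = of_int 2" "phi r 0 * phi r 1 + phi r 0 * phi r 2 + phi r 1 * phi r 2 = of_int (- 8)" "phi r 0 * phi r 1 * phi r 2 = of_int (- 8)"
  using ex_quart[where ?e1.0 = 2 and ?e2.0 = 2 and ?e3.0 = 0 and ?e4.0 = 2] by auto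
 let ?V = "vand (r 0) (r 1) (r 2) (r 3)"
 have "(?V - 56) * (?V + 56) = 0" using V by (simp add: power2_eq_square algebra_simps)
 then have "?V = of_int 56 \<or> ?V = of_int (- 56)" by (auto simp: eq_neg_iff_add_eq_0)
 then have "\<exists>k. ?V = of_int k \<and> k ~= 0"
 proof
  assume "?V = of_int 56"
  then show ?thesis by (intro exI[of _ 56]) (simp only:, simp)
 next
  assume "?V = of_int (- 56)"
  then show ?thesis by (intro exI[of _ "- 56"]) (simp only:, simp)
 qed
 then obtain k where k: "?V = of_int k" "k ~= 0" by blast
 \<comment> \<open>The resolvent \<open>t ^ 3 - 2 * t\<^sup>2 - 8 * t + 8\<close> becomes Eisenstein
   at 7 under \<open>t = 2 * y + 10\<close>.\<close>
 have cubic: "ipoly [:91, 63, 14, 1:] ((phi r j - of_int 10) / of_int 2) = 0" if "j < 3" for j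
 proof -
  define t where "t = phi r j"
  have "(t - phi r 0) * (t - phi r 1) * (t - phi r 2) = 0" using that unfolding t_def less_3_cases by auto
  moreover have "(t - phi r 0) * (t - phi r 1) * (t - phi r 2) = t * t * t - (phi r 0 + phi r 1 + phi r 2) * (t * t)
    + (phi r 0 * phi r 1 + phi r 0 * phi r 2 + phi r 1 * phi r 2) * t - phi r 0 * phi r 1 * phi r 2" by (simp add: algebra_simps)
  ultimately have t: "t * t * t - 2 * (t * t) - 8 * t + 8 = 0" unfolding ph by simp
  define y where "y = (t - 10) / 2"
  have ty: "t = 2 * y + 10" by (simp add: y_def field_simps)
  have "8 * (91 + 63 * y + 14 * (y * y) + y * y * y) = 0" using t unfolding ty by (simp add: algebra_simps)
  then have "(8 :: complex) = 0 \<or> 91 + 63 * y + 14 * (y * y) + y * y * y = 0" by (simp only: mult_eq_0_iff)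
  then have "91 + 63 * y + 14 * (y * y) + y * y * y = 0" by simp
  then show ?thesis unfolding t_def[symmetric] by (simp add: map_poly_pCons y_def[symmetric] algebra_simps)
 qed
 have "galc r = set (std ! 9)"
 proof (rule galc_stdI[where U = evn and Qs = "[\<lambda>l. l ! 0 = 1, \<lambda>l. l ! 0 = 2, \<lambda>l. l ! 0 = 3, \<lambda>l. pr l = 1]"])
  fix l assume "l \<in> galc r"
  then obtain \<alpha> where \<alpha>: "l \<in> S4" "fhom (Qr r) \<alpha>" "\<forall>i<4. \<alpha> (r i) = r (l ! i)" using galcD by blast
  show "evn l"
  proof (rule ccontr)
   assume "\<not> evn l"
   then have "\<alpha> ?V = - ?V" using galc_vand[OF \<alpha>(2,1,3)] by simp
   then show False using fhomD(7)[OF fld_Qr \<alpha>(2), of k] k by simp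
  qed
 next
  have "\<exists>l\<in>galc r. pr l = 1"
  proof (rule trans_phi[OF q, where m = 10 and n = 2])
   show "prime_elem [:91, 63, 14, 1 :: int:]" by (rule eisenstein_3[of 7]) simp_all
  qed (use cubic in simp_all)
  then show "\<forall>Q\<in>set [\<lambda>l. l ! 0 = 1, \<lambda>l. l ! 0 = 2, \<lambda>l. l ! 0 = 3, \<lambda>l. pr l = 1]. \<exists>l\<in>galc r. Q l"
   using trans_all[OF q, of 2 0 1] trans_all[OF q, of 2 0 2] trans_all[OF q, of 2 0 3] by simp
 qed code_simp
 then show ?thesis using q by blast
qed

text \<open>The polynomial \<open>x ^ 4 + 2 * x ^ 3 + 4 * x + 2\<close> has negative discriminant,
  so complex conjugation is an odd permutation; its resolvent \<open>t ^ 3 - 24\<close> is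
  Eisenstein at 3.\<close>

lemma gal_symmetric: "\<exists>r e1 e2 e3 e4. quart r e1 e2 e3 e4 \<and> galc r = set (std ! 10)"
proof -
 obtain r where q: "quart r (- 2) 0 (- 4) 2" and V: "(vand (r 0) (r 1) (r 2) (r 3))\<^sup>2 = of_int (- 15552)"
  and ph: "phi r 0 + phi r 1 + phi r 2 = of_int 0" "phi r 0 * phi r 1 + phi r 0 * phi r 2 + phi r 1 * phi r 2 = of_int 0" "phi r 0 * phi r 1 * phi r 2 = of_int 24"
  using ex_quart[where ?e1.0 = "- 2" and ?e2.0 = 0 and ?e3.0 = "- 4" and ?e4.0 = 2] by auto
 let ?V = "vand (r 0) (r 1) (r 2) (r 3)"
 have cubic: "ipoly [:- 24, 0, 0, 1:] ((phi r j - of_int 0) / of_int 1) = 0" if "j < 3" for j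
 proof -
  define t where "t = phi r j"
  have "(t - phi r 0) * (t - phi r 1) * (t - phi r 2) = 0" using that unfolding t_def less_3_cases by auto
  moreover have "(t - phi r 0) * (t - phi r 1) * (t - phi r 2) = t * t * t - (phi r 0 + phi r 1 + phi r 2) * (t * t)
    + (phi r 0 * phi r 1 + phi r 0 * phi r 2 + phi r 1 * phi r 2) * t - phi r 0 * phi r 1 * phi r 2" by (simp add: algebra_simps)
  ultimately have "t * t * t = 24" unfolding ph by simp
  then show ?thesis unfolding t_def[symmetric] by (simp add: map_poly_pCons mult.assoc)
 qed
 have odd: "\<exists>l\<in>galc r. \<not> evn l"
 proof -
  have c: "fhom (Qr r) cnj" by (simp add: fhom_def)
  obtain l where l: "l \<in> galc r" "\<forall>i<4. cnj (r i) = r (l ! i)" using galc_of_hom[OF q c] by blast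
  have S: "l \<in> S4" using l(1) by (simp add: galc_def)
  have "\<not> evn l"
  proof
   assume "evn l"
   then have "cnj ?V = ?V" using galc_vand[OF c S l(2)] by simp
   then have "Im ?V = 0" by (simp add: complex_eq_iff)
   then have "Re (?V\<^sup>2) \<ge> 0" by (simp add: power2_eq_square)
   then show False unfolding V by simp
  qed
  then show ?thesis using l(1) by blast
 qed
 have pe: "prime_elem [:- 24, 0, 0, 1 :: int:]" by (rule eisenstein_3[of 3]) simp_all
 have pr: "\<exists>l\<in>galc r. pr l = j" if "j < 3" for j
  by (rule trans_phi[OF q pe, where m = 0 and n = 1]) (use cubic that in simp_all)
 have "galc r = set (std ! 10)"
 proof (rule galc_stdI[where U = "\<lambda>l. True" and Qs = "[\<lambda>l. \<not> evn l, \<lambda>l. l ! 0 = 1, \<lambda>l. l ! 0 = 2, \<lambda>l. l ! 0 = 3, \<lambda>l. pr l = 1, \<lambda>l. pr l = 2]"])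
  show "\<forall>Q\<in>set [\<lambda>l. \<not> evn l, \<lambda>l. l ! 0 = 1, \<lambda>l. l ! 0 = 2, \<lambda>l. l ! 0 = 3, \<lambda>l. pr l = 1, \<lambda>l. pr l = 2]. \<exists>l\<in>galc r. Q l"
   using odd pr[of 1] pr[of 2] trans_all[OF q, of 2 0 1] trans_all[OF q, of 2 0 2] trans_all[OF q, of 2 0 3] by simp
 qed (code_simp, simp)
 then show ?thesis using q by blast
qed

lemma gal_std: "i < 11 ==> \<exists>r e1 e2 e3 e4. quart r e1 e2 e3 e4 \<and> galc r = set (std ! i)"
proof -
 assume "i < 11"
 then have "i = 0 \<or> i = 1 \<or> i = 2 \<or> i = 3 \<or> i = 4 \<or> i = 5 \<or> i = 6 \<or> i = 7 \<or> i = 8 \<or> i = 9 \<or> i = 10" by arith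
 then show ?thesis
  by (elim disjE; hypsubst) (rule gal_trivial gal_transposition gal_double_transposition gal_two_transpositions gal_cyclic_3 gal_sym_3
   gal_klein gal_cyclic_4 gal_dihedral gal_alternating gal_symmetric)+
qed

text \<open>Encoded as lists, \<open>G\<close> is found in the table, which presents it as a
  conjugate of a standard subgroup; relabelling the roots of the quartic for that subgroup produces
  \<open>G\<close> itself and not merely a conjugate.\<close>

theorem ex_galois:
 assumes G: "subgroup G (sym_group 4)"
 shows "\<exists>b w. qpair b w \<and> lgal b = G"
proof -
 have perm: "p permutes {1..4}" if "p \<in> G" for p using subgroup.subset[OF G] that by (auto simp: sym_group_def)
 define A where "A = enc ` G"
 have dA: "dec ` A = G" unfolding A_def image_image using enc_S4(2)[OF perm] by simp
 have SA: "A \<subseteq> S4" unfolding A_def using enc_S4(1)[OF perm] by blast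
 have "cclosed A" unfolding cclosed_def
 proof (intro conjI ballI SA)
  have "id \<in> G" using subgroup.one_closed[OF G] by (simp add: sym_group_def)
  moreover have "enc id = [0, 1, 2, 3]" by (simp add: enc_def upt_rec numeral_2_eq_2 numeral_3_eq_3 One_nat_def)
  ultimately show "[0, 1, 2, 3] \<in> A" unfolding A_def by (metis image_eqI)
  fix l m assume lm: "l \<in> A" "m \<in> A"
  then have "dec l \<in> G" "dec m \<in> G" using dA by blast+
  then have "dec l \<circ> dec m \<in> G" using subgroup.m_closed[OF G, of "dec l" "dec m"] by (simp add: sym_group_def)
  moreover have S: "l \<in> S4" "m \<in> S4" using lm SA by blast+
  ultimately have "dec (cmp l m) \<in> dec ` A" unfolding dA dec_cmp[OF S] by simp
  then obtain k where "k \<in> A" "dec (cmp l m) = dec k" by blast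
  then show "cmp l m \<in> A" using dec_inj[OF cmp_S4[OF S], of k] SA by blast
 qed
 then obtain E where E: "E \<in> set subs" "A = set (elems E)" using subgroup_listed by blast
 obtain s c d H gs gw ov where e: "E = (s, c, d, H, gs, gw, ov)" by (cases E)
 have "check_std E" using checked_std E(1) unfolding list_all_iff by blast
 then have cd: "cmp c d = [0, 1, 2, 3]" "cmp d c = [0, 1, 2, 3]" "c \<in> S4" "d \<in> S4" "s < 11" "H = map (\<lambda>m. cmp d (cmp m c)) (std ! s)"
  unfolding e check_std_def S4_eq list_ex_iff by auto
 obtain r e1 e2 e3 e4 where r: "quart r e1 e2 e3 e4" "galc r = set (std ! s)" using gal_std[OF cd(5)] by blast
 have "galc (\<lambda>i. r (c ! i)) = A" unfolding galc_conj[OF cd(3,4,1,2)] r(2) E(2) e elems_def cd(6) by simp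
 then have "lgal (\<lambda>j k. r (c ! k) ^ j) = G" using lgal_powers[of "\<lambda>i. r (c ! i)"] dA by simp
 then show ?thesis using quart_qpair[OF quart_relabel[OF r(1) cd(3)]] by blast
qed

theorem theorem5p1:
  fixes G :: "(nat \<Rightarrow> nat) set"
  assumes "subgroup G (sym_group 4)"
  shows "\<exists>F. finite F \<and> F \<noteq> {} \<and> (\<forall>S\<in>F. polytope S \<and> aff_dim S = 3) \<and> P4 G = \<Union>F"
proof (intro exI[of _ "cell ` realizable G"] conjI ballI)
  show "finite (cell ` realizable G)" using finite_realizable by simp
  show "cell ` realizable G \<noteq> {}" using ex_galois[OF assms] by (auto simp: realizable_def)
  show "P4 G = \<Union> (cell ` realizable G)" by (rule P4_eq)
  fix S assume "S \<in> cell ` realizable G"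
  then obtain N where N: "N \<in> realizable G" "S = cell N" by blast
  have "finite N" by (rule finite_subset[OF realizable_subset[OF N(1)]]) simp
  then show "polytope S" "aff_dim S = 3" using polytope_cell aff_dim_cell[OF realizable_subset[OF N(1)]] N(2) by auto
qed

end
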